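(* Let $K\in\mathbb{N}=\{1,2,\dots\}$ be fixed. For the number $X_n$ of key comparisons used by optimal $K$-pivot QuickSort we have $$\operatorname{Var}(X_n)\sim\sigma_K^2\,n^2\qquad(n\to\infty),$$ where $$\sigma_K^2=\frac{K+2}{K}\,\mathbb{E}\left[\left(\alpha_K\sum_{i=0}^K D_i\ln(D_i)+l_{\mathrm{opt}}(D)\right)^2\right].$$ For $K=3$ an explicit value is $$\sigma_3^2=\frac{3051169}{657072}-\frac{17689}{36504}\pi^2+\frac{1463}{2808}\ln(2)-\frac{665}{8424}\ln(3)\approx 0.1354.$$
   Context: Notation: $H_n=\sum_{i=1}^n \frac1i$. Probabilistic model. Fix $K\in\mathbb{N}$. Let $V_1,\dots,V_K,a_1,a_2,\dots$ be independent random variables, uniformly distributed on $[0,1]$. For $n>K$ the list to be sorted is $a_1,\dots,a_{n-K},V_1,\dots,V_K$; the last $K$ items are the pivots, and $p_1<\dots<p_K$ denote the sorted pivots. The spacings are $D_0=p_1$, $D_i=p_{i+1}-p_i$ for $1\le i\le K-1$, $D_K=1-p_K$, and $D=(D_0,\dots,D_K)$. The sublists $S_0,\dots,S_K$ consist of the non-pivot elements of the list lying in $(0,p_1),(p_1,p_2),\dots,(p_K,1)$, respectively, and $I_i^{(n)}=|S_i|$. Classification trees. $\mathcal{T}$ is the (finite) set of all binary search trees with internal nodes $p_1,\dots,p_K$ and external nodes (leaves) $S_0,\dots,S_K$ from left to right. For $t\in\mathcal{T}$, $h_t(i)$ is the depth of the leaf $S_i$ in $t$ (the number of comparisons needed to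 classify an element into $S_i$ using $t$), and $l_t(x_0,\dots,x_K)=\sum_{i=0}^K x_i h_t(i)$. Put $l_{\mathrm{opt}}(D)=\min_{t\in\mathcal{T}} l_t(D)$, $\gamma_K=\mathbb{E}[l_{\mathrm{opt}}(D)]$ and $\alpha_K=\gamma_K/(H_{K+1}-1)$. Optimal partition strategy. The elements $a_1,\dots,a_{n-K}$ are classified one after another. Let $C^{(k)}_i$ be the number of elements among $a_1,\dots,a_{k-1}$ classified into $S_i$. The element $a_k$ is classified using the tree $t\in\mathcal{T}$ minimizing $l_t(C^{(k)}_0+1,\dots,C^{(k)}_K+1)$; ties are resolved by choosing the smallest minimizing tree with respect to an arbitrary but fixed total order on $\mathcal{T}$. With $G_{t,k}$ the event that $a_k$ is classified using $t$, the number of comparisons in the partitioning stage is $$P_n=\sum_{k=1}^{n-K}\sum_{t\in\mathcal{T}}\sum_{i=0}^K \mathbf{1}_{G_{t,k}}\mathbf{1}_{\{a_k\in S_i\}}h_t(i)+R_K,$$ where $R_K\le K^2$ is the number of comparisons used to sort the $K$ pivots by a fixed elementary sorting algorithm. Number of key comparisons. For $0\le n\le K$, $X_n$ is the number of comparisons a fixed elementary sorting algorithm uses on $n$ elements in uniformly random order (at most $K^2$). For $n>K$ the distribution of $X_n$ is given recursively by $$X_n\stackrel{d}{=}\sum_{i=0}^K X^{(i)}_{I_i^{(n)}}+P_n,$$ where the $X^{(i)}_m$ are distributed as $X_m$, and the sequences $(X^{(i)}_m)_{m\ge0}$, $i=0,\dots,K$, are independent of each other and of $(I_0^{(n)},\dots,I_K^{(n)},P_n)$.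 *)

theory Defs
  imports "HOL-Probability.Probability" "HOL-Library.Tree" "HOL-Library.Landau_Symbols"
    "HOL-Combinatorics.Permutations"
begin

section \<open>Pivots and spacings\<close>

text \<open>The unsorted pivots are \<open>v 1, \<dots>, v K\<close>. The sorted pivots are extended by
  \<open>p\<^sub>0 = 0\<close> and \<open>p\<^sub>K\<^sub>+\<^sub>1 = 1\<close>, so that the two boundary spacings and the two boundary
  intervals need no separate treatment.\<close>

definition pivot :: "nat \<Rightarrow> (nat \<Rightarrow> real) \<Rightarrow> nat \<Rightarrow> real" where
  "pivot K v i =
     (if i = 0 then 0 else if i \<le> K then sort (map v [1..<Suc K]) ! (i - 1) else 1)"

definition spacing :: "nat \<Rightarrow> (nat \<Rightarrow> real) \<Rightarrow> nat \<Rightarrow> real" where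
  "spacing K v i = pivot K v (Suc i) - pivot K v i"

definition bucket :: "nat \<Rightarrow> (nat \<Rightarrow> real) \<Rightarrow> nat \<Rightarrow> real set" where
  "bucket K v i = {pivot K v i<..<pivot K v (Suc i)}"

text \<open>The number of elements among \<open>a 1, \<dots>, a m\<close> that belong to the \<open>i\<close>-th sublist; it
  vanishes for \<open>i > K\<close>.\<close>

definition bucket_count :: "nat \<Rightarrow> (nat \<Rightarrow> real) \<Rightarrow> (nat \<Rightarrow> real) \<Rightarrow> nat \<Rightarrow> nat \<Rightarrow> nat" where
  "bucket_count K v a m i = card {k \<in> {1..m}. a k \<in> bucket K v i}"


section \<open>Classification trees\<close>

text \<open>The internal node \<open>p\<^sub>i\<close> is represented by its index \<open>i\<close>.\<close>

definition class_trees :: "nat \<Rightarrow> nat tree set" where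
  "class_trees K = {t. bst t \<and> set_tree t = {1..K}}"

fun leaf_depths :: "'a tree \<Rightarrow> nat list" where
  "leaf_depths Leaf = [0]"
| "leaf_depths (Node l x r) = map Suc (leaf_depths l @ leaf_depths r)"

definition leaf_depth :: "nat tree \<Rightarrow> nat \<Rightarrow> nat" where
  "leaf_depth t i = leaf_depths t ! i"

definition path_cost :: "nat \<Rightarrow> nat tree \<Rightarrow> (nat \<Rightarrow> real) \<Rightarrow> real" where
  "path_cost K t x = (\<Sum>i\<le>K. x i * real (leaf_depth t i))"

definition opt_cost :: "nat \<Rightarrow> (nat \<Rightarrow> real) \<Rightarrow> real" where
  "opt_cost K x = (MIN t\<in>class_trees K. path_cost K t x)"

text \<open>The least minimizing tree with respect to a linear order \<open>r\<close> on \<open>class_trees K\<close>.\<close>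

definition opt_tree :: "(nat tree \<times> nat tree) set \<Rightarrow> nat \<Rightarrow> (nat \<Rightarrow> real) \<Rightarrow> nat tree" where
  "opt_tree r K x =
     (let A = {t \<in> class_trees K. path_cost K t x = opt_cost K x}
      in THE t. t \<in> A \<and> (\<forall>s\<in>A. (t, s) \<in> r))"


section \<open>Elementary sorting algorithms\<close>

text \<open>A deterministic comparison-based algorithm for a fixed number of keys is a decision tree.
  It compares the keys at two positions and finally returns a list of positions.\<close>

datatype 'i cmp_alg = Output "'i list" | Compare 'i 'i "'i cmp_alg" "'i cmp_alg"

fun result :: "'i cmp_alg \<Rightarrow> ('i \<Rightarrow> 'a::linorder) \<Rightarrow> 'i list" where
  "result (Output is) x = is"
| "result (Compare i j s t) x = (if x i < x j then result s x else result t x)"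

fun comparisons :: "'i cmp_alg \<Rightarrow> ('i \<Rightarrow> 'a::linorder) \<Rightarrow> nat" where
  "comparisons (Output is) x = 0"
| "comparisons (Compare i j s t) x =
     Suc (if x i < x j then comparisons s x else comparisons t x)"

text \<open>Since only comparisons are available, it suffices to consider inputs \<open>\<sigma> 1, \<dots>, \<sigma> m\<close> for
  permutations \<open>\<sigma>\<close>. The first conjunct confines the algorithm to the \<open>m\<close> given keys.\<close>

definition sorts :: "nat \<Rightarrow> nat cmp_alg \<Rightarrow> bool" where
  "sorts m alg \<longleftrightarrow> set_cmp_alg alg \<subseteq> {1..m} \<and>
     (\<forall>\<sigma>. \<sigma> permutes {1..m} \<longrightarrow> map \<sigma> (result alg \<sigma>) = [1..<Suc m])"

definition elementary_sort :: "nat \<Rightarrow> nat \<Rightarrow> nat cmp_alg \<Rightarrow> bool" where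
  "elementary_sort K m alg \<longleftrightarrow> sorts m alg \<and>
     (\<forall>\<sigma>. \<sigma> permutes {1..m} \<longrightarrow> comparisons alg \<sigma> \<le> K\<^sup>2)"

definition random_order_comparisons :: "nat \<Rightarrow> nat cmp_alg \<Rightarrow> nat pmf" where
  "random_order_comparisons m alg =
     map_pmf (comparisons alg) (pmf_of_set {\<sigma>. \<sigma> permutes {1..m}})"


section \<open>The partitioning stage\<close>

text \<open>The tree used for \<open>a k\<close>, and the number of comparisons for a list of length \<open>n\<close>.\<close>

definition tree_used ::
    "(nat tree \<times> nat tree) set \<Rightarrow> nat \<Rightarrow> (nat \<Rightarrow> real) \<Rightarrow> (nat \<Rightarrow> real) \<Rightarrow> nat \<Rightarrow> nat tree" where
  "tree_used r K v a k = opt_tree r K (\<lambda>i. real (bucket_count K v a (k - 1) i + 1))"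

definition partition_cost ::
    "(nat tree \<times> nat tree) set \<Rightarrow> nat cmp_alg \<Rightarrow> nat \<Rightarrow> nat \<Rightarrow> (nat \<Rightarrow> real) \<Rightarrow> (nat \<Rightarrow> real) \<Rightarrow> nat"
  where
  "partition_cost r piv K n v a =
     (\<Sum>k=1..n - K. \<Sum>t\<in>class_trees K. \<Sum>i\<le>K.
        of_bool (tree_used r K v a k = t) * of_bool (a k \<in> bucket K v i) * leaf_depth t i)
     + comparisons piv v"


section \<open>Optimal multi-pivot QuickSort\<close>

abbreviation unif01 :: "real measure" where
  "unif01 \<equiv> uniform_measure lborel {0..1}"

text \<open>The probability space \<open>M\<close> carries the pivots \<open>V 1, \<dots>, V K\<close>, the elements
  \<open>a 1, a 2, \<dots>\<close> and the copies \<open>Y i m\<close> of the number \<open>X m\<close> of comparisons, used in the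
  \<open>i\<close>-th recursive call. Only the law of each \<open>X n\<close> matters, so these variables may live on a
  different space \<open>N\<close>. The relation \<open>r\<close> breaks ties between minimizing trees; \<open>base m\<close> sorts lists
  of length \<open>m \<le> K\<close>, and \<open>piv\<close> sorts the pivots.

  In \<open>indep_rec\<close>, the vector of sublist sizes and the partitioning cost are packed into the
  single sequence with entries \<open>P\<^sub>n, I\<^sub>0, \<dots>, I\<^sub>K, 0, 0, \<dots>\<close>, because \<open>indep_vars\<close> requires all
  variables to have the same type.\<close>

locale optimal_quicksort =
  prob_space M + N: prob_space N
  for M :: "'a measure" and N :: "'b measure" +
  fixes K :: nat
    and r :: "(nat tree \<times> nat tree) set"
    and base :: "nat \<Rightarrow> nat cmp_alg"
    and piv :: "nat cmp_alg"
    and V :: "nat \<Rightarrow> 'a \<Rightarrow> real"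
    and a :: "nat \<Rightarrow> 'a \<Rightarrow> real"
    and Y :: "nat \<Rightarrow> nat \<Rightarrow> 'a \<Rightarrow> nat"
    and X :: "nat \<Rightarrow> 'b \<Rightarrow> nat"
  assumes tie_order: "linear_order_on (class_trees K) r"
    and base_sort: "\<And>m. m \<le> K \<Longrightarrow> elementary_sort K m (base m)"
    and pivot_sort: "elementary_sort K K piv"
    and indep_input: "indep_vars (\<lambda>_. borel) (case_sum V a) ({1..K} <+> {1..})"
    and V_uniform: "\<And>i. i \<in> {1..K} \<Longrightarrow> distr M borel (V i) = unif01"
    and a_uniform: "\<And>k. k \<ge> 1 \<Longrightarrow> distr M borel (a k) = unif01"
    and X_measurable: "\<And>n. X n \<in> measurable N (count_space UNIV)"
    and Y_law: "\<And>i m. i \<le> K \<Longrightarrow>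
      distr M (count_space UNIV) (Y i m) = distr N (count_space UNIV) (X m)"
    and indep_rec: "\<And>n. n > K \<Longrightarrow>
      indep_vars (\<lambda>_. \<Pi>\<^sub>M m\<in>UNIV. count_space UNIV)
        (\<lambda>j \<omega>. if j \<le> K then (\<lambda>m. Y j m \<omega>)
               else case_nat
                 (partition_cost r piv K n (\<lambda>i. V i \<omega>) (\<lambda>k. a k \<omega>))
                 (bucket_count K (\<lambda>i. V i \<omega>) (\<lambda>k. a k \<omega>) (n - K)))
        {..Suc K}"
    and X_base: "\<And>n. n \<le> K \<Longrightarrow>
      distr N (count_space UNIV) (X n) = measure_pmf (random_order_comparisons n (base n))"
    and X_rec: "\<And>n. n > K \<Longrightarrow>
      distr N (count_space UNIV) (X n) =
      distr M (count_space UNIV)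
        (\<lambda>\<omega>. (\<Sum>i\<le>K. Y i (bucket_count K (\<lambda>i. V i \<omega>) (\<lambda>k. a k \<omega>) (n - K) i) \<omega>)
              + partition_cost r piv K n (\<lambda>i. V i \<omega>) (\<lambda>k. a k \<omega>))"


section \<open>The constants\<close>

abbreviation pivot_space :: "nat \<Rightarrow> (nat \<Rightarrow> real) measure" where
  "pivot_space K \<equiv> \<Pi>\<^sub>M i\<in>{1..K}. unif01"

definition gamma_const :: "nat \<Rightarrow> real" where
  "gamma_const K = (LINT v|pivot_space K. opt_cost K (spacing K v))"

definition alpha_const :: "nat \<Rightarrow> real" where
  "alpha_const K = gamma_const K / (harm (K + 1) - 1)"

definition sigma_sq :: "nat \<Rightarrow> real" where
  "sigma_sq K = (real K + 2) / real K *
     (LINT v|pivot_space K.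
        (alpha_const K * (\<Sum>i\<le>K. spacing K v i * ln (spacing K v i))
         + opt_cost K (spacing K v))\<^sup>2)"

end

theory Submission
  imports Defs "HOL-Real_Asymp.Real_Asymp"
begin

text \<open>Put \<open>J\<^sub>i = I\<^sub>i + 1\<close>. Then \<open>\<Sum>\<^sub>i J\<^sub>i = n + 1\<close>, and averaging over \<open>i\<close> a function of \<open>J\<^sub>i\<close> is, by the
  formula for the spacing distribution, an explicit average over \<open>{1, \<dots>, n + 1 - K}\<close>. The
  mean and the variance of \<open>X\<^sub>n\<close> therefore satisfy scalar linear recurrences. The mean
  recurrence shows \<open>E X\<^sub>n = (n + 1) (\<alpha>\<^sub>K H\<^sub>n\<^sub>+\<^sub>1 + w\<^sub>n)\<close> with \<open>w\<close> convergent, so that the toll of the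
  variance recurrence, divided by \<open>n + 1\<close>, converges in \<open>L\<^sup>2\<close> to
  \<open>\<alpha>\<^sub>K \<Sum>\<^sub>i D\<^sub>i ln D\<^sub>i + l\<^sub>o\<^sub>p\<^sub>t(D)\<close>: the counts \<open>J\<^sub>i\<close> concentrate around \<open>n D\<^sub>i\<close>, and the partitioning cost
  around \<open>n l\<^sub>o\<^sub>p\<^sub>t(D)\<close> by a martingale argument. Since \<open>E \<Sum>\<^sub>i D\<^sub>i\<^sup>2 = 2 / (K + 2)\<close>, solving the
  recurrence multiplies the limiting second moment by \<open>(K + 2) / K\<close>.

  For \<open>K = 3\<close>, \<open>l\<^sub>o\<^sub>p\<^sub>t(D) = 2 - m\<close> where \<open>m\<close> is the positive part of a maximum of four linear forms.
  A valuation identity expresses \<open>P(m)\<close> through indicators of polyhedral cones, each of which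
  splits into simplicial cones. Shearing these onto the whole simplex leaves integrals of
  \<open>x (l ln l)\<close> with \<open>l\<close> a linear form, which are evaluated by repeated integration by parts.\<close>

section \<open>Recurrences with a gap average\<close>

text \<open>The averaging operator of the mean recurrence fixes linear sequences, so the recurrence
  does not contract at the scale n, and the mean partitioning cost is controlled only up to O(sqrt
  n), which rules out an explicit solution. What rescues the argument is that the ranks sum to n +
  1: the toll sees the sequence w only through differences, so the existence of a limit suffices and
  its value cancels. Existence comes from a linear functional of w that would be conserved by an
  exact solution of the averaging equation; here its increments are O(n^(-3/2)). The variance is
  easier, because j (j + 1) is an eigensequence with eigenvalue 2 / (K + 2) < 1. In place of
  conditional expectations, one computation with a product measure shows that the next element hits
  a sublist with probability equal to its spacing, tested against functions of the past; all
  martingale facts are orthogonality relations drawn from it. For K = 3 the valuation identity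
  leaves three cone types up to permutations of the spacings, and integrals are taken in the
  extended nonnegative reals, so that permutations and shears ask for measurability only.\<close>

definition gap_sum :: "nat => nat => (nat => real) => real" where
 "gap_sum k N f = (\<Sum>j\<in>{1..<N}. real ((N - 1 - j) choose k) * f j)"

text \<open>In the application \<open>k = K - 1\<close> and \<open>N = n + 1\<close>. The weights
  have total mass \<open>k + 2\<close>, the number of sublists: this is the sum over all sublists of
  an expectation, not a probability average.\<close>

definition gap_avg :: "nat => (nat => real) => nat => real" where
 "gap_avg k f N = real (k + 2) * gap_sum k N f / real ((N - 1) choose (k + 1))"

lemma gap_sum_0_Suc: "N >= 1 ==> gap_sum 0 (Suc N) f = gap_sum 0 N f + f N"
 by (simp add: gap_sum_def)

lemma gap_sum_Suc_Suc:
 assumes "N >= 1"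
 shows "gap_sum (Suc k) (Suc N) f = gap_sum (Suc k) N f + gap_sum k N f"
proof -
 have "real ((Suc N - 1 - j) choose Suc k) * f j =
   real ((N - 1 - j) choose Suc k) * f j + real ((N - 1 - j) choose k) * f j"
  if "j \<in> {1..<N}" for j
 proof -
  have "Suc N - 1 - j = Suc (N - 1 - j)" using that by auto
  then show ?thesis by (simp only: binomial_Suc_Suc of_nat_add) (simp add: algebra_simps)
 qed
 then have "(\<Sum>j\<in>{1..<N}. real ((Suc N - 1 - j) choose Suc k) * f j)
   = gap_sum (Suc k) N f + gap_sum k N f"
  unfolding gap_sum_def sum.distrib[symmetric] by (intro sum.cong) auto
 then show ?thesis using assms by (simp add: gap_sum_def)
qed

text \<open>By Pascal's rule, \<open>gap_sum k\<close> is the (k + 1)-fold iterated partial sum of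
  \<open>f\<close>. A closed form is therefore verified by checking one difference equation per
  summation and the zero initial values.\<close>

lemma gap_sum_eqI:
 assumes "!!k. R k 1 = 0"
  and "!!N. N >= 1 ==> R 0 (Suc N) = R 0 N + f N"
  and "!!k N. N >= 1 ==> R (Suc k) (Suc N) = R (Suc k) N + R k N"
  and "N >= 1"
 shows "gap_sum k N f = R k N"
 using assms(4)
proof (induction N arbitrary: k rule: dec_induct)
 case base
 show ?case using assms(1) by (simp add: gap_sum_def)
next
 case (step N)
 then show ?case
  by (cases k) (simp_all only: gap_sum_0_Suc gap_sum_Suc_Suc assms(2,3) One_nat_def)
qed

lemma binomial_Suc_2: "real (Suc N choose 2) = real N * (real N + 1) / 2"
 by (simp add: choose_two) (simp add: real_of_nat_div algebra_simps)

lemma gap_sum_id: "N >= 1 ==> gap_sum k N real = real (N choose (k + 2))"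
proof (rule gap_sum_eqI)
 fix N :: nat assume "N >= 1"
 show "real (Suc N choose (0 + 2)) = real (N choose (0+2)) + real N"
  by (simp add: numeral_2_eq_2)
qed (auto simp: numeral_2_eq_2)

lemma gap_sum_rising2:
 "N >= 1 ==> gap_sum k N (%j. real j * (real j + 1)) = 2 * real (Suc N choose (k + 3))"
proof (rule gap_sum_eqI)
 fix N :: nat
 have "Suc (Suc N) choose 3 = (Suc N choose 2) + (Suc N choose 3)"
  by (simp add: eval_nat_numeral)
 then show "2 * real (Suc (Suc N) choose (0 + 3)) = 2 * real (Suc N choose (0+3)) + real N * (real N + 1)"
  using binomial_Suc_2[of N] by simp
qed (auto simp: eval_nat_numeral)

text \<open>Absorption turns the increment 1 / (N + 1) of the harmonic number back into a binomial
  coefficient, which is the form that the difference equations for \<open>j * harm j\<close>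
  require.\<close>

lemma binomial_harm_Suc:
 "real (Suc N choose Suc k) * harm (Suc N) =
  real (Suc N choose Suc k) * harm N + real (N choose k) / real (Suc k)"
proof -
 have "real (Suc k) * real (Suc N choose Suc k) = real (Suc N) * real (N choose k)"
  by (metis Suc_times_binomial of_nat_mult)
 then have "real (Suc N choose Suc k) / real (Suc N) = real (N choose k) / real (Suc k)"
  by (simp add: field_simps del: of_nat_Suc binomial_Suc_Suc)
 then show ?thesis by (simp add: harm_Suc algebra_simps divide_inverse)
qed

lemma gap_sum_harm:
 "N >= 1 ==> gap_sum k N (%j. real j * harm j) =
   real (N choose (k + 2)) * (harm N - (harm (k + 2) - 1))"
proof (rule gap_sum_eqI)
 fix N :: nat assume "N >= 1"
 have "(harm 2 :: real) = 3 / 2" by (simp add: harm_expand)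
 then show "real (Suc N choose (0 + 2)) * (harm (Suc N) - (harm (0 + 2) - 1))
  = real (N choose (0 + 2)) * (harm N - (harm (0 + 2) - 1)) + real N * harm N"
  using binomial_harm_Suc[of N 1] by (simp add: numeral_2_eq_2 algebra_simps)
next
 fix k N :: nat
 have "harm (Suc k + 2) = (harm (k + 2) :: real) + 1 / real (k + 3)"
  by (simp add: harm_Suc divide_inverse add_ac)
 then show "real (Suc N choose (Suc k + 2)) * (harm (Suc N) - (harm (Suc k + 2) - 1))
  = real (N choose (Suc k + 2)) * (harm N - (harm (Suc k + 2) - 1))
   + real (N choose (k + 2)) * (harm N - (harm (k + 2) - 1))"
  using binomial_harm_Suc[of N "k + 2"] by (simp add: algebra_simps)
next
 fix k :: nat
 show "real (1 choose (k + 2)) * (harm 1 - (harm (k + 2) - 1)) = 0"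
  by (simp add: binomial_eq_0)
qed auto

lemma binomial_absorb_real: "real (Suc a) * real (a choose b) = real (Suc b) * real (Suc a choose Suc b)"
 by (metis Suc_times_binomial of_nat_mult)

lemma binomial_absorb2_real:
 "real (Suc (Suc a)) * real (Suc a) * real (a choose b)
   = real (b + 2) * real (b + 1) * real (Suc (Suc a) choose (b + 2))"
proof -
 have "real (Suc (Suc a)) * (real (Suc a) * real (a choose b))
   = real (Suc (Suc a)) * (real (Suc b) * real (Suc a choose Suc b))"
  by (simp only: binomial_absorb_real)
 also have "... = real (Suc b) * (real (Suc (Suc a)) * real (Suc a choose Suc b))"
  by (rule mult.left_commute)
 also have "... = real (Suc b) * (real (Suc (Suc b)) * real (Suc (Suc a) choose Suc (Suc b)))"
  by (simp only: binomial_absorb_real[of "Suc a" "Suc b"])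
 finally show ?thesis by (simp only: mult_ac add_2_eq_Suc' Suc_eq_plus1[symmetric])
qed

text \<open>Probabilistically this is the identity that the ranks sum to n + 1. That a linear
  sequence is fixed is the source of the difficulty with the mean.\<close>

lemma gap_avg_id:
 assumes "N >= k + 2" shows "gap_avg k real N = real N"
proof -
 obtain n where N: "N = Suc n" using assms by (cases N) auto
 show ?thesis
  using binomial_absorb_real[of n "k+1"] assms gap_sum_id[of N k]
  unfolding gap_avg_def N by (simp add: field_simps del: binomial_Suc_Suc)
qed

text \<open>The rising factorial, rather than the square, is an exact eigensequence. For K = k + 1
  pivots the eigenvalue \<open>2 / (k + 3)\<close> is the expected sum of the squared
  spacings.\<close>

lemma gap_avg_rising2:
 assumes "N >= k + 2"
 shows "gap_avg k (%j. real j * (real j + 1)) N = 2 / real (k + 3) * (real N * (real N + 1))"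
proof -
 obtain n where N: "N = Suc n" using assms by (cases N) auto
 have "real (Suc N) * (real N * real (n choose (k + 1))) =
    real (k + 2) * (real (Suc N) * real (N choose (k + 2)))"
  using binomial_absorb_real[of n "k+1"] unfolding N by simp
 also have "... = real (k + 2) * (real (k + 3) * real (Suc N choose (k + 3)))"
  using binomial_absorb_real[of N "k+2"]
  by (simp del: binomial_Suc_Suc add: numeral_3_eq_3 add_ac)
 finally show ?thesis
  using assms gap_sum_rising2[of N k]
  unfolding gap_avg_def N by (simp add: field_simps del: binomial_Suc_Suc)
qed

text \<open>With k = K - 1 the defect \<open>harm (k + 2) - 1\<close> is the denominator of
  \<open>alpha_const\<close>: multiplied by that constant, the sequence N H_N accounts for exactly
  the linear part \<open>gamma_const K * N\<close> of the toll.\<close>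

lemma gap_avg_harm:
 assumes "N >= k + 2"
 shows "gap_avg k (%j. real j * harm j) N = real N * (harm N - (harm (k + 2) - 1))"
proof -
 obtain n where N: "N = Suc n" using assms by (cases N) auto
 have "real (k + 2) * real (N choose (k + 2)) = real N * real (n choose (k+1))"
  using binomial_absorb_real[of n "k+1"] unfolding N by simp
 then show ?thesis
  using assms gap_sum_harm[of N k] N
  by (simp add: gap_avg_def nonzero_divide_eq_eq mult_ac del: binomial_Suc_Suc)
qed

lemma gap_avg_add: "gap_avg k (%j. f j + g j) N = gap_avg k f N + gap_avg k g N"
 by (simp add: gap_avg_def gap_sum_def algebra_simps sum.distrib add_divide_distrib)

lemma gap_avg_diff: "gap_avg k (%j. f j - g j) N = gap_avg k f N - gap_avg k g N"
 by (simp add: gap_avg_def gap_sum_def algebra_simps sum_subtractf diff_divide_distrib)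

lemma gap_avg_cmult: "gap_avg k (%j. c * f j) N = c * gap_avg k f N"
 by (simp add: gap_avg_def gap_sum_def sum_distrib_left mult_ac)

lemma gap_avg_uminus: "gap_avg k (%j. - f j) N = - gap_avg k f N"
 using gap_avg_cmult[of k "-1" f N] by simp

lemma gap_avg_mono:
 assumes "!!j. j >= 1 ==> j < N ==> f j <= g j"
 shows "gap_avg k f N <= gap_avg k g N"
 unfolding gap_avg_def gap_sum_def
 by (intro divide_right_mono mult_left_mono sum_mono) (auto intro: assms)

lemma gap_avg_abs_le:
 assumes "!!j. j >= 1 ==> j < N ==> \<bar>f j\<bar> <= g j"
 shows "\<bar>gap_avg k f N\<bar> <= gap_avg k g N"
proof -
 have "gap_avg k f N <= gap_avg k g N"
  by (rule gap_avg_mono) (use assms in force)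
 moreover have "gap_avg k (%j. - f j) N <= gap_avg k g N"
  by (rule gap_avg_mono) (use assms in force)
 ultimately show ?thesis by (simp add: gap_avg_uminus)
qed

text \<open>The multiple c of N (N + 1) with c (1 - 2 / (k + 3)) = \<beta> absorbs the leading toll.
  The remainder has a toll of order o(N^2), and the eigenvalue below 1 keeps it from
  accumulating.\<close>

theorem gap_recurrence_quadratic:
 fixes v b :: "nat => real"
 assumes rec: "!!N. N >= k + 3 ==> v N = gap_avg k v N + b N"
  and b: "(%N. b N / (real N)\<^sup>2) \<longlonglongrightarrow> \<beta>"
 shows "(%N. v N / (real N)\<^sup>2) \<longlonglongrightarrow> \<beta> * (real k + 3) / (real k + 1)"
proof -
 define c where "c = \<beta> * (real k + 3) / (real k + 1)"
 define f where "f N = v N - c * (real N * (real N + 1))" for N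
 define b' where "b' N = b N - \<beta> * (real N * (real N + 1))" for N
 have recf: "f N = gap_avg k f N + b' N" if "N >= k + 3" for N
 proof -
  have "gap_avg k f N = gap_avg k v N - c * (2 / real (k + 3) * (real N * (real N + 1)))"
   unfolding f_def gap_avg_diff gap_avg_cmult using that gap_avg_rising2[of k N] by simp
  moreover have "c - c * (2 / real (k + 3)) = \<beta>"
  proof -
   have "c - c * (2 / real (k + 3)) = c * ((real k + 1) / (real k + 3))"
    by (simp add: field_simps)
   then show ?thesis by (simp add: c_def)
  qed
  then have "c * (real N * (real N + 1)) - c * (2 / real (k + 3)) * (real N * (real N + 1))
    = \<beta> * (real N * (real N + 1))"
   by (metis left_diff_distrib)
  ultimately show ?thesis using rec[OF that] by (simp add: f_def b'_def)
 qed
 have b'0: "(%N. b' N / (real N * (real N + 1))) \<longlonglongrightarrow> 0"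
 proof -
  have "(%N. b N / (real N)\<^sup>2 * (real N / (real N + 1)) - \<beta>) \<longlonglongrightarrow> \<beta> * 1 - \<beta>"
   by (intro tendsto_diff tendsto_mult b tendsto_const) real_asymp
  moreover have "eventually (%N. b N / (real N)\<^sup>2 * (real N / (real N + 1)) - \<beta> = b' N / (real N * (real N + 1))) sequentially"
   using eventually_gt_at_top[of 0]
   by eventually_elim (simp add: b'_def divide_simps power2_eq_square)
  ultimately show ?thesis by (simp add: filterlim_cong)
 qed
 have f0: "(%N. f N / (real N)\<^sup>2) \<longlonglongrightarrow> 0"
 proof (rule LIMSEQ_I)
  fix \<epsilon> :: real assume "\<epsilon> > 0"
  define \<delta> where "\<delta> = \<epsilon> / 4"
  define q where "q = 1 - 2 / real (k + 3)"
  have q: "q > 0" "\<delta> > 0" using \<open>\<epsilon> > 0\<close> by (auto simp: q_def \<delta>_def field_simps)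
  obtain N1 where N1: "!!N. N >= N1 ==> \<bar>b' N / (real N * (real N + 1))\<bar> < \<delta> * q"
   using LIMSEQ_D[OF b'0, of "\<delta> * q"] q by auto
  define N2 where "N2 = max N1 (k + 3)"
  define B where "B = (\<Sum>j\<in>{1..<N2}. \<bar>f j\<bar>)"
  have "B >= 0" unfolding B_def by (simp add: sum_nonneg)
  \<comment> \<open>Under the average the quadratic term shrinks by the factor 1 - q, which leaves
    room \<delta> q for the toll; the linear term is reproduced exactly and carries the finitely
    many initial values collected in \<open>B\<close>.\<close>
  have bd: "\<bar>f N\<bar> <= \<delta> * (real N * (real N + 1)) + B * real N" if "N >= 1" for N
   using that
  proof (induction N rule: less_induct)
   case (less N)
   show ?case
   proof (cases "N < N2")
    case True
    then have "\<bar>f N\<bar> <= B" unfolding B_def using less.prems by (intro member_le_sum) auto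
    also have "B <= B * real N" using less.prems \<open>B >= 0\<close> by (simp add: mult_le_cancel_left1)
    finally show ?thesis using \<open>\<delta> > 0\<close> by (smt (verit) mult_nonneg_nonneg of_nat_0_le_iff)
   next
    case False
    then have N: "N >= k + 3" "N >= N1" by (auto simp: N2_def)
    have "\<bar>gap_avg k f N\<bar> <= gap_avg k (%j. \<delta> * (real j * (real j + 1)) + B * real j) N"
     by (rule gap_avg_abs_le) (use less.IH in auto)
    also have "... = \<delta> * (2 / real (k + 3) * (real N * (real N + 1))) + B * real N"
     unfolding gap_avg_add gap_avg_cmult using N gap_avg_rising2[of k N] gap_avg_id[of k N] by simp
    finally have 1: "\<bar>gap_avg k f N\<bar> <= \<delta> * (1 - q) * (real N * (real N + 1)) + B * real N"
     by (simp add: q_def)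
    have "\<bar>b' N\<bar> <= \<delta> * q * (real N * (real N + 1))"
     using N1[OF N(2)] N(1) by (simp add: abs_divide divide_less_eq split: if_splits)
    with 1 show ?thesis using recf[OF N(1)] by (simp add: algebra_simps)
   qed
  qed
  obtain N3 where N3: "real N3 > B / \<delta>" "N3 >= 1"
   by (metis gt_ex less_le_not_le linorder_linear max.cobounded2 max.strict_coboundedI1 of_nat_less_iff reals_Archimedean2 One_nat_def order.strict_trans nat_le_linear)
  show "\<exists>no. \<forall>n\<ge>no. norm (f n / (real n)\<^sup>2 - 0) < \<epsilon>"
  proof (intro exI allI impI)
   fix n assume n: "n >= N3"
   then have n1: "n >= 1" and "real n > B / \<delta>" using N3 by (auto simp: less_le_trans)
   then have "B < \<delta> * real n" using q by (simp add: field_simps)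
   then have "B * real n <= \<delta> * real n * real n" by (intro mult_right_mono) auto
   moreover have "\<delta> * (real n * (real n + 1)) <= \<delta> * (real n * (2 * real n))"
    using q n1 by (intro mult_left_mono) auto
   ultimately have "\<bar>f n\<bar> <= 3 * \<delta> * (real n)\<^sup>2"
    using bd[OF n1] by (simp add: power2_eq_square algebra_simps)
   moreover have n2: "(real n)\<^sup>2 > 0" using n1 by simp
   ultimately have "\<bar>f n\<bar> / (real n)\<^sup>2 <= 3 * \<delta>" by (simp only: pos_divide_le_eq)
   also have "3 * \<delta> < \<epsilon>" using \<open>\<epsilon> > 0\<close> by (simp add: \<delta>_def)
   finally show "norm (f n / (real n)\<^sup>2 - 0) < \<epsilon>" by (simp add: abs_divide)
  qed
 qed
 have "(%N. f N / (real N)\<^sup>2 + c * (real N * (real N + 1) / (real N)\<^sup>2)) \<longlonglongrightarrow> 0 + c * 1"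
  by (intro tendsto_add f0 tendsto_mult tendsto_const) real_asymp
 then show ?thesis unfolding f_def c_def by (simp add: diff_divide_distrib)
qed

section \<open>Size-biased averages and an invariant functional\<close>

lemma choose_mono_upper: "m <= n ==> m choose k <= n choose k"
 by (rule lift_Suc_mono_le[of "%n. n choose k"]) (cases k; simp)

text \<open>The law of the rank J_i when sublist i is picked with probability J_i / N. It turns the
  average of j w(j), divided by N, into a genuine expectation of w.\<close>

definition size_biased :: "nat => nat => nat => real" where
 "size_biased k N j = real j * real ((N - 1 - j) choose k) / real (N choose (k + 2))"

lemma size_biased_nonneg [simp]: "size_biased k N j >= 0"
 by (simp add: size_biased_def)

lemma gap_avg_eq_size_biased:
 assumes "N >= k + 2"
 shows "gap_avg k (%j. real j * w j) N = real N * (\<Sum>j\<in>{1..<N}. size_biased k N j * w j)"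
proof -
 obtain n where N: "N = Suc n" using assms by (cases N) auto
 have *: "real (k + 2) * real (N choose (k + 2)) = real N * real ((N - 1) choose (k+1))"
  using binomial_absorb_real[of n "k+1"] unfolding N by simp
 have "real (k + 2) / real ((N - 1) choose (k+1)) = real N / real (N choose (k + 2))"
  using * assms by (simp add: divide_simps mult_ac)
 then have "gap_avg k (%j. real j * w j) N
   = real N / real (N choose (k + 2)) * gap_sum k N (%j. real j * w j)"
  unfolding gap_avg_def by (metis times_divide_eq_left)
 then show ?thesis
  by (simp add: gap_sum_def size_biased_def sum_distrib_left sum_divide_distrib mult_ac)
qed

lemma sum_size_biased:
 assumes "N >= k + 2"
 shows "(\<Sum>j\<in>{1..<N}. size_biased k N j) = 1"
 using gap_avg_eq_size_biased[OF assms, of "%_. 1"] gap_avg_id[OF assms] assms by simp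

text \<open>A single rank j has mass O(j / N^2), so finitely many early values of a bounded sequence
  have no influence in the limit.\<close>

lemma size_biased_le:
 assumes "j >= 1" "N >= k + 2"
 shows "size_biased k N j <= real (k + 2) * real (k + 2) * real j / (real N)\<^sup>2 * 2"
proof -
 obtain n where N: "N = Suc (Suc n)" using assms by (metis add_2_eq_Suc' le_Suc_ex plus_nat.simps(2))
 have "real N * real (Suc n) * real (n choose k) = real (k+1) * real (k+2) * real (N choose (k + 2))"
  unfolding N binomial_absorb2_real by (simp only: mult_ac)
 moreover have "real ((N - 1 - j) choose k) <= real (n choose k)"
  using assms N by (intro of_nat_mono choose_mono_upper) auto
 moreover have "real (N choose (k + 2)) > 0" using assms by simp
 ultimately have "real N * real (Suc n) * real ((N - 1 - j) choose k) <= real (k+1) * real (k+2) * real (N choose (k + 2))"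
  by (metis mult_left_mono of_nat_0_le_iff of_nat_mult)
 then have "real ((N - 1 - j) choose k) / real (N choose (k + 2)) <= real (k+1) * real (k+2) / (real N * real (Suc n))"
  using \<open>real (N choose (k + 2)) > 0\<close> N by (simp add: divide_simps mult_ac)
 also have "... <= real (k+2) * real (k+2) / (real N * (real N / 2))"
  by (intro frac_le mult_mono mult_left_mono) (auto simp: N)
 also have "... = real (k+2) * real (k+2) / (real N)\<^sup>2 * 2" by (simp add: power2_eq_square)
 finally have "real j * (real ((N - 1 - j) choose k) / real (N choose (k + 2))) <= real j * (real (k+2) * real (k+2) / (real N)\<^sup>2 * 2)"
  by (intro mult_left_mono) auto
 then show ?thesis by (simp add: size_biased_def mult_ac)
qed

text \<open>\<open>inv_weight k M j\<close> is \<open>1 / (j (j + 1))\<close> times the mass that the invariant measure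
 \<open>1 / (N + 1)\<close> of the size-biased chain, started at \<open>j\<close> and run upwards in time, puts on steps
 across \<open>M\<close>. In closed form it is \<open>\<Sum>\<^sub>l C(M-j,l) B(l+2,M-l)\<close> with Euler's Beta function.\<close>

definition beta_coeff :: "nat => nat => real" where
 "beta_coeff l M = 1 / (real (l + 2) * real (Suc M choose (l + 2)))"

definition inv_weight :: "nat => nat => nat => real" where
 "inv_weight k M j = real j * (\<Sum>l\<le>k. real ((M - j) choose l) * beta_coeff l M)"

text \<open>This is B(a,b) = B(a+1,b) + B(a,b+1) with a = l + 2 and b = M - l.\<close>

lemma beta_coeff_rec:
 assumes "l < M"
 shows "beta_coeff l M = beta_coeff (Suc l) (Suc M) + beta_coeff l (Suc M)"
proof -
 obtain d where M: "M = Suc (l + d)" using assms less_iff_Suc_add by blast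
 have 1: "real (Suc M choose (l + 2)) = fact (l + d + 2) / (fact (l + 2) * fact d)"
  unfolding M by (subst binomial_fact) (auto simp: add_ac)
 have 2: "real (Suc (Suc M) choose (l + 3)) = fact (l + d + 3) / (fact (l + 3) * fact d)"
  unfolding M by (subst binomial_fact) (auto simp: add_ac eval_nat_numeral)
 have 3: "real (Suc (Suc M) choose (l + 2)) = fact (l + d + 3) / (fact (l + 2) * fact (d + 1))"
  unfolding M by (subst binomial_fact) (auto simp: add_ac eval_nat_numeral)
 define A F D :: real where "A = fact (l + d + 2)" and "F = fact (l + 2)" and "D = fact d"
 have f: "fact (l + d + 3) = (real l + real d + 3) * A"
  "fact (l + 3) = (real l + 3) * F" "fact (d + 1) = (real d + 1) * D"
  by (simp_all add: A_def F_def D_def eval_nat_numeral algebra_simps)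
 have p: "A > 0" "F > 0" "D > 0"
  by (auto simp: A_def F_def D_def)
 have b1: "beta_coeff l M = F * D / ((real l + 2) * A)"
  unfolding beta_coeff_def 1 A_def F_def D_def by (simp del: fact_Suc)
 have b2: "beta_coeff (Suc l) (Suc M) = F * D / ((real l + real d + 3) * A)"
 proof -
  have "beta_coeff (Suc l) (Suc M) = 1 / ((real l + 3) * real (Suc (Suc M) choose (l + 3)))"
   unfolding beta_coeff_def by (simp add: numeral_3_eq_3 add_ac del: binomial_Suc_Suc)
  then show ?thesis unfolding 2 f D_def[symmetric] using p by (simp del: fact_Suc)
 qed
 have b3: "beta_coeff l (Suc M) = F * ((real d + 1) * D) / ((real l + 2) * ((real l + real d + 3) * A))"
  unfolding beta_coeff_def 3 f F_def[symmetric] by (simp del: fact_Suc)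
 show ?thesis unfolding b1 b2 b3 using p by (simp add: divide_simps) (simp add: algebra_simps)
qed

lemma inv_weight_diag: "M >= 1 ==> inv_weight k M M = 1 / (real M + 1)"
proof -
 assume "M >= 1"
 have "(\<Sum>l\<le>k. real ((M - M) choose l) * beta_coeff l M) = (\<Sum>l\<in>{0}. real ((M - M) choose l) * beta_coeff l M)"
  by (rule sum.mono_neutral_right) auto
 moreover have "beta_coeff 0 M = 1 / (real M * (real M + 1))"
  using binomial_Suc_2[of M] by (simp add: beta_coeff_def numeral_2_eq_2 del: binomial_Suc_Suc)
 ultimately show ?thesis using \<open>M >= 1\<close> by (simp add: inv_weight_def)
qed

text \<open>Pascal's rule for the binomials and the recurrence for the Beta values telescope in
  \<open>l\<close>. Only the top term l = k survives, and absorption identifies it with the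
  size-biased weight.\<close>

lemma inv_weight_step:
 assumes "j >= 1" "j <= M" "Suc M >= k + 2"
 shows "inv_weight k M j - inv_weight k (Suc M) j = size_biased k (Suc M) j / (real M + 2)"
proof -
 define m where "m = M - j"
 have *: "real (m choose l) * beta_coeff l M
    = real (m choose l) * (beta_coeff (Suc l) (Suc M) + beta_coeff l (Suc M))" for l
 proof (cases "l <= m")
  case True
  then have "l < M" using assms by (auto simp: m_def)
  then show ?thesis using beta_coeff_rec[of l M] by simp
 qed (simp add: binomial_eq_0)
 have "(\<Sum>l\<le>n. real (m choose l) * beta_coeff l M)
   = (\<Sum>l\<le>n. real (Suc m choose l) * beta_coeff l (Suc M)) + real (m choose n) * beta_coeff (Suc n) (Suc M)" for n
 proof (induction n)
  case 0
  show ?case using *[of 0] by simp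
 next
  case (Suc n)
  then show ?case using *[of "Suc n"] by (simp add: distrib_left distrib_right)
 qed
 moreover have "Suc M - j = Suc m" using assms by (simp add: m_def)
 ultimately have "inv_weight k M j - inv_weight k (Suc M) j
   = real j * (real (m choose k) * beta_coeff (Suc k) (Suc M))"
  unfolding inv_weight_def m_def[symmetric] by (simp add: distrib_left)
 moreover have "real (k + 3) * real (Suc (Suc M) choose (k + 3)) = (real M + 2) * real (Suc M choose (k + 2))"
  using binomial_absorb_real[of "Suc M" "k+2"] by (simp add: numeral_3_eq_3 add_ac del: binomial_Suc_Suc)
 then have "beta_coeff (Suc k) (Suc M) = 1 / ((real M + 2) * real (Suc M choose (k + 2)))"
  by (simp add: beta_coeff_def numeral_3_eq_3 del: binomial_Suc_Suc)
 ultimately show ?thesis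
  by (simp add: size_biased_def m_def mult_ac del: binomial_Suc_Suc)
qed

lemma inv_weight_nonneg [simp]: "inv_weight k M j >= 0"
 by (simp add: inv_weight_def beta_coeff_def sum_nonneg)

text \<open>The product of \<open>beta_coeff l M\<close> with \<open>(M - 1) choose l\<close> is
  exactly (l + 1) / (M (M + 1)), so each of the k + 1 terms is at most (k + 1) / M^2.\<close>

lemma inv_weight_le:
 assumes "j >= 1" "M >= 1"
 shows "inv_weight k M j <= (real k + 1)\<^sup>2 * real j / (real M)\<^sup>2"
proof -
 obtain m where M: "M = Suc m" using assms by (cases M) auto
 have "real ((M - j) choose l) * beta_coeff l M <= (real k + 1) / (real M)\<^sup>2" if "l <= k" for l
 proof (cases "m choose l = 0")
  case True
  then have "(M - j) choose l = 0" using choose_mono_upper[of "M - j" m l] assms by (simp add: M)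
  then show ?thesis by (simp del: binomial_eq_0_iff)
 next
  case False
  then have pos: "real (m choose l) > 0" by simp
  have eq: "real (l + 2) * real (Suc M choose (l + 2)) * real (l + 1)
    = real (Suc M) * real M * real (m choose l)"
   unfolding M binomial_absorb2_real by (simp only: mult_ac)
  have "beta_coeff l M = real (l + 1) / (real (l + 2) * real (Suc M choose (l + 2)) * real (l + 1))"
   by (simp add: beta_coeff_def del: binomial_Suc_Suc)
  also have "... = real (l + 1) / (real (Suc M) * real M * real (m choose l))" by (simp only: eq)
  finally have b: "beta_coeff l M = real (l + 1) / (real (Suc M) * real M * real (m choose l))" .
  have "real ((M - j) choose l) * beta_coeff l M <= real (m choose l) * beta_coeff l M"
   using assms M by (intro mult_right_mono of_nat_mono choose_mono_upper) (auto simp: beta_coeff_def)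
  also have "... = real (l + 1) / (real (Suc M) * real M)" using pos by (simp add: b)
  also have "... <= (real k + 1) / (real M * real M)"
   using that M by (intro frac_le mult_mono) auto
  finally show ?thesis by (simp add: power2_eq_square)
 qed
 then have "(\<Sum>l\<le>k. real ((M - j) choose l) * beta_coeff l M) <= (\<Sum>l\<le>k. (real k + 1) / (real M)\<^sup>2)"
  by (intro sum_mono) auto
 then have "real j * (\<Sum>l\<le>k. real ((M - j) choose l) * beta_coeff l M) <= real j * (\<Sum>l\<le>k. (real k + 1) / (real M)\<^sup>2)"
  by (intro mult_left_mono) auto
 then show ?thesis by (simp add: inv_weight_def power2_eq_square mult_ac add.commute)
qed

text \<open>Passing to the next level changes the functional only by the error of \<open>w\<close>
  in the averaging equation there, divided by \<open>M + 2\<close>; along exact solutions it is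
  conserved.\<close>

lemma inv_functional_step:
 assumes "Suc M >= k + 2"
 shows "(\<Sum>j\<in>{1..Suc M}. inv_weight k (Suc M) j * w j) =
  (\<Sum>j\<in>{1..M}. inv_weight k M j * w j)
   + (w (Suc M) - (\<Sum>j\<in>{1..<Suc M}. size_biased k (Suc M) j * w j)) / (real M + 2)"
proof -
 have "(\<Sum>j\<in>{1..M}. inv_weight k M j * w j) - (\<Sum>j\<in>{1..M}. inv_weight k (Suc M) j * w j)
  = (\<Sum>j\<in>{1..M}. (inv_weight k M j - inv_weight k (Suc M) j) * w j)"
  by (simp add: sum_subtractf left_diff_distrib)
 also have "... = (\<Sum>j\<in>{1..M}. size_biased k (Suc M) j * w j) / (real M + 2)"
  unfolding sum_divide_distrib using assms by (intro sum.cong) (auto simp: inv_weight_step)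
 finally show ?thesis
  using inv_weight_diag[of "Suc M" k] by (simp add: atLeastLessThanSuc_atLeastAtMost diff_divide_distrib add.commute)
qed

text \<open>On [0,1] the square root dominates 3x/2 - x^2/2, which agrees with it at 0 and is
  tangent to it at 1, and the averages of this quadratic are known exactly. The gain factor above 1
  makes the square root usable as a barrier.\<close>

lemma gap_avg_sqrt_ge:
 assumes "N >= k + 2"
 shows "gap_avg k (%j. sqrt (real j)) N >= (1 + (real k + 1) / (2 * (real k + 3))) * sqrt (real N)"
proof -
 have N: "real N > 0" using assms by simp
 have pt: "sqrt (real N) * (3 / 2 * (1 / real N) * real j - 1 / 2 * (1 / (real N)\<^sup>2) * (real j * (real j + 1) - real j)) <= sqrt (real j)"
  if "j < N" for j
 proof -
  define x where "x = sqrt (real j / real N)"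
  have x: "0 <= x" "x <= 1" "x\<^sup>2 = real j / real N" using that by (auto simp: x_def)
  \<comment> \<open>The variable x is the square root of j / N, so the claimed comparison is
    polynomial; its double zero at x = 1 is the tangency.\<close>
  have "2 * x - 3 * x\<^sup>2 + x^4 = x * (1 - x)\<^sup>2 * (x + 2)" by (simp add: power2_eq_square eval_nat_numeral algebra_simps)
  also have "... >= 0" using x by simp
  finally have "3 / 2 * x\<^sup>2 - 1 / 2 * (x\<^sup>2)\<^sup>2 <= x" by (simp flip: power_mult)
  then have "sqrt (real N) * (3 / 2 * (real j / real N) - 1 / 2 * (real j / real N)\<^sup>2) <= sqrt (real N) * x"
   unfolding x by (intro mult_left_mono) auto
  also have "sqrt (real N) * x = sqrt (real j)" using N by (simp add: x_def real_sqrt_divide)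
  finally show ?thesis by (simp add: power2_eq_square algebra_simps)
 qed
 have "(1 + (real k + 1) / (2 * (real k + 3))) <= 3/2 - (real N + 1) / (real N * (real k + 3)) + 1 / (2 * real N)"
 proof -
  have "3/2 - (real N + 1) / (real N * (real k + 3)) + 1 / (2 * real N) - (1 + (real k + 1) / (2 * (real k + 3)))
   = (1 / real N) * (1 / 2 - 1 / (real k + 3))"
   using N by (simp add: divide_simps) (simp add: algebra_simps)
  moreover have "... >= 0" using N by (intro mult_nonneg_nonneg) (auto simp: field_simps)
  ultimately show ?thesis by linarith
 qed
 also have "... = 3 / 2 * (1 / real N) * real N - 1 / 2 * (1 / (real N)\<^sup>2) * (2 / real (k + 3) * (real N * (real N + 1)) - real N)"
  using N by (simp add: divide_simps power2_eq_square) (simp add: algebra_simps)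
 also have "sqrt (real N) * ... = gap_avg k (%j. sqrt (real N) * (3 / 2 * (1 / real N) * real j - 1 / 2 * (1 / (real N)\<^sup>2) * (real j * (real j + 1) - real j))) N"
  unfolding gap_avg_cmult gap_avg_diff using gap_avg_id[OF assms] gap_avg_rising2[OF assms] by simp
 also have "... <= gap_avg k (%j. sqrt (real j)) N" using pt by (intro gap_avg_mono) auto
 finally have "sqrt (real N) * (1 + (real k + 1) / (2 * (real k + 3))) <= gap_avg k (%j. sqrt (real j)) N"
  by (simp add: mult_left_mono)
 then show ?thesis by (simp add: mult.commute)
qed

text \<open>B N - c sqrt N is a supersolution: the linear part is fixed by the average, while the
  average of the square root exceeds sqrt N by \<eta> sqrt N. The choice c \<eta> = C pays for the
  error term.\<close>

lemma gap_recurrence_bounded: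
 fixes e :: "nat => real"
 assumes "!!N. N >= k + 2 ==> \<bar>e N - gap_avg k e N\<bar> <= C * sqrt (real N)"
 shows "\<exists>B. \<forall>N\<ge>1. \<bar>e N\<bar> <= B * real N"
proof -
 define \<eta> where "\<eta> = (real k + 1) / (2 * (real k + 3))"
 have \<eta>: "\<eta> > 0" by (simp add: \<eta>_def)
 have "0 <= C * sqrt (real (k+2))" using assms[of "k+2"] by linarith
 then have C: "C >= 0" by (simp add: zero_le_mult_iff)
 define c where "c = C / \<eta>"
 have c: "c >= 0" "c * \<eta> = C" using C \<eta> by (auto simp: c_def)
 define B where "B = (\<Sum>j\<in>{1..<k+2}. \<bar>e j\<bar>) + c"
 have *: "\<bar>e N\<bar> <= B * real N - c * sqrt (real N)" if "N >= 1" for N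
  using that
 proof (induction N rule: less_induct)
  case (less N)
  have sq: "sqrt (real N) <= real N"
   using less.prems by (intro real_le_lsqrt) (auto simp: power2_eq_square)
  show ?case
  proof (cases "N < k + 2")
   case True
   have "\<bar>e N\<bar> <= (\<Sum>j\<in>{1..<k+2}. \<bar>e j\<bar>)"
    using True less.prems by (intro member_le_sum) auto
   also have "... <= (\<Sum>j\<in>{1..<k+2}. \<bar>e j\<bar>) * real N"
    using less.prems mult_left_mono[of 1 "real N" "\<Sum>j\<in>{1..<k+2}. \<bar>e j\<bar>"] sum_nonneg[of "{1..<k+2}" "%j. \<bar>e j\<bar>"]
    by simp
   finally have "\<bar>e N\<bar> <= (\<Sum>j\<in>{1..<k+2}. \<bar>e j\<bar>) * real N" .
   moreover have "c * sqrt (real N) <= c * real N" using sq c by (intro mult_left_mono) auto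
   ultimately show ?thesis by (simp add: B_def algebra_simps)
  next
   case False
   then have N: "N >= k + 2" by simp
   have "\<bar>gap_avg k e N\<bar> <= gap_avg k (%j. B * real j - c * sqrt (real j)) N"
    by (rule gap_avg_abs_le) (use less.IH in auto)
   also have "... = B * real N - c * gap_avg k (%j. sqrt (real j)) N"
    unfolding gap_avg_diff gap_avg_cmult gap_avg_id[OF N] ..
   also have "... <= B * real N - c * ((1 + \<eta>) * sqrt (real N))"
    using gap_avg_sqrt_ge[OF N] c by (intro diff_left_mono mult_left_mono) (auto simp: \<eta>_def)
   also have "... = B * real N - c * sqrt (real N) - C * sqrt (real N)"
    unfolding c(2)[symmetric] by (simp add: algebra_simps)
   finally show ?thesis using assms[OF N] by linarith
  qed
 qed
 then have "\<bar>e N\<bar> <= B * real N" if "N >= 1" for N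
 proof -
  have "0 <= c * sqrt (real N)" using c by simp
  then show ?thesis using * [OF that] by linarith
 qed
 then show ?thesis by blast
qed

text \<open>Away from the upper end both weights are of order j / N^2. Near j = N the size-biased
  weight degenerates like (N - j)^k, hence the restriction to j <= (1 - \<eta>) N.\<close>

lemma inv_weight_le_size_biased:
 assumes "0 < \<eta>" "\<eta> < 1"
 shows "\<exists>C>0. \<exists>N0. \<forall>N\<ge>N0. \<forall>j\<ge>1. real j <= (1 - \<eta>) * real N \<longrightarrow>
  inv_weight k N j <= C * size_biased k N j"
proof -
 \<comment> \<open>From \<open>(n choose k) >= (n / k) ^ k\<close> with n = N - 1 - j >= \<eta> N /
   2. For k = 0 the convention x / 0 = 0 and 0 ^ 0 = 1 give q = 1.\<close>
 define q where "q = (\<eta> / 2 / real k) ^ k"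
 have q: "q > 0" using assms by (cases "k = 0") (auto simp: q_def)
 obtain N0 where N0: "real N0 > (2 * real k + 2) / \<eta>" using reals_Archimedean2 by blast
 show ?thesis
 proof (intro exI[of _ "(real k + 1)\<^sup>2 / q"] exI[of _ "N0 + k + 2"] conjI allI impI)
  show "(real k + 1)\<^sup>2 / q > 0" using q by simp
  fix N j :: nat
  assume N: "N0 + k + 2 <= N" and j: "1 <= j" "real j <= (1 - \<eta>) * real N"
  have "(2 * real k + 2) / \<eta> < real N" using N0 N by linarith
  then have big: "2 * real k + 2 < \<eta> * real N" using assms by (simp add: field_simps)
  have jN: "real j < real N"
  proof -
   have "0 < \<eta> * real N" using big by linarith
   then show ?thesis using j by (simp add: algebra_simps)
  qed
  then have m: "real (N - 1 - j) = real N - 1 - real j" by linarith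
  have m': "real (N - 1 - j) >= \<eta> / 2 * real N"
   using big j unfolding m by (simp add: algebra_simps)
  then have "k <= N - 1 - j" using big by linarith
  then have "(real (N - 1 - j) / real k) ^ k <= real ((N - 1 - j) choose k)"
   by (rule binomial_ge_n_over_k_pow_k)
  moreover have "(\<eta> / 2 / real k * real N) ^ k <= (real (N - 1 - j) / real k) ^ k"
   using divide_right_mono[OF m', of "real k"] assms by (intro power_mono) auto
  ultimately have b: "q * real N ^ k <= real ((N - 1 - j) choose k)"
   unfolding q_def power_mult_distrib by linarith
  have "real (N choose (k + 2)) <= real (N ^ (k + 2))"
   using N by (intro of_nat_mono binomial_le_pow) auto
  then have c: "real (N choose (k + 2)) <= real N ^ k * (real N)\<^sup>2"
   by (simp add: power_add power2_eq_square mult_ac)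
  have Npos: "real N > 0" using N by simp
  have "q / (real N)\<^sup>2 = (q * real N ^ k) / (real N ^ k * (real N)\<^sup>2)"
   using Npos by simp
  also have "... <= real ((N - 1 - j) choose k) / real (N choose (k + 2))"
   using b c N by (intro frac_le) auto
  finally have d: "q / (real N)\<^sup>2 <= real ((N - 1 - j) choose k) / real (N choose (k + 2))" .
  have "inv_weight k N j <= (real k + 1)\<^sup>2 * real j / (real N)\<^sup>2"
   using inv_weight_le[of j N k] j N by simp
  also have "... = (real k + 1)\<^sup>2 / q * (real j * (q / (real N)\<^sup>2))"
   using q by simp
  also have "... <= (real k + 1)\<^sup>2 / q * (real j * (real ((N - 1 - j) choose k) / real (N choose (k + 2))))"
   using q d by (intro mult_left_mono) auto
  finally show "inv_weight k N j <= (real k + 1)\<^sup>2 / q * size_biased k N j"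
   by (simp add: size_biased_def)
 qed
qed

text \<open>Where \<open>w\<close> is close to its limit superior, almost all of the values averaged by
 \<open>size_biased\<close> are close to it, hence also almost all of those averaged by \<open>inv_weight\<close>.\<close>

lemma inv_functional_ge_limsup:
 fixes w :: "nat => real"
 assumes bdd: "!!j. \<bar>w j\<bar> <= B"
  and up: "!!\<epsilon>. \<epsilon> > 0 ==> eventually (%N. w N <= S + \<epsilon>) sequentially"
  and freq: "!!\<epsilon>. \<epsilon> > 0 ==> frequently (%N. w N > S - \<epsilon>) sequentially"
  and rec: "(%N. w N - (\<Sum>j\<in>{1..<N}. size_biased k N j * w j)) \<longlonglongrightarrow> 0"
  and lim: "(%N. \<Sum>j\<in>{1..N}. inv_weight k N j * w j) \<longlonglongrightarrow> L"
  and mass: "eventually (%N. (\<Sum>j\<in>{1..N}. inv_weight k N j) = h) sequentially"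
 shows "h * S <= L"
proof (rule field_le_epsilon)
 fix \<delta> :: real assume "\<delta> > 0"
 have B: "B >= 0" using bdd[of 0] by linarith
 have S: "\<bar>S\<bar> <= B + 1"
 proof -
  obtain N where "w N <= S + 1" using up[of 1] by (auto simp: eventually_sequentially)
  moreover obtain N' where "w N' > S - 1" using freq[of 1] by (auto dest: frequently_ex)
  ultimately show ?thesis using bdd[of N] bdd[of N'] by (simp add: abs_le_iff)
 qed
 define D where "D = 2 * B + 3"
 have D: "D > 0" "!!\<epsilon> j. 0 <= \<epsilon> ==> \<epsilon> <= 1 ==> \<bar>S + \<epsilon> - w j\<bar> <= D"
  subgoal using B by (simp add: D_def)
  subgoal for \<epsilon> j using S bdd[of j] by (simp add: D_def abs_le_iff)
  done
 have h0: "h >= 0"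
 proof -
  obtain N where "(\<Sum>j\<in>{1..N}. inv_weight k N j) = h" using mass by (auto simp: eventually_sequentially)
  then show ?thesis using sum_nonneg[of "{1..N}" "inv_weight k N"] by simp
 qed
 define C1 where "C1 = (real k + 1)\<^sup>2"
 \<comment> \<open>At most 2 \<eta> N indices lie above (1 - \<eta>) N, each of weight at most C1 /
   N and with a deviation of at most \<open>D\<close>; this choice limits their contribution to
   \<delta> / 4.\<close>
 define \<eta> where "\<eta> = min (1/2) (\<delta> / (8 * D * C1))"
 have C1: "C1 > 0" by (simp add: C1_def)
 have \<eta>: "0 < \<eta>" "\<eta> < 1" "D * C1 * (2 * \<eta>) <= \<delta> / 4"
 proof -
  show "0 < \<eta>" "\<eta> < 1" using \<open>\<delta> > 0\<close> D C1 by (auto simp: \<eta>_def)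
  have "D * C1 * (2 * \<eta>) <= D * C1 * (2 * (\<delta> / (8 * D * C1)))"
   using D C1 by (intro mult_left_mono) (auto simp: \<eta>_def)
  then show "D * C1 * (2 * \<eta>) <= \<delta> / 4" using D C1 by simp
 qed
 obtain C N0 where C: "C > 0"
  and CN: "!!N j. N >= N0 ==> j >= 1 ==> real j <= (1 - \<eta>) * real N ==> inv_weight k N j <= C * size_biased k N j"
  using inv_weight_le_size_biased[OF \<eta>(1,2), of k] by metis
 define \<epsilon> where "\<epsilon> = min 1 (\<delta> / (16 * C))"
 have \<epsilon>: "0 < \<epsilon>" "\<epsilon> <= 1" "C * (4 * \<epsilon>) <= \<delta> / 4"
 proof -
  show "0 < \<epsilon>" "\<epsilon> <= 1" using \<open>\<delta> > 0\<close> C by (auto simp: \<epsilon>_def)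
  have "C * (4 * \<epsilon>) <= C * (4 * (\<delta> / (16 * C)))"
   using C by (intro mult_left_mono) (auto simp: \<epsilon>_def)
  then show "C * (4 * \<epsilon>) <= \<delta> / 4" using C by simp
 qed
 obtain N1 where N1: "!!N. N >= N1 ==> w N <= S + \<epsilon>"
  using up[OF \<epsilon>(1)] by (auto simp: eventually_sequentially)
 \<comment> \<open>Bounds the total contribution of the indices below \<open>N1\<close>, for which w
   is not yet known to stay below S + \<epsilon>.\<close>
 define q where "q N = real (k+2) * real (k+2) * real N1 / (real N)\<^sup>2 * 2 * D * real N1" for N
 have "q \<longlonglongrightarrow> 0" unfolding q_def by real_asymp
 then have e1: "eventually (%N. q N < \<epsilon>) sequentially" using \<epsilon>(1) by (rule order_tendstoD)
 have e2: "eventually (%N. \<bar>w N - (\<Sum>j\<in>{1..<N}. size_biased k N j * w j)\<bar> < \<epsilon>) sequentially"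
  using tendstoD[OF rec \<epsilon>(1)] by (simp add: dist_real_def)
 have e3: "eventually (%N. (\<Sum>j\<in>{1..N}. inv_weight k N j * w j) < L + \<delta> / 4) sequentially"
  using \<open>\<delta> > 0\<close> by (intro order_tendstoD[OF lim]) auto
 have e4: "eventually (%N. real N > 1 / \<eta>) sequentially"
  using filterlim_real_sequentially by (rule filterlim_at_top_dense[THEN iffD1, rule_format])
 have "eventually (%N. q N < \<epsilon> \<and> \<bar>w N - (\<Sum>j\<in>{1..<N}. size_biased k N j * w j)\<bar> < \<epsilon>
   \<and> (\<Sum>j\<in>{1..N}. inv_weight k N j * w j) < L + \<delta> / 4 \<and> real N > 1 / \<eta> \<and> N >= N0 + N1 + k + 2 \<and> (\<Sum>j\<in>{1..N}. inv_weight k N j) = h) sequentially"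
  by (intro eventually_conj e1 e2 e3 e4 mass eventually_ge_at_top)
 from frequently_ex[OF frequently_eventually_conj[OF freq[OF \<epsilon>(1)] this]]
 obtain N where N: "w N > S - \<epsilon>" "q N < \<epsilon>" "\<bar>w N - (\<Sum>j\<in>{1..<N}. size_biased k N j * w j)\<bar> < \<epsilon>"
   "(\<Sum>j\<in>{1..N}. inv_weight k N j * w j) < L + \<delta> / 4" "real N > 1 / \<eta>" "N >= N0 + N1 + k + 2" "(\<Sum>j\<in>{1..N}. inv_weight k N j) = h"
  by blast
 define x where "x j = S + \<epsilon> - w j" for j
 have x: "\<bar>x j\<bar> <= D" for j using D(2)[of \<epsilon> j] \<epsilon> by (simp add: x_def)
 have xpos: "x j >= 0" if "j >= N1" for j using N1[OF that] by (simp add: x_def)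
 have sN: "(\<Sum>j\<in>{1..<N}. size_biased k N j) = 1" using N by (intro sum_size_biased) auto
 have "(\<Sum>j\<in>{1..<N}. size_biased k N j * x j) = S + \<epsilon> - (\<Sum>j\<in>{1..<N}. size_biased k N j * w j)"
  unfolding x_def by (simp add: right_diff_distrib sum_subtractf sN[simplified] flip: sum_distrib_right)
 also have "... <= 3 * \<epsilon>" using N(1,3) by linarith
 finally have s1: "(\<Sum>j\<in>{1..<N}. size_biased k N j * x j) <= 3 * \<epsilon>" .
 \<comment> \<open>Only indices below \<open>N1\<close> can have negative \<open>x j\<close>.
   Replacing \<open>x\<close> by its positive part costs no more than \<open>q N\<close>, and
   afterwards the smallness of the average says something about the individual terms.\<close>
 have s2: "(\<Sum>j\<in>{1..<N}. size_biased k N j * (max (x j) 0 - x j)) <= \<epsilon>"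
 proof -
  have "(\<Sum>j\<in>{1..<N}. size_biased k N j * (max (x j) 0 - x j))
   = (\<Sum>j\<in>{1..<N1}. size_biased k N j * (max (x j) 0 - x j))"
   using N xpos by (intro sum.mono_neutral_right) (auto simp: max_def intro: order.antisym)
  also have "... <= (\<Sum>j\<in>{1..<N1}. real (k + 2) * real (k + 2) * real N1 / (real N)\<^sup>2 * 2 * D)"
  proof (intro sum_mono mult_mono)
   fix j assume j: "j \<in> {1..<N1}"
   have "size_biased k N j <= real (k + 2) * real (k + 2) * real j / (real N)\<^sup>2 * 2"
    using j N by (intro size_biased_le) auto
   also have "... <= real (k + 2) * real (k + 2) * real N1 / (real N)\<^sup>2 * 2"
    using j by (intro mult_right_mono divide_right_mono mult_left_mono) auto
   finally show "size_biased k N j <= real (k + 2) * real (k + 2) * real N1 / (real N)\<^sup>2 * 2" .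
   show "max (x j) 0 - x j <= D" using x[of j] by (auto simp: max_def)
  qed (use D in auto)
  also have "... <= q N" using D by (simp add: q_def mult_ac mult_left_mono divide_right_mono)
  finally show ?thesis using N(2) by simp
 qed
 have s3: "(\<Sum>j\<in>{1..<N}. size_biased k N j * max (x j) 0) <= 4 * \<epsilon>"
  using s1 s2 by (simp add: right_diff_distrib sum_subtractf)
 define A where "A = {j\<in>{1..N}. real j <= (1 - \<eta>) * real N}"
 define A' where "A' = {j\<in>{1..N}. \<not> real j <= (1 - \<eta>) * real N}"
 have Npos: "real N > 0" using N by simp
 have AN: "A \<subseteq> {1..<N}"
 proof
  fix j assume j: "j \<in> A"
  have "(1 - \<eta>) * real N < 1 * real N" using \<eta> Npos by (intro mult_strict_right_mono) auto
  moreover have "real j <= (1 - \<eta>) * real N" using j by (simp add: A_def)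
  ultimately have "real j < real N" by linarith
  then show "j \<in> {1..<N}" using j by (simp add: A_def)
 qed
 have "(\<Sum>j\<in>{1..N}. inv_weight k N j * x j) <= (\<Sum>j\<in>{1..N}. inv_weight k N j * max (x j) 0)"
  by (intro sum_mono mult_left_mono) auto
 also have "... = (\<Sum>j\<in>A. inv_weight k N j * max (x j) 0) + (\<Sum>j\<in>A'. inv_weight k N j * max (x j) 0)"
  unfolding A_def A'_def by (subst sum.union_disjoint[symmetric]) (auto intro!: sum.cong)
 also have "(\<Sum>j\<in>A. inv_weight k N j * max (x j) 0) <= (\<Sum>j\<in>A. C * (size_biased k N j * max (x j) 0))"
  unfolding mult.assoc[symmetric] using N by (intro sum_mono mult_right_mono CN) (auto simp: A_def)
 also have "(\<Sum>j\<in>A. C * (size_biased k N j * max (x j) 0)) <= (\<Sum>j\<in>{1..<N}. C * (size_biased k N j * max (x j) 0))"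
  using AN C by (intro sum_mono2) auto
 also have "... <= C * (4 * \<epsilon>)" unfolding sum_distrib_left[symmetric] using s3 C by (intro mult_left_mono) auto
 also have "... <= \<delta> / 4" by fact
 also have "(\<Sum>j\<in>A'. inv_weight k N j * max (x j) 0) <= (\<Sum>j\<in>A'. C1 / real N * D)"
 proof (intro sum_mono mult_mono)
  fix j assume j: "j \<in> A'"
  then have "inv_weight k N j <= C1 * real j / (real N)\<^sup>2"
   unfolding C1_def by (intro inv_weight_le) (auto simp: A'_def)
  also have "... <= C1 * real N / (real N)\<^sup>2"
   using j C1 by (intro divide_right_mono mult_left_mono) (auto simp: A'_def)
  finally show "inv_weight k N j <= C1 / real N" using Npos by (simp add: power2_eq_square)
  show "max (x j) 0 <= D" using x[of j] D by auto
 qed (use C1 in auto)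
 also have "... = real (card A') * (C1 / real N * D)" by simp
 also have "... <= (2 * \<eta> * real N) * (C1 / real N * D)"
 proof (intro mult_right_mono)
  define m where "m = nat \<lfloor>(1 - \<eta>) * real N\<rfloor>"
  have m0: "(1 - \<eta>) * real N >= 0" using \<eta> by simp
  have "A' \<subseteq> {m<..N}"
  proof
   fix j assume "j \<in> A'"
   then have "j <= N" "(1 - \<eta>) * real N < real j" by (auto simp: A'_def)
   then show "j \<in> {m<..N}" using m0 unfolding m_def by (simp add: floor_less_iff nat_less_iff)
  qed
  then have "card A' <= N - m" by (metis card_greaterThanAtMost card_mono finite_greaterThanAtMost)
  moreover have "real m > (1 - \<eta>) * real N - 1" unfolding m_def using m0 by linarith
  moreover have "real m <= (1 - \<eta>) * real N" unfolding m_def using m0 by simp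
  moreover have "(1 - \<eta>) * real N <= real N" using \<eta> Npos by (simp add: algebra_simps)
  ultimately have "card A' <= N - m" "real m > (1 - \<eta>) * real N - 1" "m <= N" by linarith+
  then have "real (card A') <= \<eta> * real N + 1" by (simp add: algebra_simps of_nat_diff)
  moreover have "1 <= \<eta> * real N" using N(5) \<eta> by (simp add: field_simps)
  ultimately show "real (card A') <= 2 * \<eta> * real N" by linarith
 qed (use C1 D in auto)
 also have "... = D * C1 * (2 * \<eta>)" using Npos by simp
 also have "... <= \<delta> / 4" by fact
 finally have "(\<Sum>j\<in>{1..N}. inv_weight k N j * x j) <= \<delta> / 4 + \<delta> / 4" by simp
 moreover have "(\<Sum>j\<in>{1..N}. inv_weight k N j * x j) = h * (S + \<epsilon>) - (\<Sum>j\<in>{1..N}. inv_weight k N j * w j)"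
  unfolding x_def using N(7) by (simp add: right_diff_distrib sum_subtractf flip: sum_distrib_right)
 moreover have "h * S <= h * (S + \<epsilon>)" using h0 \<epsilon> by (intro mult_left_mono) auto
 ultimately show "h * S <= L + \<delta>" using N(4) \<open>\<delta> > 0\<close> by linarith
qed

text \<open>The limit superior as the infimum of all eventual upper bounds, in the \<epsilon>-form
  that is applied to a sequence and to its negative.\<close>

lemma bounded_real_limsup:
 fixes w :: "nat => real"
 assumes "!!j. \<bar>w j\<bar> <= B"
 shows "\<exists>S. (\<forall>\<epsilon>>0. eventually (%N. w N <= S + \<epsilon>) sequentially) \<and>
  (\<forall>\<epsilon>>0. frequently (%N. w N > S - \<epsilon>) sequentially)"
proof (rule exI, intro conjI allI impI)
 define U where "U = {x. eventually (%N. w N <= x) sequentially}"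
 have ne: "B \<in> U" unfolding U_def using assms by (auto simp: abs_le_iff)
 have bb: "bdd_below U"
 proof (rule bdd_belowI)
  fix x assume "x \<in> U"
  then obtain N where "w N <= x" unfolding U_def by (auto simp: eventually_sequentially)
  then show "- B <= x" using assms[of N] by linarith
 qed
 fix \<epsilon> :: real assume e: "\<epsilon> > 0"
 obtain x where "x \<in> U" "x < Inf U + \<epsilon>" using cInf_lessD[of U "Inf U + \<epsilon>"] ne e by auto
 then show "eventually (%N. w N <= Inf U + \<epsilon>) sequentially"
  unfolding U_def by (auto elim: eventually_mono)
 show "frequently (%N. w N > Inf U - \<epsilon>) sequentially"
 proof (rule ccontr)
  assume "\<not> ?thesis"
  then have "Inf U - \<epsilon> \<in> U" unfolding U_def by (simp add: not_frequently not_less)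
  then show False using cInf_lower[OF _ bb] e by fastforce
 qed
qed

text \<open>Let L be the limit of the invariant functional along w = e N / N and h its value on the
  constant 1. The comparison with the limit superior gives h limsup w <= L, and applied to -w it
  gives h liminf w >= L.\<close>

theorem gap_recurrence_linear:
 fixes e :: "nat => real"
 assumes err: "!!N. N >= k + 2 ==> \<bar>e N - gap_avg k e N\<bar> <= C * sqrt (real N)"
 shows "convergent (%N. e N / real N)"
proof -
 define w where "w N = e N / real N" for N
 obtain B where B: "!!N. N >= 1 ==> \<bar>e N\<bar> <= B * real N"
  using gap_recurrence_bounded[OF err] by blast
 have wB: "\<bar>w N\<bar> <= B" for N
 proof (cases "N >= 1")
  case True
  then show ?thesis using B[OF True] by (simp add: w_def abs_divide divide_le_eq)
 next
  case False
  have "0 <= B" using B[of 1] by simp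
  then show ?thesis using False by (simp add: w_def not_less_eq_eq)
 qed
 have C0: "C >= 0" using err[of "k+2"] by (smt (verit) add_2_eq_Suc' mult_less_0_iff of_nat_0_less_iff order_refl real_sqrt_gt_zero zero_less_Suc)
 have werr: "\<bar>w N - (\<Sum>j\<in>{1..<N}. size_biased k N j * w j)\<bar> <= C * (1 / sqrt (real N))" if N: "N >= k + 2" for N
 proof -
  have "gap_avg k e N = gap_avg k (%j. real j * w j) N"
   by (auto simp: gap_avg_def gap_sum_def w_def intro!: sum.cong)
  also have "... = real N * (\<Sum>j\<in>{1..<N}. size_biased k N j * w j)"
   by (rule gap_avg_eq_size_biased[OF N])
  finally have "e N - gap_avg k e N = real N * (w N - (\<Sum>j\<in>{1..<N}. size_biased k N j * w j))"
   using N by (simp add: w_def right_diff_distrib)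
  then have "real N * \<bar>w N - (\<Sum>j\<in>{1..<N}. size_biased k N j * w j)\<bar> <= C * sqrt (real N)"
   using err[OF N] by (simp add: abs_mult)
  moreover have "C * sqrt (real N) = real N * (C * (1 / sqrt (real N)))"
   using N by (simp add: field_simps)
  ultimately show ?thesis using N by (metis add_2_eq_Suc' mult_le_cancel_left_pos of_nat_0_less_iff less_le_trans zero_less_Suc)
 qed
 define \<Phi> where "\<Phi> u M = (\<Sum>j\<in>{1..M}. inv_weight k M j * u j)" for u M
 have step: "\<Phi> u (Suc M) = \<Phi> u M + (u (Suc M) - (\<Sum>j\<in>{1..<Suc M}. size_biased k (Suc M) j * u j)) / (real M + 2)"
  if "Suc M >= k + 2" for u M unfolding \<Phi>_def by (rule inv_functional_step[OF that])
 \<comment> \<open>The increments are the errors of w divided by M + 2, hence O(M^(-3/2)) and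
   summable. The term \<open>d 0\<close> is split off because the step formula starts at
   \<open>Suc M = k + 2\<close>.\<close>
 define d where "d n = \<Phi> w (Suc n + k) - \<Phi> w (n + k)" for n
 have "summable (%n. d (Suc n))"
 proof (rule summable_comparison_test')
  have "summable (%n. C * (real n powr (-3/2)))"
   by (intro summable_mult) (simp add: summable_real_powr_iff)
  then show "summable (%n. C * (real (Suc n) powr (-3/2)))" by (subst summable_Suc_iff)
  fix n :: nat assume "0 <= n"
  define M where "M = Suc n + k"
  have M: "Suc M >= k + 2" by (simp add: M_def)
  have "d (Suc n) = (w (Suc M) - (\<Sum>j\<in>{1..<Suc M}. size_biased k (Suc M) j * w j)) / (real M + 2)"
   using step[OF M, of w] by (simp add: d_def M_def)
  then have "norm (d (Suc n)) <= C * (1 / sqrt (real (Suc M))) / (real M + 2)"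
   using divide_right_mono[OF werr[OF M], of "real M + 2"]
   by (simp add: abs_divide del: sum.op_ivl_Suc)
  also have "... <= C * (1 / sqrt (real (Suc n))) / real (Suc n)"
   using C0 by (intro frac_le mult_left_mono) (auto simp: M_def)
  also have "... = C * (real (Suc n) powr (-3/2))"
  proof -
   define x where "x = real (Suc n)"
   have x: "x > 0" by (simp add: x_def)
   have "x powr (-3/2) = x powr (- (1/2)) * x powr (-1)" by (subst powr_add[symmetric]) simp
   also have "x powr (- (1/2)) = 1 / sqrt x" using x by (simp add: powr_minus_divide powr_half_sqrt)
   also have "x powr (-1) = 1 / x" using x by (simp add: powr_minus_divide)
   finally show ?thesis by (simp add: x_def)
  qed
  finally show "norm (d (Suc n)) <= C * (real (Suc n) powr (-3/2))" .
 qed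
 then have "summable d" by (subst (asm) summable_Suc_iff)
 then have "convergent (%n. \<Sum>i<n. d i)" by (simp add: summable_iff_convergent)
 moreover have "(\<Sum>i<n. d i) = \<Phi> w (n + k) - \<Phi> w k" for n
  unfolding d_def using sum_lessThan_telescope[of "%n. \<Phi> w (n + k)" n] by simp
 ultimately obtain l where "(%n. \<Phi> w (n + k) - \<Phi> w k) \<longlonglongrightarrow> l" by (auto simp: convergent_def)
 then have "(%n. \<Phi> w (n + k) - \<Phi> w k + \<Phi> w k) \<longlonglongrightarrow> l + \<Phi> w k" by (intro tendsto_add tendsto_const)
 then have "(%n. \<Phi> w (n + k)) \<longlonglongrightarrow> l + \<Phi> w k" by simp
 then obtain L where L: "\<Phi> w \<longlonglongrightarrow> L" using LIMSEQ_offset by blast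
 \<comment> \<open>The size-biased weights sum to 1 from level k + 2 on, so the total mass of the
   functional no longer changes after level k + 1.\<close>
 define h where "h = \<Phi> (%_. 1) (k + 1)"
 have hM: "\<Phi> (%_. 1) M = h" if "M >= k + 1" for M
  using that
 proof (induction M rule: dec_induct)
  case (step n)
  then have "Suc n >= k + 2" by simp
  from assms step.IH \<open>Suc n >= k + 2\<close> show ?case
   using \<open>!!u M. k + 2 <= Suc M ==> \<Phi> u (Suc M) = \<Phi> u M + (u (Suc M) - (\<Sum>j\<in>{1..<Suc M}. size_biased k (Suc M) j * u j)) / (real M + 2)\<close>[of n "%_. 1"]
    sum_size_biased[of k "Suc n"] by simp
 qed (simp add: h_def)
 have mass: "eventually (%N. (\<Sum>j\<in>{1..N}. inv_weight k N j) = h) sequentially"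
  using eventually_ge_at_top[of "k + 1"] by eventually_elim (use hM in \<open>simp add: \<Phi>_def\<close>)
 have h: "h > 0"
 proof -
  have "inv_weight k (k+1) (k+1) > 0" by (subst inv_weight_diag) auto
  moreover have "inv_weight k (k+1) (k+1) <= h" unfolding h_def \<Phi>_def
   using member_le_sum[of "k+1" "{1..k+1}" "inv_weight k (k+1)"] by simp
  ultimately show ?thesis by simp
 qed
 have rec: "(%N. w N - (\<Sum>j\<in>{1..<N}. size_biased k N j * w j)) \<longlonglongrightarrow> 0"
 proof (rule Lim_null_comparison)
  show "eventually (%N. norm (w N - (\<Sum>j\<in>{1..<N}. size_biased k N j * w j)) <= C * (1 / sqrt (real N))) sequentially"
   using eventually_ge_at_top[of "k + 2"] by eventually_elim (use werr in simp)
  show "(%N. C * (1 / sqrt (real N))) \<longlonglongrightarrow> 0" by real_asymp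
 qed
 obtain S where S: "!!\<epsilon>. \<epsilon> > 0 ==> eventually (%N. w N <= S + \<epsilon>) sequentially"
  "!!\<epsilon>. \<epsilon> > 0 ==> frequently (%N. w N > S - \<epsilon>) sequentially"
  using bounded_real_limsup[of w, OF wB] by blast
 have mB: "\<bar>- w N\<bar> <= B" for N using wB[of N] by simp
 obtain T where T: "!!\<epsilon>. \<epsilon> > 0 ==> eventually (%N. - w N <= T + \<epsilon>) sequentially"
  "!!\<epsilon>. \<epsilon> > 0 ==> frequently (%N. - w N > T - \<epsilon>) sequentially"
  using bounded_real_limsup[of "%N. - w N", OF mB] by blast
 have 1: "h * S <= L"
  by (rule inv_functional_ge_limsup[OF wB S rec L[unfolded \<Phi>_def] mass])
 have 2: "h * T <= - L"
 proof (rule inv_functional_ge_limsup[OF mB T _ _ mass])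
  show "(%N. - w N - (\<Sum>j = 1..<N. size_biased k N j * - w j)) \<longlonglongrightarrow> 0"
   using tendsto_minus[OF rec] by (simp add: sum_negf)
  show "(%N. \<Sum>j = 1..N. inv_weight k N j * - w j) \<longlonglongrightarrow> - L"
   using tendsto_minus[OF L[unfolded \<Phi>_def]] by (simp add: sum_negf)
 qed
 have "S <= L / h" "T <= - L / h" using 1 2 h by (simp_all add: field_simps)
 have "w \<longlonglongrightarrow> L / h"
 proof (rule LIMSEQ_I)
  fix \<epsilon> :: real assume "\<epsilon> > 0"
  then have "\<epsilon> / 2 > 0" by simp
  have "eventually (%N. norm (w N - L / h) < \<epsilon>) sequentially"
   using S(1)[OF \<open>\<epsilon> / 2 > 0\<close>] T(1)[OF \<open>\<epsilon> / 2 > 0\<close>]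
  proof eventually_elim
   case (elim N)
   have "w N - L / h <= \<epsilon> / 2" "L / h - w N <= \<epsilon> / 2" using elim \<open>S <= L / h\<close> \<open>T <= - L / h\<close> by auto
   then show ?case using \<open>\<epsilon> > 0\<close> unfolding real_norm_def by linarith
  qed
  then show "\<exists>no. \<forall>n\<ge>no. norm (w n - L / h) < \<epsilon>" by (simp add: eventually_sequentially)
 qed
 then show ?thesis unfolding w_def convergent_def by blast
qed

section \<open>Classification trees and order statistics\<close>

lemma finite_trees_over:
 assumes "finite A"
 shows "finite {t. size t <= n \<and> set_tree t \<subseteq> A}"
proof (induction n)
 case 0
 have "{t. size t <= 0 \<and> set_tree t \<subseteq> A} \<subseteq> {Leaf}" by (auto simp: eq_size_0)
 then show ?case using finite_subset by blast
next
 case (Suc n)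
 let ?T = "{t. size t <= n \<and> set_tree t \<subseteq> A}"
 have "{t. size t <= Suc n \<and> set_tree t \<subseteq> A} \<subseteq> insert Leaf ((%(l, x, r). Node l x r) ` (?T \<times> A \<times> ?T))"
 proof
  fix t assume "t \<in> {t. size t <= Suc n \<and> set_tree t \<subseteq> A}"
  then show "t \<in> insert Leaf ((%(l, x, r). Node l x r) ` (?T \<times> A \<times> ?T))"
   by (cases t) (auto intro!: image_eqI[of _ _ "(_, _, _)"])
 qed
 moreover have "finite (insert Leaf ((%(l, x, r). Node l x r) ` (?T \<times> A \<times> ?T)))"
  using Suc assms by simp
 ultimately show ?case by (rule finite_subset)
qed

lemma size_class_trees: "t \<in> class_trees K ==> size t = K"
proof -
 assume t: "t \<in> class_trees K"
 then have "distinct (inorder t)"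
  by (auto simp: class_trees_def bst_iff_sorted_wrt_less strict_sorted_iff)
 then have "size t = card (set_tree t)" using distinct_card[of "inorder t"] by simp
 then show ?thesis using t by (simp add: class_trees_def)
qed

lemma finite_class_trees: "finite (class_trees K)"
 by (rule finite_subset[OF _ finite_trees_over[of "{1..K}" K]])
  (auto simp: size_class_trees, auto simp: class_trees_def)

lemma class_trees_nonempty: "class_trees K \<noteq> {}"
proof -
 have "\<exists>t. bst t \<and> set_tree t = {1..K}"
 proof (induction K)
  case 0
  show ?case by (intro exI[of _ Leaf]) auto
 next
  case (Suc K)
  then obtain t where "bst t" "set_tree t = {1..K}" by auto
  moreover from this have "bst (Node t (Suc K) Leaf)" by simp
  moreover have "{1..Suc K} = insert (Suc K) {1..K}" by auto
  ultimately show ?case by (intro exI[of _ "Node t (Suc K) Leaf"]) simp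
 qed
 then show ?thesis by (auto simp: class_trees_def)
qed

lemma length_leaf_depths: "length (leaf_depths t) = Suc (size t)"
 by (induction t) auto

lemma leaf_depths_le: "d \<in> set (leaf_depths t) ==> d <= size t"
proof (induction t arbitrary: d)
 case (Node l x r)
 then obtain d' where "d = Suc d'" "d' \<in> set (leaf_depths l) \<or> d' \<in> set (leaf_depths r)" by auto
 then show ?case using Node.IH(1)[of d'] Node.IH(2)[of d'] by auto
qed simp

lemma leaf_depth_bounds:
 assumes "t \<in> class_trees K" "i <= K"
 shows "leaf_depth t i <= K" "K >= 1 ==> 1 <= leaf_depth t i"
proof -
 have s: "size t = K" by (rule size_class_trees[OF assms(1)])
 then have m: "leaf_depth t i \<in> set (leaf_depths t)"
  unfolding leaf_depth_def using assms(2) by (intro nth_mem) (simp add: length_leaf_depths)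
 show "leaf_depth t i <= K" using leaf_depths_le[OF m] s by simp
 show "1 <= leaf_depth t i" if "K >= 1" using m s that by (cases t) auto
qed

lemma opt_cost_le: "t \<in> class_trees K ==> opt_cost K x <= path_cost K t x"
 unfolding opt_cost_def by (intro Min_le) (auto simp: finite_class_trees)

lemma opt_cost_attained: "\<exists>t\<in>class_trees K. path_cost K t x = opt_cost K x"
proof -
 have "opt_cost K x \<in> (%t. path_cost K t x) ` class_trees K"
  unfolding opt_cost_def by (intro Min_in) (auto simp: finite_class_trees class_trees_nonempty)
 then show ?thesis by auto
qed

lemma path_cost_bounds:
 assumes "t \<in> class_trees K" "K >= 1" "!!i. i <= K ==> x i >= 0"
 shows "(\<Sum>i\<le>K. x i) <= path_cost K t x" "path_cost K t x <= real K * (\<Sum>i\<le>K. x i)"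
proof -
 have "x i * 1 <= x i * real (leaf_depth t i)" "x i * real (leaf_depth t i) <= x i * real K" if "i <= K" for i
  using leaf_depth_bounds[OF assms(1) that] assms(2) assms(3)[OF that] by (intro mult_left_mono; simp)+
 then show "(\<Sum>i\<le>K. x i) <= path_cost K t x" "path_cost K t x <= real K * (\<Sum>i\<le>K. x i)"
  unfolding path_cost_def sum_distrib_left by (auto intro!: sum_mono simp: mult.commute[of "real K"])
qed

lemma opt_cost_bounds:
 assumes "K >= 1" "!!i. i <= K ==> x i >= 0"
 shows "(\<Sum>i\<le>K. x i) <= opt_cost K x" "opt_cost K x <= real K * (\<Sum>i\<le>K. x i)"
proof -
 obtain t where t: "t \<in> class_trees K" "path_cost K t x = opt_cost K x" using opt_cost_attained by blast
 show "(\<Sum>i\<le>K. x i) <= opt_cost K x" "opt_cost K x <= real K * (\<Sum>i\<le>K. x i)"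
  using path_cost_bounds[of t K x, OF t(1) assms] t(2) by (simp_all add: atMost_def)
qed

lemma linear_order_least:
 assumes "linear_order_on C r" "finite A" "A \<noteq> {}" "A \<subseteq> C"
 shows "\<exists>t\<in>A. \<forall>s\<in>A. (t, s) \<in> r"
 using assms(2-4)
proof (induction A rule: finite_ne_induct)
 case (singleton x)
 then show ?case using assms(1) by (auto simp: order_on_defs refl_on_def)
next
 case (insert x A)
 then obtain t where t: "t \<in> A" "\<forall>s\<in>A. (t, s) \<in> r" by auto
 have "x \<noteq> t" using insert.hyps t by auto
 then have "(x, t) \<in> r \<or> (t, x) \<in> r"
  using assms(1) insert.prems t by (auto simp: order_on_defs total_on_def)
 moreover have "(x, x) \<in> r" using assms(1) insert.prems by (auto simp: order_on_defs refl_on_def)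
 moreover have "trans r" using assms(1) by (auto simp: order_on_defs)
 ultimately show ?case using t by (auto dest: transD)
qed

text \<open>The first equivalence replaces the definite description by finitely many comparisons of
  path costs, which is what makes the event that a given tree is chosen measurable.\<close>

lemma opt_tree_eq_iff:
 assumes "linear_order_on (class_trees K) r" "t \<in> class_trees K"
 shows "opt_tree r K x = t \<longleftrightarrow> path_cost K t x = opt_cost K x \<and>
  (\<forall>s\<in>class_trees K. path_cost K s x = opt_cost K x \<longrightarrow> (t, s) \<in> r)"
  and "opt_tree r K x \<in> class_trees K" "path_cost K (opt_tree r K x) x = opt_cost K x"
proof -
 define A where "A = {t \<in> class_trees K. path_cost K t x = opt_cost K x}"
 have "\<exists>t\<in>A. \<forall>s\<in>A. (t, s) \<in> r"
  using opt_cost_attained[of K x]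
  by (intro linear_order_least[OF assms(1)]) (auto simp: A_def finite_class_trees)
 then obtain u where u: "u \<in> A" "\<forall>s\<in>A. (u, s) \<in> r" by auto
 have anti: "antisym r" using assms(1) by (auto simp: order_on_defs)
 have uniq: "t = u" if "t \<in> A" "\<forall>s\<in>A. (t, s) \<in> r" for t
  using that u anti by (auto dest: antisymD)
 have eq: "opt_tree r K x = u"
  unfolding opt_tree_def Let_def A_def[symmetric]
  by (rule the_equality) (use u in blast, use uniq in blast)
 show "opt_tree r K x \<in> class_trees K" "path_cost K (opt_tree r K x) x = opt_cost K x"
  using u unfolding eq by (auto simp: A_def)
 show "opt_tree r K x = t \<longleftrightarrow> path_cost K t x = opt_cost K x \<and>
  (\<forall>s\<in>class_trees K. path_cost K s x = opt_cost K x \<longrightarrow> (t, s) \<in> r)"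
  unfolding eq using u uniq[of t] assms(2) by (auto simp: A_def)
qed

section \<open>Order statistics, spacings and sublists\<close>

lemma pivot_0 [simp]: "pivot K v 0 = 0"
 by (simp add: pivot_def)

lemma pivot_Suc_K [simp]: "pivot K v (Suc K) = 1"
 by (simp add: pivot_def)

lemma pivot_in_image:
 assumes "1 <= i" "i <= K" shows "pivot K v i \<in> v ` {1..K}"
proof -
 have "sort (map v [1..<Suc K]) ! (i - 1) \<in> set (sort (map v [1..<Suc K]))"
  using assms by (intro nth_mem) auto
 then show ?thesis using assms by (auto simp: pivot_def)
qed

lemma pivot_unit:
 assumes "!!j. j \<in> {1..K} ==> v j \<in> {0..1}"
 shows "pivot K v i \<in> {0..1}"
proof (cases "1 <= i \<and> i <= K")
 case True
 then show ?thesis using pivot_in_image[of i K v] assms by auto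
qed (auto simp: pivot_def)

lemma pivot_mono:
 assumes "!!j. j \<in> {1..K} ==> v j \<in> {0..1}" "i <= j"
 shows "pivot K v i <= pivot K v j"
proof -
 consider "i = 0" | "j > K" | "1 <= i" "j <= K" by linarith
 then show ?thesis
 proof cases
  case 3
  then show ?thesis using assms(2)
   by (auto simp: pivot_def intro!: sorted_nth_mono)
 qed (use pivot_unit[of K v i] pivot_unit[of K v j] assms in \<open>auto simp: pivot_def\<close>)
qed

lemma spacing_nonneg:
 assumes "!!j. j \<in> {1..K} ==> v j \<in> {0..1}"
 shows "0 <= spacing K v i"
 using pivot_mono[of K v i "Suc i", OF assms] by (simp add: spacing_def)

lemma sum_spacing: "(\<Sum>i\<le>K. spacing K v i) = 1"
 unfolding spacing_def
 by (subst sum_Suc_diff'[of 0 "Suc K" "pivot K v", unfolded atLeast0LessThan lessThan_Suc_atMost]) auto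

lemma spacing_le_1:
 assumes "!!j. j \<in> {1..K} ==> v j \<in> {0..1}"
 shows "spacing K v i <= 1"
 using pivot_unit[of K v i, OF assms] pivot_unit[of K v "Suc i", OF assms]
 by (simp add: spacing_def)

lemma bucket_disjoint:
 assumes "!!j. j \<in> {1..K} ==> v j \<in> {0..1}" "i \<noteq> j"
 shows "bucket K v i \<inter> bucket K v j = {}"
proof -
 have "bucket K v i \<inter> bucket K v j = {}" if "i < j" for i j
  using pivot_mono[of K v "Suc i" j, OF assms(1)] that by (auto simp: bucket_def)
 then show ?thesis using assms(2) by (metis Int_commute nat_neq_iff)
qed

lemma bucket_count_eq_sum: "bucket_count K v a m i = (\<Sum>k\<in>{1..m}. of_bool (a k \<in> bucket K v i))"
 unfolding bucket_count_def by (simp add: of_bool_def sum.If_cases Int_def conj_commute)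

lemma sum_of_bool_bucket_le:
 assumes "!!j. j \<in> {1..K} ==> v j \<in> {0..1}"
  and "!!i. i <= K ==> f i <= c" "0 <= c"
 shows "(\<Sum>i\<le>K. of_bool (x \<in> bucket K v i) * f i) <= (c::real)"
proof (cases "\<exists>j\<le>K. x \<in> bucket K v j")
 case True
 then obtain j where j: "j <= K" "x \<in> bucket K v j" by auto
 have "x \<notin> bucket K v i" if "i \<noteq> j" for i
  using j bucket_disjoint[of K v i j, OF assms(1) that] by auto
 then have "(\<Sum>i\<le>K. of_bool (x \<in> bucket K v i) * f i) = (\<Sum>i\<in>{j}. of_bool (x \<in> bucket K v i) * f i)"
  using j by (intro sum.mono_neutral_right) auto
 then show ?thesis using j assms(2)[of j] by simp
next
 case False
 then have "(\<Sum>i\<le>K. of_bool (x \<in> bucket K v i) * f i) = 0" by (intro sum.neutral) auto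
 then show ?thesis using assms(3) by simp
qed

text \<open>Only an inequality holds pointwise: the buckets are open intervals, so an element that
  equals a pivot is counted nowhere. Equality holds almost surely, see
  \<open>AE_sum_cnt\<close>.\<close>

lemma sum_bucket_count_le:
 assumes "!!j. j \<in> {1..K} ==> v j \<in> {0..1}"
 shows "(\<Sum>i\<le>K. bucket_count K v a m i) <= m"
proof -
 have "(\<Sum>i\<le>K. bucket_count K v a m i) = card (\<Union>i\<le>K. {k \<in> {1..m}. a k \<in> bucket K v i})"
  unfolding bucket_count_def
 proof (rule card_UN_disjoint[symmetric])
  show "\<forall>i\<in>{..K}. \<forall>j\<in>{..K}. i \<noteq> j \<longrightarrow>
   {k \<in> {1..m}. a k \<in> bucket K v i} \<inter> {k \<in> {1..m}. a k \<in> bucket K v j} = {}"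
   using bucket_disjoint[of K v, OF assms] by (auto simp: disjoint_iff)
 qed auto
 also have "... <= card {1..m}" by (intro card_mono) auto
 finally show ?thesis by simp
qed

lemma bucket_count_le: "bucket_count K v a m i <= m"
proof -
 have "card {k \<in> {1..m}. a k \<in> bucket K v i} <= card {1..m}" by (rule card_mono) auto
 then show ?thesis unfolding bucket_count_def by simp
qed

text \<open>Points of the product spaces are functions that are meaningful on a finite index set
  only; this and the following congruences pass between them and the full families of random
  variables.\<close>

lemma pivot_cong:
 assumes "!!j. j \<in> {1..K} ==> v j = v' j"
 shows "pivot K v = pivot K v'"
proof -
 have "map v [1..<Suc K] = map v' [1..<Suc K]" using assms by (intro map_cong) auto
 then show ?thesis by (intro ext) (simp only: pivot_def)
qed

lemma spacing_cong:
 assumes "!!j. j \<in> {1..K} ==> v j = v' j"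
 shows "spacing K v = spacing K v'"
 by (intro ext) (simp only: spacing_def pivot_cong[OF assms])

lemma bucket_cong:
 assumes "!!j. j \<in> {1..K} ==> v j = v' j"
 shows "bucket K v = bucket K v'"
 by (intro ext) (simp only: bucket_def pivot_cong[OF assms])

lemma bucket_count_cong:
 assumes "!!j. j \<in> {1..K} ==> v j = v' j" "!!k. k \<in> {1..m} ==> a k = a' k"
 shows "bucket_count K v a m = bucket_count K v' a' m"
proof
 fix i
 have "bucket K v = bucket K v'" by (rule bucket_cong[OF assms(1)])
 then show "bucket_count K v a m i = bucket_count K v' a' m i"
  unfolding bucket_count_eq_sum by (intro sum.cong) (simp_all add: assms(2))
qed

text \<open>The tree for element k is a function of the pivots and of the elements before k. This
  predictability carries the martingale argument for the partitioning cost.\<close>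

lemma tree_used_cong:
 assumes "!!j. j \<in> {1..K} ==> v j = v' j" "!!l. l \<in> {1..k - 1} ==> a l = a' l"
 shows "tree_used r K v a k = tree_used r K v' a' k"
proof -
 have "bucket_count K v a (k - 1) = bucket_count K v' a' (k - 1)"
  by (rule bucket_count_cong[OF assms])
 then show ?thesis by (simp only: tree_used_def)
qed

text \<open>A decision tree has finite depth. The bound K^2 of \<open>elementary_sort\<close> speaks
  about permutations, whereas the pivots are real keys.\<close>

lemma comparisons_bounded: "\<exists>B. \<forall>x :: 'i => 'a :: linorder. comparisons alg x <= B"
proof (induction alg)
 case (Compare i j s t)
 then obtain B C where B: "!!x :: 'i => 'a. comparisons s x <= B" and C: "!!x :: 'i => 'a. comparisons t x <= C"
  by auto
 have "comparisons (Compare i j s t) x <= Suc (B + C)" for x :: "'i => 'a"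
  using B[of x] C[of x] by simp
 then show ?case by blast
qed auto

text \<open>Comparing an order statistic with \<open>x\<close> amounts to counting the values up to \<open>x\<close>.\<close>

lemma sorted_nth_le_iff:
 assumes "sorted ys" "n < length ys"
 shows "ys ! n <= x \<longleftrightarrow> n < length (filter (%y. y <= x) ys)"
 using assms
proof (induction ys arbitrary: n)
 case (Cons y ys)
 show ?case
 proof (cases "y <= x")
  case True
  then show ?thesis using Cons by (cases n) auto
 next
  case False
  then have "filter (%y. y <= x) (y # ys) = []" using Cons.prems by (force simp: filter_empty_conv)
  moreover have "(y # ys) ! n >= y" using Cons.prems by (cases n) auto
  ultimately show ?thesis using False by auto
 qed
qed simp

lemma nth_sort_le_iff:
 fixes x :: "'a :: linorder"
 assumes "n < length ys"
 shows "sort ys ! n <= x \<longleftrightarrow> n < length (filter (%y. y <= x) ys)"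
proof -
 have "length (filter (%y. y <= x) (sort ys)) = size (filter_mset (%y. y <= x) (mset (sort ys)))"
  by (metis mset_filter size_mset)
 also have "... = length (filter (%y. y <= x) ys)"
  by (metis mset_filter size_mset mset_sort)
 finally show ?thesis using sorted_nth_le_iff[of "sort ys" n x] assms by simp
qed

lemma pivot_measurable:
 assumes "!!j. j \<in> {1..K} ==> f j \<in> borel_measurable M"
 shows "(%om. pivot K (%j. f j om) i) \<in> borel_measurable M"
proof (cases "1 <= i \<and> i <= K")
 case True
 have "{om\<in>space M. pivot K (%j. f j om) i <= x} \<in> sets M" for x
 proof -
  have "pivot K (%j. f j om) i <= x \<longleftrightarrow> real (i - 1) < (\<Sum>j\<in>{1..K}. of_bool (f j om <= x))" for om
  proof -
   have len: "length (filter (%y. y <= x) (map (%j. f j om) [1..<Suc K]))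
     = card {j\<in>{1..K}. f j om <= x}"
    unfolding filter_map length_map
    by (subst distinct_card[symmetric]) (auto intro!: arg_cong[where f = card])
   have c: "(\<Sum>j\<in>{1..K}. of_bool (f j om <= x)) = real (card {j\<in>{1..K}. f j om <= x})"
    by (simp add: of_bool_def sum.If_cases Int_def conj_commute)
   have "pivot K (%j. f j om) i <= x \<longleftrightarrow> i - 1 < card {j\<in>{1..K}. f j om <= x}"
    using True diff_less[of 1 i] nth_sort_le_iff[of "i - 1" "map (%j. f j om) [1..<Suc K]" x, unfolded len]
    by (auto simp: pivot_def simp del: upt_Suc)
   then show ?thesis unfolding c of_nat_less_iff .
  qed
  moreover have "(%om. \<Sum>j\<in>{1..K}. of_bool (f j om <= x) :: real) \<in> borel_measurable M"
  proof (intro borel_measurable_sum)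
   fix j assume "j \<in> {1..K}"
   then have [measurable]: "f j \<in> borel_measurable M" by (rule assms)
   show "(%om. of_bool (f j om <= x)) \<in> borel_measurable M" unfolding of_bool_def by measurable
  qed
  then have "{om\<in>space M. real (i - 1) < (\<Sum>j\<in>{1..K}. of_bool (f j om <= x))} \<in> sets M"
   by measurable
  ultimately show ?thesis by (simp only:)
 qed
 then show ?thesis by (simp add: borel_measurable_iff_le)
qed (auto simp: pivot_def)

lemma spacing_measurable:
 assumes "!!j. j \<in> {1..K} ==> f j \<in> borel_measurable M"
 shows "(%om. spacing K (%j. f j om) i) \<in> borel_measurable M"
 unfolding spacing_def by (intro borel_measurable_diff pivot_measurable assms)

lemma bucket_measurable:
 assumes "!!j. j \<in> {1..K} ==> f j \<in> borel_measurable M" and [measurable]: "g \<in> borel_measurable M"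
 shows "Measurable.pred M (%om. g om \<in> bucket K (%j. f j om) i)"
proof -
 have [measurable]: "(%om. pivot K (%j. f j om) i) \<in> borel_measurable M" for i
  by (rule pivot_measurable[OF assms(1)])
 show ?thesis unfolding bucket_def greaterThanLessThan_iff by measurable
qed

lemma measurable_of_nat_count:
 assumes "(%om. real (f om)) \<in> borel_measurable M"
 shows "f \<in> measurable M (count_space UNIV)"
proof (subst measurable_count_space_eq2_countable, intro conjI ballI)
 fix n :: nat
 have "f -` {n} \<inter> space M = (%om. real (f om)) -` {real n} \<inter> space M" by auto
 also have "... \<in> sets M" by (intro measurable_sets[OF assms]) auto
 finally show "f -` {n} \<inter> space M \<in> sets M" .
qed auto

lemma bucket_count_measurable_real:
 assumes "!!j. j \<in> {1..K} ==> f j \<in> borel_measurable M" "!!k. k \<in> {1..m} ==> g k \<in> borel_measurable M"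
 shows "(%om. real (bucket_count K (%j. f j om) (%k. g k om) m i)) \<in> borel_measurable M"
proof -
 have [measurable]: "Measurable.pred M (%om. g k om \<in> bucket K (%j. f j om) i)" if "k \<in> {1..m}" for k
  using that by (intro bucket_measurable assms)
 show ?thesis unfolding bucket_count_eq_sum of_nat_sum of_nat_of_bool unfolding of_bool_def
  by (intro borel_measurable_sum) measurable
qed

lemma opt_cost_measurable:
 assumes "!!i. i <= K ==> (%om. x om i) \<in> borel_measurable M"
 shows "(%om. opt_cost K (x om)) \<in> borel_measurable M"
  and "(%om. path_cost K t (x om)) \<in> borel_measurable M"
proof -
 have p: "(%om. path_cost K t (x om)) \<in> borel_measurable M" for t
  unfolding path_cost_def by (intro borel_measurable_sum borel_measurable_times assms) auto
 then show "(%om. path_cost K t (x om)) \<in> borel_measurable M" .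
 show "(%om. opt_cost K (x om)) \<in> borel_measurable M"
  unfolding opt_cost_def by (intro borel_measurable_Min finite_class_trees p)
qed

lemma tree_used_measurable:
 assumes "linear_order_on (class_trees K) r" "t \<in> class_trees K"
  and "!!j. j \<in> {1..K} ==> f j \<in> borel_measurable M" "!!l. l \<in> {1..k - 1} ==> g l \<in> borel_measurable M"
 shows "Measurable.pred M (%om. tree_used r K (%j. f j om) (%k. g k om) k = t)"
proof -
 define x where "x om i = real (bucket_count K (%j. f j om) (%k. g k om) (k - 1) i + 1)" for om i
 have "(%om. x om i) \<in> borel_measurable M" for i
  unfolding x_def of_nat_add by (intro borel_measurable_add bucket_count_measurable_real assms) auto
 then have [measurable]: "(%om. opt_cost K (x om)) \<in> borel_measurable M"
  "(%om. path_cost K t (x om)) \<in> borel_measurable M" for t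
  by (auto intro: opt_cost_measurable)
 have [measurable]: "finite (class_trees K)" by (rule finite_class_trees)
 have "Measurable.pred M (%om. path_cost K t (x om) = opt_cost K (x om) \<and>
  (\<forall>s\<in>class_trees K. path_cost K s (x om) = opt_cost K (x om) \<longrightarrow> (t, s) \<in> r))"
  by (intro pred_intros_logic pred_intros_finite finite_class_trees) measurable
 then show ?thesis unfolding tree_used_def opt_tree_eq_iff(1)[OF assms(1,2)] x_def .
qed

section \<open>Spacings of uniform pivots\<close>

lemma prob_space_unif01: "prob_space unif01"
 by (rule prob_space_uniform_measure) auto

interpretation unif01: prob_space unif01
 by (rule prob_space_unif01)

lemma ennreal_divide_1 [simp]: "(x :: ennreal) / 1 = x"
 by (simp add: divide_ennreal_def)

lemma unif01_eq_density: "unif01 = density lborel (%x. ennreal (indicator {0..1} x))"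
 unfolding uniform_measure_def
 by (intro density_cong) (auto simp: divide_ennreal_def indicator_def)

lemma emeasure_unif01: "A \<in> sets borel ==> emeasure unif01 A = emeasure lborel ({0..1} \<inter> A)"
 unfolding unif01_eq_density
 by (subst emeasure_density)
  (auto simp: ennreal_indicator indicator_inter_arith[symmetric] intro!: nn_integral_indicator)

lemma AE_unif01_interior: "AE x in unif01. x \<in> {0<..<1}"
proof -
 have "AE x in lborel. x \<noteq> (0::real)" "AE x in lborel. x \<noteq> (1::real)" by (rule AE_lborel_singleton)+
 then have "AE x in lborel. 0 < ennreal (indicator {0..1} x) \<longrightarrow> x \<in> {0<..<1::real}"
  by eventually_elim (auto simp: indicator_def)
 then show ?thesis unfolding unif01_eq_density by (subst AE_density) auto
qed

lemma integral_unif01: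
 assumes "continuous_on {0..1} (f :: real => real)" and [measurable]: "f \<in> borel_measurable borel"
 shows "(LINT x|unif01. f x) = integral {0..1} f"
proof -
 have int: "set_integrable lborel {0..1} f"
  unfolding set_integrable_def by (rule borel_integrable_compact[OF _ assms(1)]) auto
 have "(LINT x|unif01. f x) = (LINT x|lborel. indicator {0..1} x *\<^sub>R f x)"
  unfolding unif01_eq_density by (subst integral_density) auto
 also have "... = integral {0..1} f"
  using set_borel_integral_eq_integral(2)[OF int] by (simp add: set_lebesgue_integral_def)
 finally show ?thesis .
qed

interpretation unif01_product: product_sigma_finite "%_::nat. unif01"
 by standard

lemma sets_pivot_space [measurable_cong]: "sets (pivot_space K) = sets (\<Pi>\<^sub>M i\<in>{1..K}. borel)"
 by (intro sets_PiM_cong) auto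

lemma prob_space_pivot_space: "prob_space (pivot_space K)"
 by (intro prob_space_PiM prob_space_unif01)

lemma pivot_space_insert:
 assumes "j \<in> {1..K}" and f: "f \<in> borel_measurable (\<Pi>\<^sub>M i\<in>{1..K}. borel)"
 shows "(\<integral>\<^sup>+v. f v \<partial>pivot_space K) = (\<integral>\<^sup>+y. (\<integral>\<^sup>+v. f (v(j := y)) \<partial>(\<Pi>\<^sub>M i\<in>{1..K}-{j}. unif01)) \<partial>unif01)"
proof -
 have 1: "{1..K} = insert j ({1..K}-{j})" using assms by auto
 have "f \<in> borel_measurable (Pi\<^sub>M (insert j ({1..K}-{j})) (%_. unif01))"
  using f unfolding 1[symmetric] by (simp cong: measurable_cong_sets add: sets_pivot_space)
 from unif01_product.product_nn_integral_insert_rev[OF _ _ this] show ?thesis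
  unfolding 1[symmetric] by simp
qed

lemma AE_pivot_space_unit: "AE v in pivot_space K. \<forall>j\<in>{1..K}. v j \<in> {0<..<1}"
 by (intro AE_finite_allI AE_PiM_component AE_unif01_interior prob_space_unif01) auto

text \<open>By Fubini in one coordinate: with all other coordinates fixed, a coincidence confines
  this coordinate to a single point.\<close>

lemma AE_pivot_space_inj: "AE v in pivot_space K. inj_on v {1..K}"
proof -
 have "AE v in pivot_space K. v i \<noteq> v j" if ij: "i \<in> {1..K}" "j \<in> {1..K}" "i \<noteq> j" for i j
 proof -
  have "(%v. v i) \<in> borel_measurable (\<Pi>\<^sub>M i\<in>{1..K}. borel :: real measure)"
   "(%v. v j) \<in> borel_measurable (\<Pi>\<^sub>M i\<in>{1..K}. borel :: real measure)"
   using ij by auto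
  then have P: "{v \<in> space (\<Pi>\<^sub>M i\<in>{1..K}. borel :: real measure). v i = v j} \<in> sets (\<Pi>\<^sub>M i\<in>{1..K}. borel)"
   by (rule borel_measurable_eq)
  have f: "(%v. indicator {v. v i = v j} v :: ennreal) \<in> borel_measurable (\<Pi>\<^sub>M i\<in>{1..K}. borel :: real measure)"
   unfolding indicator_def mem_Collect_eq of_bool_def by (rule measurable_If) (use P in auto)
  have "(\<integral>\<^sup>+v. indicator {v. v i = v j} v \<partial>pivot_space K)
    = (\<integral>\<^sup>+v. (\<integral>\<^sup>+y. indicator {v. v i = v j} (v(j := y)) \<partial>unif01) \<partial>(\<Pi>\<^sub>M i\<in>{1..K}-{j}. unif01))"
  proof -
   have 1: "{1..K} = insert j ({1..K}-{j})" using ij by auto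
   have "(%v. indicator {v. v i = v j} v :: ennreal) \<in> borel_measurable (Pi\<^sub>M (insert j ({1..K}-{j})) (%_. unif01))"
    using f unfolding 1[symmetric] by (simp cong: measurable_cong_sets add: sets_pivot_space)
   from unif01_product.product_nn_integral_insert[OF _ _ this] show ?thesis
    unfolding 1[symmetric] by simp
  qed
  also have "... = (\<integral>\<^sup>+v. (\<integral>\<^sup>+y. indicator {v i} y \<partial>unif01) \<partial>(\<Pi>\<^sub>M i\<in>{1..K}-{j}. unif01))"
   using ij by (intro nn_integral_cong) (auto simp: indicator_def)
  also have "... = (\<integral>\<^sup>+v. 0 \<partial>(\<Pi>\<^sub>M i\<in>{1..K}-{j}. unif01))"
  proof (intro nn_integral_cong)
   fix v :: "nat => real"
   have "emeasure lborel ({0..1} \<inter> {v i}) = 0" by (rule emeasure_lborel_countable) auto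
   then show "(\<integral>\<^sup>+y. indicator {v i} y \<partial>unif01) = 0" by (simp add: emeasure_unif01)
  qed
  finally have "(\<integral>\<^sup>+v. indicator {v. v i = v j} v \<partial>pivot_space K) = 0" by simp
  then have "AE v in pivot_space K. (indicator {v. v i = v j} v :: ennreal) = 0"
   using f by (subst (asm) nn_integral_0_iff_AE) (simp_all cong: measurable_cong_sets add: sets_pivot_space)
  then show ?thesis by eventually_elim (auto simp: indicator_def split: if_splits)
 qed
 then have "AE v in pivot_space K. \<forall>i\<in>{1..K}. \<forall>j\<in>{1..K}. i \<noteq> j \<longrightarrow> v i \<noteq> v j"
  by (intro AE_finite_allI) auto
 then show ?thesis by eventually_elim (auto simp: inj_on_def)
qed

lemma pivot_image: "pivot K v ` {1..K} = v ` {1..K}"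
proof -
 have "pivot K v ` {1..K} = (%i. sort (map v [1..<Suc K]) ! (i - 1)) ` {1..K}"
  by (intro image_cong) (auto simp: pivot_def)
 also have "... = (%i. sort (map v [1..<Suc K]) ! i) ` ((%i. i - 1) ` {1..K})"
  by (simp add: image_image)
 also have "(%i. i - 1) ` {1..K} = {..<K}"
 proof -
  have "i \<in> (%i. i - 1) ` {1..K}" if "i < K" for i
   using that by (intro image_eqI[of _ _ "Suc i"]) auto
  then show ?thesis by force
 qed
 also have "(%i. sort (map v [1..<Suc K]) ! i) ` {..<K} = set (sort (map v [1..<Suc K]))"
  unfolding set_conv_nth by (auto simp del: upt_Suc)
 finally show ?thesis by (simp add: atLeastLessThanSuc_atLeastAtMost del: upt_Suc)
qed

lemma pivot_strict:
 assumes "inj_on v {1..K}" "1 <= i" "i < j" "j <= K"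
 shows "pivot K v i < pivot K v j"
proof -
 have "distinct (map v [1..<Suc K])"
  using assms(1) by (simp add: distinct_map atLeastLessThanSuc_atLeastAtMost del: upt_Suc)
 then have "sorted_wrt (<) (sort (map v [1..<Suc K]))" by (simp add: strict_sorted_iff del: upt_Suc)
 then have "sort (map v [1..<Suc K]) ! (i - 1) < sort (map v [1..<Suc K]) ! (j - 1)"
  using assms by (intro sorted_wrt_nth_less[where P = "(<)"]) (auto simp del: upt_Suc)
 then show ?thesis using assms by (simp add: pivot_def)
qed

text \<open>Sorting preserves the multiset of values, so symmetric sums do not see the order of the
  pivots.\<close>

lemma sum_pivot: "(\<Sum>i\<in>{1..K}. h (pivot K v i)) = (\<Sum>j\<in>{1..K}. h (v j) :: real)"
proof -
 have "(\<Sum>j\<in>{1..K}. h (v j)) = sum_list (map h (map v [1..<Suc K]))"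
  by (simp add: interv_sum_list_conv_sum_set_nat comp_def atLeastLessThanSuc_atLeastAtMost del: upt_Suc)
 also have "... = sum_mset (image_mset h (mset (map v [1..<Suc K])))"
  by (simp only: mset_map[symmetric] sum_mset_sum_list)
 also have "... = sum_mset (image_mset h (mset (sort (map v [1..<Suc K]))))"
  by (simp only: mset_sort)
 also have "... = sum_list (map h (sort (map v [1..<Suc K])))"
  by (simp only: mset_map[symmetric] sum_mset_sum_list)
 also have "... = (\<Sum>i<K. h (sort (map v [1..<Suc K]) ! i))"
  by (simp add: sum_list_sum_nth atLeast0LessThan del: upt_Suc)
 also have "... = (\<Sum>i<K. h (pivot K v (Suc i)))"
  by (intro sum.cong) (auto simp: pivot_def)
 also have "... = (\<Sum>i\<in>{1..K}. h (pivot K v i))"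
  by (rule sum.reindex_bij_witness[of _ "%i. i - 1" Suc]) auto
 finally show ?thesis by simp
qed

text \<open>The spacing to the right of \<open>v j\<close> exceeds \<open>x\<close> if and only if no pivot lies in
 \<open>(v j, v j + x]\<close>; summing over all spacings makes their order irrelevant.\<close>

lemma sum_spacing_tail:
 assumes K: "K >= 1" and unit: "!!j. j \<in> {1..K} ==> v j \<in> {0<..<1}" and inj: "inj_on v {1..K}" and x: "0 <= x"
 shows "(\<Sum>i\<le>K. of_bool (x < spacing K v i)) = of_bool (\<forall>j\<in>{1..K}. x < v j) +
  (\<Sum>j\<in>{1..K}. of_bool (v j + x < 1 \<and> (\<forall>l\<in>{1..K}. \<not> (v j < v l \<and> v l <= v j + x))) :: real)"
proof -
 define h where "h y = (of_bool (y + x < 1 \<and> (\<forall>l\<in>{1..K}. \<not> (y < v l \<and> v l <= y + x))) :: real)" for y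
 have unit': "!!j. j \<in> {1..K} ==> v j \<in> {0..1}" using unit by fastforce
 have mono: "pivot K v i <= pivot K v j" if "i <= j" for i j
  by (rule pivot_mono[OF unit' that])
 have im: "\<exists>m\<in>{1..K}. v l = pivot K v m" if "l \<in> {1..K}" for l
  using pivot_image[of K v] that by (metis (no_types, lifting) imageE image_eqI)
 have 0: "of_bool (x < spacing K v 0) = (of_bool (\<forall>j\<in>{1..K}. x < v j) :: real)"
 proof -
  have "x < pivot K v 1 \<longleftrightarrow> (\<forall>j\<in>{1..K}. x < v j)"
  proof
   assume "x < pivot K v 1"
   show "\<forall>j\<in>{1..K}. x < v j"
   proof
    fix j assume "j \<in> {1..K}"
    then obtain m where "m \<in> {1..K}" "v j = pivot K v m" using im by blast
    then show "x < v j" using mono[of 1 m] \<open>x < pivot K v 1\<close> by auto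
   qed
  next
   assume "\<forall>j\<in>{1..K}. x < v j"
   then show "x < pivot K v 1" using pivot_in_image[of 1 K v] K by auto
  qed
  then show ?thesis by (simp add: spacing_def)
 qed
 have step: "of_bool (x < spacing K v i) = h (pivot K v i)" if i: "i \<in> {1..K}" for i
 proof -
  have "x < spacing K v i \<longleftrightarrow> pivot K v i + x < 1 \<and> (\<forall>l\<in>{1..K}. \<not> (pivot K v i < v l \<and> v l <= pivot K v i + x))"
  proof
   assume A: "x < spacing K v i"
   have "pivot K v (Suc i) <= 1" using pivot_unit[of K v "Suc i", OF unit'] by simp
   moreover have "\<not> (pivot K v i < v l \<and> v l <= pivot K v i + x)" if l: "l \<in> {1..K}" for l
   proof
    assume B: "pivot K v i < v l \<and> v l <= pivot K v i + x"
    obtain m where m: "m \<in> {1..K}" "v l = pivot K v m" using im[OF l] by blast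
    then have "\<not> m <= i" using B mono[of m i] by auto
    then have "pivot K v (Suc i) <= v l" using m mono[of "Suc i" m] by simp
    then show False using A B by (simp add: spacing_def)
   qed
   ultimately show "pivot K v i + x < 1 \<and> (\<forall>l\<in>{1..K}. \<not> (pivot K v i < v l \<and> v l <= pivot K v i + x))"
    using A by (auto simp: spacing_def)
  next
   assume A: "pivot K v i + x < 1 \<and> (\<forall>l\<in>{1..K}. \<not> (pivot K v i < v l \<and> v l <= pivot K v i + x))"
   show "x < spacing K v i"
   proof (cases "i = K")
    case True
    then show ?thesis using A by (simp add: spacing_def)
   next
    case False
    then have "pivot K v i < pivot K v (Suc i)" using i pivot_strict[OF inj, of i "Suc i"] by auto
    moreover obtain l where "l \<in> {1..K}" "v l = pivot K v (Suc i)"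
     using False i pivot_in_image[of "Suc i" K v] by fastforce
    ultimately have "\<not> pivot K v (Suc i) <= pivot K v i + x" using A by metis
    then show ?thesis by (simp add: spacing_def)
   qed
  qed
  then show ?thesis by (simp add: h_def)
 qed
 have "{..K} = insert 0 {1..K}" by auto
 then have "(\<Sum>i\<le>K. of_bool (x < spacing K v i)) = of_bool (x < spacing K v 0) + (\<Sum>i\<in>{1..K}. of_bool (x < spacing K v i) :: real)"
  by simp
 also have "(\<Sum>i\<in>{1..K}. of_bool (x < spacing K v i) :: real) = (\<Sum>i\<in>{1..K}. h (pivot K v i))"
  by (intro sum.cong refl step)
 also have "... = (\<Sum>j\<in>{1..K}. h (v j))" by (rule sum_pivot)
 finally show ?thesis unfolding 0 h_def .
qed

lemma box_measurable:
 fixes I :: "nat set"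
 assumes "finite I" "A \<in> sets borel"
 shows "(%v. indicator {v. \<forall>j\<in>I. v j \<in> A} v :: ennreal) \<in> borel_measurable (\<Pi>\<^sub>M i\<in>I. unif01)"
proof -
 have "{v. \<forall>j\<in>I. v j \<in> A} \<inter> space (\<Pi>\<^sub>M i\<in>I. unif01) = (\<Pi>\<^sub>E j\<in>I. A)"
  by (auto simp: space_PiM PiE_iff)
 moreover have "(\<Pi>\<^sub>E j\<in>I. A) \<in> sets (\<Pi>\<^sub>M i\<in>I. unif01)"
  using assms by (intro sets_PiM_I_finite) auto
 ultimately show ?thesis by (subst borel_measurable_indicator_iff) simp
qed

lemma emeasure_box_unif01:
 fixes I :: "nat set"
 assumes "finite I" "A \<in> sets borel"
 shows "(\<integral>\<^sup>+v. indicator {v. \<forall>j\<in>I. v j \<in> A} v \<partial>(\<Pi>\<^sub>M i\<in>I. unif01)) = (emeasure unif01 A) ^ card I"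
proof -
 have "(\<integral>\<^sup>+v. indicator {v. \<forall>j\<in>I. v j \<in> A} v \<partial>(\<Pi>\<^sub>M i\<in>I. unif01))
   = (\<integral>\<^sup>+v. indicator (\<Pi>\<^sub>E j\<in>I. A) v \<partial>(\<Pi>\<^sub>M i\<in>I. unif01))"
  by (intro nn_integral_cong) (auto simp: indicator_def space_PiM PiE_iff)
 also have "... = emeasure (\<Pi>\<^sub>M i\<in>I. unif01) (\<Pi>\<^sub>E j\<in>I. A)"
  using assms by (intro nn_integral_indicator sets_PiM_I_finite) auto
 also have "... = (\<Prod>j\<in>I. emeasure unif01 A)"
  using assms by (intro unif01_product.emeasure_PiM) auto
 finally show ?thesis by simp
qed

lemma right_gap_measurable:
 fixes f :: "nat => 'a => real"
 assumes f: "!!l. l \<in> {1..K} ==> f l \<in> borel_measurable M" and j: "j \<in> {1..K}"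
 shows "(%om. of_bool (f j om + x < 1 \<and> (\<forall>l\<in>{1..K}. \<not> (f j om < f l om \<and> f l om <= f j om + x))) :: real) \<in> borel_measurable M"
proof -
 have [measurable]: "f j \<in> borel_measurable M" by (rule f[OF j])
 have 1: "Measurable.pred M (%om. \<not> (f j om < f l om \<and> f l om <= f j om + x))" if "l \<in> {1..K}" for l
 proof -
  have [measurable]: "f l \<in> borel_measurable M" by (rule f[OF that])
  show ?thesis by measurable
 qed
 have [measurable]: "Measurable.pred M (%om. \<forall>l\<in>{1..K}. \<not> (f j om < f l om \<and> f l om <= f j om + x))"
  by (intro pred_intros_finite 1) auto
 show ?thesis unfolding of_bool_def by measurable
qed

lemma all_gt_measurable:
 fixes f :: "nat => 'a => real"
 assumes f: "!!l. l \<in> {1..K} ==> f l \<in> borel_measurable M"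
 shows "(%om. of_bool (\<forall>l\<in>{1..K}. x < f l om) :: real) \<in> borel_measurable M"
proof -
 have 1: "Measurable.pred M (%om. x < f l om)" if "l \<in> {1..K}" for l
 proof -
  have [measurable]: "f l \<in> borel_measurable M" by (rule f[OF that])
  show ?thesis by measurable
 qed
 have [measurable]: "Measurable.pred M (%om. \<forall>l\<in>{1..K}. x < f l om)"
  by (intro pred_intros_finite 1) auto
 show ?thesis unfolding of_bool_def by measurable
qed

text \<open>Each of the K + 1 events in \<open>sum_spacing_tail\<close> has probability (1 - x)^K.
  For the one attached to pivot j, fix its value y < 1 - x: the other K - 1 pivots must avoid an
  interval of length x inside [0,1], and y itself ranges over a set of measure 1 - x.\<close>

lemma nn_integral_spacing_tail:
 assumes K: "K >= 1" and x: "0 <= x" "x <= 1"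
 shows "(\<integral>\<^sup>+v. ennreal (\<Sum>i\<le>K. of_bool (x < spacing K v i)) \<partial>pivot_space K)
  = ennreal ((real K + 1) * (1 - x) ^ K)"
proof -
 have comp: "(%v. v l) \<in> borel_measurable (\<Pi>\<^sub>M i\<in>{1..K}. borel :: real measure)" if "l \<in> {1..K}" for l
  using that by auto
 define F where "F j v = (of_bool (v j + x < 1 \<and> (\<forall>l\<in>{1..K}. \<not> (v j < v l \<and> v l <= v j + x))) :: real)"
  for j :: nat and v :: "nat => real"
 define F0 where "F0 v = (of_bool (\<forall>l\<in>{1..K}. x < v l) :: real)" for v :: "nat => real"
 have Smeas: "F j \<in> borel_measurable (\<Pi>\<^sub>M i\<in>{1..K}. borel)" if "j \<in> {1..K}" for j
  unfolding F_def by (rule right_gap_measurable[of K "%l v. v l", OF comp that])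
 have [measurable]: "F0 \<in> borel_measurable (pivot_space K)"
  using all_gt_measurable[of K "%l v. v l", OF comp] unfolding F0_def
  by (simp only: measurable_cong_sets[OF sets_pivot_space refl])
 have Sm: "F j \<in> borel_measurable (pivot_space K)" if "j \<in> {1..K}" for j
  using Smeas[OF that] by (simp only: measurable_cong_sets[OF sets_pivot_space refl])
 have U: "emeasure unif01 {x<..} = ennreal (1 - x)"
 proof -
  have "{0..1} \<inter> {x<..} = {x<..1}" using x by auto
  then show ?thesis using x by (simp add: emeasure_unif01)
 qed
 have 0: "(\<integral>\<^sup>+v. ennreal (F0 v) \<partial>pivot_space K) = ennreal ((1 - x) ^ K)"
 proof -
  have "(\<integral>\<^sup>+v. ennreal (F0 v) \<partial>pivot_space K)
   = (\<integral>\<^sup>+v. indicator {v. \<forall>j\<in>{1..K}. v j \<in> {x<..}} v \<partial>pivot_space K)"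
   by (intro nn_integral_cong) (auto simp: F0_def indicator_def)
  also have "... = emeasure unif01 {x<..} ^ card {1..K}" by (rule emeasure_box_unif01) auto
  finally show ?thesis using x by (simp add: U ennreal_power)
 qed
 have 1: "(\<integral>\<^sup>+v. ennreal (F j v) \<partial>pivot_space K) = ennreal ((1 - x) ^ K)" if j: "j \<in> {1..K}" for j
 proof -
  have "(\<integral>\<^sup>+v. ennreal (F j v) \<partial>pivot_space K)
   = (\<integral>\<^sup>+y. (\<integral>\<^sup>+v. ennreal (F j (v(j := y))) \<partial>(\<Pi>\<^sub>M i\<in>{1..K}-{j}. unif01)) \<partial>unif01)"
   by (rule pivot_space_insert[OF j]) (rule measurable_compose[OF Smeas[OF j] measurable_ennreal])
  also have "... = (\<integral>\<^sup>+y. (\<integral>\<^sup>+v. ennreal (of_bool (y + x < 1 \<and> (\<forall>l\<in>{1..K}-{j}. \<not> (y < v l \<and> v l <= y + x)))) \<partial>(\<Pi>\<^sub>M i\<in>{1..K}-{j}. unif01)) \<partial>unif01)"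
  proof -
   have "F j (v(j := y)) = of_bool (y + x < 1 \<and> (\<forall>l\<in>{1..K}-{j}. \<not> (y < v l \<and> v l <= y + x)))" for v y
   proof -
    have "(\<forall>l\<in>{1..K}. \<not> (y < (v(j := y)) l \<and> (v(j := y)) l <= y + x))
     \<longleftrightarrow> (\<forall>l\<in>{1..K}-{j}. \<not> (y < v l \<and> v l <= y + x))"
     by (auto split: if_splits)
    then show ?thesis by (simp only: F_def fun_upd_same)
   qed
   then show ?thesis by (simp only:)
  qed
  also have "... = (\<integral>\<^sup>+y. indicator {0..<1-x} y * ennreal ((1 - x) ^ (K - 1)) \<partial>unif01)"
  proof (intro nn_integral_cong_AE, use AE_unif01_interior in eventually_elim)
   fix y :: real assume y: "y \<in> {0<..<1}"
   have "(\<integral>\<^sup>+v. ennreal (of_bool (y + x < 1 \<and> (\<forall>l\<in>{1..K}-{j}. \<not> (y < v l \<and> v l <= y + x)))) \<partial>(\<Pi>\<^sub>M i\<in>{1..K}-{j}. unif01))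
    = (\<integral>\<^sup>+v. indicator {0..<1-x} y * indicator {v. \<forall>l\<in>{1..K}-{j}. v l \<in> - {y<..y+x}} v \<partial>(\<Pi>\<^sub>M i\<in>{1..K}-{j}. unif01))"
   proof (rule nn_integral_cong)
    fix v :: "nat => real"
    have 1: "y \<in> {0..<1-x} \<longleftrightarrow> y + x < 1" using y by auto
    have 2: "v \<in> {v. \<forall>l\<in>{1..K}-{j}. v l \<in> - {y<..y+x}} \<longleftrightarrow> (\<forall>l\<in>{1..K}-{j}. \<not> (y < v l \<and> v l <= y + x))"
     by simp
    show "ennreal (of_bool (y + x < 1 \<and> (\<forall>l\<in>{1..K}-{j}. \<not> (y < v l \<and> v l <= y + x))))
     = indicator {0..<1-x} y * indicator {v. \<forall>l\<in>{1..K}-{j}. v l \<in> - {y<..y+x}} v"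
     unfolding indicator_def 1 2
     by (cases "y + x < 1"; cases "\<forall>l\<in>{1..K}-{j}. \<not> (y < v l \<and> v l <= y + x)") (simp_all only: simp_thms of_bool_eq, simp_all)
   qed
   also have "... = indicator {0..<1-x} y * (emeasure unif01 (- {y<..y+x})) ^ card ({1..K}-{j})"
   proof (subst nn_integral_cmult)
    show "(%v. indicator {v. \<forall>l\<in>{1..K}-{j}. v l \<in> - {y<..y+x}} v :: ennreal) \<in> borel_measurable (\<Pi>\<^sub>M i\<in>{1..K}-{j}. unif01)"
     by (rule box_measurable) auto
    show "indicator {0..<1-x} y * (\<integral>\<^sup>+v. indicator {v. \<forall>l\<in>{1..K}-{j}. v l \<in> - {y<..y+x}} v \<partial>(\<Pi>\<^sub>M i\<in>{1..K}-{j}. unif01))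
     = indicator {0..<1-x} y * (emeasure unif01 (- {y<..y+x})) ^ card ({1..K}-{j})"
     by (subst emeasure_box_unif01) auto
   qed
   also have "... = indicator {0..<1-x} y * ennreal ((1 - x) ^ (K - 1))"
   proof (cases "y < 1 - x")
    case True
    have "{0..1} \<inter> - {y<..y+x} = {0..y} \<union> {y+x<..1}" using True x y by auto
    then have "emeasure unif01 (- {y<..y+x}) = emeasure lborel ({0..y} \<union> {y+x<..1})"
     by (simp add: emeasure_unif01)
    also have "... = emeasure lborel {0..y} + emeasure lborel {y+x<..1}"
     using x by (intro plus_emeasure[symmetric]) auto
    also have "... = ennreal (1 - x)" using True y x by (simp flip: ennreal_plus)
    finally show ?thesis using x j by (simp add: ennreal_power)
   qed (use y in auto)
   finally show "(\<integral>\<^sup>+v. ennreal (of_bool (y + x < 1 \<and> (\<forall>l\<in>{1..K}-{j}. \<not> (y < v l \<and> v l <= y + x)))) \<partial>(\<Pi>\<^sub>M i\<in>{1..K}-{j}. unif01))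
    = indicator {0..<1-x} y * ennreal ((1 - x) ^ (K - 1))" .
  qed
  also have "... = ennreal ((1 - x) ^ (K - 1)) * emeasure unif01 {0..<1-x}"
   by (subst mult.commute) (subst nn_integral_cmult, auto)
  also have "emeasure unif01 {0..<1-x} = ennreal (1 - x)"
  proof -
   have "{0..1} \<inter> {0..<1-x} = {0..<1-x}" using x by auto
   then show ?thesis using x by (simp add: emeasure_unif01)
  qed
  also have "ennreal ((1 - x) ^ (K - 1)) * ennreal (1 - x) = ennreal ((1 - x) ^ K)"
  proof -
   have "(1 - x) ^ K = (1 - x) ^ (K - 1) * (1 - x)" using K by (cases K) auto
   then show ?thesis using x by (simp add: ennreal_mult)
  qed
  finally show ?thesis .
 qed
 have "(\<integral>\<^sup>+v. ennreal (\<Sum>i\<le>K. of_bool (x < spacing K v i)) \<partial>pivot_space K)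
  = (\<integral>\<^sup>+v. ennreal (F0 v) + (\<Sum>j\<in>{1..K}. ennreal (F j v)) \<partial>pivot_space K)"
 proof (intro nn_integral_cong_AE, use AE_pivot_space_unit AE_pivot_space_inj in eventually_elim)
  fix v :: "nat => real" assume v: "\<forall>j\<in>{1..K}. v j \<in> {0<..<1}" "inj_on v {1..K}"
  have "(\<Sum>i\<le>K. of_bool (x < spacing K v i)) = F0 v + (\<Sum>j\<in>{1..K}. F j v)"
   unfolding F0_def F_def using v by (intro sum_spacing_tail[OF K _ _ x(1)]) auto
  moreover have "0 <= F0 v" "!!j. 0 <= F j v" by (auto simp: F0_def F_def)
  ultimately show "ennreal (\<Sum>i\<le>K. of_bool (x < spacing K v i)) = ennreal (F0 v) + (\<Sum>j\<in>{1..K}. ennreal (F j v))"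
   by (subst sum_ennreal) (auto simp: sum_nonneg simp flip: ennreal_plus)
 qed
 also have "... = (\<integral>\<^sup>+v. ennreal (F0 v) \<partial>pivot_space K) + (\<Sum>j\<in>{1..K}. (\<integral>\<^sup>+v. ennreal (F j v) \<partial>pivot_space K))"
 proof -
  have Sm': "(%v. ennreal (F j v)) \<in> borel_measurable (pivot_space K)" if "j \<in> {1..K}" for j
   by (rule measurable_compose[OF Sm[OF that] measurable_ennreal])
  have "(\<integral>\<^sup>+v. ennreal (F0 v) + (\<Sum>j\<in>{1..K}. ennreal (F j v)) \<partial>pivot_space K)
   = (\<integral>\<^sup>+v. ennreal (F0 v) \<partial>pivot_space K) + (\<integral>\<^sup>+v. (\<Sum>j\<in>{1..K}. ennreal (F j v)) \<partial>pivot_space K)"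
   by (intro nn_integral_add borel_measurable_sum Sm') measurable
  then show ?thesis by (simp only: nn_integral_sum[OF Sm'])
 qed
 also have "... = ennreal ((1 - x) ^ K) + (\<Sum>j\<in>{1..K}. ennreal ((1 - x) ^ K))"
  by (simp only: 0 1 cong: sum.cong)
 also have "... = ennreal ((real K + 1) * (1 - x) ^ K)"
  using x by (subst sum_ennreal) (auto simp: algebra_simps simp flip: ennreal_plus)
 finally show ?thesis .
qed


lemma integral_spacing_tail:
 assumes "K >= 1" "0 <= x" "x <= 1"
 shows "(LINT v|pivot_space K. (\<Sum>i\<le>K. of_bool (x < spacing K v i))) = (real K + 1) * (1 - x) ^ K"
proof -
 have sp [measurable]: "(%v. spacing K v i) \<in> borel_measurable (pivot_space K)" for i
  by (intro spacing_measurable) (auto cong: measurable_cong_sets simp: sets_pivot_space)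
 have "(%v. \<Sum>i\<le>K. of_bool (x < spacing K v i) :: real) \<in> borel_measurable (pivot_space K)"
  unfolding of_bool_def by measurable
 then have "(LINT v|pivot_space K. (\<Sum>i\<le>K. of_bool (x < spacing K v i)))
   = enn2real (\<integral>\<^sup>+v. ennreal (\<Sum>i\<le>K. of_bool (x < spacing K v i)) \<partial>pivot_space K)"
  by (intro integral_eq_nn_integral) (auto intro!: sum_nonneg)
 then show ?thesis unfolding nn_integral_spacing_tail[OF assms] using assms by simp
qed

lemma integral_unif01_below:
 assumes d: "0 <= d" "d <= 1" and \<psi>: "!!x. (\<psi> has_real_derivative \<psi>' x) (at x)" and c: "continuous_on UNIV \<psi>'"
  and g: "!!x. x \<in> {0..1} ==> g x = \<psi>' x" and [measurable]: "g \<in> borel_measurable borel"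
 shows "(LINT x|unif01. g x * of_bool (x < d)) = \<psi> d - \<psi> (0::real)"
proof -
 have [measurable]: "\<psi>' \<in> borel_measurable borel" using c by (rule borel_measurable_continuous_onI)
 have "(LINT x|unif01. g x * of_bool (x < d)) = (LINT x|lborel. indicator {0..1} x * (g x * of_bool (x < d)))"
  unfolding unif01_eq_density by (subst integral_density) (auto simp: of_bool_def)
 also have "... = (LINT x|lborel. \<psi>' x * indicator {0..d} x)"
 proof (rule integral_cong_AE)
  show "AE x in lborel. indicator {0..1} x * (g x * of_bool (x < d)) = \<psi>' x * indicator {0..d} x"
   using AE_lborel_singleton[of d] by eventually_elim (use d g in \<open>auto simp: indicator_def\<close>)
 qed (auto simp: of_bool_def)
 also have "... = \<psi> d - \<psi> 0"
  using d \<psi> c by (intro integral_FTC_Icc_real) (auto simp: continuous_on_eq_continuous_at)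
 finally show ?thesis .
qed

text \<open>Layer-cake argument: \<psi>(D) - \<psi>(0) is the integral of the derivative over x < D.
  After Fubini the tail formula applies, and a closing integration by parts removes the derivative
  again.\<close>

lemma sum_spacing_expectation:
 assumes K: "K >= 1" and \<psi>: "!!x. (\<psi> has_real_derivative \<psi>' x) (at x)" and c: "continuous_on UNIV \<psi>'"
 shows "(LINT v|pivot_space K. (\<Sum>i\<le>K. \<psi> (spacing K v i)))
  = (real K + 1) * real K * integral {0..1} (%x. \<psi> x * (1 - x) ^ (K - 1))"
proof -
 interpret P: prob_space "pivot_space K" by (rule prob_space_pivot_space)
 interpret PU: pair_prob_space "pivot_space K" unif01 ..
 \<comment> \<open>Clamping the argument makes the derivative bounded on the whole line, hence
   integrable over the product space, and changes nothing on [0,1].\<close>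
 define g where "g x = \<psi>' (max 0 (min 1 x))" for x :: real
 have g: "g x = \<psi>' x" if "x \<in> {0..1}" for x using that by (simp add: g_def)
 have gc: "continuous_on UNIV g" unfolding g_def
  by (intro continuous_on_compose2[OF c] continuous_intros) auto
 then have [measurable]: "g \<in> borel_measurable borel" by (rule borel_measurable_continuous_onI)
 have "compact (\<psi>' ` {0..1})" by (intro compact_continuous_image continuous_on_subset[OF c]) auto
 then obtain B where "\<forall>y\<in>\<psi>' ` {0..1}. norm y <= B" using compact_imp_bounded bounded_iff by metis
 then have B: "!!x. x \<in> {0..1} ==> \<bar>\<psi>' x\<bar> <= B" by auto
 have gB: "\<bar>g x\<bar> <= B" for x unfolding g_def by (rule B) auto
 have sp [measurable]: "(%v. spacing K v i) \<in> borel_measurable (pivot_space K)" for i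
  by (intro spacing_measurable) (auto cong: measurable_cong_sets simp: sets_pivot_space)
 define T where "T v x = (\<Sum>i\<le>K. of_bool (x < spacing K v i) :: real)" for v x
 have T: "0 <= T v x" "T v x <= real K + 1" for v x
 proof -
  show "0 <= T v x" unfolding T_def by (intro sum_nonneg) auto
  have "T v x <= (\<Sum>i\<le>K. 1)" unfolding T_def by (intro sum_mono) auto
  then show "T v x <= real K + 1" by simp
 qed
 have mT [measurable]: "(%(v, x). T v x) \<in> borel_measurable (pivot_space K \<Otimes>\<^sub>M unif01)"
  unfolding T_def of_bool_def by measurable
 have int: "integrable (pivot_space K \<Otimes>\<^sub>M unif01) (%(v, x). g x * T v x)"
 proof (rule PU.P.integrable_const_bound[where B = "B * (real K + 1)"])
  show "AE p in pivot_space K \<Otimes>\<^sub>M unif01. norm (case p of (v, x) => g x * T v x) <= B * (real K + 1)"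
  proof (intro AE_I2)
   fix p :: "(nat => real) \<times> real"
   show "norm (case p of (v, x) => g x * T v x) <= B * (real K + 1)"
    using gB[of "snd p"] T[of "fst p" "snd p"] by (cases p) (auto simp: abs_mult intro!: mult_mono)
  qed
 qed measurable
 have "(LINT v|pivot_space K. (\<Sum>i\<le>K. \<psi> (spacing K v i)))
   = (LINT v|pivot_space K. (real K + 1) * \<psi> 0 + (LINT x|unif01. g x * T v x))"
 proof (rule integral_cong_AE)
  have "\<psi> \<in> borel_measurable borel"
   using \<psi> by (intro borel_measurable_continuous_onI continuous_at_imp_continuous_on ballI DERIV_isCont)
  then show "(%v. \<Sum>i\<le>K. \<psi> (spacing K v i)) \<in> borel_measurable (pivot_space K)" by measurable
  show "(%v. (real K + 1) * \<psi> 0 + (LINT x|unif01. g x * T v x)) \<in> borel_measurable (pivot_space K)"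
   using unif01.borel_measurable_lebesgue_integral[OF borel_measurable_integrable[OF int]] by measurable
  show "AE v in pivot_space K. (\<Sum>i\<le>K. \<psi> (spacing K v i)) = (real K + 1) * \<psi> 0 + (LINT x|unif01. g x * T v x)"
   using AE_pivot_space_unit
  proof eventually_elim
   fix v :: "nat => real" assume "\<forall>j\<in>{1..K}. v j \<in> {0<..<1}"
   then have u: "!!j. j \<in> {1..K} ==> v j \<in> {0..1}" by fastforce
   have "(LINT x|unif01. g x * T v x) = (LINT x|unif01. (\<Sum>i\<le>K. g x * of_bool (x < spacing K v i)))"
    unfolding T_def sum_distrib_left ..
   also have "... = (\<Sum>i\<le>K. (LINT x|unif01. g x * of_bool (x < spacing K v i)))"
   proof (rule Bochner_Integration.integral_sum)
    fix i
    show "integrable unif01 (%x. g x * of_bool (x < spacing K v i))"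
     using gB by (intro unif01.integrable_const_bound[where B = B]) (auto simp: of_bool_def intro: order.trans[OF abs_ge_zero gB])
   qed
   also have "... = (\<Sum>i\<le>K. \<psi> (spacing K v i) - \<psi> 0)"
    using spacing_nonneg[of K v, OF u] spacing_le_1[of K v, OF u]
    by (intro sum.cong integral_unif01_below[OF _ _ \<psi> c g]) auto
   finally show "(\<Sum>i\<le>K. \<psi> (spacing K v i)) = (real K + 1) * \<psi> 0 + (LINT x|unif01. g x * T v x)"
    by (simp add: sum_subtractf algebra_simps)
  qed
 qed
 also have "... = (real K + 1) * \<psi> 0 + (LINT v|pivot_space K. (LINT x|unif01. g x * T v x))"
 proof -
  have "integrable (pivot_space K) (%v. LINT x|unif01. g x * T v x)"
   using PU.integrable_fst'[OF int] by (simp only: prod.case)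
  moreover have "integrable (pivot_space K) (%v. (real K + 1) * \<psi> 0)" by (rule P.integrable_const)
  ultimately show ?thesis
   by (simp only: Bochner_Integration.integral_add lebesgue_integral_const P.prob_space scaleR_one)
 qed
 also have "(LINT v|pivot_space K. (LINT x|unif01. g x * T v x)) = (LINT x|unif01. (LINT v|pivot_space K. g x * T v x))"
  using PU.Fubini_integral[OF int] by simp
 also have "... = (LINT x|unif01. (real K + 1) * (g x * (1 - x) ^ K))"
 proof (rule integral_cong_AE)
  have "(%(x, v). g x * T v x) \<in> borel_measurable (unif01 \<Otimes>\<^sub>M pivot_space K)"
   unfolding T_def of_bool_def by measurable
  then show "(%x. LINT v|pivot_space K. g x * T v x) \<in> borel_measurable unif01"
   by (rule P.borel_measurable_lebesgue_integral)
  show "AE x in unif01. (LINT v|pivot_space K. g x * T v x) = (real K + 1) * (g x * (1 - x) ^ K)"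
   using AE_unif01_interior
  proof eventually_elim
   fix x :: real assume x: "x \<in> {0<..<1}"
   have "(LINT v|pivot_space K. g x * T v x) = g x * (LINT v|pivot_space K. T v x)"
    by (rule integral_mult_right_zero)
   also have "(LINT v|pivot_space K. T v x) = (real K + 1) * (1 - x) ^ K"
    unfolding T_def using x by (intro integral_spacing_tail[OF K]) auto
   finally show "(LINT v|pivot_space K. g x * T v x) = (real K + 1) * (g x * (1 - x) ^ K)"
    by (simp only: mult_ac)
  qed
 qed auto
 also have "... = (real K + 1) * integral {0..1} (%x. g x * (1 - x) ^ K)"
  by (subst integral_mult_right_zero, subst integral_unif01)
   (auto intro!: continuous_intros continuous_on_subset[OF gc])
 also have "integral {0..1} (%x. g x * (1 - x) ^ K) = integral {0..1} (%x. \<psi>' x * (1 - x) ^ K)"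
  by (intro Henstock_Kurzweil_Integration.integral_cong) (simp add: g)
 also have "... = real K * integral {0..1} (%x. \<psi> x * (1 - x) ^ (K - 1)) - \<psi> 0"
 proof -
  have \<psi>c: "continuous_on {0..1} \<psi>"
   using \<psi> by (intro continuous_at_imp_continuous_on ballI DERIV_isCont)
  have "((%x. \<psi>' x * (1 - x) ^ K - real K * (\<psi> x * (1 - x) ^ (K - 1))) has_integral (\<psi> 1 * (1 - 1) ^ K - \<psi> 0 * (1 - 0) ^ K)) {0..1}"
  proof (rule fundamental_theorem_of_calculus)
   fix x :: real
   have "((%x. \<psi> x * (1 - x) ^ K) has_real_derivative (\<psi>' x * (1 - x) ^ K - real K * (\<psi> x * (1 - x) ^ (K - 1)))) (at x)"
    by (auto intro!: derivative_eq_intros \<psi> simp: algebra_simps)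
   then show "((%x. \<psi> x * (1 - x) ^ K) has_vector_derivative (\<psi>' x * (1 - x) ^ K - real K * (\<psi> x * (1 - x) ^ (K - 1)))) (at x within {0..1})"
    by (simp add: has_real_derivative_iff_has_vector_derivative has_vector_derivative_at_within)
  qed auto
  then have "integral {0..1} (%x. \<psi>' x * (1 - x) ^ K - real K * (\<psi> x * (1 - x) ^ (K - 1))) = - \<psi> 0"
   using K by (simp add: integral_unique)
  moreover have "integral {0..1} (%x. \<psi>' x * (1 - x) ^ K - real K * (\<psi> x * (1 - x) ^ (K - 1)))
   = integral {0..1} (%x. \<psi>' x * (1 - x) ^ K) - real K * integral {0..1} (%x. \<psi> x * (1 - x) ^ (K - 1))"
   by (subst Henstock_Kurzweil_Integration.integral_diff)
    (auto intro!: integrable_continuous_real continuous_intros \<psi>c continuous_on_subset[OF c])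
  ultimately show ?thesis by simp
 qed
 finally show ?thesis by (simp add: algebra_simps)
qed

text \<open>The Beta integral at integer arguments. The endpoints are exempted because
  \<open>powr\<close> and \<open>^\<close> disagree at 0 for exponent 0.\<close>

lemma integral_power_mult_power:
 "((%x::real. x ^ a * (1 - x) ^ b) has_integral (fact a * fact b / fact (a + b + 1))) {0..1}"
proof -
 have "((%t. t powr (real (a + 1) - 1) * (1 - t) powr (real (b + 1) - 1)) has_integral Beta (real (a + 1)) (real (b + 1))) {0..1}"
  by (rule has_integral_Beta_real) auto
 moreover have "Beta (real (a + 1)) (real (b + 1)) = fact a * fact b / fact (a + b + 1)"
 proof -
  have "Gamma (real (Suc a) + real (Suc b)) = (fact (a + b + 1) :: real)"
   using Gamma_fact[of "a + b + 1", where ?'a = real] by (simp add: add_ac)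
  then show ?thesis using Gamma_fact[of a, where ?'a = real] Gamma_fact[of b, where ?'a = real]
   by (simp add: Beta_def add_ac)
 qed
 ultimately have "((%t. t powr (real (a + 1) - 1) * (1 - t) powr (real (b + 1) - 1)) has_integral (fact a * fact b / fact (a + b + 1))) {0..1}"
  by simp
 then show ?thesis
  by (rule has_integral_spike_finite[of "{0, 1}", rotated 2]) (auto simp: powr_realpow)
qed

text \<open>A list of \<open>m\<close> uniform elements puts exactly \<open>j\<close> of them into a spacing of size \<open>x\<close> with the
 binomial probability below; averaging over the spacings gives the kernel of \<open>gap_avg\<close>.\<close>

lemma sum_spacing_binomial:
 assumes K: "K >= 1" and j: "j <= m"
 shows "(LINT v|pivot_space K. (\<Sum>i\<le>K. real (m choose j) * (spacing K v i) ^ j * (1 - spacing K v i) ^ (m - j)))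
  = (real K + 1) * real ((m + K - 1 - j) choose (K - 1)) / real ((m + K) choose K)"
proof -
 define \<psi> where "\<psi> x = real (m choose j) * x ^ j * (1 - x) ^ (m - j)" for x :: real
 define \<psi>' where "\<psi>' x = real (m choose j) * (real j * x ^ (j - 1)) * (1 - x) ^ (m - j)
   - real (m choose j) * x ^ j * (real (m - j) * (1 - x) ^ (m - j - 1))" for x :: real
 have d: "(\<psi> has_real_derivative \<psi>' x) (at x)" for x
  unfolding \<psi>_def \<psi>'_def by (auto intro!: derivative_eq_intros simp: algebra_simps)
 have c: "continuous_on UNIV \<psi>'" unfolding \<psi>'_def by (intro continuous_intros)
 have "(LINT v|pivot_space K. (\<Sum>i\<le>K. \<psi> (spacing K v i)))
  = (real K + 1) * real K * integral {0..1} (%x. \<psi> x * (1 - x) ^ (K - 1))"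
  by (rule sum_spacing_expectation[OF K d c])
 also have "(%x. \<psi> x * (1 - x) ^ (K - 1)) = (%x. real (m choose j) * (x ^ j * (1 - x) ^ (m - j + (K - 1))))"
  by (simp add: \<psi>_def power_add mult_ac)
 also have "integral {0..1} ... = real (m choose j) * (fact j * fact (m - j + (K - 1)) / fact (j + (m - j + (K - 1)) + 1))"
  by (intro integral_unique has_integral_mult_right integral_power_mult_power)
 also have "j + (m - j + (K - 1)) + 1 = m + K" using j K by simp
 also have "m - j + (K - 1) = m + K - 1 - j" using j K by simp
 also have "real (m choose j) = fact m / (fact j * fact (m - j))" using j by (rule binomial_fact)
 also have "(real K + 1) * real K * (fact m / (fact j * fact (m - j)) * (fact j * fact (m + K - 1 - j) / fact (m + K)))
   = (real K + 1) * real ((m + K - 1 - j) choose (K - 1)) / real ((m + K) choose K)"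
 proof -
  have 1: "real ((m + K - 1 - j) choose (K - 1)) = fact (m + K - 1 - j) / (fact (K - 1) * fact (m - j))"
   using j K by (subst binomial_fact) (auto simp: Suc_diff_le)
  have 2: "real ((m + K) choose K) = fact (m + K) / (fact K * fact m)"
   by (subst binomial_fact) auto
  have 3: "(fact K :: real) = real K * fact (K - 1)" using K by (simp add: fact_reduce)
  show ?thesis unfolding 1 2 3 by (simp add: divide_simps)
 qed
 finally show ?thesis by (simp add: \<psi>_def)
qed

section \<open>One round of the algorithm\<close>

lemma integral_bucket_unif01:
 assumes "!!j. j \<in> {1..K} ==> v j \<in> {0..1}"
 shows "(LINT x|unif01. of_bool (x \<in> bucket K v i)) = spacing K v i"
proof -
 have p: "pivot K v i \<in> {0..1}" "pivot K v (Suc i) \<in> {0..1}" by (rule pivot_unit[OF assms]; assumption)+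
 have le: "pivot K v i <= pivot K v (Suc i)" by (rule pivot_mono[OF assms]) auto
 have "(LINT x|unif01. of_bool (x \<in> bucket K v i)) = measure unif01 (bucket K v i)"
  unfolding indicator_def[symmetric, abs_def] by (simp add: bucket_def)
 also have "... = measure lborel ({0..1} \<inter> bucket K v i)"
  unfolding measure_def by (subst emeasure_unif01) (auto simp: bucket_def)
 also have "{0..1} \<inter> bucket K v i = bucket K v i" using p by (auto simp: bucket_def)
 also have "measure lborel (bucket K v i) = spacing K v i"
  using le by (simp add: bucket_def spacing_def)
 finally show ?thesis .
qed

context optimal_quicksort
begin

abbreviation piv_of :: "'a => nat => real" where "piv_of om \<equiv> (%i. V i om)"
abbreviation elem_of :: "'a => nat => real" where "elem_of om \<equiv> (%k. a k om)"
abbreviation gap :: "nat => 'a => real" where "gap i om \<equiv> spacing K (piv_of om) i"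
abbreviation cnt :: "nat => nat => 'a => nat" where
 "cnt m i om \<equiv> bucket_count K (piv_of om) (elem_of om) m i"
abbreviation hit :: "nat => nat => 'a => real" where
 "hit k i om \<equiv> of_bool (a k om \<in> bucket K (piv_of om) i)"
abbreviation tree_at :: "nat => 'a => nat tree" where
 "tree_at k om \<equiv> tree_used r K (piv_of om) (elem_of om) k"

text \<open>What is known before element k is read. The sum type is that of
  \<open>indep_input\<close>, so independence of \<open>a k\<close> from the past is just
  disjointness of index sets.\<close>

definition past_index :: "nat => (nat + nat) set" where
 "past_index k = {1..K} <+> {1..<k}"

definition past_of :: "nat => 'a => nat + nat => real" where
 "past_of k om = restrict (%s. case_sum V a s om) (past_index k)"

lemma V_measurable: "i \<in> {1..K} ==> V i \<in> borel_measurable M"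
 using indep_input unfolding indep_vars_def by (force dest: bspec[where x = "Inl i"])

lemma a_measurable: "k >= 1 ==> a k \<in> borel_measurable M"
 using indep_input unfolding indep_vars_def by (force dest: bspec[where x = "Inr k"])

lemma AE_V: "AE om in M. \<forall>i\<in>{1..K}. V i om \<in> {0<..<1}"
proof (intro AE_finite_allI)
 fix i assume i: "i \<in> {1..K}"
 have "AE x in distr M borel (V i). x \<in> {0<..<1}" unfolding V_uniform[OF i] by (rule AE_unif01_interior)
 then show "AE om in M. V i om \<in> {0<..<1}"
  by (subst (asm) AE_distr_iff) (auto intro: V_measurable[OF i])
qed auto

lemma AE_V_closed: "AE om in M. \<forall>i\<in>{1..K}. V i om \<in> {0..1}"
 using AE_V by eventually_elim fastforce

lemma indep_past:
 assumes "k >= 1"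
 shows "indep_var (PiM (past_index k) (%_. borel)) (past_of k)
  (PiM {Inr k} (%_. borel)) (%om. restrict (%s. case_sum V a s om) {Inr k})"
 unfolding past_of_def[abs_def] using assms
 by (intro indep_var_restrict[OF indep_input]) (auto simp: past_index_def)

lemma past_of_simps:
 "j \<in> {1..K} ==> past_of k om (Inl j) = V j om" "l \<in> {1..<k} ==> past_of k om (Inr l) = a l om"
 by (auto simp: past_of_def past_index_def)

lemma past_component:
 "j \<in> {1..K} ==> (%w. w (Inl j)) \<in> borel_measurable (PiM (past_index k) (%_. borel :: real measure))"
 "l \<in> {1..<k} ==> (%w. w (Inr l)) \<in> borel_measurable (PiM (past_index k) (%_. borel :: real measure))"
 unfolding past_index_def by (rule measurable_component_singleton; auto)+

text \<open>Since \<open>a k\<close> is independent of the past, the joint law is a product, and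
  integrating the indicator over \<open>a k\<close> alone gives the spacing. The bounded function
  \<Phi> of the past serves as test function, so this is the conditional probability of a hit
  without conditional expectations.\<close>

lemma one_step:
 fixes F :: "(nat + nat => real) => real"
 assumes k: "k >= 1" and F [measurable]: "F \<in> borel_measurable (PiM (past_index k) (%_. borel))"
  and \<Phi>: "!!om. \<Phi> om = F (past_of k om)" and B: "AE om in M. \<bar>\<Phi> om\<bar> <= B"
 shows "expectation (%om. \<Phi> om * (hit k i om - gap i om)) = 0"
proof -
 let ?P = "PiM (past_index k) (%_. borel :: real measure)"
 let ?Q = "PiM {Inr k} (%_. borel :: real measure) :: (nat + nat => real) measure"
 define R where "R om = restrict (%s. case_sum V a s om) {Inr k}" for om
 have ind: "indep_var ?P (past_of k) ?Q R" unfolding R_def[abs_def] by (rule indep_past[OF k])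
 then have rv [measurable]: "past_of k \<in> measurable M ?P" "R \<in> measurable M ?Q"
  using indep_var_rv1 indep_var_rv2 by blast+
 have dist: "distr M (?P \<Otimes>\<^sub>M ?Q) (%om. (past_of k om, R om)) = distr M ?P (past_of k) \<Otimes>\<^sub>M distr M ?Q R"
  using ind unfolding indep_var_distribution_eq by simp
 interpret Q: prob_space "distr M ?P (past_of k)" by (rule prob_space_distr) fact
 interpret R: prob_space "distr M ?Q R" by (rule prob_space_distr) fact
 interpret QU: pair_prob_space "distr M ?P (past_of k)" "distr M ?Q R" ..
 have R: "R om (Inr k) = a k om" for om by (simp add: R_def)
 have ev [measurable]: "(%w. w (Inr k)) \<in> borel_measurable ?Q" by auto
 have Rint: "(LINT w'|distr M ?Q R. h (w' (Inr k))) = (LINT x|unif01. h x)" if [measurable]: "h \<in> borel_measurable borel" for h :: "real => real"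
 proof -
  have "(LINT w'|distr M ?Q R. h (w' (Inr k))) = (LINT om|M. h (a k om))"
   by (subst integral_distr) (auto simp: R)
  also have "... = (LINT x|distr M borel (a k). h x)"
   using a_measurable[OF k] by (subst integral_distr) auto
  finally show ?thesis unfolding a_uniform[OF k] .
 qed
 define pv where "pv w = (%j. w (Inl j))" for w :: "nat + nat => real"
 have sp [measurable]: "(%w. spacing K (pv w) i) \<in> borel_measurable ?P"
  unfolding pv_def by (intro spacing_measurable past_component)
 have [measurable]: "Measurable.pred (?P \<Otimes>\<^sub>M ?Q) (%p. snd p (Inr k) \<in> bucket K (pv (fst p)) i)"
  unfolding pv_def
  by (intro bucket_measurable measurable_compose[OF measurable_fst past_component(1)] measurable_compose[OF measurable_snd ev]) auto
 define G where "G p = F (fst p) * (of_bool (snd p (Inr k) \<in> bucket K (pv (fst p)) i) - spacing K (pv (fst p)) i)"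
  for p :: "(nat + nat => real) \<times> (nat + nat => real)"
 have Gm [measurable]: "G \<in> borel_measurable (?P \<Otimes>\<^sub>M ?Q)"
  unfolding G_def of_bool_def by measurable
 have pc: "spacing K (pv (past_of k om)) = spacing K (piv_of om)" "bucket K (pv (past_of k om)) = bucket K (piv_of om)" for om
  unfolding pv_def by (intro spacing_cong bucket_cong past_of_simps; assumption)+
 have eq: "\<Phi> om * (hit k i om - gap i om) = G (past_of k om, R om)" for om
  by (simp add: G_def \<Phi> pc R)
 have intG: "integrable M (%om. G (past_of k om, R om))"
 proof (rule integrable_const_bound[where B = "B * 2"])
  show "AE om in M. norm (G (past_of k om, R om)) <= B * 2"
   using B AE_V_closed
  proof eventually_elim
   case (elim om)
   have "\<bar>hit k i om - gap i om\<bar> <= 2"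
    using spacing_nonneg[of K "piv_of om" i] spacing_le_1[of K "piv_of om" i] elim(2) by (auto simp: of_bool_def)
   then show ?case unfolding eq[symmetric] using elim(1) by (auto simp: abs_mult intro!: mult_mono)
  qed
 qed measurable
 have "expectation (%om. \<Phi> om * (hit k i om - gap i om)) = expectation (%om. G (past_of k om, R om))"
  by (simp only: eq)
 also have "... = (LINT p|distr M (?P \<Otimes>\<^sub>M ?Q) (%om. (past_of k om, R om)). G p)"
  by (subst integral_distr) auto
 also have "... = (LINT p|(distr M ?P (past_of k) \<Otimes>\<^sub>M distr M ?Q R). G p)" unfolding dist ..
 also have "... = (LINT w|distr M ?P (past_of k). (LINT w'|distr M ?Q R. G (w, w')))"
 proof (rule QU.integral_fst'[symmetric])
  have "integrable (distr M (?P \<Otimes>\<^sub>M ?Q) (%om. (past_of k om, R om))) G"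
   using intG by (subst integrable_distr_eq) auto
  then show "integrable (distr M ?P (past_of k) \<Otimes>\<^sub>M distr M ?Q R) G" unfolding dist .
 qed
 also have "... = (LINT w|distr M ?P (past_of k). 0)"
 proof (rule integral_cong_AE)
  \<comment> \<open>The length of a bucket equals its probability only when the pivots lie in the
    unit interval.\<close>
  have "AE w in distr M ?P (past_of k). \<forall>j\<in>{1..K}. w (Inl j) \<in> {0..1}"
  proof (intro AE_finite_allI)
   fix j assume j: "j \<in> {1..K}"
   have "{w \<in> space ?P. w (Inl j) \<in> {0..1}} \<in> sets ?P"
    using measurable_sets[OF past_component(1)[OF j], of "{0..1}"] by (simp add: vimage_def Int_def conj_commute)
   then show "AE w in distr M ?P (past_of k). w (Inl j) \<in> {0..1}"
    using AE_V_closed j by (subst AE_distr_iff) (auto elim!: eventually_mono simp: past_of_simps)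
  qed auto
  then show "AE w in distr M ?P (past_of k). (LINT w'|distr M ?Q R. G (w, w')) = 0"
  proof eventually_elim
   fix w :: "nat + nat => real" assume "\<forall>j\<in>{1..K}. w (Inl j) \<in> {0..1}"
   then have u: "!!j. j \<in> {1..K} ==> pv w j \<in> {0..1}" by (simp add: pv_def)
   have bm [measurable]: "bucket K (pv w) i \<in> sets borel" by (simp add: bucket_def)
   have "(LINT w'|distr M ?Q R. G (w, w')) = (LINT x|unif01. F w * (of_bool (x \<in> bucket K (pv w) i) - spacing K (pv w) i))"
    unfolding G_def fst_conv snd_conv by (rule Rint) (simp add: of_bool_def)
   also have "integrable unif01 (indicator (bucket K (pv w) i) :: real => real)"
   proof (rule unif01.integrable_const_bound[where B = 1])
    show "(indicator (bucket K (pv w) i) :: real => real) \<in> borel_measurable unif01"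
     by (rule borel_measurable_indicator) (simp add: bm)
   qed (auto simp: indicator_def)
   then have "integrable unif01 (%x. of_bool (x \<in> bucket K (pv w) i) :: real)"
    by (simp add: indicator_def[abs_def])
   then have "(LINT x|unif01. F w * (of_bool (x \<in> bucket K (pv w) i) - spacing K (pv w) i))
    = F w * ((LINT x|unif01. of_bool (x \<in> bucket K (pv w) i)) - spacing K (pv w) i)"
    by (subst integral_mult_right_zero, subst Bochner_Integration.integral_diff) (auto simp: unif01.prob_space)
   also have "... = 0" by (simp only: integral_bucket_unif01[OF u] diff_self mult_zero_right)
   finally show "(LINT w'|distr M ?Q R. G (w, w')) = 0" .
  qed
  have "case_prod (%w w'. G (w, w')) \<in> borel_measurable (distr M ?P (past_of k) \<Otimes>\<^sub>M distr M ?Q R)"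
   by (simp add: case_prod_unfold)
  then show "(%w. LINT w'|distr M ?Q R. G (w, w')) \<in> borel_measurable (distr M ?P (past_of k))"
   by (rule R.borel_measurable_lebesgue_integral)
 qed auto
 finally show ?thesis by simp
qed

text \<open>Independence is available for a family over a sum type; restricting it to the left
  summand and reindexing along \<open>Inl\<close> gives the product measure over 1..K.\<close>

lemma distr_pivots:
 assumes K: "K >= 1"
 shows "distr M (\<Pi>\<^sub>M i\<in>{1..K}. borel) (%om. \<lambda>i\<in>{1..K}. V i om) = pivot_space K"
proof -
 let ?S = "Inl ` {1..K} :: (nat + nat) set" and ?X = "case_sum V a"
 have ind: "indep_vars (%_. borel) ?X ?S"
  by (rule indep_vars_subset[OF indep_input]) auto
 have rv: "?X s \<in> borel_measurable M" if s: "s \<in> ?S" for s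
 proof -
  obtain i where "s = Inl i" "i \<in> {1..K}" using s by blast
  then show ?thesis using V_measurable[of i] by simp
 qed
 have [measurable]: "(%om. \<lambda>s\<in>?S. ?X s om) \<in> measurable M (PiM ?S (%_. borel))"
  by (intro measurable_restrict rv)
 have sets: "sets (PiM ?S (%_. unif01)) = sets (PiM ?S (%_. borel))" by (intro sets_PiM_cong) auto
 have "distr M (PiM ?S (%_. borel)) (%om. \<lambda>s\<in>?S. ?X s om) = PiM ?S (%s. distr M borel (?X s))"
  using ind K by (subst (asm) indep_vars_iff_distr_eq_PiM') (auto intro: rv)
 also have "... = PiM ?S (%_. unif01)" by (intro PiM_cong) (auto simp: V_uniform)
 finally have d: "distr M (PiM ?S (%_. borel)) (%om. \<lambda>s\<in>?S. ?X s om) = PiM ?S (%_. unif01)" .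
 have m: "(%w. \<lambda>n\<in>{1..K}. w (Inl n)) \<in> measurable (PiM ?S (%_. borel :: real measure)) (\<Pi>\<^sub>M i\<in>{1..K}. borel)"
  by (intro measurable_restrict measurable_component_singleton) auto
 have "pivot_space K = distr (PiM ?S (%_. unif01)) (pivot_space K) (%w. \<lambda>n\<in>{1..K}. w (Inl n))"
  by (rule distr_PiM_reindex[symmetric]) (auto intro: prob_space_unif01)
 also have "... = distr (PiM ?S (%_. unif01)) (\<Pi>\<^sub>M i\<in>{1..K}. borel) (%w. \<lambda>n\<in>{1..K}. w (Inl n))"
  by (rule distr_cong) (simp_all only: sets_pivot_space)
 also have "... = distr M (\<Pi>\<^sub>M i\<in>{1..K}. borel) ((%w. \<lambda>n\<in>{1..K}. w (Inl n)) \<circ> (%om. \<lambda>s\<in>?S. ?X s om))"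
  unfolding d[symmetric] by (rule distr_distr[OF m]) measurable
 also have "(%w. \<lambda>n\<in>{1..K}. w (Inl n)) \<circ> (%om. \<lambda>s\<in>?S. ?X s om) = (%om. \<lambda>i\<in>{1..K}. V i om)"
  by (auto simp: fun_eq_iff restrict_def)
 finally show ?thesis ..
qed

lemma expectation_pivots:
 fixes F :: "(nat => real) => real"
 assumes K: "K >= 1" and F: "F \<in> borel_measurable (\<Pi>\<^sub>M i\<in>{1..K}. borel)"
  and cong: "!!om. F (\<lambda>i\<in>{1..K}. V i om) = F (piv_of om)"
 shows "expectation (%om. F (piv_of om)) = (LINT v|pivot_space K. F v)"
proof -
 have "(%om. \<lambda>i\<in>{1..K}. V i om) \<in> measurable M (\<Pi>\<^sub>M i\<in>{1..K}. borel)"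
  by (intro measurable_restrict V_measurable)
 then show ?thesis unfolding distr_pivots[OF K, symmetric]
  by (subst integral_distr[OF _ F]) (simp_all only: cong)
qed

end

section \<open>Sublist sizes given the pivots\<close>

context optimal_quicksort
begin

lemma gap_measurable [measurable]: "gap i \<in> borel_measurable M"
 by (intro spacing_measurable V_measurable)

lemma cnt_measurable_real [measurable]: "(%om. real (cnt m i om)) \<in> borel_measurable M"
 by (intro bucket_count_measurable_real V_measurable a_measurable) auto

lemma hit_measurable [measurable]: "k >= 1 ==> hit k i \<in> borel_measurable M"
proof -
 assume k: "k >= 1"
 have [measurable]: "Measurable.pred M (%om. a k om \<in> bucket K (piv_of om) i)"
  by (intro bucket_measurable V_measurable a_measurable k)
 show ?thesis unfolding of_bool_def by measurable
qed

lemma AE_gap: "AE om in M. \<forall>i. 0 <= gap i om \<and> gap i om <= 1"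
 using AE_V_closed by eventually_elim (auto intro!: spacing_nonneg spacing_le_1)

lemma cnt_0 [simp]: "cnt 0 i om = 0"
 by (simp add: bucket_count_eq_sum)

lemma integrable_AE_bounded:
 assumes "f \<in> borel_measurable M" "AE om in M. \<bar>f om\<bar> <= (B::real)"
 shows "integrable M f"
 by (rule integrable_const_bound[where B = B]) (use assms in auto)

text \<open>Pythagoras for bounded martingale differences: orthogonality of every increment to the
  preceding partial sum already makes the second moment grow at most linearly.\<close>

lemma second_moment_le:
 fixes \<xi> :: "nat => 'a => real"
 assumes meas: "!!k. k >= 1 ==> \<xi> k \<in> borel_measurable M"
  and bd: "!!k. k >= 1 ==> AE om in M. \<bar>\<xi> k om\<bar> <= c"
  and orth: "!!m. expectation (%om. (\<Sum>k\<in>{1..m}. \<xi> k om) * \<xi> (Suc m) om) = 0"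
 shows "expectation (%om. (\<Sum>k\<in>{1..m}. \<xi> k om)\<^sup>2) <= real m * c\<^sup>2"
  and "AE om in M. \<bar>\<Sum>k\<in>{1..m}. \<xi> k om\<bar> <= real m * c"
proof -
 define S where "S m om = (\<Sum>k\<in>{1..m}. \<xi> k om)" for m om
 have Sm [measurable]: "S m \<in> borel_measurable M" for m
  unfolding S_def by (intro borel_measurable_sum meas) auto
 have Sb: "AE om in M. \<bar>S m om\<bar> <= real m * c" for m
 proof -
  have "AE om in M. \<forall>k\<in>{1..m}. \<bar>\<xi> k om\<bar> <= c" by (intro AE_finite_allI bd) auto
  then show ?thesis
  proof eventually_elim
   case (elim om)
   have "\<bar>S m om\<bar> <= (\<Sum>k\<in>{1..m}. \<bar>\<xi> k om\<bar>)" unfolding S_def by (rule sum_abs)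
   also have "... <= (\<Sum>k\<in>{1..m}. c)" by (intro sum_mono) (use elim in auto)
   finally show ?case by simp
  qed
 qed
 then show "AE om in M. \<bar>\<Sum>k\<in>{1..m}. \<xi> k om\<bar> <= real m * c" unfolding S_def .
 have "expectation (%om. (S m om)\<^sup>2) <= real m * c\<^sup>2"
 proof (induction m)
  case 0
  then show ?case by (simp add: S_def)
 next
  case (Suc m)
  have [measurable]: "\<xi> (Suc m) \<in> borel_measurable M" by (rule meas) auto
  have i1: "integrable M (%om. (S m om)\<^sup>2)"
  proof (rule integrable_AE_bounded[where B = "(real m * c)\<^sup>2"])
   show "AE om in M. \<bar>(S m om)\<^sup>2\<bar> <= (real m * c)\<^sup>2"
    using Sb[of m] by eventually_elim (auto simp: abs_le_square_iff[symmetric])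
  qed measurable
  have i2: "integrable M (%om. S m om * \<xi> (Suc m) om)"
  proof (rule integrable_AE_bounded[where B = "real m * c * c"])
   show "AE om in M. \<bar>S m om * \<xi> (Suc m) om\<bar> <= real m * c * c"
    using Sb[of m] bd[of "Suc m", OF le_add1[of 1 m, unfolded plus_1_eq_Suc]]
    by eventually_elim (auto simp: abs_mult intro!: mult_mono)
  qed measurable
  have c2: "AE om in M. (\<xi> (Suc m) om)\<^sup>2 <= c\<^sup>2"
   using bd[of "Suc m", OF le_add1[of 1 m, unfolded plus_1_eq_Suc]]
   by eventually_elim (auto simp: abs_le_square_iff[symmetric])
  have i3: "integrable M (%om. (\<xi> (Suc m) om)\<^sup>2)"
   by (rule integrable_AE_bounded[where B = "c\<^sup>2"]) (use c2 in auto)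
  have "(%om. (S (Suc m) om)\<^sup>2) = (%om. (S m om)\<^sup>2 + 2 * (S m om * \<xi> (Suc m) om) + (\<xi> (Suc m) om)\<^sup>2)"
   by (simp add: S_def power2_eq_square algebra_simps fun_eq_iff)
  then have "expectation (%om. (S (Suc m) om)\<^sup>2)
   = expectation (%om. (S m om)\<^sup>2) + 2 * expectation (%om. S m om * \<xi> (Suc m) om) + expectation (%om. (\<xi> (Suc m) om)\<^sup>2)"
   using i1 i2 i3 by simp
  also have "expectation (%om. S m om * \<xi> (Suc m) om) = 0" unfolding S_def by (rule orth)
  also have "expectation (%om. (\<xi> (Suc m) om)\<^sup>2) <= expectation (%om. c\<^sup>2)"
   by (intro integral_mono_AE i3 c2) auto
  also have "expectation (%om. c\<^sup>2) = c\<^sup>2" by (simp add: prob_space)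
  finally show ?case using Suc by (simp add: algebra_simps)
 qed
 then show "expectation (%om. (\<Sum>k\<in>{1..m}. \<xi> k om)\<^sup>2) <= real m * c\<^sup>2" unfolding S_def .
qed

text \<open>Used to exhibit test functions for \<open>one_step\<close>. The side conditions
  \<open>m < k\<close> and \<open>l <= k\<close> say that element k and the later ones do not
  enter.\<close>

lemma past_pivots:
 "spacing K (%j. past_of k om (Inl j)) = spacing K (piv_of om)"
 "bucket K (%j. past_of k om (Inl j)) = bucket K (piv_of om)"
 "m < k ==> bucket_count K (%j. past_of k om (Inl j)) (%l. past_of k om (Inr l)) m = bucket_count K (piv_of om) (elem_of om) m"
 "l <= k ==> tree_used r K (%j. past_of k om (Inl j)) (%l. past_of k om (Inr l)) l = tree_at l om"
   apply (rule spacing_cong, rule past_of_simps, assumption)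
  apply (rule bucket_cong, rule past_of_simps, assumption)
  apply (rule bucket_count_cong; rule past_of_simps; simp)
 apply (rule tree_used_cong; rule past_of_simps; auto)
 done

lemma count_orthogonal:
 "expectation (%om. (\<Sum>k\<in>{1..m}. hit k i om - gap i om) * (hit (Suc m) i om - gap i om)) = 0"
proof (rule one_step[where B = "real m"])
 let ?F = "%w. real (bucket_count K (%j. w (Inl j)) (%l. w (Inr l)) m i) - real m * spacing K (%j. w (Inl j)) i"
 show "?F \<in> borel_measurable (PiM (past_index (Suc m)) (%_. borel))"
  by (intro borel_measurable_diff borel_measurable_times bucket_count_measurable_real spacing_measurable
    past_component borel_measurable_const) auto
 show "(\<Sum>k\<in>{1..m}. hit k i om - gap i om) = ?F (past_of (Suc m) om)" for om
  by (simp add: past_pivots sum_subtractf bucket_count_eq_sum)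
 show "AE om in M. \<bar>\<Sum>k\<in>{1..m}. hit k i om - gap i om\<bar> <= real m"
  using AE_gap
 proof eventually_elim
  case (elim om)
  have "\<bar>\<Sum>k\<in>{1..m}. hit k i om - gap i om\<bar> <= (\<Sum>k\<in>{1..m}. \<bar>hit k i om - gap i om\<bar>)" by (rule sum_abs)
  also have "... <= (\<Sum>k\<in>{1..m}. 1)" by (intro sum_mono) (use elim[rule_format, of i] in \<open>auto simp: of_bool_def\<close>)
  finally show ?case by simp
 qed
qed auto

lemma count_second_moment: "expectation (%om. (real (cnt m i om) - real m * gap i om)\<^sup>2) <= real m"
proof -
 have "real (cnt m i om) - real m * gap i om = (\<Sum>k\<in>{1..m}. hit k i om - gap i om)" for om
  by (simp add: sum_subtractf bucket_count_eq_sum)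
 moreover have "expectation (%om. (\<Sum>k\<in>{1..m}. hit k i om - gap i om)\<^sup>2) <= real m * 1\<^sup>2"
 proof (rule second_moment_le(1)[where \<xi> = "%k om. hit k i om - gap i om", OF _ _ count_orthogonal])
  fix k :: nat assume "k >= 1"
  then show "(%om. hit k i om - gap i om) \<in> borel_measurable M" by (intro borel_measurable_diff hit_measurable gap_measurable)
  show "AE om in M. \<bar>hit k i om - gap i om\<bar> <= 1"
   using AE_gap by eventually_elim (auto simp: of_bool_def dest!: spec[of _ i])
 qed
 ultimately show ?thesis by simp
qed

text \<open>Given its spacing x, a sublist size is binomial with parameters m and x; the test
  function \<psi> stands in for conditioning. In the induction, the new element multiplies the test
  function by x or by 1 - x, and Pascal's rule combines the two cases.\<close>

lemma count_distribution:
 assumes \<psi>: "\<psi> \<in> borel_measurable borel" "!!x. x \<in> {0..1} ==> \<bar>\<psi> x\<bar> <= B"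
 shows "expectation (%om. of_bool (cnt m i om = j) * \<psi> (gap i om))
  = expectation (%om. real (m choose j) * gap i om ^ j * (1 - gap i om) ^ (m - j) * \<psi> (gap i om))"
 using assms
proof (induction m arbitrary: j \<psi> B)
 case 0
 show ?case by (cases j) auto
next
 case (Suc m)
 note [measurable] = Suc.prems(1)
 have B0: "B >= 0" using Suc.prems(2)[of 0] by auto
 have cm [measurable]: "Measurable.pred M (%om. cnt m i om = j)" for j m
 proof -
  have "Measurable.pred M (%om. real (cnt m i om) = real j)" by measurable
  then show ?thesis by simp
 qed
 have hm [measurable]: "hit (Suc m) i \<in> borel_measurable M" by (rule hit_measurable) auto
 define A where "A j om = of_bool (cnt m i om = j) * \<psi> (gap i om)" for j om
 have Am [measurable]: "A j \<in> borel_measurable M" for j unfolding A_def of_bool_def by measurable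
 have AB: "AE om in M. \<bar>A j om\<bar> <= B" for j
  using AE_gap by eventually_elim (use Suc.prems(2) B0 in \<open>auto simp: A_def of_bool_def\<close>)
 have key: "expectation (%om. A j om * (hit (Suc m) i om - gap i om)) = 0" for j
 proof (rule one_step[OF _ _ _ AB])
  let ?F = "%w. of_bool (bucket_count K (%l. w (Inl l)) (%l. w (Inr l)) m i = j) * \<psi> (spacing K (%l. w (Inl l)) i)"
  have [measurable]: "(%w. spacing K (%l. w (Inl l)) i) \<in> borel_measurable (PiM (past_index (Suc m)) (%_. borel))"
   by (intro spacing_measurable past_component)
  have "(%w. real (bucket_count K (%l. w (Inl l)) (%l. w (Inr l)) m i)) \<in> borel_measurable (PiM (past_index (Suc m)) (%_. borel))"
   by (intro bucket_count_measurable_real past_component) auto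
  then have "Measurable.pred (PiM (past_index (Suc m)) (%_. borel)) (%w. real (bucket_count K (%l. w (Inl l)) (%l. w (Inr l)) m i) = real j)"
   by measurable
  then have [measurable]: "Measurable.pred (PiM (past_index (Suc m)) (%_. borel)) (%w. bucket_count K (%l. w (Inl l)) (%l. w (Inr l)) m i = j)"
   by simp
  show "?F \<in> borel_measurable (PiM (past_index (Suc m)) (%_. borel))" unfolding of_bool_def by measurable
  show "A j om = ?F (past_of (Suc m) om)" for om by (simp add: A_def past_pivots)
 qed auto
 have intA: "integrable M (%om. A j om * gap i om)" "integrable M (%om. A j om * hit (Suc m) i om)" "integrable M (A j)" for j
 proof -
  show "integrable M (A j)" by (rule integrable_AE_bounded[OF Am AB])
  show "integrable M (%om. A j om * gap i om)"
  proof (rule integrable_AE_bounded[where B = "B * 1"])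
   show "AE om in M. \<bar>A j om * gap i om\<bar> <= B * 1"
    using AB[of j] AE_gap by eventually_elim (auto simp: abs_mult intro: order.trans[OF mult_left_le])
  qed measurable
  show "integrable M (%om. A j om * hit (Suc m) i om)"
  proof (rule integrable_AE_bounded[where B = "B * 1"])
   show "AE om in M. \<bar>A j om * hit (Suc m) i om\<bar> <= B * 1"
    using AB[of j] by eventually_elim (auto simp: abs_mult of_bool_def intro: order.trans[OF abs_ge_zero])
  qed measurable
 qed
 have hitgap: "expectation (%om. A j om * hit (Suc m) i om) = expectation (%om. A j om * gap i om)" for j
  using key[of j] intA[of j] by (simp add: right_diff_distrib)
 define Q where "Q m j x = real (m choose j) * x ^ j * (1 - x) ^ (m - j)" for m j and x :: real
 have IH: "expectation (%om. A j om * \<phi> (gap i om)) = expectation (%om. Q m j (gap i om) * (\<phi> (gap i om) * \<psi> (gap i om)))"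
  if [measurable]: "\<phi> \<in> borel_measurable borel" and \<phi>: "!!x. x \<in> {0..1} ==> \<bar>\<phi> x\<bar> <= 1" for j \<phi>
 proof -
  have "\<bar>\<phi> x * \<psi> x\<bar> <= B" if "x \<in> {0..1}" for x
   using mult_mono[OF \<phi>[OF that] Suc.prems(2)[OF that]] by (simp add: abs_mult)
  then have "expectation (%om. of_bool (cnt m i om = j) * (\<phi> (gap i om) * \<psi> (gap i om)))
   = expectation (%om. Q m j (gap i om) * (\<phi> (gap i om) * \<psi> (gap i om)))"
   unfolding Q_def using Suc.IH[of "%x. \<phi> x * \<psi> x" B j] by simp
  then show ?thesis by (simp add: A_def mult_ac)
 qed
 have intQ: "integrable M (%om. Q m j (gap i om) * (\<phi> (gap i om) * \<psi> (gap i om)))"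
  if [measurable]: "\<phi> \<in> borel_measurable borel" and \<phi>: "!!x. x \<in> {0..1} ==> \<bar>\<phi> x\<bar> <= 1" for j \<phi>
 proof (rule integrable_AE_bounded[where B = "real (m choose j) * (1 * B)"])
  have Qb: "\<bar>Q m j x\<bar> <= real (m choose j)" if "x \<in> {0..1}" for x
  proof -
   have "x ^ j * (1 - x) ^ (m - j) <= 1 * 1" using that by (intro mult_mono power_le_one) auto
   moreover have "0 <= x ^ j * (1 - x) ^ (m - j)" using that by auto
   ultimately have "\<bar>real (m choose j) * (x ^ j * (1 - x) ^ (m - j))\<bar> <= real (m choose j) * 1"
    unfolding abs_mult by (intro mult_mono) auto
   then show ?thesis by (simp add: Q_def mult_ac)
  qed
  show "AE om in M. \<bar>Q m j (gap i om) * (\<phi> (gap i om) * \<psi> (gap i om))\<bar> <= real (m choose j) * (1 * B)"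
   using AE_gap
  proof eventually_elim
   case (elim om)
   then have "gap i om \<in> {0..1}" by auto
   then have "\<bar>Q m j (gap i om)\<bar> <= real (m choose j)" "\<bar>\<phi> (gap i om)\<bar> <= 1" "\<bar>\<psi> (gap i om)\<bar> <= B"
    using Qb \<phi> Suc.prems(2) by blast+
   then show ?case unfolding abs_mult by (intro mult_mono) auto
  qed
  show "(%om. Q m j (gap i om) * (\<phi> (gap i om) * \<psi> (gap i om))) \<in> borel_measurable M"
   unfolding Q_def by measurable
 qed
 have one_minus: "expectation (%om. A j om * (1 - hit (Suc m) i om)) = expectation (%om. Q m j (gap i om) * ((1 - gap i om) * \<psi> (gap i om)))" for j
 proof -
  have "expectation (%om. A j om * (1 - hit (Suc m) i om)) = expectation (%om. A j om * (1 - gap i om))"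
   using intA[of j] hitgap[of j] by (simp add: right_diff_distrib)
  also have "... = expectation (%om. Q m j (gap i om) * ((1 - gap i om) * \<psi> (gap i om)))"
   by (rule IH) auto
  finally show ?thesis .
 qed
 have step: "of_bool (cnt (Suc m) i om = j) * \<psi> (gap i om)
   = (if j = 0 then 0 else A (j - 1) om * hit (Suc m) i om) + A j om * (1 - hit (Suc m) i om)" for om
 proof -
  have "cnt (Suc m) i om = cnt m i om + (if a (Suc m) om \<in> bucket K (piv_of om) i then 1 else 0)"
   by (simp add: bucket_count_eq_sum)
  then show ?thesis by (cases j) (auto simp: A_def)
 qed
 show ?case
 proof (cases j)
  case 0
  have "expectation (%om. of_bool (cnt (Suc m) i om = j) * \<psi> (gap i om)) = expectation (%om. A 0 om * (1 - hit (Suc m) i om))"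
   unfolding step using 0 by simp
  then show ?thesis unfolding one_minus using 0 by (simp add: Q_def mult_ac)
 next
  case (Suc j')
  have i2: "integrable M (%om. A j om * (1 - hit (Suc m) i om))" using intA[of j] by (simp add: right_diff_distrib)
  have "expectation (%om. of_bool (cnt (Suc m) i om = j) * \<psi> (gap i om))
   = expectation (%om. A j' om * hit (Suc m) i om) + expectation (%om. A j om * (1 - hit (Suc m) i om))"
   unfolding step using Suc intA[of j'] i2 by simp
  also have "... = expectation (%om. Q m j' (gap i om) * (gap i om * \<psi> (gap i om)))
    + expectation (%om. Q m j (gap i om) * ((1 - gap i om) * \<psi> (gap i om)))"
   unfolding one_minus hitgap by (subst IH) auto
  also have "... = expectation (%om. Q m j' (gap i om) * (gap i om * \<psi> (gap i om)) + Q m j (gap i om) * ((1 - gap i om) * \<psi> (gap i om)))"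
   by (intro Bochner_Integration.integral_add[symmetric] intQ[of "%x. x"] intQ[of "%x. 1 - x"]) auto
  also have "(%om. Q m j' (gap i om) * (gap i om * \<psi> (gap i om)) + Q m j (gap i om) * ((1 - gap i om) * \<psi> (gap i om)))
   = (%om. real (Suc m choose j) * gap i om ^ j * (1 - gap i om) ^ (Suc m - j) * \<psi> (gap i om))"
  proof
   fix om
   have "Q m j' x * x + Q m j x * (1 - x) = real (Suc m choose j) * x ^ j * (1 - x) ^ (Suc m - j)" for x
   proof (cases "j <= m")
    case True
    then have "(1 - x) ^ (m - j') = (1 - x) * (1 - x) ^ (m - j)" "Suc m - j = Suc (m - j)"
     using Suc by (auto simp: Suc_diff_Suc[symmetric] simp del: Suc_diff_Suc)
    then show ?thesis using Suc by (simp add: Q_def algebra_simps)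
   next
    case False
    then show ?thesis using Suc by (cases "j = Suc m") (auto simp: Q_def binomial_eq_0)
   qed
   then show "Q m j' (gap i om) * (gap i om * \<psi> (gap i om)) + Q m j (gap i om) * ((1 - gap i om) * \<psi> (gap i om))
    = real (Suc m choose j) * gap i om ^ j * (1 - gap i om) ^ (Suc m - j) * \<psi> (gap i om)"
    by (simp flip: mult.assoc distrib_right)
  qed
  finally show ?thesis .
 qed
qed

end

section \<open>The cost of the partitioning stage\<close>

context optimal_quicksort
begin

definition step_cost :: "nat => 'a => real" where
 "step_cost k om = (\<Sum>i\<le>K. hit k i om * real (leaf_depth (tree_at k om) i))"

text \<open>The conditional expectation of \<open>step_cost k\<close> given the past: the past fixes
  the tree, and the element falls into sublist i with probability \<open>gap i\<close>.\<close>

definition mean_cost :: "nat => 'a => real" where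
 "mean_cost k om = path_cost K (tree_at k om) (spacing K (piv_of om))"

abbreviation opt :: "'a => real" where "opt om \<equiv> opt_cost K (spacing K (piv_of om))"

lemma tree_at_class: "tree_at k om \<in> class_trees K"
proof -
 obtain t where "t \<in> class_trees K" using class_trees_nonempty by blast
 then show ?thesis unfolding tree_used_def by (rule opt_tree_eq_iff(2)[OF tie_order])
qed

lemma tree_at_optimal:
 "path_cost K (tree_at k om) (%i. real (cnt (k - 1) i om + 1)) <= path_cost K t (%i. real (cnt (k - 1) i om + 1))"
 if t: "t \<in> class_trees K"
 unfolding tree_used_def opt_tree_eq_iff(3)[OF tie_order t] by (rule opt_cost_le[OF t])

lemma real_partition_cost:
 "real (partition_cost r piv K n (piv_of om) (elem_of om))
  = (\<Sum>k\<in>{1..n - K}. step_cost k om) + real (comparisons piv (piv_of om))"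
proof -
 have "(\<Sum>t\<in>class_trees K. \<Sum>i\<le>K. real (of_bool (tree_at k om = t) * of_bool (a k om \<in> bucket K (piv_of om) i) * leaf_depth t i))
   = step_cost k om" for k
 proof -
  have "(\<Sum>t\<in>class_trees K. \<Sum>i\<le>K. real (of_bool (tree_at k om = t) * of_bool (a k om \<in> bucket K (piv_of om) i) * leaf_depth t i))
   = (\<Sum>t\<in>{tree_at k om}. \<Sum>i\<le>K. real (of_bool (tree_at k om = t) * of_bool (a k om \<in> bucket K (piv_of om) i) * leaf_depth t i))"
   by (intro sum.mono_neutral_right) (auto simp: finite_class_trees tree_at_class)
  then show ?thesis by (simp add: step_cost_def)
 qed
 then show ?thesis unfolding partition_cost_def of_nat_add of_nat_sum by simp
qed

lemma tree_at_measurable [measurable]: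
 "t \<in> class_trees K ==> Measurable.pred M (%om. tree_at k om = t)"
 by (intro tree_used_measurable[OF tie_order] V_measurable a_measurable) auto

text \<open>Summing over all trees with indicators replaces a random depth by constants, so that
  measurability and \<open>one_step\<close> can be applied to one tree and one leaf at a
  time.\<close>

lemma step_cost_expand:
 "step_cost k om = (\<Sum>t\<in>class_trees K. \<Sum>i\<le>K. of_bool (tree_at k om = t) * real (leaf_depth t i) * hit k i om)"
 "mean_cost k om = (\<Sum>t\<in>class_trees K. \<Sum>i\<le>K. of_bool (tree_at k om = t) * real (leaf_depth t i) * gap i om)"
proof -
 have *: "(\<Sum>t\<in>class_trees K. \<Sum>i\<le>K. of_bool (tree_at k om = t) * real (leaf_depth t i) * f i)
   = (\<Sum>i\<le>K. real (leaf_depth (tree_at k om) i) * f i)" for f :: "nat => real"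
 proof -
  have "(\<Sum>t\<in>class_trees K. \<Sum>i\<le>K. of_bool (tree_at k om = t) * real (leaf_depth t i) * f i)
   = (\<Sum>t\<in>{tree_at k om}. \<Sum>i\<le>K. of_bool (tree_at k om = t) * real (leaf_depth t i) * f i)"
   by (intro sum.mono_neutral_right) (auto simp: finite_class_trees tree_at_class)
  then show ?thesis by simp
 qed
 show "step_cost k om = (\<Sum>t\<in>class_trees K. \<Sum>i\<le>K. of_bool (tree_at k om = t) * real (leaf_depth t i) * hit k i om)"
  unfolding * step_cost_def by (simp add: mult.commute)
 show "mean_cost k om = (\<Sum>t\<in>class_trees K. \<Sum>i\<le>K. of_bool (tree_at k om = t) * real (leaf_depth t i) * gap i om)"
  unfolding * mean_cost_def path_cost_def by (simp add: mult.commute)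
qed

lemma step_cost_measurable: "k >= 1 ==> step_cost k \<in> borel_measurable M"
 and mean_cost_measurable [measurable]: "mean_cost k \<in> borel_measurable M"
proof -
 have t: "(%om. of_bool (tree_at k om = t) * real (leaf_depth t i)) \<in> borel_measurable M" if "t \<in> class_trees K" for t i
 proof -
  have [measurable]: "Measurable.pred M (%om. tree_at k om = t)" by (rule tree_at_measurable[OF that])
  show ?thesis unfolding of_bool_def by measurable
 qed
 show "mean_cost k \<in> borel_measurable M"
  unfolding step_cost_expand(2)[abs_def] by (intro borel_measurable_sum borel_measurable_times[OF t gap_measurable])
 show "step_cost k \<in> borel_measurable M" if "k >= 1"
  unfolding step_cost_expand(1)[abs_def] by (intro borel_measurable_sum borel_measurable_times[OF t hit_measurable[OF that]])
qed

lemma opt_measurable [measurable]: "opt \<in> borel_measurable M"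
 by (intro opt_cost_measurable gap_measurable)

context
 assumes K1: "K >= 1"
begin

lemma step_cost_bounds: "AE om in M. \<forall>k. 0 <= step_cost k om \<and> step_cost k om <= real K"
 using AE_V_closed
proof eventually_elim
 case (elim om)
 show ?case
 proof (intro allI conjI)
  fix k
  show "0 <= step_cost k om" unfolding step_cost_def by (intro sum_nonneg) auto
  show "step_cost k om <= real K" unfolding step_cost_def
   using elim leaf_depth_bounds(1)[OF tree_at_class] by (intro sum_of_bool_bucket_le) auto
 qed
qed

lemma mean_cost_bounds:
 "AE om in M. \<forall>k. opt om <= mean_cost k om \<and> mean_cost k om <= real K"
 "AE om in M. 1 <= opt om \<and> opt om <= real K"
proof -
 show "AE om in M. \<forall>k. opt om <= mean_cost k om \<and> mean_cost k om <= real K"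
  using AE_gap
 proof eventually_elim
  case (elim om)
  show ?case unfolding mean_cost_def
   using opt_cost_le[OF tree_at_class] path_cost_bounds(2)[OF tree_at_class K1, of "spacing K (piv_of om)"] elim
   by (auto simp: sum_spacing)
 qed
 show "AE om in M. 1 <= opt om \<and> opt om <= real K"
  using AE_gap
 proof eventually_elim
  case (elim om)
  show ?case using opt_cost_bounds[OF K1, of "spacing K (piv_of om)"] elim by (auto simp: sum_spacing)
 qed
qed

lemma step_diff_bound: "AE om in M. \<forall>k. \<bar>step_cost k om - mean_cost k om\<bar> <= real K"
 using step_cost_bounds mean_cost_bounds
proof eventually_elim
 case (elim om)
 show ?case
 proof
  fix k
  show "\<bar>step_cost k om - mean_cost k om\<bar> <= real K"
   using elim(1)[rule_format, of k] elim(2)[rule_format, of k] elim(3) by linarith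
 qed
qed

text \<open>Apply \<open>one_step\<close> for each tree t and leaf i with the test function \<Phi>
  times the indicator that t is used, which is again a function of the past.\<close>

lemma cost_orthogonal:
 fixes \<Phi> :: "'a => real" and F :: "(nat + nat => real) => real"
 assumes k: "k >= 1" and F: "F \<in> borel_measurable (PiM (past_index k) (%_. borel))"
  and \<Phi>: "!!om. \<Phi> om = F (past_of k om)" and B: "AE om in M. \<bar>\<Phi> om\<bar> <= B"
 shows "expectation (%om. \<Phi> om * (step_cost k om - mean_cost k om)) = 0"
proof -
 note [measurable] = F
 define \<Theta> where "\<Theta> t i om = of_bool (tree_at k om = t) * real (leaf_depth t i) * \<Phi> om" for t i om
 have pm [measurable]: "past_of k \<in> measurable M (PiM (past_index k) (%_. borel))"
  using indep_var_rv1[OF indep_past[OF k]] .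
 have \<Phi>m [measurable]: "\<Phi> \<in> borel_measurable M" unfolding \<Phi>[abs_def] by measurable
 have \<Theta>B: "AE om in M. \<bar>\<Theta> t i om\<bar> <= real (leaf_depth t i) * B" for t i
  using B
 proof eventually_elim
  case (elim om)
  then have "0 <= B" by linarith
  then show ?case using elim by (cases "tree_at k om = t") (auto simp: \<Theta>_def abs_mult intro!: mult_left_mono)
 qed
 have \<Theta>m [measurable]: "\<Theta> t i \<in> borel_measurable M" if "t \<in> class_trees K" for t i
 proof -
  have [measurable]: "Measurable.pred M (%om. tree_at k om = t)" by (rule tree_at_measurable[OF that])
  show ?thesis unfolding \<Theta>_def of_bool_def by measurable
 qed
 have zero: "expectation (%om. \<Theta> t i om * (hit k i om - gap i om)) = 0" if t: "t \<in> class_trees K" for t i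
 proof (rule one_step[OF k _ _ \<Theta>B])
  let ?F = "%w. of_bool (tree_used r K (%l. w (Inl l)) (%l. w (Inr l)) k = t) * real (leaf_depth t i) * F w"
  have [measurable]: "Measurable.pred (PiM (past_index k) (%_. borel)) (%w. tree_used r K (%l. w (Inl l)) (%l. w (Inr l)) k = t)"
   by (intro tree_used_measurable[OF tie_order t] past_component) auto
  show "?F \<in> borel_measurable (PiM (past_index k) (%_. borel))" unfolding of_bool_def by measurable
  show "\<Theta> t i om = ?F (past_of k om)" for om by (simp add: \<Theta>_def past_pivots \<Phi>)
 qed
 have int: "integrable M (%om. \<Theta> t i om * (hit k i om - gap i om))" if t: "t \<in> class_trees K" for t i
 proof (rule integrable_AE_bounded[where B = "real (leaf_depth t i) * B * 1"])
  show "(%om. \<Theta> t i om * (hit k i om - gap i om)) \<in> borel_measurable M"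
   by (intro borel_measurable_times \<Theta>m[OF t] borel_measurable_diff hit_measurable[OF k] gap_measurable)
  show "AE om in M. \<bar>\<Theta> t i om * (hit k i om - gap i om)\<bar> <= real (leaf_depth t i) * B * 1"
   using \<Theta>B[of t i] AE_gap
  proof eventually_elim
   case (elim om)
   have "\<bar>hit k i om - gap i om\<bar> <= 1" using elim(2)[rule_format, of i] by (auto simp: of_bool_def)
   then show ?case unfolding abs_mult using elim(1) by (intro mult_mono) auto
  qed
 qed
 have "(%om. \<Phi> om * (step_cost k om - mean_cost k om))
  = (%om. \<Sum>t\<in>class_trees K. \<Sum>i\<le>K. \<Theta> t i om * (hit k i om - gap i om))"
  unfolding step_cost_expand sum_subtractf[symmetric] sum_distrib_left \<Theta>_def
  by (intro ext sum.cong refl) (simp add: algebra_simps)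
 then have "expectation (%om. \<Phi> om * (step_cost k om - mean_cost k om))
  = (\<Sum>t\<in>class_trees K. \<Sum>i\<le>K. expectation (%om. \<Theta> t i om * (hit k i om - gap i om)))"
  using int by simp
 then show ?thesis using zero by simp
qed

lemma cost_second_moment:
 "expectation (%om. (\<Sum>k\<in>{1..m}. step_cost k om - mean_cost k om)\<^sup>2) <= real m * (real K)\<^sup>2"
proof (rule second_moment_le(1)[where \<xi> = "%k om. step_cost k om - mean_cost k om"])
 fix k :: nat assume k: "k >= 1"
 show "(%om. step_cost k om - mean_cost k om) \<in> borel_measurable M"
  by (intro borel_measurable_diff step_cost_measurable[OF k] mean_cost_measurable)
 show "AE om in M. \<bar>step_cost k om - mean_cost k om\<bar> <= real K"
  using step_diff_bound by eventually_elim auto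
next
 fix m
 show "expectation (%om. (\<Sum>k\<in>{1..m}. step_cost k om - mean_cost k om) * (step_cost (Suc m) om - mean_cost (Suc m) om)) = 0"
 proof (rule cost_orthogonal[where B = "real m * real K"])
  let ?T = "%w k. tree_used r K (%l. w (Inl l)) (%l. w (Inr l)) k"
  let ?F = "%w. \<Sum>k\<in>{1..m}. \<Sum>t\<in>class_trees K. \<Sum>i\<le>K. of_bool (?T w k = t) * real (leaf_depth t i) *
   (of_bool (w (Inr k) \<in> bucket K (%l. w (Inl l)) i) - spacing K (%l. w (Inl l)) i)"
  show "?F \<in> borel_measurable (PiM (past_index (Suc m)) (%_. borel))"
  proof (intro borel_measurable_sum)
   fix k t i assume k: "k \<in> {1..m}" and t: "t \<in> class_trees K"
   have [measurable]: "Measurable.pred (PiM (past_index (Suc m)) (%_. borel)) (%w. ?T w k = t)"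
    using k by (intro tree_used_measurable[OF tie_order t] past_component) auto
   have [measurable]: "Measurable.pred (PiM (past_index (Suc m)) (%_. borel)) (%w. w (Inr k) \<in> bucket K (%l. w (Inl l)) i)"
    using k by (intro bucket_measurable past_component) auto
   have [measurable]: "(%w. spacing K (%l. w (Inl l)) i) \<in> borel_measurable (PiM (past_index (Suc m)) (%_. borel))"
    by (intro spacing_measurable past_component)
   show "(%w. of_bool (?T w k = t) * real (leaf_depth t i) *
     (of_bool (w (Inr k) \<in> bucket K (%l. w (Inl l)) i) - spacing K (%l. w (Inl l)) i))
    \<in> borel_measurable (PiM (past_index (Suc m)) (%_. borel))"
    unfolding of_bool_def by measurable
  qed
  show "(\<Sum>k\<in>{1..m}. step_cost k om - mean_cost k om) = ?F (past_of (Suc m) om)" for om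
   unfolding step_cost_expand sum_subtractf[symmetric]
   by (intro sum.cong refl) (simp add: past_pivots past_of_simps right_diff_distrib)
  show "AE om in M. \<bar>\<Sum>k\<in>{1..m}. step_cost k om - mean_cost k om\<bar> <= real m * real K"
   using step_diff_bound
  proof eventually_elim
   case (elim om)
   have "\<bar>\<Sum>k\<in>{1..m}. step_cost k om - mean_cost k om\<bar> <= (\<Sum>k\<in>{1..m}. \<bar>step_cost k om - mean_cost k om\<bar>)"
    by (rule sum_abs)
   also have "... <= (\<Sum>k\<in>{1..m}. real K)" by (intro sum_mono) (use elim in auto)
   finally show ?case by simp
  qed
 qed simp
qed

text \<open>The tree in use is optimal for the counts plus one, which differ from k times the
  spacings by an amount of order sqrt k. Optimality for perturbed weights costs at most K times the
  perturbation; division by k leaves 1 / sqrt k.\<close>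

lemma mean_cost_near_opt:
 assumes k: "k >= 1"
 shows "expectation (%om. mean_cost k om - opt om) <= 2 * real K * (real K + 1) / sqrt (real k)"
proof -
 define s where "s = sqrt (real k)"
 have s: "s >= 1" "s > 0" "s * s = real k" using k by (auto simp: s_def)
 have pt: "AE om in M. real k * (mean_cost k om - opt om)
   <= real K * (\<Sum>i\<le>K. ((real (cnt (k - 1) i om) - real (k - 1) * gap i om)\<^sup>2 / s + s) / 2 + 1)"
  using AE_gap
 proof eventually_elim
  case (elim om)
  let ?T = "tree_at k om" and ?D = "spacing K (piv_of om)"
  define x where "x i = real (cnt (k - 1) i om + 1)" for i
  obtain t where t: "t \<in> class_trees K" "path_cost K t ?D = opt om" using opt_cost_attained by blast
  \<comment> \<open>Compares both trees at the observed weights \<open>x\<close>, where the tree in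
    use is at least as good, up to a correction that is linear in the deviation of \<open>x\<close>
    from the spacings scaled by k.\<close>
  have lin: "real k * path_cost K u ?D = path_cost K u x - (\<Sum>i\<le>K. (x i - real k * ?D i) * real (leaf_depth u i))" for u
   by (simp add: path_cost_def sum_distrib_left algebra_simps sum_subtractf)
  have "real k * (mean_cost k om - opt om) = path_cost K ?T x - path_cost K t x
    + (\<Sum>i\<le>K. (x i - real k * ?D i) * (real (leaf_depth t i) - real (leaf_depth ?T i)))"
   unfolding mean_cost_def t(2)[symmetric] right_diff_distrib lin by (simp add: sum_subtractf)
  also have "... <= (\<Sum>i\<le>K. (x i - real k * ?D i) * (real (leaf_depth t i) - real (leaf_depth ?T i)))"
  proof -
   have "x = (%i. real (cnt (k - 1) i om + 1))" by (simp add: x_def fun_eq_iff)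
   then have "path_cost K ?T x <= path_cost K t x" by (simp only: tree_at_optimal[OF t(1)])
   then show ?thesis by simp
  qed
  also have "... <= (\<Sum>i\<le>K. (((real (cnt (k - 1) i om) - real (k - 1) * gap i om)\<^sup>2 / s + s) / 2 + 1) * real K)"
  proof (intro sum_mono)
   fix i assume "i \<in> {..K}"
   then have "leaf_depth t i <= K" "leaf_depth ?T i <= K"
    using leaf_depth_bounds(1)[OF t(1)] leaf_depth_bounds(1)[OF tree_at_class] by auto
   then have d: "\<bar>real (leaf_depth t i) - real (leaf_depth ?T i)\<bar> <= real K" by linarith
   define y where "y = real (cnt (k - 1) i om) - real (k - 1) * gap i om"
   have "x i - real k * ?D i = y + (1 - gap i om)"
    using k by (simp add: x_def y_def of_nat_diff algebra_simps)
   then have "\<bar>x i - real k * ?D i\<bar> <= \<bar>y\<bar> + 1" using elim[rule_format, of i] by linarith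
   \<comment> \<open>Arithmetic-geometric mean with weight s = sqrt k. It trades the absolute
     deviation for its square, whose expectation is at most k by
     \<open>count_second_moment\<close>.\<close>
   also have "\<bar>y\<bar> <= (y\<^sup>2 / s + s) / 2"
   proof -
    have "0 <= (\<bar>y\<bar> - s)\<^sup>2" by simp
    then have "2 * \<bar>y\<bar> * s <= y\<^sup>2 + s * s" by (simp add: power2_eq_square algebra_simps)
    then have "\<bar>y\<bar> * 2 <= (y\<^sup>2 + s * s) / s" using s by (simp add: pos_le_divide_eq mult_ac)
    moreover have "(y\<^sup>2 + s * s) / s = y\<^sup>2 / s + s" using s(2) by (simp add: add_divide_distrib)
    ultimately have "\<bar>y\<bar> * 2 <= y\<^sup>2 / s + s" by (simp only:)
    then show ?thesis by (simp add: mult.commute)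
   qed
   finally have "\<bar>x i - real k * ?D i\<bar> <= (y\<^sup>2 / s + s) / 2 + 1" by simp
   then have "\<bar>(x i - real k * ?D i) * (real (leaf_depth t i) - real (leaf_depth ?T i))\<bar> <= ((y\<^sup>2 / s + s) / 2 + 1) * real K"
    unfolding abs_mult using d by (intro mult_mono) auto
   then show "(x i - real k * ?D i) * (real (leaf_depth t i) - real (leaf_depth ?T i))
    <= (((real (cnt (k - 1) i om) - real (k - 1) * gap i om)\<^sup>2 / s + s) / 2 + 1) * real K"
    unfolding y_def by linarith
  qed
  also have "... = real K * (\<Sum>i\<le>K. ((real (cnt (k - 1) i om) - real (k - 1) * gap i om)\<^sup>2 / s + s) / 2 + 1)"
   by (simp add: sum_distrib_left mult.commute)
  finally show ?case .
 qed
 have isq: "integrable M (%om. (real (cnt (k - 1) i om) - real (k - 1) * gap i om)\<^sup>2)" for i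
 proof (rule integrable_AE_bounded[where B = "(real (k - 1))\<^sup>2"])
  show "AE om in M. \<bar>(real (cnt (k - 1) i om) - real (k - 1) * gap i om)\<^sup>2\<bar> <= (real (k - 1))\<^sup>2"
   using AE_gap
  proof eventually_elim
   case (elim om)
   have "real (cnt (k - 1) i om) <= real (k - 1)" "0 <= real (k - 1) * gap i om" "real (k - 1) * gap i om <= real (k - 1)"
    using bucket_count_le[of K "piv_of om" "elem_of om" "k - 1" i] elim[rule_format, of i]
    by (auto intro: mult_left_le simp del: of_nat_diff)
   then have "\<bar>real (cnt (k - 1) i om) - real (k - 1) * gap i om\<bar> <= \<bar>real (k - 1)\<bar>" by linarith
   then show ?case by (simp only: abs_le_square_iff abs_power2)
  qed
 qed measurable
 have imo: "integrable M (%om. mean_cost k om - opt om)"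
 proof (rule integrable_AE_bounded[where B = "real K"])
  show "AE om in M. \<bar>mean_cost k om - opt om\<bar> <= real K"
   using mean_cost_bounds
  proof eventually_elim
   case (elim om)
   then show ?case using elim(1)[rule_format, of k] by linarith
  qed
 qed measurable
 have "real k * expectation (%om. mean_cost k om - opt om) = expectation (%om. real k * (mean_cost k om - opt om))"
  by simp
 also have "... <= expectation (%om. real K * (\<Sum>i\<le>K. ((real (cnt (k - 1) i om) - real (k - 1) * gap i om)\<^sup>2 / s + s) / 2 + 1))"
  by (rule integral_mono_AE[OF _ _ pt]) (use isq imo in auto)
 also have "... = real K * (\<Sum>i\<le>K. (expectation (%om. (real (cnt (k - 1) i om) - real (k - 1) * gap i om)\<^sup>2) / s + s) / 2 + 1)"
  using isq by (simp add: prob_space)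
 also have "... <= real K * (\<Sum>i\<le>K. (s + s) / 2 + s)"
 proof (intro mult_left_mono sum_mono add_mono divide_right_mono)
  fix i
  have "expectation (%om. (real (cnt (k - 1) i om) - real (k - 1) * gap i om)\<^sup>2) <= real (k - 1)"
   by (rule count_second_moment)
  also have "... <= s * s" using s by simp
  finally show "expectation (%om. (real (cnt (k - 1) i om) - real (k - 1) * gap i om)\<^sup>2) / s <= s"
   using s by (simp only: pos_divide_le_eq)
 qed (use s in auto)
 also have "... = s * (2 * real K * (real K + 1))" by simp
 finally have "s * (s * expectation (%om. mean_cost k om - opt om)) <= s * (2 * real K * (real K + 1))"
  using s(3) by (simp add: mult.assoc[symmetric])
 then have "s * expectation (%om. mean_cost k om - opt om) <= 2 * real K * (real K + 1)"
  using s by (simp only: mult_le_cancel_left_pos)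
 then show ?thesis using s unfolding s_def[symmetric] by (simp only: pos_le_divide_eq mult.commute)
qed

end

end

section \<open>Splitting the cost into fluctuations and toll\<close>

context optimal_quicksort
begin

definition mean_X :: "nat => real" where "mean_X n = N.expectation (%om. real (X n om))"
definition var_X :: "nat => real" where "var_X n = N.variance (%om. real (X n om))"

abbreviation part :: "nat => 'a => nat" where
 "part n om \<equiv> partition_cost r piv K n (piv_of om) (elem_of om)"

definition input_data :: "nat => 'a => nat => nat" where
 "input_data n om = case_nat (part n om) (bucket_count K (piv_of om) (elem_of om) (n - K))"

lemma input_data_simps [simp]: "input_data n om 0 = part n om" "input_data n om (Suc i) = cnt (n - K) i om"
 by (simp_all add: input_data_def)

abbreviation seqs :: "(nat => nat) measure" where "seqs \<equiv> \<Pi>\<^sub>M m\<in>UNIV. count_space UNIV"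

lemma indep_rec': "n > K ==>
 indep_vars (%_. seqs) (%j om. if j <= K then (%m. Y j m om) else input_data n om) {..Suc K}"
 using indep_rec[of n] unfolding input_data_def .

lemma data_measurable:
 assumes "n > K" "j <= Suc K"
 shows "(%om. if j <= K then (%m. Y j m om) else input_data n om) \<in> measurable M seqs"
proof -
 have "\<forall>j\<in>{..Suc K}. (%om. if j <= K then (%m. Y j m om) else input_data n om) \<in> measurable M seqs"
  using indep_rec'[OF assms(1)] unfolding indep_vars_def by (rule conjunct1)
 then show ?thesis by (rule bspec) (use assms(2) in simp)
qed

lemma Y_seq_measurable: "j <= K ==> (%om m. Y j m om) \<in> measurable M seqs"
 using data_measurable[of "Suc K" j] by (simp only: lessI le_SucI if_True)

lemma input_data_measurable: "n > K ==> input_data n \<in> measurable M seqs"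
 using data_measurable[of n "Suc K"] by simp

lemma Y_measurable: "j <= K ==> Y j m \<in> measurable M (count_space UNIV)"
 using measurable_compose[OF Y_seq_measurable measurable_component_singleton[of m]] by simp

lemma part_measurable: "n > K ==> part n \<in> measurable M (count_space UNIV)"
 using measurable_compose[OF input_data_measurable measurable_component_singleton[of 0]] by simp

lemma Y_expectation:
 fixes h :: "nat => real"
 assumes "j <= K"
 shows "expectation (%om. h (Y j m om)) = N.expectation (%om. h (X m om))"
proof -
 have "expectation (%om. h (Y j m om)) = (LINT x|distr M (count_space UNIV) (Y j m). h x)"
  using Y_measurable[OF assms] by (subst integral_distr) auto
 also have "... = N.expectation (%om. h (X m om))"
  unfolding Y_law[OF assms] using X_measurable by (subst integral_distr) auto
 finally show ?thesis .
qed

lemma Y_AE: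
 assumes j: "j <= K" and "AE om in N. P (X m om)"
 shows "AE om in M. P (Y j m om)"
proof -
 have "AE x in distr N (count_space UNIV) (X m). P x"
  using assms(2) X_measurable[of m] by (subst AE_distr_iff) auto
 then show ?thesis unfolding Y_law[OF j, symmetric]
  using Y_measurable[OF j] by (subst (asm) AE_distr_iff) auto
qed

context
 assumes K1: "K >= 1"
begin

lemma comparisons_piv_bounded: "\<exists>R. \<forall>om. comparisons piv (piv_of om) <= R"
 using comparisons_bounded[where alg = piv and 'a = real] by blast

lemma part_bounded: "\<exists>B. AE om in M. real (part n om) <= B"
proof -
 obtain R where R: "!!om. comparisons piv (piv_of om) <= R" using comparisons_piv_bounded by blast
 have "AE om in M. real (part n om) <= real (n - K) * real K + real R"
  using step_cost_bounds[OF K1]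
 proof eventually_elim
  case (elim om)
  have "(\<Sum>k\<in>{1..n-K}. step_cost k om) <= (\<Sum>k\<in>{1..n-K}. real K)"
   by (intro sum_mono) (use elim in auto)
  then show ?case unfolding real_partition_cost using R[of om] by (simp del: of_nat_diff)
 qed
 then show ?thesis by blast
qed

text \<open>Strong induction: for n > K each sublist has at most n - K < n elements. Almost sure
  boundedness for every fixed n settles all later questions of integrability.\<close>

lemma X_bounded: "\<exists>B. AE om in N. real (X n om) <= B"
proof (induction n rule: less_induct)
 case (less n)
 show ?case
 proof (cases "n <= K")
  case True
  obtain B where B: "\<forall>x :: nat => nat. comparisons (base n) x <= B"
   using comparisons_bounded[where alg = "base n" and 'a = nat] by blast
  have "AE x in distr N (count_space UNIV) (X n). x <= B"
   unfolding X_base[OF True] random_order_comparisons_def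
   by (auto simp: AE_measure_pmf_iff B)
  then have "AE om in N. X n om <= B" using X_measurable[of n] by (subst (asm) AE_distr_iff) auto
  then show ?thesis by (intro exI[of _ "real B"]) simp
 next
  case False
  then have n: "n > K" by simp
  obtain B where B: "!!m. m < n ==> AE om in N. real (X m om) <= B m" using less.IH by metis
  obtain C where C: "AE om in M. real (part n om) <= C" using part_bounded by blast
  have Yb: "AE om in M. \<forall>i\<in>{..K}. \<forall>m\<in>{..<n}. real (Y i m om) <= B m"
   by (intro AE_finite_allI Y_AE[where P = "%x. real x <= B m" for m] B) auto
  have "AE om in M. real ((\<Sum>i\<le>K. Y i (cnt (n - K) i om) om) + part n om) <= (\<Sum>i\<le>K. \<Sum>m<n. \<bar>B m\<bar>) + C"
   using Yb C
  proof eventually_elim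
   case (elim om)
   have "real (Y i (cnt (n - K) i om) om) <= (\<Sum>m<n. \<bar>B m\<bar>)" if "i <= K" for i
   proof -
    have "cnt (n - K) i om < n" using bucket_count_le[of K "piv_of om" "elem_of om" "n - K" i] n K1 by linarith
    then have "real (Y i (cnt (n - K) i om) om) <= B (cnt (n - K) i om)" "\<bar>B (cnt (n - K) i om)\<bar> <= (\<Sum>m<n. \<bar>B m\<bar>)"
     using elim(1) that member_le_sum[of "cnt (n - K) i om" "{..<n}" "%m. \<bar>B m\<bar>"] by auto
    then show ?thesis by linarith
   qed
   then have "(\<Sum>i\<le>K. real (Y i (cnt (n - K) i om) om)) <= (\<Sum>i\<le>K. \<Sum>m<n. \<bar>B m\<bar>)" by (intro sum_mono) auto
   then show ?case using elim(2) by simp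
  qed
  moreover have m: "(%om. (\<Sum>i\<le>K. Y i (cnt (n - K) i om) om) + part n om) \<in> measurable M (count_space UNIV)"
  proof (rule measurable_of_nat_count)
   have "(%om. real (Y i (cnt (n - K) i om) om)) \<in> borel_measurable M" if "i <= K" for i
   proof -
    have "(%om. Y i (cnt (n - K) i om) om) \<in> measurable M (count_space UNIV)"
     by (rule measurable_compose_countable[OF Y_measurable[OF that]])
      (rule measurable_of_nat_count[OF cnt_measurable_real])
    then show ?thesis by (rule measurable_compose) simp
   qed
   moreover have "(%om. real (part n om)) \<in> borel_measurable M"
    by (rule measurable_compose[OF part_measurable[OF n]]) simp
   ultimately show "(%om. real ((\<Sum>i\<le>K. Y i (cnt (n - K) i om) om) + part n om)) \<in> borel_measurable M"
    by simp
  qed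
  ultimately have "AE x in distr N (count_space UNIV) (X n). real x <= (\<Sum>i\<le>K. \<Sum>m<n. \<bar>B m\<bar>) + C"
   unfolding X_rec[OF n] by (subst AE_distr_iff) auto
  then show ?thesis using X_measurable[of n] by (subst (asm) AE_distr_iff) auto
 qed
qed

text \<open>The copies are independent of the data as whole sequences, so \<open>f\<close> and
  \<open>g\<close> may read fixed entries m of them while \<open>h\<close> selects the event that
  the sublist sizes are these m.\<close>

lemma indep_product:
 fixes f g h :: "(nat => nat) => real"
 assumes n: "n > K" and ij: "i <= K" "j <= K" "i \<noteq> j"
  and meas: "f \<in> borel_measurable seqs" "g \<in> borel_measurable seqs" "h \<in> borel_measurable seqs"
  and int: "integrable M (%om. f (%m. Y i m om))" "integrable M (%om. g (%m. Y j m om))" "integrable M (%om. h (input_data n om))"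
 shows "expectation (%om. f (%m. Y i m om) * g (%m. Y j m om) * h (input_data n om))
  = expectation (%om. f (%m. Y i m om)) * expectation (%om. g (%m. Y j m om)) * expectation (%om. h (input_data n om))"
  and "integrable M (%om. f (%m. Y i m om) * g (%m. Y j m om) * h (input_data n om))"
proof -
 define W where "W l om = (if l <= K then (%m. Y l m om) else input_data n om)" for l om
 define F where "F l = (if l = i then f else if l = j then g else h)" for l
 have ind: "indep_vars (%_. borel) (%l om. F l (W l om)) {i, j, Suc K}"
 proof (rule indep_vars_compose2[where X = W and M' = "%_. seqs"])
  show "indep_vars (%_. seqs) W {i, j, Suc K}"
   unfolding W_def[abs_def] by (rule indep_vars_subset[OF indep_rec'[OF n]]) (use ij in auto)
 qed (use meas in \<open>auto simp: F_def\<close>)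
 have d: "i \<noteq> Suc K" "j \<noteq> Suc K" using ij by auto
 have W: "F i (W i om) = f (%m. Y i m om)" "F j (W j om) = g (%m. Y j m om)" "F (Suc K) (W (Suc K) om) = h (input_data n om)" for om
  using ij d by (auto simp: F_def W_def)
 have ints: "integrable M (%om. F l (W l om))" if "l \<in> {i, j, Suc K}" for l
  using that int by (auto simp: W)
 have prod: "(\<Prod>l\<in>{i, j, Suc K}. A l) = A i * A j * A (Suc K)" for A :: "nat => real"
  using ij d by (simp add: mult.assoc)
 show "expectation (%om. f (%m. Y i m om) * g (%m. Y j m om) * h (input_data n om))
  = expectation (%om. f (%m. Y i m om)) * expectation (%om. g (%m. Y j m om)) * expectation (%om. h (input_data n om))"
  using indep_vars_lebesgue_integral[OF _ ind ints] unfolding prod W by simp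
 show "integrable M (%om. f (%m. Y i m om) * g (%m. Y j m om) * h (input_data n om))"
  using indep_vars_integrable[OF _ ind ints] unfolding prod W by simp
qed

lemma integrable_X: "integrable N (%om. h (real (X n om)) :: real)" if h: "continuous_on UNIV h"
proof -
 obtain B where B: "AE om in N. real (X n om) <= B" using X_bounded by blast
 have "compact (h ` {0..B})" by (intro compact_continuous_image continuous_on_subset[OF h]) auto
 then obtain C where C: "\<forall>y\<in>h ` {0..B}. norm y <= C" using compact_imp_bounded bounded_iff by metis
 show ?thesis
 proof (rule N.integrable_const_bound[where B = C])
  show "AE om in N. norm (h (real (X n om))) <= C" using B by eventually_elim (use C in auto)
  show "(%om. h (real (X n om))) \<in> borel_measurable N"
   by (rule measurable_compose[OF X_measurable]) simp
 qed
qed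

definition cen :: "nat => nat => 'a => real" where "cen i m om = real (Y i m om) - mean_X m"
text \<open>The deviation of the recursive cost from its mean at the realised size of the sublist;
  it is centred given the input data.\<close>

definition fluct :: "nat => nat => 'a => real" where
 "fluct n i om = cen i (cnt (n - K) i om) om"
text \<open>The part of X_n minus its mean that is determined by the input data. Its second moment
  is the inhomogeneous term of the variance recurrence.\<close>

definition toll :: "nat => 'a => real" where
 "toll n om = (\<Sum>i\<le>K. mean_X (cnt (n - K) i om)) + real (part n om) - mean_X n"

lemma cen_facts:
 assumes i: "i <= K"
 shows "integrable M (cen i m)" "expectation (cen i m) = 0"
  "integrable M (%om. (cen i m om)\<^sup>2)" "expectation (%om. (cen i m om)\<^sup>2) = var_X m"
proof -
 have integ: "integrable M (%om. h (real (Y i m om)))" if h: "continuous_on UNIV h" for h :: "real => real"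
 proof -
  have "integrable (distr N (count_space UNIV) (X m)) (%x. h (real x))"
   using integrable_X[OF h, of m] X_measurable[of m] by (subst integrable_distr_eq) auto
  then show ?thesis unfolding Y_law[OF i, symmetric]
   using Y_measurable[OF i] by (subst (asm) integrable_distr_eq) auto
 qed
 show 1: "integrable M (cen i m)" unfolding cen_def[abs_def]
  by (rule integ[of "%x. x - mean_X m"]) (intro continuous_intros)
 show "integrable M (%om. (cen i m om)\<^sup>2)" unfolding cen_def[abs_def]
  by (rule integ[of "%x. (x - mean_X m)\<^sup>2"]) (intro continuous_intros)
 show "expectation (%om. (cen i m om)\<^sup>2) = var_X m"
  unfolding cen_def var_X_def mean_X_def using Y_expectation[OF i, of "%x. (real x - c)\<^sup>2" for c] by simp
 have "integrable N (%om. real (X m om))" by (rule integrable_X[of "%x. x"]) (intro continuous_intros)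
 then show "expectation (cen i m) = 0"
  unfolding cen_def[abs_def] Y_expectation[OF i, of "%x. real x - mean_X m"]
  by (simp add: mean_X_def N.prob_space)
qed

lemma fun_cnt_measurable: "(%om. f (cnt m i om) :: real) \<in> borel_measurable M"
 by (rule measurable_compose[OF measurable_of_nat_count[OF cnt_measurable_real]]) simp

lemma fun_cnt_bounded: "\<bar>f (cnt m i om) :: real\<bar> <= (\<Sum>j\<le>m. \<bar>f j\<bar>)"
 using bucket_count_le[of K "piv_of om" "elem_of om" m i]
  member_le_sum[of "cnt m i om" "{..m}" "%j. \<bar>f j\<bar>"] by auto

lemma integrable_fun_cnt: "integrable M (%om. f (cnt m i om) :: real)"
 by (rule integrable_AE_bounded[OF fun_cnt_measurable AE_I2[OF fun_cnt_bounded]])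

lemma fluct_expand: "fluct n i om = (\<Sum>m\<le>n - K. cen i m om * of_bool (cnt (n - K) i om = m))"
proof -
 have "(\<Sum>m\<le>n - K. cen i m om * of_bool (cnt (n - K) i om = m))
  = (\<Sum>m\<in>{cnt (n - K) i om}. cen i m om * of_bool (cnt (n - K) i om = m))"
  using bucket_count_le[of K "piv_of om" "elem_of om" "n - K" i]
  by (intro sum.mono_neutral_right) auto
 then show ?thesis by (simp add: fluct_def)
qed

lemma seqs_component [measurable]: "(%z. f (z m) :: real) \<in> borel_measurable seqs"
 by (rule measurable_compose[OF measurable_component_singleton[of m]]) auto

lemma seqs_pred [measurable]: "Measurable.pred seqs (%z. z m = l)"
 by (rule measurable_compose[OF measurable_component_singleton[of m]]) auto

lemma toll_bounded: "\<exists>B. AE om in M. \<bar>toll n om\<bar> <= B"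
proof -
 obtain C where C: "AE om in M. real (part n om) <= C" using part_bounded by blast
 have "AE om in M. \<bar>toll n om\<bar> <= (\<Sum>i\<le>K. \<Sum>j\<le>n - K. \<bar>mean_X j\<bar>) + C + \<bar>mean_X n\<bar>"
  using C
 proof eventually_elim
  case (elim om)
  have "\<bar>\<Sum>i\<le>K. mean_X (cnt (n - K) i om)\<bar> <= (\<Sum>i\<le>K. \<Sum>j\<le>n - K. \<bar>mean_X j\<bar>)"
   by (intro order.trans[OF sum_abs] sum_mono fun_cnt_bounded)
  moreover have "0 <= real (part n om)" by simp
  ultimately show ?case unfolding toll_def using elim by linarith
 qed
 then show ?thesis by blast
qed

lemma toll_measurable: "n > K ==> toll n \<in> borel_measurable M"
 unfolding toll_def[abs_def]
 by (intro borel_measurable_diff borel_measurable_add borel_measurable_sum fun_cnt_measurable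
   measurable_compose[OF part_measurable]) auto

lemma toll_eq_data: "toll n om = (\<Sum>i\<le>K. mean_X (input_data n om (Suc i))) + real (input_data n om 0) - mean_X n"
 by (simp add: toll_def)

text \<open>Expanding over the finitely many possible sizes separates the copies from the data.
  Independence then yields mean 0 and variance \<open>var_X\<close> at the realised size.\<close>

lemma fluct_data:
 assumes n: "n > K" and i: "i <= K" and h: "h \<in> borel_measurable seqs" "AE om in M. \<bar>h (input_data n om)\<bar> <= B"
 shows "integrable M (%om. fluct n i om * h (input_data n om))"
  "expectation (%om. fluct n i om * h (input_data n om)) = 0"
  "integrable M (%om. (fluct n i om)\<^sup>2)"
  "expectation (%om. (fluct n i om)\<^sup>2) = expectation (%om. var_X (cnt (n - K) i om))"
proof -
 note [measurable] = h(1)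
 \<comment> \<open>\<open>indep_product\<close> is stated for two distinct sublists; the second one
   exists because K >= 1 and contributes the constant factor 1.\<close>
 obtain j where j: "j <= K" "i \<noteq> j" using K1 by (metis le_zero_eq not_one_le_zero zero_le)
 define h' where "h' m z = of_bool (z (Suc i) = m) * h z" for m and z :: "nat => nat"
 have h'm [measurable]: "h' m \<in> borel_measurable seqs" for m unfolding h'_def of_bool_def by measurable
 have h'i: "integrable M (%om. h' m (input_data n om))" for m
 proof (rule integrable_AE_bounded)
  show "(%om. h' m (input_data n om)) \<in> borel_measurable M" by (rule measurable_compose[OF input_data_measurable[OF n] h'm])
  show "AE om in M. \<bar>h' m (input_data n om)\<bar> <= B" using h(2)
   by eventually_elim (auto simp: h'_def of_bool_def)
 qed
 have cm: "(%z. real (z m) - mean_X m) \<in> borel_measurable seqs" for m by measurable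
 have one: "(%z. 1 :: real) \<in> borel_measurable seqs" by auto
 have i1: "integrable M (%om. real (Y i m om) - mean_X m)" for m using cen_facts(1)[OF i, of m] by (simp add: cen_def[abs_def])
 have e: "(%om. fluct n i om * h (input_data n om))
   = (%om. \<Sum>m\<le>n - K. (real (Y i m om) - mean_X m) * 1 * h' m (input_data n om))"
  unfolding fluct_expand h'_def cen_def sum_distrib_right input_data_simps
  by (intro ext sum.cong refl) (simp add: mult.assoc)
 have terms: "integrable M (%om. (real (Y i m om) - mean_X m) * 1 * h' m (input_data n om))"
  "expectation (%om. (real (Y i m om) - mean_X m) * 1 * h' m (input_data n om)) = 0" for m
  using indep_product[OF n i j(1) j(2) cm one h'm i1 _ h'i, of m m] cen_facts(2)[OF i, of m]
  by (auto simp: cen_def[abs_def])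
 show "integrable M (%om. fluct n i om * h (input_data n om))" unfolding e by (intro Bochner_Integration.integrable_sum terms)
 show "expectation (%om. fluct n i om * h (input_data n om)) = 0" unfolding e
  by (subst Bochner_Integration.integral_sum) (use terms in auto)
 define g where "g m z = (of_bool (z (Suc i) = m) :: real)" for m and z :: "nat => nat"
 have gm: "g m \<in> borel_measurable seqs" for m unfolding g_def of_bool_def by measurable
 have gi: "integrable M (%om. g m (input_data n om))" for m
  using integrable_fun_cnt[of "%l. of_bool (l = m)" "n - K" i] by (simp add: g_def)
 have cm2: "(%z. (real (z m) - mean_X m)\<^sup>2) \<in> borel_measurable seqs" for m by measurable
 have i2: "integrable M (%om. (real (Y i m om) - mean_X m)\<^sup>2)" for m using cen_facts(3)[OF i, of m] by (simp add: cen_def)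
 have e2: "(%om. (fluct n i om)\<^sup>2) = (%om. \<Sum>m\<le>n - K. (real (Y i m om) - mean_X m)\<^sup>2 * 1 * g m (input_data n om))"
 proof
  fix om
  have "(\<Sum>m\<le>n - K. (real (Y i m om) - mean_X m)\<^sup>2 * 1 * g m (input_data n om))
   = (\<Sum>m\<in>{cnt (n - K) i om}. (real (Y i m om) - mean_X m)\<^sup>2 * 1 * g m (input_data n om))"
   using bucket_count_le[of K "piv_of om" "elem_of om" "n - K" i]
   by (intro sum.mono_neutral_right) (auto simp: g_def)
  then show "(fluct n i om)\<^sup>2 = (\<Sum>m\<le>n - K. (real (Y i m om) - mean_X m)\<^sup>2 * 1 * g m (input_data n om))"
   by (simp add: fluct_def cen_def g_def)
 qed
 have terms2: "integrable M (%om. (real (Y i m om) - mean_X m)\<^sup>2 * 1 * g m (input_data n om))"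
  "expectation (%om. (real (Y i m om) - mean_X m)\<^sup>2 * 1 * g m (input_data n om)) = expectation (%om. var_X m * g m (input_data n om))" for m
  using indep_product[OF n i j(1) j(2) cm2 one gm i2 _ gi, of m m] cen_facts(4)[OF i, of m]
  by (auto simp: cen_def prob_space)
 show "integrable M (%om. (fluct n i om)\<^sup>2)" unfolding e2 by (intro Bochner_Integration.integrable_sum terms2)
 have "expectation (%om. (fluct n i om)\<^sup>2) = (\<Sum>m\<le>n - K. expectation (%om. var_X m * g m (input_data n om)))"
  unfolding e2 by (subst Bochner_Integration.integral_sum) (use terms2 in auto)
 also have "... = expectation (%om. \<Sum>m\<le>n - K. var_X m * g m (input_data n om))"
  using gi by (subst Bochner_Integration.integral_sum) auto
 also have "(%om. \<Sum>m\<le>n - K. var_X m * g m (input_data n om)) = (%om. var_X (cnt (n - K) i om))"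
 proof
  fix om
  have "(\<Sum>m\<le>n - K. var_X m * g m (input_data n om)) = (\<Sum>m\<in>{cnt (n - K) i om}. var_X m * g m (input_data n om))"
   using bucket_count_le[of K "piv_of om" "elem_of om" "n - K" i]
   by (intro sum.mono_neutral_right) (auto simp: g_def)
  then show "(\<Sum>m\<le>n - K. var_X m * g m (input_data n om)) = var_X (cnt (n - K) i om)" by (simp add: g_def)
 qed
 finally show "expectation (%om. (fluct n i om)\<^sup>2) = expectation (%om. var_X (cnt (n - K) i om))" .
qed

text \<open>Expanded over both sizes, every term contains a centred copy of sublist i that is
  independent of the other two factors.\<close>

lemma fluct_cross:
 assumes n: "n > K" and i: "i <= K" and j: "j <= K" "i \<noteq> j"
 shows "integrable M (%om. fluct n i om * fluct n j om)" "expectation (%om. fluct n i om * fluct n j om) = 0"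
proof -
 define h where "h m m' z = of_bool (z (Suc i) = m) * (of_bool (z (Suc j) = m') :: real)" for m m' and z :: "nat => nat"
 have hm: "h m m' \<in> borel_measurable seqs" for m m' unfolding h_def of_bool_def by measurable
 have hi: "integrable M (%om. h m m' (input_data n om))" for m m'
  by (rule integrable_AE_bounded[where B = 1], rule measurable_compose[OF input_data_measurable[OF n] hm])
   (auto simp: h_def)
 have cm: "(%z. real (z m) - mean_X m) \<in> borel_measurable seqs" for m by measurable
 have ii: "integrable M (%om. real (Y i m om) - mean_X m)" for m using cen_facts(1)[OF i, of m] by (simp add: cen_def[abs_def])
 have ij: "integrable M (%om. real (Y j m om) - mean_X m)" for m using cen_facts(1)[OF j(1), of m] by (simp add: cen_def[abs_def])
 have e: "(%om. fluct n i om * fluct n j om)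
  = (%om. \<Sum>m\<le>n - K. \<Sum>m'\<le>n - K. (real (Y i m om) - mean_X m) * (real (Y j m' om) - mean_X m') * h m m' (input_data n om))"
  unfolding fluct_expand h_def cen_def sum_product input_data_simps
  by (intro ext sum.cong refl) (simp only: mult_ac)
 have terms: "integrable M (%om. (real (Y i m om) - mean_X m) * (real (Y j m' om) - mean_X m') * h m m' (input_data n om))"
  "expectation (%om. (real (Y i m om) - mean_X m) * (real (Y j m' om) - mean_X m') * h m m' (input_data n om)) = 0" for m m'
  using indep_product[OF n i j cm cm hm ii ij hi, of m m' m m'] cen_facts(2)[OF i, of m]
  by (auto simp: cen_def[abs_def])
 show "integrable M (%om. fluct n i om * fluct n j om)" unfolding e by (intro Bochner_Integration.integrable_sum terms)
 show "expectation (%om. fluct n i om * fluct n j om) = 0" unfolding e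
  by (subst Bochner_Integration.integral_sum, intro Bochner_Integration.integrable_sum terms)
   (subst Bochner_Integration.integral_sum, use terms in auto)
qed

end

end

section \<open>Estimates for harmonic numbers and x ln x\<close>

lemma sqrt_inverse_sum_le: "(\<Sum>k\<in>{1..m}. 1 / sqrt (real k)) <= 2 * sqrt (real m)"
proof (induction m)
 case (Suc m)
 have "1 / sqrt (real (Suc m)) <= 2 * (sqrt (real (Suc m)) - sqrt (real m))"
 proof -
  define x y where "x = sqrt (real (Suc m))" and "y = sqrt (real m)"
  have xy: "0 <= y" "y <= x" "0 < x" "x * x - y * y = 1" by (auto simp: x_def y_def)
  have "1 = (x - y) * (x + y)" using xy(4) by (simp add: algebra_simps)
  also have "... <= (x - y) * (2 * x)" using xy by (intro mult_left_mono) auto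
  finally show ?thesis using xy(3) unfolding x_def[symmetric] y_def[symmetric]
   by (simp add: pos_divide_le_eq mult_ac)
 qed
 then show ?case using Suc by simp
qed simp

text \<open>H_n - ln n decreases in n, whereas H_n - ln n - 1/n increases; comparing a with b in
  both sequences encloses the difference between 0 and 1 / a.\<close>

lemma harm_diff_ln:
 assumes "1 <= a" "a <= b"
 shows "\<bar>harm a - harm b - ln (real a / real b)\<bar> <= 1 / real a"
proof -
 have "harm b - ln (real b) <= harm a - ln (real a) \<and> harm a - ln (real a) - 1 / real a <= harm b - ln (real b) - 1 / real b"
  using assms(2)
 proof (induction b rule: dec_induct)
  case base
  show ?case by simp
 next
  case (step b)
  have b: "real b > 0" using step assms by simp
  have h: "harm (Suc b) = (harm b + 1 / real (Suc b) :: real)" by (simp add: harm_Suc divide_inverse)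
  have "ln (real (Suc b)) - ln (real b) = ln (1 + 1 / real b)"
  proof -
   have "1 + 1 / real b = real (Suc b) / real b" using b by (simp add: field_simps)
   then show ?thesis using b by (simp add: ln_div del: of_nat_Suc)
  qed
  moreover have "ln (1 + 1 / real b) <= 1 / real b" using b by (intro ln_add_one_self_le_self) auto
  moreover have "1 / real (Suc b) <= ln (1 + 1 / real b)"
  proof -
   have "ln (real b / real (Suc b)) <= real b / real (Suc b) - 1" using b by (intro ln_le_minus_one) auto
   moreover have "real b / real (Suc b) - 1 = - (1 / real (Suc b))" by (simp add: field_simps)
   moreover have "ln (real b / real (Suc b)) = - ln (1 + 1 / real b)"
   proof -
    have "real b / real (Suc b) = inverse (1 + 1 / real b)" using b by (simp add: field_simps)
    moreover have "0 < 1 + 1 / real b" using b by (simp add: add_pos_pos)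
    ultimately show ?thesis by (simp add: ln_inverse)
   qed
   ultimately show ?thesis by linarith
  qed
  ultimately show ?case using step.IH h by linarith
 qed
 moreover have "ln (real a / real b) = ln (real a) - ln (real b)" using assms by (simp add: ln_div)
 moreover have "0 <= 1 / real b" by simp
 ultimately show ?thesis by linarith
qed

text \<open>At the left end the function value is \<open>0 * ln 0 = 0\<close>, which agrees with the
  one-sided limit.\<close>

lemma continuous_on_xlnx: "continuous_on {0..} (%x::real. x * ln x)"
proof (rule continuous_on_eq_continuous_within[THEN iffD2], intro ballI)
 fix x :: real assume x: "x \<in> {0..}"
 show "continuous (at x within {0..}) (%x. x * ln x)"
 proof (cases "x = 0")
  case True
  have "((%x::real. x * ln x) \<longlongrightarrow> 0) (at_right 0)" by real_asymp
  moreover have "at (0::real) within {0..} = at_right 0"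
   by (metis at_within_Ici_at_right)
  ultimately show ?thesis using True by (simp add: continuous_within)
 next
  case False
  then have "x > 0" using x by simp
  then show ?thesis by (intro continuous_intros) auto
 qed
qed

lemma xlnx_bounds: "0 <= x ==> x <= 1 ==> x * ln x <= 0 \<and> - 1 <= x * ln (x::real)"
proof -
 assume x: "0 <= x" "x <= 1"
 show ?thesis
 proof (cases "x = 0")
  case False
  then have "x > 0" using x by simp
  then have "ln x <= 0" "ln (1 / x) <= 1 / x - 1" using x by (auto intro: ln_le_minus_one)
  then have "- ln x <= 1 / x - 1" using \<open>x > 0\<close> by (simp add: ln_div)
  then have "x * (- ln x) <= x * (1 / x - 1)" using \<open>x > 0\<close> by (intro mult_left_mono) auto
  then have "- 1 <= x * ln x" using \<open>x > 0\<close> by (simp add: right_diff_distrib)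
  then show ?thesis using \<open>ln x <= 0\<close> x by (simp add: mult_nonneg_nonpos)
 qed simp
qed

text \<open>Close points are handled by uniform continuity; for points at distance at least d the
  quadratic term already exceeds 1, a bound for the difference. In this form closeness in mean
  square passes from the ranks to the entropy.\<close>

lemma xlnx_modulus:
 fixes \<eta> :: real
 assumes "\<eta> > 0"
 shows "\<exists>C. \<forall>x\<in>{0..1}. \<forall>y\<in>{0..1}. (x * ln x - y * ln y)\<^sup>2 <= \<eta> + C * (x - y)\<^sup>2"
proof -
 have "uniformly_continuous_on {0..1} (%x::real. x * ln x)"
  by (intro compact_uniformly_continuous continuous_on_subset[OF continuous_on_xlnx]) auto
 then have "\<exists>d>0. \<forall>x\<in>{0..1::real}. \<forall>x'\<in>{0..1}. dist x' x < d \<longrightarrow> dist (x' * ln x') (x * ln x) < \<eta>"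
  using assms unfolding uniformly_continuous_on_def by (elim allE[of _ \<eta>]) simp
 then obtain d where d0: "d > 0" "\<forall>x\<in>{0..1::real}. \<forall>x'\<in>{0..1}. dist x' x < d \<longrightarrow> dist (x' * ln x') (x * ln x) < \<eta>"
  by blast
 then have d: "d > 0" "!!x y. x \<in> {0..1::real} ==> y \<in> {0..1} ==> dist y x < d ==> dist (y * ln y) (x * ln x) < \<eta>"
  by blast+
 show ?thesis
 proof (intro exI[of _ "1 / d\<^sup>2"] ballI)
  fix x y :: real assume xy: "x \<in> {0..1}" "y \<in> {0..1}"
  have D: "\<bar>x * ln x - y * ln y\<bar> <= 1" using xlnx_bounds[of x] xlnx_bounds[of y] xy by auto
  then have D2: "(x * ln x - y * ln y)\<^sup>2 <= \<bar>x * ln x - y * ln y\<bar>"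
   using mult_left_le[of "\<bar>x * ln x - y * ln y\<bar>" "\<bar>x * ln x - y * ln y\<bar>"] by (simp add: power2_eq_square flip: abs_mult)
  have pos: "0 <= 1 / d\<^sup>2 * (x - y)\<^sup>2" by simp
  show "(x * ln x - y * ln y)\<^sup>2 <= \<eta> + 1 / d\<^sup>2 * (x - y)\<^sup>2"
  proof (cases "\<bar>x - y\<bar> < d")
   case True
   then have "\<bar>x * ln x - y * ln y\<bar> < \<eta>" using d(2)[OF xy(2,1)] by (simp add: dist_real_def)
   then show ?thesis using D2 pos by linarith
  next
   case False
   then have "d\<^sup>2 <= (x - y)\<^sup>2" using d(1) by (metis abs_le_square_iff abs_of_pos not_less)
   then have "1 <= 1 / d\<^sup>2 * (x - y)\<^sup>2" using d(1) by (simp add: pos_le_divide_eq)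
   then show ?thesis using D2 D assms by linarith
  qed
 qed
qed

section \<open>The recurrences for mean and variance\<close>

context optimal_quicksort
begin

context
 assumes K1: "K >= 1"
begin

text \<open>The binomial law given the spacing, averaged by \<open>sum_spacing_binomial\<close>. The
  shift to \<open>f (j - 1)\<close> at level n + 1 comes from counting ranks J_i = I_i + 1.\<close>

lemma sum_expectation_count:
 assumes n: "n > K"
 shows "(\<Sum>i\<le>K. expectation (%om. f (cnt (n - K) i om) :: real)) = gap_avg (K - 1) (%j. f (j - 1)) (n + 1)"
proof -
 define m where "m = n - K"
 have nm: "n = m + K" "m >= 1" using n by (auto simp: m_def)
 have p: "(\<Sum>i\<le>K. expectation (%om. of_bool (cnt m i om = j) :: real))
   = (real K + 1) * real ((n - 1 - j) choose (K - 1)) / real (n choose K)" if j: "j <= m" for j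
 proof -
  define Q where "Q v i = real (m choose j) * spacing K v i ^ j * (1 - spacing K v i) ^ (m - j)" for v i
  have Qm: "(%v. Q v i) \<in> borel_measurable (\<Pi>\<^sub>M i\<in>{1..K}. borel)" for i
  proof -
   have [measurable]: "(%v. spacing K v i) \<in> borel_measurable (\<Pi>\<^sub>M i\<in>{1..K}. borel)"
    by (intro spacing_measurable) auto
   show ?thesis unfolding Q_def by measurable
  qed
  have cong: "Q (\<lambda>i\<in>{1..K}. V i om) = Q (piv_of om)" for om
  proof -
   have "spacing K (\<lambda>i\<in>{1..K}. V i om) = spacing K (piv_of om)" by (rule spacing_cong) simp
   then show ?thesis by (intro ext) (simp only: Q_def)
  qed
  have Qint: "integrable M (%om. Q (piv_of om) i)" for i
  proof (rule integrable_AE_bounded[where B = "real (m choose j) * 1 * 1"])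
   show "(%om. Q (piv_of om) i) \<in> borel_measurable M" unfolding Q_def by measurable
   show "AE om in M. \<bar>Q (piv_of om) i\<bar> <= real (m choose j) * 1 * 1"
    using AE_gap
   proof eventually_elim
    case (elim om)
    then have "0 <= gap i om" "gap i om <= 1" by auto
    then show ?case unfolding Q_def abs_mult
     by (intro mult_mono) (auto simp: power_le_one)
   qed
  qed
  have "expectation (%om. of_bool (cnt m i om = j) :: real) = expectation (%om. Q (piv_of om) i)" for i
   using count_distribution[of "%_. 1" 1 m i j] by (simp add: Q_def)
  then have "(\<Sum>i\<le>K. expectation (%om. of_bool (cnt m i om = j) :: real)) = expectation (%om. \<Sum>i\<le>K. Q (piv_of om) i)"
   using Qint by simp
  also have "... = (LINT v|pivot_space K. (\<Sum>i\<le>K. Q v i))"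
  proof (rule expectation_pivots[OF K1])
   show "(%v. \<Sum>i\<le>K. Q v i) \<in> borel_measurable (\<Pi>\<^sub>M i\<in>{1..K}. borel)"
    by (intro borel_measurable_sum Qm)
  qed (simp only: cong)
  also have "... = (real K + 1) * real ((m + K - 1 - j) choose (K - 1)) / real ((m + K) choose K)"
   unfolding Q_def by (rule sum_spacing_binomial[OF K1 j])
  finally show ?thesis unfolding nm by simp
 qed
 have expand: "f (cnt m i om) = (\<Sum>j\<le>m. f j * of_bool (cnt m i om = j))" for i om
 proof -
  have "(\<Sum>j\<le>m. f j * of_bool (cnt m i om = j)) = (\<Sum>j\<in>{cnt m i om}. f j * of_bool (cnt m i om = j))"
   using bucket_count_le[of K "piv_of om" "elem_of om" m i] by (intro sum.mono_neutral_right) auto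
  then show ?thesis by simp
 qed
 have int: "integrable M (%om. of_bool (cnt m i om = j) :: real)" for i j
  by (rule integrable_fun_cnt[OF K1, where f = "%l. of_bool (l = j)"])
 have "expectation (%om. f (cnt m i om)) = (\<Sum>j\<le>m. f j * expectation (%om. of_bool (cnt m i om = j)))" for i
  unfolding expand using int by (subst Bochner_Integration.integral_sum) (auto intro!: sum.cong)
 then have "(\<Sum>i\<le>K. expectation (%om. f (cnt m i om))) = (\<Sum>j\<le>m. f j * (\<Sum>i\<le>K. expectation (%om. of_bool (cnt m i om = j))))"
  by (simp add: sum_distrib_left) (rule sum.swap)
 also have "... = (\<Sum>j\<le>m. f j * ((real K + 1) * real ((n - 1 - j) choose (K - 1)) / real (n choose K)))"
  by (intro sum.cong refl) (simp add: p)
 also have "... = (\<Sum>j\<in>{1..m + 1}. f (j - 1) * ((real K + 1) * real ((n - j) choose (K - 1)) / real (n choose K)))"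
  by (rule sum.reindex_bij_witness[of _ "%j. j - 1" Suc]) auto
 \<comment> \<open>For the added indices j > m + 1 the upper entry n - j is below K - 1, so the
   binomial coefficient vanishes.\<close>
 also have "... = (\<Sum>j\<in>{1..<n + 1}. f (j - 1) * ((real K + 1) * real ((n - j) choose (K - 1)) / real (n choose K)))"
  using nm K1 by (intro sum.mono_neutral_left) (auto simp: binomial_eq_0)
 also have "... = gap_avg (K - 1) (%j. f (j - 1)) (n + 1)"
  using K1 by (simp add: gap_avg_def gap_sum_def sum_distrib_left sum_divide_distrib mult_ac add_ac del: sum.op_ivl_Suc)
 finally show ?thesis unfolding m_def .
qed

text \<open>The number of uncounted elements is nonnegative almost surely and has mean zero, because
  the hit probabilities of all sublists sum to 1; this replaces an analysis of ties.\<close>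

lemma AE_sum_cnt: "AE om in M. (\<Sum>i\<le>K. cnt m i om) = m"
proof -
 have e: "expectation (%om. real (cnt m i om)) = real m * expectation (gap i)" for i
 proof -
  have ih: "integrable M (%om. hit k i om - gap i om)" "expectation (%om. hit k i om - gap i om) = 0" if "k \<in> {1..m}" for k
  proof -
   have k: "k >= 1" using that by simp
   show "integrable M (%om. hit k i om - gap i om)"
   proof (rule integrable_AE_bounded[where B = 1])
    show "(%om. hit k i om - gap i om) \<in> borel_measurable M"
     by (intro borel_measurable_diff hit_measurable[OF k] gap_measurable)
    show "AE om in M. \<bar>hit k i om - gap i om\<bar> <= 1"
     using AE_gap by eventually_elim (auto simp: of_bool_def dest!: spec[of _ i])
   qed
   show "expectation (%om. hit k i om - gap i om) = 0"
    using one_step[OF k, of "%_. 1" "%_. 1" 1 i] by simp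
  qed
  have ig: "integrable M (gap i)"
   by (rule integrable_AE_bounded[where B = 1]) (use AE_gap in \<open>auto elim!: eventually_mono\<close>)
  have "(%om. real (cnt m i om)) = (%om. (\<Sum>k\<in>{1..m}. hit k i om - gap i om) + real m * gap i om)"
   by (simp add: sum_subtractf bucket_count_eq_sum)
  then have "expectation (%om. real (cnt m i om))
    = expectation (%om. \<Sum>k\<in>{1..m}. hit k i om - gap i om) + expectation (%om. real m * gap i om)"
   by (simp only:) (intro Bochner_Integration.integral_add Bochner_Integration.integrable_sum ih(1) integrable_mult_right ig)
  also have "expectation (%om. \<Sum>k\<in>{1..m}. hit k i om - gap i om) = (\<Sum>k\<in>{1..m}. expectation (%om. hit k i om - gap i om))"
   by (intro Bochner_Integration.integral_sum ih(1))
  also have "... = 0" by (intro sum.neutral ballI ih(2))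
  finally show ?thesis by simp
 qed
 have ic: "integrable M (%om. real (cnt m i om))" for i by (rule integrable_fun_cnt[OF K1])
 have ig: "integrable M (gap i)" for i
  by (rule integrable_AE_bounded[where B = 1]) (use AE_gap in \<open>auto elim!: eventually_mono\<close>)
 have "expectation (%om. real m - (\<Sum>i\<le>K. real (cnt m i om))) = real m - (\<Sum>i\<le>K. real m * expectation (gap i))"
  using ic by (simp add: e prob_space)
 also have "(\<Sum>i\<le>K. real m * expectation (gap i)) = real m * expectation (%om. \<Sum>i\<le>K. gap i om)"
  using ig by (simp add: sum_distrib_left)
 also have "... = real m" by (simp add: sum_spacing prob_space)
 finally have z: "expectation (%om. real m - (\<Sum>i\<le>K. real (cnt m i om))) = 0" by simp
 have nn: "AE om in M. 0 <= real m - (\<Sum>i\<le>K. real (cnt m i om))"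
  using AE_V_closed
 proof eventually_elim
  case (elim om)
  then have "(\<Sum>i\<le>K. cnt m i om) <= m" by (intro sum_bucket_count_le) auto
  then show ?case by (simp flip: of_nat_sum)
 qed
 have int: "integrable M (%om. real m - (\<Sum>i\<le>K. real (cnt m i om)))" using ic by simp
 have "AE om in M. real m - (\<Sum>i\<le>K. real (cnt m i om)) = 0"
  using integral_nonneg_eq_0_iff_AE[OF int nn] z by simp
 then show ?thesis by eventually_elim (simp flip: of_nat_sum)
qed

lemma rec_measurable:
 assumes n: "n > K"
 shows "(%om. (\<Sum>i\<le>K. Y i (cnt (n - K) i om) om) + part n om) \<in> measurable M (count_space UNIV)"
proof (rule measurable_of_nat_count)
 have "(%om. real (Y i (cnt (n - K) i om) om)) \<in> borel_measurable M" if "i <= K" for i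
 proof -
  have "(%om. Y i (cnt (n - K) i om) om) \<in> measurable M (count_space UNIV)"
   by (rule measurable_compose_countable[OF Y_measurable[OF that]])
    (rule measurable_of_nat_count[OF cnt_measurable_real])
  then show ?thesis by (rule measurable_compose) simp
 qed
 moreover have "(%om. real (part n om)) \<in> borel_measurable M"
  by (rule measurable_compose[OF part_measurable[OF n]]) simp
 ultimately show "(%om. real ((\<Sum>i\<le>K. Y i (cnt (n - K) i om) om) + part n om)) \<in> borel_measurable M"
  by simp
qed

lemma X_rec_expectation:
 fixes h :: "nat => real"
 assumes n: "n > K"
 shows "N.expectation (%om. h (X n om)) = expectation (%om. h ((\<Sum>i\<le>K. Y i (cnt (n - K) i om) om) + part n om))"
proof -
 have "N.expectation (%om. h (X n om)) = (LINT x|distr N (count_space UNIV) (X n). h x)"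
  using X_measurable by (subst integral_distr) auto
 also have "... = expectation (%om. h ((\<Sum>i\<le>K. Y i (cnt (n - K) i om) om) + part n om))"
  unfolding X_rec[OF n] using rec_measurable[OF n] by (subst integral_distr) auto
 finally show ?thesis .
qed

lemma integrable_toll_power: "n > K ==> integrable M (toll n)" "n > K ==> integrable M (%om. (toll n om)\<^sup>2)"
proof -
 assume n: "n > K"
 obtain B where B: "AE om in M. \<bar>toll n om\<bar> <= B" using toll_bounded[OF K1] by blast
 note [measurable] = toll_measurable[OF K1 n]
 show "integrable M (toll n)" by (rule integrable_AE_bounded[OF _ B]) measurable
 show "integrable M (%om. (toll n om)\<^sup>2)"
 proof (rule integrable_AE_bounded[where B = "B\<^sup>2"])
  show "AE om in M. \<bar>(toll n om)\<^sup>2\<bar> <= B\<^sup>2"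
   using B
  proof eventually_elim
   case (elim om)
   then have "\<bar>toll n om\<bar> <= \<bar>B\<bar>" by linarith
   then show ?case by (simp only: abs_power2 abs_le_square_iff)
  qed
 qed measurable
qed

lemma total_eq: "real ((\<Sum>i\<le>K. Y i (cnt (n - K) i om) om) + part n om) - mean_X n = (\<Sum>i\<le>K. fluct n i om) + toll n om"
 by (simp add: fluct_def[OF K1] cen_def[OF K1] toll_def[OF K1] sum_subtractf)

text \<open>In the square of fluctuations plus toll, the products of different fluctuations and
  those with the toll have mean zero; the diagonal gives \<open>var_X\<close> at the sublist
  sizes.\<close>

lemma var_recurrence:
 assumes n: "n > K"
 shows "var_X n = gap_avg (K - 1) (%j. var_X (j - 1)) (n + 1) + expectation (%om. (toll n om)\<^sup>2)"
proof -
 obtain B where B: "AE om in M. \<bar>toll n om\<bar> <= B" using toll_bounded[OF K1] by blast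
 define h where "h z = (\<Sum>i\<le>K. mean_X (z (Suc i))) + real (z 0) - mean_X n" for z :: "nat => nat"
 have ht: "h (input_data n om) = toll n om" for om by (simp add: h_def toll_eq_data[OF K1])
 note [measurable] = seqs_component[OF K1]
 have hm: "h \<in> borel_measurable seqs" unfolding h_def by measurable
 note fd = fluct_data[OF K1 n _ hm, unfolded ht, OF _ B]
 note fc = fluct_cross[OF K1 n]
 have fij: "integrable M (%om. fluct n i om * fluct n j om)" if "i <= K" "j <= K" for i j
  using fc(1)[OF that] fd(3)[OF that(1)] by (cases "i = j") (auto simp: power2_eq_square)
 have "var_X n = N.expectation (%om. (real (X n om) - mean_X n)\<^sup>2)" by (simp add: var_X_def mean_X_def)
 also have "... = expectation (%om. ((\<Sum>i\<le>K. fluct n i om) + toll n om)\<^sup>2)"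
  unfolding X_rec_expectation[OF n, of "%x. (real x - mean_X n)\<^sup>2"] total_eq ..
 also have "(%om. ((\<Sum>i\<le>K. fluct n i om) + toll n om)\<^sup>2)
   = (%om. (\<Sum>i\<le>K. \<Sum>j\<le>K. fluct n i om * fluct n j om) + (\<Sum>i\<le>K. 2 * (fluct n i om * toll n om)) + (toll n om)\<^sup>2)"
 proof
  fix om
  have "((\<Sum>i\<le>K. fluct n i om) + toll n om)\<^sup>2
   = (\<Sum>i\<le>K. fluct n i om) * (\<Sum>j\<le>K. fluct n j om) + 2 * ((\<Sum>i\<le>K. fluct n i om) * toll n om) + (toll n om)\<^sup>2"
   by (simp add: power2_eq_square algebra_simps)
  also have "2 * ((\<Sum>i\<le>K. fluct n i om) * toll n om) = (\<Sum>i\<le>K. 2 * (fluct n i om * toll n om))"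
   by (simp only: sum_distrib_left sum_distrib_right)
  finally show "((\<Sum>i\<le>K. fluct n i om) + toll n om)\<^sup>2
   = (\<Sum>i\<le>K. \<Sum>j\<le>K. fluct n i om * fluct n j om) + (\<Sum>i\<le>K. 2 * (fluct n i om * toll n om)) + (toll n om)\<^sup>2"
   by (simp only: sum_product)
 qed
 also have "expectation ... = (\<Sum>i\<le>K. \<Sum>j\<le>K. expectation (%om. fluct n i om * fluct n j om))
   + (\<Sum>i\<le>K. 2 * expectation (%om. fluct n i om * toll n om)) + expectation (%om. (toll n om)\<^sup>2)"
 proof -
  have i1: "integrable M (%om. \<Sum>i\<le>K. \<Sum>j\<le>K. fluct n i om * fluct n j om)"
   "integrable M (%om. \<Sum>i\<le>K. 2 * (fluct n i om * toll n om))"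
   using fij fd(1) by (auto intro!: Bochner_Integration.integrable_sum)
  have "expectation (%om. \<Sum>i\<le>K. \<Sum>j\<le>K. fluct n i om * fluct n j om)
   = (\<Sum>i\<le>K. expectation (%om. \<Sum>j\<le>K. fluct n i om * fluct n j om))"
   using fij by (intro Bochner_Integration.integral_sum Bochner_Integration.integrable_sum) auto
  also have "... = (\<Sum>i\<le>K. \<Sum>j\<le>K. expectation (%om. fluct n i om * fluct n j om))"
   using fij by (intro sum.cong refl Bochner_Integration.integral_sum) auto
  moreover have "expectation (%om. \<Sum>i\<le>K. 2 * (fluct n i om * toll n om))
   = (\<Sum>i\<le>K. expectation (%om. 2 * (fluct n i om * toll n om)))"
   using fd(1) by (intro Bochner_Integration.integral_sum) auto
  ultimately show ?thesis
   using i1 integrable_toll_power(2)[OF n]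
   by (simp only: Bochner_Integration.integral_add Bochner_Integration.integrable_add integral_mult_right_zero)
 qed
 also have "(\<Sum>i\<le>K. 2 * expectation (%om. fluct n i om * toll n om)) = 0" using fd(2) by simp
 also have "(\<Sum>i\<le>K. \<Sum>j\<le>K. expectation (%om. fluct n i om * fluct n j om)) = (\<Sum>i\<le>K. expectation (%om. var_X (cnt (n - K) i om)))"
 proof (intro sum.cong refl)
  fix i assume "i \<in> {..K}"
  then have i: "i <= K" by simp
  have "(\<Sum>j\<le>K. expectation (%om. fluct n i om * fluct n j om)) = (\<Sum>j\<in>{i}. expectation (%om. fluct n i om * fluct n j om))"
   using i fc(2)[OF i] by (intro sum.mono_neutral_right) auto
  then show "(\<Sum>j\<le>K. expectation (%om. fluct n i om * fluct n j om)) = expectation (%om. var_X (cnt (n - K) i om))"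
   using fd(4)[OF i] by (simp add: power2_eq_square)
 qed
 finally show ?thesis unfolding sum_expectation_count[OF n] by simp
qed

lemma integrable_part: "n > K ==> integrable M (%om. real (part n om))"
proof -
 assume n: "n > K"
 obtain B where B: "AE om in M. real (part n om) <= B" using part_bounded[OF K1] by blast
 show ?thesis
  by (rule integrable_AE_bounded[where B = B], rule measurable_compose[OF part_measurable[OF n]]) (use B in auto)
qed

lemma mean_recurrence:
 assumes n: "n > K"
 shows "mean_X n = gap_avg (K - 1) (%j. mean_X (j - 1)) (n + 1) + expectation (%om. real (part n om))"
proof -
 have f: "integrable M (fluct n i)" "expectation (fluct n i) = 0" if "i <= K" for i
  using fluct_data(1,2)[OF K1 n that, of "%_. 1" 1] by auto
 have "integrable N (%om. real (X n om))" by (rule integrable_X[OF K1, of "%x. x"]) (intro continuous_intros)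
 then have "0 = N.expectation (%om. real (X n om) - mean_X n)" by (simp add: mean_X_def N.prob_space)
 also have "... = expectation (%om. (\<Sum>i\<le>K. fluct n i om) + toll n om)"
  unfolding X_rec_expectation[OF n, of "%x. real x - mean_X n"] total_eq ..
 also have "... = expectation (%om. \<Sum>i\<le>K. fluct n i om) + expectation (toll n)"
  using f(1) by (intro Bochner_Integration.integral_add Bochner_Integration.integrable_sum integrable_toll_power(1)[OF n]) auto
 also have "expectation (%om. \<Sum>i\<le>K. fluct n i om) = (\<Sum>i\<le>K. expectation (%om. fluct n i om))"
  using f(1) by (intro Bochner_Integration.integral_sum) auto
 also have "... = 0" using f(2) by (intro sum.neutral) auto
 also have "0 + expectation (toll n) = expectation (toll n)" by simp
 also have "... = (\<Sum>i\<le>K. expectation (%om. mean_X (cnt (n - K) i om))) + expectation (%om. real (part n om)) - mean_X n"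
  unfolding toll_def[OF K1, abs_def] using integrable_fun_cnt[OF K1, of mean_X] integrable_part[OF n] by (simp add: prob_space)
 finally show ?thesis unfolding sum_expectation_count[OF n] by simp
qed

end

end

section \<open>The variance\<close>

context optimal_quicksort
begin

abbreviation gap_entropy :: "'a => real" where "gap_entropy om \<equiv> (\<Sum>i\<le>K. gap i om * ln (gap i om))"
abbreviation limit_toll :: "'a => real" where "limit_toll om \<equiv> alpha_const K * gap_entropy om + opt om"
abbreviation rank_frac :: "nat => nat => 'a => real" where
 "rank_frac n i om \<equiv> real (cnt (n - K) i om + 1) / real (n + 1)"

context
 assumes K1: "K >= 1"
begin

lemma expectation_opt: "expectation opt = gamma_const K"
 unfolding gamma_const_def
proof (rule expectation_pivots[OF K1])
 show "(%v. opt_cost K (spacing K v)) \<in> borel_measurable (\<Pi>\<^sub>M i\<in>{1..K}. borel)"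
  by (intro opt_cost_measurable spacing_measurable) auto
 fix om
 have "spacing K (\<lambda>i\<in>{1..K}. V i om) = spacing K (piv_of om)" by (rule spacing_cong) simp
 then show "opt_cost K (spacing K (\<lambda>i\<in>{1..K}. V i om)) = opt om" by (simp only:)
qed

lemma integrable_mean_opt: "integrable M (mean_cost k)" "integrable M opt"
proof -
 show "integrable M (mean_cost k)"
 proof (rule integrable_AE_bounded[where B = "real K"])
  show "AE om in M. \<bar>mean_cost k om\<bar> <= real K" using mean_cost_bounds[OF K1]
  proof eventually_elim
   case (elim om)
   then show ?case using elim(1)[rule_format, of k] by linarith
  qed
 qed measurable
 show "integrable M opt"
 proof (rule integrable_AE_bounded[where B = "real K"])
  show "AE om in M. \<bar>opt om\<bar> <= real K" using mean_cost_bounds(2)[OF K1] by eventually_elim linarith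
 qed measurable
qed

text \<open>The difference of P_n and (n + 1) times the optimal cost is a martingale, plus the loss
  from using estimated trees, plus a bounded rest. Their second moments are of order n, n^(3/2) and
  1, so the loss dominates after division by (n + 1)^2.\<close>

lemma part_mean_and_L2:
 "\<exists>C\<ge>0. \<forall>n>K. \<bar>expectation (%om. real (part n om)) - gamma_const K * real (n + 1)\<bar> <= C * sqrt (real (n + 1))
   \<and> expectation (%om. (real (part n om) / real (n + 1) - opt om)\<^sup>2) <= C / sqrt (real (n + 1))"
proof -
 obtain R where R: "!!om. comparisons piv (piv_of om) <= R" using comparisons_piv_bounded[OF K1] by blast
 define c where "c = 2 * real K * (real K + 1)"
 have c: "c >= 0" by (simp add: c_def)
 define C1 where "C1 = real R + 2 * c + (real K + 1) * real K"
 define C2 where "C2 = 3 * ((real K)\<^sup>2 + 2 * real K * c + (real R + (real K + 1) * real K)\<^sup>2)"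
 have C: "C1 >= 0" "C2 >= 0" using c by (auto simp: C1_def C2_def)
 have main: "\<bar>expectation (%om. real (part n om)) - gamma_const K * real (n + 1)\<bar> <= C1 * sqrt (real (n + 1))
   \<and> expectation (%om. (real (part n om) / real (n + 1) - opt om)\<^sup>2) <= C2 / sqrt (real (n + 1))" if n: "n > K" for n
 proof -
  define m where "m = n - K"
  define N' where "N' = real (n + 1)"
  have Nm: "N' = real m + (real K + 1)" using n by (simp add: N'_def m_def)
  have N1: "N' >= 1" "N' > 0" by (auto simp: N'_def)
  have sN: "sqrt N' >= 1" "sqrt N' * sqrt N' = N'" "sqrt N' <= N'" "sqrt N' > 0"
   using N1 by (auto intro: real_le_lsqrt simp: power2_eq_square)
  define A where "A om = (\<Sum>k\<in>{1..m}. step_cost k om - mean_cost k om)" for om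
  define D where "D om = (\<Sum>k\<in>{1..m}. mean_cost k om - opt om)" for om
  \<comment> \<open>Only m = n - K elements are classified, but n + 1 = m + (K + 1) units are
    charged at the optimal rate; the surplus is booked here with the cost of sorting the
    pivots.\<close>
  define E where "E om = real (comparisons piv (piv_of om)) - (real K + 1) * opt om" for om
  have dec: "real (part n om) - N' * opt om = A om + D om + E om" for om
   unfolding real_partition_cost A_def D_def E_def Nm m_def[symmetric]
   by (simp add: sum_subtractf algebra_simps)
  have scm: "step_cost k \<in> borel_measurable M" if "k \<in> {1..m}" for k using that by (intro step_cost_measurable) auto
  have Am [measurable]: "A \<in> borel_measurable M"
   unfolding A_def by (intro borel_measurable_sum borel_measurable_diff scm mean_cost_measurable)
  have Dm [measurable]: "D \<in> borel_measurable M" unfolding D_def by measurable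
  have [measurable]: "(%om. real (part n om)) \<in> borel_measurable M"
   by (rule measurable_compose[OF part_measurable[OF n]]) simp
  have "E om = real (part n om) - N' * opt om - A om - D om" for om using dec[of om] by linarith
  then have Em [measurable]: "E \<in> borel_measurable M" by (subst measurable_cong) auto
  have Ab: "AE om in M. \<bar>A om\<bar> <= real m * real K"
   using step_diff_bound[OF K1]
  proof eventually_elim
   case (elim om)
   have "\<bar>A om\<bar> <= (\<Sum>k\<in>{1..m}. \<bar>step_cost k om - mean_cost k om\<bar>)" unfolding A_def by (rule sum_abs)
   also have "... <= (\<Sum>k\<in>{1..m}. real K)" by (intro sum_mono) (use elim in auto)
   finally show ?case by simp
  qed
  have Db: "AE om in M. 0 <= D om \<and> D om <= real m * real K"
   using mean_cost_bounds[OF K1]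
  proof eventually_elim
   case (elim om)
   have b: "0 <= mean_cost k om - opt om \<and> mean_cost k om - opt om <= real K" for k
    using elim(1)[rule_format, of k] elim(2) by linarith
   have "D om <= (\<Sum>k\<in>{1..m}. real K)" unfolding D_def using b by (intro sum_mono) auto
   moreover have "0 <= D om" unfolding D_def using b by (intro sum_nonneg) auto
   ultimately show ?case by simp
  qed
  have Eb: "AE om in M. \<bar>E om\<bar> <= real R + (real K + 1) * real K"
   using mean_cost_bounds(2)[OF K1]
  proof eventually_elim
   case (elim om)
   have "0 <= (real K + 1) * opt om" "(real K + 1) * opt om <= (real K + 1) * real K"
    using elim by (auto intro!: mult_left_mono mult_nonneg_nonneg)
   moreover have "real (comparisons piv (piv_of om)) <= real R" "0 <= real (comparisons piv (piv_of om))" using R by auto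
   ultimately show ?case unfolding E_def by linarith
  qed
  have iA: "integrable M A" by (rule integrable_AE_bounded[OF Am Ab])
  have iD: "integrable M D"
  proof (rule integrable_AE_bounded[OF Dm])
   show "AE om in M. \<bar>D om\<bar> <= real m * real K" using Db by eventually_elim auto
  qed
  have iE: "integrable M E" by (rule integrable_AE_bounded[OF Em Eb])
  have eA: "expectation A = 0"
  proof -
   have z: "expectation (%om. step_cost k om - mean_cost k om) = 0" if "k \<in> {1..m}" for k
    using cost_orthogonal[OF K1, of k "%_. 1" "%_. 1" 1] that by simp
   have i: "integrable M (%om. step_cost k om - mean_cost k om)" if "k \<in> {1..m}" for k
   proof (rule integrable_AE_bounded[where B = "real K"])
    show "AE om in M. \<bar>step_cost k om - mean_cost k om\<bar> <= real K"
     using step_diff_bound[OF K1] by eventually_elim auto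
    show "(%om. step_cost k om - mean_cost k om) \<in> borel_measurable M"
     by (intro borel_measurable_diff scm[OF that] mean_cost_measurable)
   qed
   show ?thesis unfolding A_def by (subst Bochner_Integration.integral_sum) (auto simp: i z simp del: atLeastAtMost_iff One_nat_def)
  qed
  have eD: "0 <= expectation D" "expectation D <= 2 * c * sqrt N'"
  proof -
   show "0 <= expectation D" using Db by (intro integral_nonneg_AE) (auto elim!: eventually_mono)
   have "expectation D = (\<Sum>k\<in>{1..m}. expectation (%om. mean_cost k om - opt om))"
    unfolding D_def by (intro Bochner_Integration.integral_sum Bochner_Integration.integrable_diff integrable_mean_opt)
   also have "... <= (\<Sum>k\<in>{1..m}. c * (1 / sqrt (real k)))"
    using mean_cost_near_opt[OF K1] unfolding c_def by (intro sum_mono) auto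
   also have "... = c * (\<Sum>k\<in>{1..m}. 1 / sqrt (real k))" by (simp add: sum_distrib_left)
   also have "... <= c * (2 * sqrt (real m))" using c sqrt_inverse_sum_le by (intro mult_left_mono) auto
   also have "... <= c * (2 * sqrt N')" using c Nm by (intro mult_left_mono) auto
   finally show "expectation D <= 2 * c * sqrt N'" by simp
  qed
  have eE: "\<bar>expectation E\<bar> <= real R + (real K + 1) * real K"
  proof -
   have "\<bar>expectation E\<bar> <= expectation (%om. \<bar>E om\<bar>)" using integral_abs_bound[of M E] by simp
   also have "... <= expectation (%om. real R + (real K + 1) * real K)"
    using iE Eb by (intro integral_mono_AE) auto
   finally show ?thesis by (simp add: prob_space)
  qed
  have "expectation (%om. real (part n om)) - gamma_const K * N' = expectation (%om. real (part n om) - N' * opt om)"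
   using integrable_part[OF K1 n] integrable_mean_opt(2) expectation_opt by simp
  also have "... = expectation D + expectation E"
   unfolding dec using iA iD iE eA by simp
  finally have "\<bar>expectation (%om. real (part n om)) - gamma_const K * N'\<bar> <= 2 * c * sqrt N' + (real R + (real K + 1) * real K)"
   using eD eE by linarith
  also have "real R + (real K + 1) * real K <= (real R + (real K + 1) * real K) * sqrt N'"
   using sN mult_left_mono[of 1 "sqrt N'" "real R + (real K + 1) * real K"] by simp
  finally have part1: "\<bar>expectation (%om. real (part n om)) - gamma_const K * N'\<bar> <= C1 * sqrt N'"
   by (simp add: C1_def algebra_simps)
  have sqb: "AE om in M. (real (part n om) - N' * opt om)\<^sup>2
    <= 3 * ((A om)\<^sup>2 + real m * real K * D om + (real R + (real K + 1) * real K)\<^sup>2)"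
   using Db Eb
  proof eventually_elim
   case (elim om)
   have "0 <= (A om - D om)\<^sup>2 + (A om - E om)\<^sup>2 + (D om - E om)\<^sup>2" by simp
   then have "(A om + D om + E om)\<^sup>2 <= 3 * ((A om)\<^sup>2 + (D om)\<^sup>2 + (E om)\<^sup>2)"
    by (simp add: power2_eq_square algebra_simps)
   also have "... <= 3 * ((A om)\<^sup>2 + real m * real K * D om + (real R + (real K + 1) * real K)\<^sup>2)"
   proof (intro mult_left_mono add_mono order_refl)
    \<comment> \<open>Bounding one factor by the maximum of \<open>D\<close> reduces its second
      moment to the first moment that \<open>mean_cost_near_opt\<close> provides.\<close>
    show "(D om)\<^sup>2 <= real m * real K * D om"
     using elim unfolding power2_eq_square by (intro mult_right_mono) auto
    show "(E om)\<^sup>2 <= (real R + (real K + 1) * real K)\<^sup>2"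
     using power_mono[OF elim(2) abs_ge_zero, of 2] by simp
   qed simp
   finally show ?case unfolding dec .
  qed
  have iA2: "integrable M (%om. (A om)\<^sup>2)"
  proof (rule integrable_AE_bounded[where B = "(real m * real K)\<^sup>2"])
   show "AE om in M. \<bar>(A om)\<^sup>2\<bar> <= (real m * real K)\<^sup>2"
    using Ab
   proof eventually_elim
    case (elim om)
    then show ?case by (metis abs_ge_zero abs_power2 power2_abs power_mono)
   qed
  qed measurable
  have iT: "integrable M (%om. (real (part n om) - N' * opt om)\<^sup>2)"
  proof (rule Bochner_Integration.integrable_bound)
   show "integrable M (%om. 3 * ((A om)\<^sup>2 + real m * real K * D om + (real R + (real K + 1) * real K)\<^sup>2))"
    using iA2 iD by simp
   show "AE om in M. norm ((real (part n om) - N' * opt om)\<^sup>2) <= norm (3 * ((A om)\<^sup>2 + real m * real K * D om + (real R + (real K + 1) * real K)\<^sup>2))"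
    using sqb by eventually_elim (simp add: abs_of_nonneg order.trans[OF zero_le_power2])
  qed measurable
  have "expectation (%om. (real (part n om) - N' * opt om)\<^sup>2)
   <= expectation (%om. 3 * ((A om)\<^sup>2 + real m * real K * D om + (real R + (real K + 1) * real K)\<^sup>2))"
   using sqb iT iA2 iD by (intro integral_mono_AE) auto
  also have "... = 3 * (expectation (%om. (A om)\<^sup>2) + real m * real K * expectation D + (real R + (real K + 1) * real K)\<^sup>2)"
   using iA2 iD by (simp add: prob_space)
  also have "... <= 3 * (real m * (real K)\<^sup>2 + real m * real K * (2 * c * sqrt N') + (real R + (real K + 1) * real K)\<^sup>2)"
   using cost_second_moment[OF K1, of m] eD unfolding A_def[symmetric]
   by (intro mult_left_mono add_mono) (auto intro!: mult_left_mono)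
  also have "... <= 3 * (N' * sqrt N' * (real K)\<^sup>2 + N' * sqrt N' * (2 * real K * c) + N' * sqrt N' * (real R + (real K + 1) * real K)\<^sup>2)"
  proof -
   have mN: "real m <= N'" using Nm by simp
   have NN: "N' <= N' * sqrt N'" "1 <= N' * sqrt N'"
    using sN N1 mult_mono[of 1 N' 1 "sqrt N'"] by auto
   have 1: "real m * (real K)\<^sup>2 <= N' * sqrt N' * (real K)\<^sup>2"
    using mN NN by (intro mult_right_mono) auto
   have "real m * (sqrt N' * (2 * real K * c)) <= N' * (sqrt N' * (2 * real K * c))"
    using mN sN c by (intro mult_right_mono) auto
   then have 2: "real m * real K * (2 * c * sqrt N') <= N' * sqrt N' * (2 * real K * c)"
    by (simp only: mult_ac)
   have 3: "1 * (real R + (real K + 1) * real K)\<^sup>2 <= N' * sqrt N' * (real R + (real K + 1) * real K)\<^sup>2"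
    using NN by (intro mult_right_mono) auto
   show ?thesis using 3 by (intro mult_left_mono add_mono 1 2) auto
  qed
  also have "... = N' * sqrt N' * C2" by (simp add: C2_def algebra_simps)
  finally have T: "expectation (%om. (real (part n om) - N' * opt om)\<^sup>2) <= N' * sqrt N' * C2" .
  have "(real (part n om) / N' - opt om)\<^sup>2 = (real (part n om) - N' * opt om)\<^sup>2 / N'\<^sup>2" for om
  proof -
   have "real (part n om) / N' - opt om = (real (part n om) - N' * opt om) / N'" using N1 by (simp add: diff_divide_distrib)
   then show ?thesis by (simp add: power_divide)
  qed
  then have "expectation (%om. (real (part n om) / N' - opt om)\<^sup>2) = expectation (%om. (real (part n om) - N' * opt om)\<^sup>2) / N'\<^sup>2"
   by simp
  also have "... <= N' * sqrt N' * C2 / N'\<^sup>2" using T by (intro divide_right_mono) auto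
  also have "... = C2 / sqrt N'"
  proof -
   have "N' * sqrt N' * C2 * sqrt N' = C2 * N'\<^sup>2"
    using sN(2) by (metis mult.assoc mult.commute power2_eq_square)
   then show ?thesis using N1 sN by (simp add: divide_eq_eq eq_divide_eq)
  qed
  finally show ?thesis using part1 unfolding N'_def by blast
 qed
 show ?thesis
 proof (intro exI[of _ "max C1 C2"] conjI allI impI)
  show "0 <= max C1 C2" using C by simp
  fix n assume n: "n > K"
  have "C1 * sqrt (real (n + 1)) <= max C1 C2 * sqrt (real (n + 1))" "C2 / sqrt (real (n + 1)) <= max C1 C2 / sqrt (real (n + 1))"
   by (intro mult_right_mono divide_right_mono; simp)+
  then show "\<bar>expectation (%om. real (part n om)) - gamma_const K * real (n + 1)\<bar> <= max C1 C2 * sqrt (real (n + 1))"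
   "expectation (%om. (real (part n om) / real (n + 1) - opt om)\<^sup>2) <= max C1 C2 / sqrt (real (n + 1))"
   using main[OF n] by linarith+
 qed
qed

text \<open>Indexed by n + 1; divided by its index it is the correction to the leading term \<alpha>
  H of the normalised mean.\<close>

definition excess :: "nat => real" where
 "excess N' = mean_X (N' - 1) - alpha_const K * (real N' * harm N')"

lemma harm_gt_1: "harm (K + 1) - 1 > (0 :: real)"
proof -
 have "harm 2 <= (harm (K + 1) :: real)" using K1 by (intro harm_mono) auto
 moreover have "(harm 2 :: real) = 3 / 2" by (simp add: harm_expand)
 ultimately show ?thesis by linarith
qed

lemma excess_convergent: "convergent (%N'. excess N' / real N')"
proof -
 obtain C where C: "C >= 0" "!!n. n > K ==> \<bar>expectation (%om. real (part n om)) - gamma_const K * real (n + 1)\<bar> <= C * sqrt (real (n + 1))"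
  using part_mean_and_L2 by blast
 define C0 where "C0 = \<bar>excess (K + 1) - gap_avg (K - 1) excess (K + 1)\<bar>"
 show ?thesis
 proof (rule gap_recurrence_linear[where k = "K - 1" and C = "C + C0"])
  fix N' assume "N' >= K - 1 + 2"
  then have N': "N' >= K + 1" using K1 by simp
  have s1: "sqrt (real N') >= 1" using N' by simp
  show "\<bar>excess N' - gap_avg (K - 1) excess N'\<bar> <= (C + C0) * sqrt (real N')"
  proof (cases "N' = K + 1")
   case True
   have "C0 * 1 <= C0 * sqrt (real N')" using s1 by (intro mult_left_mono) (auto simp: C0_def)
   moreover have "0 <= C * sqrt (real N')" using C(1) by simp
   ultimately show ?thesis unfolding True C0_def by (simp add: algebra_simps)
  next
   case False
   define n where "n = N' - 1"
   have n: "n > K" "N' = n + 1" using N' False by (auto simp: n_def)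
   have k: "K - 1 + 2 = K + 1" using K1 by simp
   have "gap_avg (K - 1) excess N' = gap_avg (K - 1) (%j. mean_X (j - 1)) N' - alpha_const K * gap_avg (K - 1) (%j. real j * harm j) N'"
    unfolding excess_def[abs_def] gap_avg_diff gap_avg_cmult ..
   also have "gap_avg (K - 1) (%j. real j * harm j) N' = real N' * (harm N' - (harm (K + 1) - 1))"
    using gap_avg_harm[of "K - 1" N'] N' K1 unfolding k by simp
   also have "alpha_const K * (real N' * (harm N' - (harm (K + 1) - 1)))
     = alpha_const K * (real N' * harm N') - gamma_const K * real N'"
   proof -
    have "alpha_const K * (harm (K + 1) - 1) = gamma_const K" using harm_gt_1 by (simp add: alpha_const_def)
    moreover have "alpha_const K * (real N' * (harm N' - (harm (K + 1) - 1)))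
     = alpha_const K * (real N' * harm N') - (alpha_const K * (harm (K + 1) - 1)) * real N'"
     by (simp add: algebra_simps)
    ultimately show ?thesis by simp
   qed
   finally have "excess N' - gap_avg (K - 1) excess N' = expectation (%om. real (part n om)) - gamma_const K * real (n + 1)"
    using mean_recurrence[OF K1 n(1)] unfolding excess_def n(2) by simp
   then have "\<bar>excess N' - gap_avg (K - 1) excess N'\<bar> <= C * sqrt (real N')" using C(2)[OF n(1)] n(2) by simp
   moreover have "0 <= C0 * sqrt (real N')" by (simp add: C0_def)
   ultimately show ?thesis by (simp add: algebra_simps)
  qed
 qed
qed

end

end

section \<open>The limit of the toll in mean square\<close>

lemma abs_power2_le: "\<bar>x\<bar> <= B ==> \<bar>x\<^sup>2\<bar> <= (B :: real)\<^sup>2"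
 using power_mono[of "\<bar>x\<bar>" B 2] by simp

text \<open>The factor j / N damps the indices at which \<open>w\<close> has not yet settled; for
  all later ones both values are close to the limit.\<close>

lemma weighted_diff_small:
 fixes w :: "nat => real"
 assumes w: "w \<longlonglongrightarrow> L" and \<epsilon>: "\<epsilon> > 0"
 shows "eventually (%N. \<forall>j\<in>{1..N}. real j / real N * \<bar>w j - w N\<bar> <= \<epsilon>) sequentially"
proof -
 obtain B where B: "!!j. \<bar>w j\<bar> <= B"
  using convergent_imp_Bseq[OF convergentI[OF w]] by (auto simp: Bseq_def)
 have B0: "B >= 0" using B[of 0] by linarith
 obtain N1 where N1: "!!j. j >= N1 ==> \<bar>w j - L\<bar> < \<epsilon> / 2"
  using LIMSEQ_D[OF w, of "\<epsilon> / 2"] \<epsilon> by auto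
 have "eventually (%N. real N > real N1 * (2 * B) / \<epsilon>) sequentially"
  using filterlim_real_sequentially by (rule filterlim_at_top_dense[THEN iffD1, rule_format])
 then show ?thesis using eventually_ge_at_top[of "N1 + 1"]
 proof eventually_elim
  case (elim N)
  have Np: "real N > 0" using elim by simp
  show ?case
  proof
   fix j assume j: "j \<in> {1..N}"
   show "real j / real N * \<bar>w j - w N\<bar> <= \<epsilon>"
   proof (cases "j >= N1")
    case True
    have "\<bar>w j - w N\<bar> <= \<epsilon>" using N1[OF True] N1[of N] elim by linarith
    moreover have "real j / real N <= 1" using j Np by simp
    ultimately show ?thesis using mult_mono[of "real j / real N" 1 "\<bar>w j - w N\<bar>" \<epsilon>] by simp
   next
    case False
    have "\<bar>w j - w N\<bar> <= 2 * B" using B[of j] B[of N] by linarith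
    then have "real j / real N * \<bar>w j - w N\<bar> <= real N1 / real N * (2 * B)"
     using False Np B0 by (intro mult_mono divide_right_mono) auto
    also have "... <= \<epsilon>" using elim \<epsilon> Np by (simp add: field_simps)
    finally show ?thesis .
   qed
  qed
 qed
qed

text \<open>For a bounded limit, Young's inequality gives |T^2 - L^2| <= \<delta> + q (T - L)^2 with
  \<delta> arbitrarily small and q depending on \<delta> and the bound only.\<close>

lemma (in prob_space) second_moment_tendsto:
 fixes T :: "nat => 'a => real" and L :: "'a => real"
 assumes T: "eventually (%n. integrable M (%om. (T n om)\<^sup>2) \<and> integrable M (%om. (T n om - L om)\<^sup>2)) sequentially"
  and Lm: "L \<in> borel_measurable M" and Lb: "AE om in M. \<bar>L om\<bar> <= c"
  and lim: "(%n. expectation (%om. (T n om - L om)\<^sup>2)) \<longlonglongrightarrow> 0"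
 shows "(%n. expectation (%om. (T n om)\<^sup>2)) \<longlonglongrightarrow> expectation (%om. (L om)\<^sup>2)"
proof (rule LIMSEQ_I)
 fix \<epsilon> :: real assume \<epsilon>: "\<epsilon> > 0"
 define \<delta> where "\<delta> = \<epsilon> / 2"
 define q where "q = c\<^sup>2 / \<delta> + 1"
 have \<delta>: "\<delta> > 0" using \<epsilon> by (simp add: \<delta>_def)
 then have q: "q > 0" by (simp add: q_def add_nonneg_pos)
 have iL: "integrable M (%om. (L om)\<^sup>2)"
 proof (rule integrable_const_bound[where B = "c\<^sup>2"])
  show "AE om in M. norm ((L om)\<^sup>2) <= c\<^sup>2"
   using Lb
  proof eventually_elim
   case (elim om)
   then show ?case by (metis abs_ge_zero norm_power power2_abs power_mono real_norm_def)
  qed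
 qed (use Lm in measurable)
 have "eventually (%n. norm (expectation (%om. (T n om - L om)\<^sup>2) - 0) < \<delta> / q) sequentially"
  using LIMSEQ_D[OF lim, of "\<delta> / q"] \<delta> q by (simp add: eventually_sequentially)
 then have "eventually (%n. norm (expectation (%om. (T n om)\<^sup>2) - expectation (%om. (L om)\<^sup>2)) < \<epsilon>) sequentially"
  using T
 proof eventually_elim
  case (elim n)
  then have i: "integrable M (%om. (T n om)\<^sup>2)" "integrable M (%om. (T n om - L om)\<^sup>2)" by auto
  have pt: "AE om in M. \<bar>(T n om)\<^sup>2 - (L om)\<^sup>2\<bar> <= \<delta> + q * (T n om - L om)\<^sup>2"
   using Lb
  proof eventually_elim
   case (elim om)
   define d where "d = T n om - L om"
   have "(T n om)\<^sup>2 - (L om)\<^sup>2 = 2 * L om * d + d\<^sup>2" by (simp add: d_def power2_eq_square algebra_simps)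
   then have "\<bar>(T n om)\<^sup>2 - (L om)\<^sup>2\<bar> <= \<bar>2 * L om * d\<bar> + d\<^sup>2" by (metis abs_power2 abs_triangle_ineq)
   also have "\<bar>2 * L om * d\<bar> = 2 * (\<bar>L om\<bar> * \<bar>d\<bar>)" by (simp add: abs_mult)
   also have "\<bar>L om\<bar> * \<bar>d\<bar> <= c * \<bar>d\<bar>" using elim by (intro mult_right_mono) auto
   also have "2 * (c * \<bar>d\<bar>) <= \<delta> + c\<^sup>2 / \<delta> * d\<^sup>2"
   proof -
    have "0 <= (\<delta> - c * \<bar>d\<bar>)\<^sup>2 / \<delta>" using \<delta> by simp
    also have "(\<delta> - c * \<bar>d\<bar>)\<^sup>2 / \<delta> = \<delta> - 2 * (c * \<bar>d\<bar>) + c\<^sup>2 / \<delta> * d\<^sup>2"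
     using \<delta> by (simp add: power2_diff power_mult_distrib field_simps) (simp add: power2_eq_square)
    finally show ?thesis by linarith
   qed
   finally show ?case by (simp add: d_def q_def algebra_simps)
  qed
  have "\<bar>expectation (%om. (T n om)\<^sup>2) - expectation (%om. (L om)\<^sup>2)\<bar> = \<bar>expectation (%om. (T n om)\<^sup>2 - (L om)\<^sup>2)\<bar>"
   using i iL by simp
  also have "... <= expectation (%om. \<bar>(T n om)\<^sup>2 - (L om)\<^sup>2\<bar>)" by (rule integral_abs_bound)
  also have "... <= expectation (%om. \<delta> + q * (T n om - L om)\<^sup>2)"
   using i iL pt by (intro integral_mono_AE) auto
  also have "... = \<delta> + q * expectation (%om. (T n om - L om)\<^sup>2)" using i by (simp add: prob_space)
  also have "... < \<delta> + q * (\<delta> / q)"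
   using elim q by (intro add_strict_left_mono mult_strict_left_mono) (auto simp: abs_less_iff)
  also have "... = \<epsilon>" using q by (simp add: \<delta>_def)
  finally show ?case by simp
 qed
 then show "\<exists>no. \<forall>n\<ge>no. norm (expectation (%om. (T n om)\<^sup>2) - expectation (%om. (L om)\<^sup>2)) < \<epsilon>"
  by (simp add: eventually_sequentially)
qed

context optimal_quicksort
begin

context
 assumes K1: "K >= 1"
begin

lemma rank_frac_bounds:
 assumes "n > K"
 shows "0 < rank_frac n i om" "rank_frac n i om <= 1"
proof -
 have "cnt (n - K) i om <= n - K" by (rule bucket_count_le)
 then have "real (cnt (n - K) i om + 1) <= real (n + 1)" using assms by (intro of_nat_mono) auto
 then show "0 < rank_frac n i om" "rank_frac n i om <= 1" by (auto simp: divide_le_eq)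
qed

lemma rank_frac_L2:
 assumes n: "n > K"
 shows "expectation (%om. (rank_frac n i om - gap i om)\<^sup>2) <= 2 * (1 + (real K + 1)\<^sup>2) / real (n + 1)"
  and "integrable M (%om. (rank_frac n i om - gap i om)\<^sup>2)"
proof -
 define m where "m = n - K"
 define N' where "N' = real (n + 1)"
 have Nm: "N' = real m + (real K + 1)" using n by (simp add: N'_def m_def)
 have N1: "N' >= 1" by (simp add: N'_def)
 define S where "S om = real (cnt m i om) - real m * gap i om" for om
 have Sm [measurable]: "S \<in> borel_measurable M" unfolding S_def by measurable
 have iS: "integrable M (%om. (S om)\<^sup>2)"
 proof (rule integrable_AE_bounded[where B = "(real m)\<^sup>2"])
  show "AE om in M. \<bar>(S om)\<^sup>2\<bar> <= (real m)\<^sup>2"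
   using AE_gap
  proof eventually_elim
   case (elim om)
   have "real (cnt m i om) <= real m" "0 <= real m * gap i om" "real m * gap i om <= real m"
    using bucket_count_le[of K "piv_of om" "elem_of om" m i] elim[rule_format, of i]
    by (auto intro: mult_left_le)
   then have "\<bar>S om\<bar> <= \<bar>real m\<bar>" unfolding S_def by linarith
   then show ?case by (simp only: abs_le_square_iff abs_power2)
  qed
 qed measurable
 have pt: "AE om in M. (rank_frac n i om - gap i om)\<^sup>2 <= 2 * ((S om)\<^sup>2 + (real K + 1)\<^sup>2) / N'\<^sup>2"
  using AE_gap
 proof eventually_elim
  case (elim om)
  define u where "u = 1 - (real K + 1) * gap i om"
  have g: "0 <= gap i om" "gap i om <= 1" using elim by auto
  then have "0 <= (real K + 1) * gap i om" "(real K + 1) * gap i om <= real K + 1"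
   by (auto intro: mult_left_le)
  then have "\<bar>u\<bar> <= \<bar>real K + 1\<bar>" unfolding u_def by linarith
  then have u2: "u\<^sup>2 <= (real K + 1)\<^sup>2" by (simp only: abs_le_square_iff)
  have "rank_frac n i om - gap i om = (S om + u) / N'"
  proof -
   have "S om + u = real (cnt m i om + 1) - gap i om * N'" by (simp add: S_def u_def Nm algebra_simps)
   then show ?thesis using N1 unfolding N'_def[symmetric] m_def[symmetric] by (simp add: diff_divide_distrib)
  qed
  then have "(rank_frac n i om - gap i om)\<^sup>2 = (S om + u)\<^sup>2 / N'\<^sup>2" by (simp add: power_divide)
  also have "(S om + u)\<^sup>2 <= 2 * ((S om)\<^sup>2 + (real K + 1)\<^sup>2)"
  proof -
   have "0 <= (S om - u)\<^sup>2" by simp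
   then have "(S om + u)\<^sup>2 <= 2 * ((S om)\<^sup>2 + u\<^sup>2)" by (simp add: power2_eq_square algebra_simps)
   also have "... <= 2 * ((S om)\<^sup>2 + (real K + 1)\<^sup>2)"
    by (intro mult_left_mono add_mono order_refl u2) auto
   finally show ?thesis .
  qed
  finally show ?case by (simp add: divide_right_mono)
 qed
 have i2: "integrable M (%om. 2 * ((S om)\<^sup>2 + (real K + 1)\<^sup>2) / N'\<^sup>2)" using iS by simp
 show i1: "integrable M (%om. (rank_frac n i om - gap i om)\<^sup>2)"
 proof (rule Bochner_Integration.integrable_bound[OF i2])
  have [measurable]: "(%om. rank_frac n i om) \<in> borel_measurable M" by (rule fun_cnt_measurable[OF K1])
  show "(%om. (rank_frac n i om - gap i om)\<^sup>2) \<in> borel_measurable M" by measurable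
  show "AE om in M. norm ((rank_frac n i om - gap i om)\<^sup>2) <= norm (2 * ((S om)\<^sup>2 + (real K + 1)\<^sup>2) / N'\<^sup>2)"
   using pt by eventually_elim (simp add: abs_of_nonneg)
 qed
 have "expectation (%om. (rank_frac n i om - gap i om)\<^sup>2) <= expectation (%om. 2 * ((S om)\<^sup>2 + (real K + 1)\<^sup>2) / N'\<^sup>2)"
  by (rule integral_mono_AE[OF i1 i2 pt])
 also have "... = 2 * (expectation (%om. (S om)\<^sup>2) + (real K + 1)\<^sup>2) / N'\<^sup>2"
  using iS by (simp add: prob_space)
 also have "... <= 2 * (N' + N' * (real K + 1)\<^sup>2) / N'\<^sup>2"
 proof (intro divide_right_mono mult_left_mono add_mono)
  show "expectation (%om. (S om)\<^sup>2) <= N'" using count_second_moment[of m i] Nm unfolding S_def by linarith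
  show "(real K + 1)\<^sup>2 <= N' * (real K + 1)\<^sup>2" using N1 mult_right_mono[of 1 N' "(real K + 1)\<^sup>2"] by simp
 qed auto
 also have "... = 2 * (1 + (real K + 1)\<^sup>2) / N'"
  using N1 by (simp add: power2_eq_square divide_simps) (simp add: algebra_simps)
 finally show "expectation (%om. (rank_frac n i om - gap i om)\<^sup>2) <= 2 * (1 + (real K + 1)\<^sup>2) / real (n + 1)"
  unfolding N'_def .
qed

text \<open>Because the ranks sum to n + 1, the constants \<open>harm (n + 1)\<close> and
  \<open>w (n + 1)\<close> may be moved inside the sums. This removes both the logarithmic growth
  and the unknown limit of \<open>w\<close>.\<close>

lemma toll_decomposition:
 assumes n: "n > K"
 defines "w \<equiv> %j. excess j / real j"
 shows "AE om in M. toll n om / real (n + 1) = alpha_const K * (\<Sum>i\<le>K. rank_frac n i om * (harm (cnt (n - K) i om + 1) - harm (n + 1)))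
  + (\<Sum>i\<le>K. rank_frac n i om * (w (cnt (n - K) i om + 1) - w (n + 1))) + real (part n om) / real (n + 1)"
 using AE_sum_cnt[OF K1, of "n - K"]
proof eventually_elim
 case (elim om)
 define J where "J i = cnt (n - K) i om + 1" for i
 define N' where "N' = real (n + 1)"
 have N': "N' > 0" by (simp add: N'_def)
 have mX: "mean_X c = alpha_const K * (real (c + 1) * harm (c + 1)) + real (c + 1) * w (c + 1)" for c
  by (simp add: w_def excess_def[OF K1])
 have "(\<Sum>i\<le>K. real (J i)) = real (\<Sum>i\<le>K. cnt (n - K) i om) + (real K + 1)"
  by (simp add: J_def sum.distrib)
 then have sJ: "(\<Sum>i\<le>K. real (J i)) = N'" using elim n by (simp add: N'_def)
 have s: "(\<Sum>i\<le>K. real (J i) * (f i - c)) = (\<Sum>i\<le>K. real (J i) * f i) - N' * c" for f :: "nat => real" and c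
  unfolding sJ[symmetric] by (simp add: right_diff_distrib sum_subtractf sum_distrib_right)
 have "toll n om = alpha_const K * (\<Sum>i\<le>K. real (J i) * harm (J i)) + (\<Sum>i\<le>K. real (J i) * w (J i)) + real (part n om)
   - (alpha_const K * (N' * harm (n + 1)) + N' * w (n + 1))"
  unfolding toll_def[OF K1] mX J_def[symmetric] N'_def by (simp add: sum.distrib sum_distrib_left)
 also have "... = alpha_const K * (\<Sum>i\<le>K. real (J i) * (harm (J i) - harm (n + 1))) + (\<Sum>i\<le>K. real (J i) * (w (J i) - w (n + 1))) + real (part n om)"
  unfolding s by (simp add: algebra_simps)
 finally have "toll n om / N' = alpha_const K * ((\<Sum>i\<le>K. real (J i) * (harm (J i) - harm (n + 1))) / N')
   + (\<Sum>i\<le>K. real (J i) * (w (J i) - w (n + 1))) / N' + real (part n om) / N'"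
  by (simp add: add_divide_distrib)
 then show ?case unfolding J_def[symmetric] N'_def[symmetric] sum_divide_distrib by simp
qed

text \<open>Three errors are estimated: harmonic numbers versus logarithms together with the
  differences of \<open>w\<close>, which is uniformly small; the entropy at the rank fractions
  versus the spacings; and the partitioning cost versus its limit.\<close>

lemma toll_L2_limit:
 "(%n. expectation (%om. (toll n om / real (n + 1) - limit_toll om)\<^sup>2)) \<longlonglongrightarrow> 0"
proof -
 define al where "al = alpha_const K"
 define w where "w j = excess j / real j" for j
 obtain Lw where w: "w \<longlonglongrightarrow> Lw" using excess_convergent[OF K1] unfolding w_def convergent_def by blast
 obtain CP where CP: "CP >= 0" "!!n. n > K ==> expectation (%om. (real (part n om) / real (n + 1) - opt om)\<^sup>2) <= CP / sqrt (real (n + 1))"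
  using part_mean_and_L2[OF K1] by blast
 define k1 where "k1 = real K + 1"
 have gm: "(%om. gap i om * ln (gap i om)) \<in> borel_measurable M" for i by measurable
 have bound: "eventually (%n. expectation (%om. (toll n om / real (n + 1) - limit_toll om)\<^sup>2)
   <= 3 * ((k1 * (\<bar>al\<bar> + 1) * \<eta>)\<^sup>2 + al\<^sup>2 * (k1 * (k1 * (2 * \<eta>))) + \<eta>)) sequentially" if \<eta>: "\<eta> > 0" for \<eta> :: real
 proof -
  obtain C where C: "!!x y. x \<in> {0..1} ==> y \<in> {0..1} ==> (x * ln x - y * ln y)\<^sup>2 <= \<eta> + C * (x - y)\<^sup>2"
   using xlnx_modulus[OF \<eta>] by blast
  define C' where "C' = max C 0"
  have C': "!!x y. x \<in> {0..1} ==> y \<in> {0..1} ==> (x * ln x - y * ln y)\<^sup>2 <= \<eta> + C' * (x - y)\<^sup>2" "C' >= 0"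
  proof -
   fix x y :: real assume "x \<in> {0..1}" "y \<in> {0..1}"
   then have "(x * ln x - y * ln y)\<^sup>2 <= \<eta> + C * (x - y)\<^sup>2" by (rule C)
   moreover have "C * (x - y)\<^sup>2 <= C' * (x - y)\<^sup>2" by (intro mult_right_mono) (auto simp: C'_def)
   ultimately show "(x * ln x - y * ln y)\<^sup>2 <= \<eta> + C' * (x - y)\<^sup>2" by linarith
  qed (simp add: C'_def)
  have e1: "eventually (%n. \<forall>j\<in>{1..n + 1}. real j / real (n + 1) * \<bar>w j - w (n + 1)\<bar> <= \<eta>) sequentially"
   using weighted_diff_small[OF w \<eta>] by (rule eventually_compose_filterlim) (rule filterlim_add_const_nat_at_top)
  have e2: "eventually (%n. 1 / real (n + 1) < \<eta>) sequentially"
  proof -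
   have "(%n. 1 / real (n + 1)) \<longlonglongrightarrow> 0" by real_asymp
   then show ?thesis using \<eta> by (rule order_tendstoD)
  qed
  have e3: "eventually (%n. CP / sqrt (real (n + 1)) < \<eta>) sequentially"
  proof -
   have "(%n. CP / sqrt (real (n + 1))) \<longlonglongrightarrow> 0" by real_asymp
   then show ?thesis using \<eta> by (rule order_tendstoD)
  qed
  have e4: "eventually (%n. C' * (2 * (1 + k1\<^sup>2) / real (n + 1)) < \<eta>) sequentially"
  proof -
   have "(%n. C' * (2 * (1 + k1\<^sup>2) / real (n + 1))) \<longlonglongrightarrow> 0" by real_asymp
   then show ?thesis using \<eta> by (rule order_tendstoD)
  qed
  show ?thesis using e1 e2 e3 e4 eventually_gt_at_top[of K]
  proof eventually_elim
   case (elim n)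
   note n = \<open>n > K\<close>
   define x where "x i om = rank_frac n i om" for i om
   define dl where "dl i om = x i om * ln (x i om) - gap i om * ln (gap i om)" for i om
   define dp where "dp om = real (part n om) / real (n + 1) - opt om" for om
   have xm [measurable]: "x i \<in> borel_measurable M" for i unfolding x_def by (rule fun_cnt_measurable[OF K1])
   have dlm [measurable]: "dl i \<in> borel_measurable M" for i unfolding dl_def by measurable
   have pm [measurable]: "(%om. real (part n om)) \<in> borel_measurable M"
    by (rule measurable_compose[OF part_measurable[OF n]]) simp
   have [measurable]: "dp \<in> borel_measurable M" unfolding dp_def by measurable
   have [measurable]: "toll n \<in> borel_measurable M" by (rule toll_measurable[OF K1 n])
   have xb: "x i om \<in> {0..1}" for i om using rank_frac_bounds[OF n, where i = i and om = om] by (simp add: x_def)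
   have near: "AE om in M. \<bar>toll n om / real (n + 1) - (al * (\<Sum>i\<le>K. x i om * ln (x i om)) + real (part n om) / real (n + 1))\<bar>
     <= k1 * (\<bar>al\<bar> + 1) * \<eta>"
    using toll_decomposition[OF n, folded w_def]
   proof eventually_elim
    case (elim om)
    define J where "J i = cnt (n - K) i om + 1" for i
    have J: "1 <= J i" "J i <= n + 1" for i
     using bucket_count_le[of K "piv_of om" "elem_of om" "n - K" i] by (auto simp: J_def)
    have xJ: "x i om = real (J i) / real (n + 1)" for i by (simp add: x_def J_def)
    have h: "\<bar>x i om * (harm (J i) - harm (n + 1)) - x i om * ln (x i om)\<bar> <= \<eta>" for i
    proof -
     have "\<bar>harm (J i) - harm (n + 1) - ln (x i om)\<bar> <= 1 / real (J i)"
      unfolding xJ by (rule harm_diff_ln[OF J])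
     then have "x i om * \<bar>harm (J i) - harm (n + 1) - ln (x i om)\<bar> <= x i om * (1 / real (J i))"
      using xb[of i om] by (intro mult_left_mono) auto
     \<comment> \<open>The weight J_i / (n + 1) cancels the logarithmic error 1 / J_i, so even tiny
       sublists cause no trouble.\<close>
     also have "... = 1 / real (n + 1)" using J(1)[of i] by (simp add: xJ)
     also have "... <= \<eta>" using \<open>1 / real (n + 1) < \<eta>\<close> by simp
     finally show ?thesis using xb[of i om] by (simp add: abs_mult right_diff_distrib[symmetric])
    qed
    have ww: "\<bar>x i om * (w (J i) - w (n + 1))\<bar> <= \<eta>" for i
    proof -
     have "real (J i) / real (n + 1) * \<bar>w (J i) - w (n + 1)\<bar> <= \<eta>"
      using \<open>\<forall>j\<in>{1..n + 1}. real j / real (n + 1) * \<bar>w j - w (n + 1)\<bar> <= \<eta>\<close> J[of i] by auto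
     then show ?thesis by (simp add: xJ abs_mult)
    qed
    have "toll n om / real (n + 1) - (al * (\<Sum>i\<le>K. x i om * ln (x i om)) + real (part n om) / real (n + 1))
     = al * (\<Sum>i\<le>K. x i om * (harm (J i) - harm (n + 1)) - x i om * ln (x i om)) + (\<Sum>i\<le>K. x i om * (w (J i) - w (n + 1)))"
     unfolding elim al_def[symmetric] x_def[symmetric] J_def[symmetric] by (simp add: xJ sum_subtractf right_diff_distrib)
    also have "\<bar>...\<bar> <= \<bar>al\<bar> * (\<Sum>i\<le>K. \<eta>) + (\<Sum>i\<le>K. \<eta>)"
    proof -
     have "\<bar>\<Sum>i\<le>K. x i om * (harm (J i) - harm (n + 1)) - x i om * ln (x i om)\<bar> <= (\<Sum>i\<le>K. \<eta>)"
      by (intro order.trans[OF sum_abs] sum_mono h)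
     then have "\<bar>al * (\<Sum>i\<le>K. x i om * (harm (J i) - harm (n + 1)) - x i om * ln (x i om))\<bar> <= \<bar>al\<bar> * (\<Sum>i\<le>K. \<eta>)"
      unfolding abs_mult by (intro mult_left_mono) auto
     moreover have "\<bar>\<Sum>i\<le>K. x i om * (w (J i) - w (n + 1))\<bar> <= (\<Sum>i\<le>K. \<eta>)"
      by (intro order.trans[OF sum_abs] sum_mono ww)
     ultimately show ?thesis by linarith
    qed
    also have "... = k1 * (\<bar>al\<bar> + 1) * \<eta>" by (simp add: k1_def algebra_simps)
    finally show ?case .
   qed
   have pt: "AE om in M. (toll n om / real (n + 1) - limit_toll om)\<^sup>2
    <= 3 * ((k1 * (\<bar>al\<bar> + 1) * \<eta>)\<^sup>2 + al\<^sup>2 * (k1 * (\<Sum>i\<le>K. \<eta> + C' * (x i om - gap i om)\<^sup>2)) + (dp om)\<^sup>2)"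
    using near AE_gap
   proof eventually_elim
    case (elim om)
    define p q where "p = toll n om / real (n + 1) - (al * (\<Sum>i\<le>K. x i om * ln (x i om)) + real (part n om) / real (n + 1))"
     and "q = al * (\<Sum>i\<le>K. dl i om)"
    have "toll n om / real (n + 1) - limit_toll om = p + q + dp om"
     unfolding p_def q_def dp_def dl_def al_def by (simp add: sum_subtractf algebra_simps)
    moreover have "0 <= (p - q)\<^sup>2 + (p - dp om)\<^sup>2 + (q - dp om)\<^sup>2" by simp
    then have "(p + q + dp om)\<^sup>2 <= 3 * (p\<^sup>2 + q\<^sup>2 + (dp om)\<^sup>2)" by (simp add: power2_eq_square algebra_simps)
    moreover have "p\<^sup>2 <= (k1 * (\<bar>al\<bar> + 1) * \<eta>)\<^sup>2"
     using elim(1) unfolding p_def[symmetric] by (metis abs_ge_zero power2_abs power_mono)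
    moreover have "q\<^sup>2 <= al\<^sup>2 * (k1 * (\<Sum>i\<le>K. \<eta> + C' * (x i om - gap i om)\<^sup>2))"
    proof -
     have "(\<Sum>i\<le>K. dl i om)\<^sup>2 <= (\<Sum>i\<le>K. (dl i om)\<^sup>2) * real (card {..K})"
      by (rule sum_squared_le_sum_of_squares)
     also have "... <= (\<Sum>i\<le>K. \<eta> + C' * (x i om - gap i om)\<^sup>2) * real (card {..K})"
      unfolding dl_def using elim(2) xb by (intro mult_right_mono sum_mono C'(1)) auto
     finally have "(\<Sum>i\<le>K. dl i om)\<^sup>2 <= k1 * (\<Sum>i\<le>K. \<eta> + C' * (x i om - gap i om)\<^sup>2)"
      by (simp add: k1_def mult.commute[of "1 + real K"] add.commute[of "real K"])
     then show ?thesis unfolding q_def power_mult_distrib by (intro mult_left_mono) auto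
    qed
    ultimately show ?case by simp
   qed
   have idp: "integrable M (%om. (dp om)\<^sup>2)"
   proof -
    obtain B where B: "AE om in M. real (part n om) <= B" using part_bounded[OF K1] by blast
    show ?thesis
    proof (rule integrable_AE_bounded[where B = "(B + real K)\<^sup>2"])
     show "AE om in M. \<bar>(dp om)\<^sup>2\<bar> <= (B + real K)\<^sup>2"
      using B mean_cost_bounds(2)[OF K1]
     proof eventually_elim
      case (elim om)
      have "real (part n om) / real (n + 1) <= real (part n om) / 1" by (intro divide_left_mono) auto
      moreover have "0 <= real (part n om) / real (n + 1)" by simp
      ultimately have "\<bar>dp om\<bar> <= B + real K" unfolding dp_def using elim by linarith
      then show ?case by (rule abs_power2_le)
     qed
    qed measurable
   qed
   have ix: "integrable M (%om. (x i om - gap i om)\<^sup>2)" for i unfolding x_def by (rule rank_frac_L2(2)[OF n])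
   have iR: "integrable M (%om. 3 * ((k1 * (\<bar>al\<bar> + 1) * \<eta>)\<^sup>2 + al\<^sup>2 * (k1 * (\<Sum>i\<le>K. \<eta> + C' * (x i om - gap i om)\<^sup>2)) + (dp om)\<^sup>2))"
    using ix idp by simp
   have iT: "integrable M (%om. (toll n om / real (n + 1) - limit_toll om)\<^sup>2)"
   proof (rule Bochner_Integration.integrable_bound[OF iR])
    show "(%om. (toll n om / real (n + 1) - limit_toll om)\<^sup>2) \<in> borel_measurable M" by measurable
    show "AE om in M. norm ((toll n om / real (n + 1) - limit_toll om)\<^sup>2)
     <= norm (3 * ((k1 * (\<bar>al\<bar> + 1) * \<eta>)\<^sup>2 + al\<^sup>2 * (k1 * (\<Sum>i\<le>K. \<eta> + C' * (x i om - gap i om)\<^sup>2)) + (dp om)\<^sup>2))"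
     using pt
    proof eventually_elim
     case (elim om)
     show ?case unfolding real_norm_def abs_power2 by (rule order.trans[OF elim abs_ge_self])
    qed
   qed
   have "expectation (%om. (toll n om / real (n + 1) - limit_toll om)\<^sup>2)
    <= expectation (%om. 3 * ((k1 * (\<bar>al\<bar> + 1) * \<eta>)\<^sup>2 + al\<^sup>2 * (k1 * (\<Sum>i\<le>K. \<eta> + C' * (x i om - gap i om)\<^sup>2)) + (dp om)\<^sup>2))"
    by (rule integral_mono_AE[OF iT iR pt])
   also have "... = 3 * ((k1 * (\<bar>al\<bar> + 1) * \<eta>)\<^sup>2 + al\<^sup>2 * (k1 * (\<Sum>i\<le>K. \<eta> + C' * expectation (%om. (x i om - gap i om)\<^sup>2))) + expectation (%om. (dp om)\<^sup>2))"
    using ix idp by (simp add: prob_space)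
   also have "... <= 3 * ((k1 * (\<bar>al\<bar> + 1) * \<eta>)\<^sup>2 + al\<^sup>2 * (k1 * (\<Sum>i\<le>K. \<eta> + \<eta>)) + \<eta>)"
   proof (intro mult_left_mono add_mono order_refl sum_mono)
    show "expectation (%om. (dp om)\<^sup>2) <= \<eta>"
     using CP(2)[OF n] \<open>CP / sqrt (real (n + 1)) < \<eta>\<close> unfolding dp_def by linarith
    fix i
    have "C' * expectation (%om. (x i om - gap i om)\<^sup>2) <= C' * (2 * (1 + k1\<^sup>2) / real (n + 1))"
     using rank_frac_L2(1)[OF n, of i] C'(2) unfolding x_def k1_def by (intro mult_left_mono) auto
    then show "C' * expectation (%om. (x i om - gap i om)\<^sup>2) <= \<eta>"
     using \<open>C' * (2 * (1 + k1\<^sup>2) / real (n + 1)) < \<eta>\<close> by linarith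
   qed (auto simp: k1_def)
   also have "... = 3 * ((k1 * (\<bar>al\<bar> + 1) * \<eta>)\<^sup>2 + al\<^sup>2 * (k1 * (k1 * (2 * \<eta>))) + \<eta>)" by (simp add: k1_def)
   finally show ?case .
  qed
 qed
 show ?thesis
 proof (rule order_tendstoI)
  fix y :: real assume "y < 0"
  then show "eventually (%n. y < expectation (%om. (toll n om / real (n + 1) - limit_toll om)\<^sup>2)) sequentially"
   by (intro always_eventually allI) (auto intro: less_le_trans)
 next
  fix y :: real assume y: "y > 0"
  have "((%\<eta>. 3 * ((k1 * (\<bar>al\<bar> + 1) * \<eta>)\<^sup>2 + al\<^sup>2 * (k1 * (k1 * (2 * \<eta>))) + \<eta>)) \<longlongrightarrow> 3 * ((k1 * (\<bar>al\<bar> + 1) * 0)\<^sup>2 + al\<^sup>2 * (k1 * (k1 * (2 * 0))) + 0)) (at_right 0)"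
   by (intro tendsto_intros)
  then have "eventually (%\<eta>. 3 * ((k1 * (\<bar>al\<bar> + 1) * \<eta>)\<^sup>2 + al\<^sup>2 * (k1 * (k1 * (2 * \<eta>))) + \<eta>) < y) (at_right 0)"
   using y by (intro order_tendstoD) auto
  moreover have "eventually (%\<eta>::real. \<eta> > 0) (at_right 0)" by (simp add: eventually_at_right_less)
  ultimately obtain \<eta> :: real where "\<eta> > 0" "3 * ((k1 * (\<bar>al\<bar> + 1) * \<eta>)\<^sup>2 + al\<^sup>2 * (k1 * (k1 * (2 * \<eta>))) + \<eta>) < y"
   using eventually_happens'[OF trivial_limit_at_right_real[of "0::real"] eventually_conj] by blast
  then show "eventually (%n. expectation (%om. (toll n om / real (n + 1) - limit_toll om)\<^sup>2) < y) sequentially"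
   using bound[of \<eta>] by (auto elim: eventually_mono)
 qed
qed

lemma variance_asymptotics:
 "(%n. var_X n / (real n)\<^sup>2) \<longlonglongrightarrow> sigma_sq K"
proof -
 define \<beta> where "\<beta> = expectation (%om. (limit_toll om)\<^sup>2)"
 have Lm [measurable]: "limit_toll \<in> borel_measurable M" by measurable
 have Lb: "AE om in M. \<bar>limit_toll om\<bar> <= \<bar>alpha_const K\<bar> * (real K + 1) + real K"
  using AE_gap mean_cost_bounds(2)[OF K1]
 proof eventually_elim
  case (elim om)
  have "\<bar>gap_entropy om\<bar> <= (\<Sum>i\<le>K. 1)"
   using xlnx_bounds elim(1) by (intro order.trans[OF sum_abs] sum_mono) (auto simp: abs_le_iff intro: order.trans)
  then have "\<bar>alpha_const K * gap_entropy om\<bar> <= \<bar>alpha_const K\<bar> * (real K + 1)"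
   unfolding abs_mult by (intro mult_left_mono) auto
  then show ?case using elim(2) by linarith
 qed
 have "(%n. expectation (%om. (toll n om / real (n + 1))\<^sup>2)) \<longlonglongrightarrow> \<beta>"
  unfolding \<beta>_def
 proof (rule second_moment_tendsto[OF _ Lm Lb toll_L2_limit])
  show "eventually (%n. integrable M (%om. (toll n om / real (n + 1))\<^sup>2) \<and>
   integrable M (%om. (toll n om / real (n + 1) - limit_toll om)\<^sup>2)) sequentially"
   using eventually_gt_at_top[of K]
  proof eventually_elim
   case (elim n)
   have [measurable]: "toll n \<in> borel_measurable M" by (rule toll_measurable[OF K1 elim])
   obtain B where B: "AE om in M. \<bar>toll n om\<bar> <= B" using toll_bounded[OF K1] by blast
   have Tb: "AE om in M. \<bar>toll n om / real (n + 1)\<bar> <= B"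
    using B
   proof eventually_elim
    case (elim om)
    have "\<bar>toll n om\<bar> / real (n + 1) <= \<bar>toll n om\<bar> / 1" by (intro divide_left_mono) auto
    then show ?case using elim by (simp add: abs_divide)
   qed
   have 1: "integrable M (%om. (toll n om / real (n + 1))\<^sup>2)"
   proof (rule integrable_AE_bounded[where B = "B\<^sup>2"])
    show "AE om in M. \<bar>(toll n om / real (n + 1))\<^sup>2\<bar> <= B\<^sup>2"
     using Tb
    proof eventually_elim
     case (elim om)
     then show ?case by (rule abs_power2_le)
    qed
   qed measurable
   have 2: "integrable M (%om. (toll n om / real (n + 1) - limit_toll om)\<^sup>2)"
   proof (rule integrable_AE_bounded[where B = "(B + (\<bar>alpha_const K\<bar> * (real K + 1) + real K))\<^sup>2"])
    show "AE om in M. \<bar>(toll n om / real (n + 1) - limit_toll om)\<^sup>2\<bar> <= (B + (\<bar>alpha_const K\<bar> * (real K + 1) + real K))\<^sup>2"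
     using Tb Lb
    proof eventually_elim
     case (elim om)
     then have "\<bar>toll n om / real (n + 1) - limit_toll om\<bar> <= B + (\<bar>alpha_const K\<bar> * (real K + 1) + real K)" by linarith
     then show ?case by (rule abs_power2_le)
    qed
   qed measurable
   show ?case using 1 2 by blast
  qed
 qed
 then have "(%n. expectation (%om. (toll n om)\<^sup>2) / (real (n + 1))\<^sup>2) \<longlonglongrightarrow> \<beta>"
  by (simp add: power_divide)
 then have "(%n. expectation (%om. (toll (n + 1 - 1) om)\<^sup>2) / (real (n + 1))\<^sup>2) \<longlonglongrightarrow> \<beta>" by simp
 then have b: "(%N'. expectation (%om. (toll (N' - 1) om)\<^sup>2) / (real N')\<^sup>2) \<longlonglongrightarrow> \<beta>"
  by (rule LIMSEQ_offset[where k = 1])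
 have "(%N'. var_X (N' - 1) / (real N')\<^sup>2) \<longlonglongrightarrow> \<beta> * (real (K - 1) + 3) / (real (K - 1) + 1)"
 proof (rule gap_recurrence_quadratic[OF _ b])
  fix N' assume "K - 1 + 3 <= N'"
  then have "N' - 1 > K" "N' - 1 + 1 = N'" using K1 by auto
  then show "var_X (N' - 1) = gap_avg (K - 1) (%N'. var_X (N' - 1)) N' + expectation (%om. (toll (N' - 1) om)\<^sup>2)"
   using var_recurrence[OF K1, of "N' - 1"] by simp
 qed
 \<comment> \<open>With k = K - 1 the factor (k + 3) / (k + 1) of the quadratic recurrence becomes
   (K + 2) / K.\<close>
 moreover have "\<beta> * (real (K - 1) + 3) / (real (K - 1) + 1) = sigma_sq K"
 proof -
  have "\<beta> = (LINT v|pivot_space K. (alpha_const K * (\<Sum>i\<le>K. spacing K v i * ln (spacing K v i)) + opt_cost K (spacing K v))\<^sup>2)"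
   unfolding \<beta>_def
  proof (rule expectation_pivots[OF K1])
   have [measurable]: "(%v. spacing K v i) \<in> borel_measurable (\<Pi>\<^sub>M i\<in>{1..K}. borel)" for i
    by (intro spacing_measurable) auto
   have [measurable]: "(%v. opt_cost K (spacing K v)) \<in> borel_measurable (\<Pi>\<^sub>M i\<in>{1..K}. borel)"
    by (intro opt_cost_measurable spacing_measurable) auto
   show "(%v. (alpha_const K * (\<Sum>i\<le>K. spacing K v i * ln (spacing K v i)) + opt_cost K (spacing K v))\<^sup>2)
    \<in> borel_measurable (\<Pi>\<^sub>M i\<in>{1..K}. borel)" by measurable
   fix om
   have "spacing K (\<lambda>i\<in>{1..K}. V i om) = spacing K (piv_of om)" by (rule spacing_cong) simp
   then show "(alpha_const K * (\<Sum>i\<le>K. spacing K (\<lambda>i\<in>{1..K}. V i om) i * ln (spacing K (\<lambda>i\<in>{1..K}. V i om) i))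
     + opt_cost K (spacing K (\<lambda>i\<in>{1..K}. V i om)))\<^sup>2 = (limit_toll om)\<^sup>2" by (simp only:)
  qed
  then show ?thesis using K1 by (simp add: sigma_sq_def of_nat_diff field_simps)
 qed
 ultimately have "(%N'. var_X (N' - 1) / (real N')\<^sup>2) \<longlonglongrightarrow> sigma_sq K" by simp
 then have "(%n. var_X (n + 1 - 1) / (real (n + 1))\<^sup>2) \<longlonglongrightarrow> sigma_sq K" by (rule LIMSEQ_ignore_initial_segment)
 then have "(%n. var_X n / (real (n + 1))\<^sup>2 * ((real (n + 1))\<^sup>2 / (real n)\<^sup>2)) \<longlonglongrightarrow> sigma_sq K * 1"
 proof (intro tendsto_mult)
  show "(%n. (real (n + 1))\<^sup>2 / (real n)\<^sup>2) \<longlonglongrightarrow> 1" by real_asymp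
 qed simp
 moreover have "var_X n / (real (n + 1))\<^sup>2 * ((real (n + 1))\<^sup>2 / (real n)\<^sup>2) = var_X n / (real n)\<^sup>2" for n by simp
 ultimately show ?thesis by simp
qed

end

end

text \<open>A limit of the ratio yields asymptotic equivalence only if it is nonzero. When all
  pivots are close to 1, one spacing is near 1 and the others near 0, so the entropy is negligible
  against \<open>opt_cost >= 1\<close>; such pivots have positive probability.\<close>

lemma sigma_sq_pos:
 assumes K: "K >= 1"
 shows "sigma_sq K > 0"
proof -
 define al where "al = alpha_const K"
 define g where "g v = al * (\<Sum>i\<le>K. spacing K v i * ln (spacing K v i)) + opt_cost K (spacing K v)" for v
 interpret P: prob_space "pivot_space K" by (rule prob_space_pivot_space)
 have sm [measurable]: "(%v. spacing K v i) \<in> borel_measurable (pivot_space K)" for i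
  by (intro spacing_measurable) (auto cong: measurable_cong_sets simp: sets_pivot_space)
 have om [measurable]: "(%v. opt_cost K (spacing K v)) \<in> borel_measurable (pivot_space K)"
  by (intro opt_cost_measurable sm)
 have gm [measurable]: "g \<in> borel_measurable (pivot_space K)" unfolding g_def by measurable
 have bnds: "AE v in pivot_space K. (\<forall>i. 0 <= spacing K v i \<and> spacing K v i <= 1) \<and> 1 <= opt_cost K (spacing K v) \<and> opt_cost K (spacing K v) <= real K"
  using AE_pivot_space_unit
 proof eventually_elim
  case (elim v)
  then have u: "!!j. j \<in> {1..K} ==> v j \<in> {0..1}" by fastforce
  have "\<forall>i. 0 <= spacing K v i \<and> spacing K v i <= 1"
   using spacing_nonneg[of K v, OF u] spacing_le_1[of K v, OF u] by blast
  then show ?case using opt_cost_bounds[OF K, of "spacing K v"] by (auto simp: sum_spacing)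
 qed
 have int: "integrable (pivot_space K) (%v. (g v)\<^sup>2)"
 proof (rule P.integrable_const_bound[where B = "(\<bar>al\<bar> * (real K + 1) + real K)\<^sup>2"])
  show "AE v in pivot_space K. norm ((g v)\<^sup>2) <= (\<bar>al\<bar> * (real K + 1) + real K)\<^sup>2"
   using bnds
  proof eventually_elim
   case (elim v)
   have "\<bar>\<Sum>i\<le>K. spacing K v i * ln (spacing K v i)\<bar> <= (\<Sum>i\<le>K. 1)"
    using xlnx_bounds elim by (intro order.trans[OF sum_abs] sum_mono) (auto simp: abs_le_iff intro: order.trans)
   then have "\<bar>al * (\<Sum>i\<le>K. spacing K v i * ln (spacing K v i))\<bar> <= \<bar>al\<bar> * (real K + 1)"
    unfolding abs_mult by (intro mult_left_mono) auto
   then have "\<bar>g v\<bar> <= \<bar>al\<bar> * (real K + 1) + real K" unfolding g_def using elim by linarith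
   then show ?case by (metis abs_ge_zero norm_power power2_abs power_mono real_norm_def)
  qed
 qed measurable
 have nz: "(LINT v|pivot_space K. (g v)\<^sup>2) \<noteq> 0"
 proof
  assume "(LINT v|pivot_space K. (g v)\<^sup>2) = 0"
  then have z: "AE v in pivot_space K. g v = 0"
   using integral_nonneg_eq_0_iff_AE[OF int] by auto
  \<comment> \<open>K + 1 terms of size c, multiplied by |al|, stay below 1, the lower bound of the
    optimal cost.\<close>
  define c where "c = 1 / ((\<bar>al\<bar> + 1) * (real K + 1))"
  have c: "c > 0" by (simp add: c_def)
  have lim: "((%x::real. x * ln x) \<longlongrightarrow> 0) (at_right 0)" "((%x::real. (1 - x) * ln (1 - x)) \<longlongrightarrow> 0) (at_right 0)"
   by real_asymp+
  have "eventually (%x::real. x * ln x > - c) (at_right 0)" "eventually (%x::real. (1 - x) * ln (1 - x) > - c) (at_right 0)"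
   using c by (auto intro!: order_tendstoD(1)[OF lim(1)] order_tendstoD(1)[OF lim(2)])
  then obtain d where d: "d > 0" "!!x::real. 0 < x ==> x < d ==> x * ln x > - c \<and> (1 - x) * ln (1 - x) > - c"
   unfolding eventually_at_right_field by (metis (no_types, lifting) min_less_iff_conj)
  define e where "e = min d (1/2)"
  have e: "0 < e" "e <= d" "e <= 1/2" using d by (auto simp: e_def)
  have U: "emeasure unif01 {1 - e<..} = ennreal e"
  proof -
   have "{0..1} \<inter> {1 - e<..} = {1 - e<..1}" using e by auto
   then show ?thesis using e by (simp add: emeasure_unif01)
  qed
  have "AE v in pivot_space K. \<not> (\<forall>j\<in>{1..K}. v j \<in> {1 - e<..})"
   using z bnds AE_pivot_space_unit
  proof eventually_elim
   case (elim v)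
   show ?case
   proof
    assume A: "\<forall>j\<in>{1..K}. v j \<in> {1 - e<..}"
    have p1: "pivot K v 1 > 1 - e" using pivot_in_image[of 1 K v] K A by auto
    then have s0: "spacing K v 0 > 1 - e" by (simp add: spacing_def)
    have each: "- c < spacing K v i * ln (spacing K v i)" if i: "i <= K" for i
    proof (cases "i = 0")
     case True
     show ?thesis
     proof (cases "spacing K v 0 = 1")
      case False
      then have "0 < 1 - spacing K v 0" "1 - spacing K v 0 < d" using s0 e elim(2) by (auto simp: less_le)
      then show ?thesis using d(2)[of "1 - spacing K v 0"] True by simp
     qed (use True c in simp)
    next
     case False
     have "spacing K v 0 + spacing K v i <= (\<Sum>i\<le>K. spacing K v i)"
      using sum_mono2[of "{..K}" "{0, i}" "spacing K v"] elim(2) False i by auto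
     then have "spacing K v i < d" using s0 e by (simp add: sum_spacing)
     then show ?thesis using d(2)[of "spacing K v i"] elim(2) c
      by (cases "spacing K v i = 0") (auto simp: less_le)
    qed
    have "\<bar>\<Sum>i\<le>K. spacing K v i * ln (spacing K v i)\<bar> <= (\<Sum>i\<le>K. c)"
    proof (intro order.trans[OF sum_abs] sum_mono)
     fix i assume "i \<in> {..K}"
     then show "\<bar>spacing K v i * ln (spacing K v i)\<bar> <= c"
      using each[of i] xlnx_bounds[of "spacing K v i"] elim(2) by auto
    qed
    also have "(\<Sum>i\<le>K. c) = 1 / (\<bar>al\<bar> + 1)"
    proof -
     have "(real K + 1) * c = 1 / (\<bar>al\<bar> + 1)" by (simp add: c_def)
     then show ?thesis by (simp add: add.commute)
    qed
    finally have "\<bar>al * (\<Sum>i\<le>K. spacing K v i * ln (spacing K v i))\<bar> <= \<bar>al\<bar> * (1 / (\<bar>al\<bar> + 1))"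
     unfolding abs_mult by (intro mult_left_mono) auto
    also have "... < 1" by (simp add: divide_less_eq)
    finally have "g v > 0" unfolding g_def using elim(2) by linarith
    then show False using elim(1) by simp
   qed
  qed
  then have "AE v in pivot_space K. (indicator {v. \<forall>j\<in>{1..K}. v j \<in> {1 - e<..}} v :: ennreal) = 0"
   by eventually_elim (simp add: indicator_def)
  then have "(\<integral>\<^sup>+v. indicator {v. \<forall>j\<in>{1..K}. v j \<in> {1 - e<..}} v \<partial>pivot_space K) = 0"
   by (subst nn_integral_0_iff_AE) (auto intro!: box_measurable)
  moreover have "(\<integral>\<^sup>+v. indicator {v. \<forall>j\<in>{1..K}. v j \<in> {1 - e<..}} v \<partial>pivot_space K) = emeasure unif01 {1 - e<..} ^ card {1..K}"
   by (rule emeasure_box_unif01) auto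
  ultimately have "ennreal e ^ card {1..K} = 0" unfolding U by simp
  then show False using e by simp
 qed
 have "(LINT v|pivot_space K. (g v)\<^sup>2) >= 0" by (intro integral_nonneg_AE) auto
 then have "(LINT v|pivot_space K. (g v)\<^sup>2) > 0" using nz by (metis order_le_less)
 then show ?thesis using K unfolding sigma_sq_def g_def al_def by simp
qed

lemma (in optimal_quicksort) variance_equivalent:
 assumes K1: "K >= 1"
 shows "(%n. N.variance (%om. real (X n om))) \<sim>[at_top] (%n. sigma_sq K * (real n)\<^sup>2)"
proof (rule asymp_equivI'_const)
 show "(%n. N.variance (%om. real (X n om)) / (real n)\<^sup>2) \<longlonglongrightarrow> sigma_sq K"
  using variance_asymptotics[OF K1] unfolding var_X_def .
 show "sigma_sq K \<noteq> 0" using sigma_sq_pos[OF K1] by simp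
qed

section \<open>Three pivots\<close>

text \<open>The iterated antiderivatives of \<open>- x ln x\<close> that vanish at \<open>0\<close>.\<close>

definition entropy_int :: "nat => real => real" where
 "entropy_int k x = x ^ (k + 1) / fact (k + 1) * (harm (k + 1) - 1 - ln x)"

lemma entropy_int_0: "entropy_int 0 x = - (x * ln x)"
 by (simp add: entropy_int_def harm_expand)

lemma entropy_int_nonneg: "0 <= x ==> x <= 1 ==> 0 <= entropy_int 0 x"
 using xlnx_bounds[of x] by (simp add: entropy_int_0)

lemma entropy_int_at_0 [simp]: "entropy_int k 0 = 0"
 by (simp add: entropy_int_def)

lemma entropy_int_measurable [measurable]: "entropy_int k \<in> borel_measurable borel"
 unfolding entropy_int_def by measurable

text \<open>Differentiating the logarithm lowers the constant by 1 / (k + 2), which is the step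
  between consecutive harmonic numbers.\<close>

lemma has_field_derivative_entropy_int [derivative_intros]:
 assumes "(g has_field_derivative g') (at t within S)" "0 < g t"
 shows "((%t. entropy_int (Suc k) (g t)) has_field_derivative entropy_int k (g t) * g') (at t within S)"
proof -
 have "(entropy_int (Suc k) has_field_derivative entropy_int k x) (at x)" if "x > 0" for x
 proof -
  have 1: "real (k + 2) * x ^ (k + 1) / fact (k + 2) = x ^ (k + 1) / fact (k + 1)"
  proof -
   have f: "fact (k + 2) = real (k + 2) * fact (k + 1)" by simp
   show ?thesis unfolding f by (subst nonzero_mult_divide_mult_cancel_left) auto
  qed
  have P: "((%x. x ^ (k + 2) / fact (k + 2)) has_real_derivative x ^ (k + 1) / fact (k + 1)) (at x)"
   using DERIV_cdivide[OF DERIV_pow[of "k + 2" x], of "fact (k + 2)"] 1 by (simp add: add.commute)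
  have L: "((%x. harm (k + 2) - 1 - ln x) has_real_derivative - (1 / x)) (at x)"
   using that by (auto intro!: derivative_eq_intros)
  have k: "Suc k + 1 = k + 2" by simp
  show ?thesis
   unfolding entropy_int_def[abs_def] k
  proof (rule DERIV_cong[OF DERIV_mult[OF P L]])
   have "- (1 / x) * (x ^ (k + 2) / fact (k + 2)) = x ^ (k + 1) / fact (k + 1) * (- (1 / real (k + 2)))"
   proof -
    have "- (1 / x) * (x * y / (n * f)) = y / f * (- (1 / n))" for y n f :: real
     using that by simp
    moreover have "x ^ (k + 2) = x * x ^ (k + 1)" "fact (k + 2) = real (k + 2) * fact (k + 1)" by auto
    ultimately show ?thesis by presburger
   qed
   moreover have "harm (k + 2) - 1 / real (k + 2) = (harm (k + 1) :: real)"
    by (simp add: harm_Suc inverse_eq_divide)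
   ultimately show "x ^ (k + 1) / fact (k + 1) * (harm (k + 2) - 1 - ln x) + - (1 / x) * (x ^ (k + 2) / fact (k + 2))
    = x ^ (k + 1) / fact (k + 1) * (harm (k + 1) - 1 - ln x)"
    by (metis (no_types, opaque_lifting) add_diff_eq diff_add_eq diff_conv_add_uminus distrib_left)
  qed
 qed
 from DERIV_chain2[OF this[OF assms(2)] assms(1)] show ?thesis .
qed

text \<open>A factor x ln x can be split off, so the formula stays continuous at 0 in spite of the
  logarithm.\<close>

lemma continuous_on_entropy_int [continuous_intros]:
 assumes "continuous_on S g" "!!t. t \<in> S ==> 0 <= g t"
 shows "continuous_on S (%t. entropy_int k (g t))"
proof -
 have "entropy_int k x = x ^ k / fact (k + 1) * ((harm (k + 1) - 1) * x - x * ln x)" for x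
  by (simp add: entropy_int_def algebra_simps)
 moreover have "continuous_on {0..} (%x::real. x ^ k / fact (k + 1) * ((harm (k + 1) - 1) * x - x * ln x))"
  by (intro continuous_intros continuous_on_xlnx) auto
 ultimately have "continuous_on {0..} (entropy_int k)" by presburger
 from continuous_on_compose2[OF this assms(1)] assms(2) show ?thesis by auto
qed

section \<open>Integration by parts and logarithmic integrals\<close>

text \<open>The antiderivative of a cubic polynomial times
  \<open>entropy_int k (\<beta> + \<delta> * t)\<close>: the polynomial is differentiated and the
  logarithmic factor integrated until, after four rounds, the polynomial is gone.\<close>

definition parts_int :: "real => real => real => real => nat => real => real => real => real" where
 "parts_int a b c d k \<beta> \<delta> t =
   (a + b * t + c * t\<^sup>2 + d * t ^ 3) * entropy_int (k + 1) (\<beta> + \<delta> * t) / \<delta>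
   - (b + 2 * c * t + 3 * d * t\<^sup>2) * entropy_int (k + 2) (\<beta> + \<delta> * t) / \<delta>\<^sup>2
   + (2 * c + 6 * d * t) * entropy_int (k + 3) (\<beta> + \<delta> * t) / \<delta> ^ 3
   - 6 * d * entropy_int (k + 4) (\<beta> + \<delta> * t) / \<delta> ^ 4"

text \<open>The linear form may vanish at an end of the interval. Therefore the fundamental theorem
  is used with derivatives in the interior and continuity up to the ends.\<close>

lemma has_integral_parts_int:
 assumes "0 <= l" "0 <= \<beta>" "0 <= \<beta> + \<delta> * l" "\<delta> \<noteq> 0"
 shows "((%t. (a + b * t + c * t\<^sup>2 + d * t ^ 3) * entropy_int k (\<beta> + \<delta> * t)) has_integral
  parts_int a b c d k \<beta> \<delta> l - parts_int a b c d k \<beta> \<delta> 0) {0..l}"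
proof (rule fundamental_theorem_of_calculus_interior[OF assms(1)])
 have conv: "\<beta> + \<delta> * t >= 0 \<and> (t \<in> {0<..<l} \<longrightarrow> \<beta> + \<delta> * t > 0)" if "t \<in> {0..l}" for t
 proof (cases "\<delta> > 0")
  case True
  then show ?thesis using that assms by (auto intro: add_nonneg_pos)
 next
  case False
  then have "\<delta> < 0" using assms by auto
  then have "\<delta> * l <= \<delta> * t" "t < l \<longrightarrow> \<delta> * l < \<delta> * t"
   using that by (auto intro: mult_left_mono_neg mult_strict_left_mono_neg)
  then show ?thesis using assms(3) by auto
 qed
 show "continuous_on {0..l} (parts_int a b c d k \<beta> \<delta>)"
  unfolding parts_int_def using conv assms(4) by (intro continuous_intros) auto
 fix t assume t: "t \<in> {0<..<l}"
 then have p: "\<beta> + \<delta> * t > 0" using conv[of t] by auto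
 have E: "((%t. entropy_int (Suc j) (\<beta> + \<delta> * t)) has_real_derivative entropy_int j (\<beta> + \<delta> * t) * \<delta>) (at t)" for j
  using p by (auto intro!: derivative_eq_intros)
 have k: "k + 4 = Suc (k + 3)" "k + 3 = Suc (k + 2)" "k + 2 = Suc (k + 1)" "k + 1 = Suc k" by auto
 have P0: "((%t. a + b * t + c * t\<^sup>2 + d * t ^ 3) has_real_derivative b + 2 * c * t + 3 * d * t\<^sup>2) (at t)"
  and P1: "((%t. b + 2 * c * t + 3 * d * t\<^sup>2) has_real_derivative 2 * c + 6 * d * t) (at t)"
  and P2: "((%t. 2 * c + 6 * d * t) has_real_derivative 6 * d) (at t)"
  by (auto intro!: derivative_eq_intros)
 note D = DERIV_diff[OF DERIV_add[OF DERIV_diff[OF DERIV_cdivide[OF DERIV_mult'[OF P0 E[of k, folded k(4)]], of \<delta>]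
  DERIV_cdivide[OF DERIV_mult'[OF P1 E[of "k + 1", folded k(3)]], of "\<delta>\<^sup>2"]]
  DERIV_cdivide[OF DERIV_mult'[OF P2 E[of "k + 2", folded k(2)]], of "\<delta> ^ 3"]]
  DERIV_cdivide[OF DERIV_cmult[OF E[of "k + 3", folded k(1)], of "6 * d"], of "\<delta> ^ 4"]]
 have "(parts_int a b c d k \<beta> \<delta> has_real_derivative
   (a + b * t + c * t\<^sup>2 + d * t ^ 3) * entropy_int k (\<beta> + \<delta> * t)) (at t)"
  unfolding parts_int_def[abs_def]
 proof (rule DERIV_cong[OF D])
  show "((a + b * t + c * t\<^sup>2 + d * t ^ 3) * (entropy_int k (\<beta> + \<delta> * t) * \<delta>) +
    (b + 2 * c * t + 3 * d * t\<^sup>2) * entropy_int (k + 1) (\<beta> + \<delta> * t)) / \<delta> -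
   ((b + 2 * c * t + 3 * d * t\<^sup>2) * (entropy_int (k + 1) (\<beta> + \<delta> * t) * \<delta>) +
    (2 * c + 6 * d * t) * entropy_int (k + 2) (\<beta> + \<delta> * t)) / \<delta>\<^sup>2 +
   ((2 * c + 6 * d * t) * (entropy_int (k + 2) (\<beta> + \<delta> * t) * \<delta>) +
    6 * d * entropy_int (k + 3) (\<beta> + \<delta> * t)) / \<delta> ^ 3 -
   6 * d * (entropy_int (k + 3) (\<beta> + \<delta> * t) * \<delta>) / \<delta> ^ 4
   = (a + b * t + c * t\<^sup>2 + d * t ^ 3) * entropy_int k (\<beta> + \<delta> * t)"
   (is "(?P * (?E0 * \<delta>) + ?Q * ?E1) / \<delta> - (?Q * (?E1 * \<delta>) + ?R * ?E2) / \<delta>\<^sup>2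
    + (?R * (?E2 * \<delta>) + ?T * ?E3) / \<delta> ^ 3 - ?T * (?E3 * \<delta>) / \<delta> ^ 4 = _")
  proof -
   have "(p * (e0 * \<delta>) + q * e1) / \<delta> - (q * (e1 * \<delta>) + r * e2) / \<delta>\<^sup>2
    + (r * (e2 * \<delta>) + u * e3) / \<delta> ^ 3 - u * (e3 * \<delta>) / \<delta> ^ 4 = p * e0" for p q r u e0 e1 e2 e3 :: real
    using assms(4) by (simp add: add_divide_distrib power2_eq_square power3_eq_cube power4_eq_xxxx)
   then show ?thesis .
  qed
 qed
 then show "(parts_int a b c d k \<beta> \<delta> has_vector_derivative
   (a + b * t + c * t\<^sup>2 + d * t ^ 3) * entropy_int k (\<beta> + \<delta> * t)) (at t)"
  by (simp add: has_real_derivative_iff_has_vector_derivative)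
qed

lemma nn_integral_between:
 fixes f :: "real => real"
 assumes "(f has_integral I) {0..l}" "!!t. 0 < t ==> t < l ==> 0 <= f t"
 shows "(\<integral>\<^sup>+t. ennreal (f t) * indicator {0<..<l} t \<partial>lborel) = ennreal I"
proof (rule nn_integral_has_integral_lebesgue')
 show "(f has_integral I) {0<..<l}"
  using assms(1) has_integral_Icc_iff_Ioo by blast
qed (use assms(2) in auto)

lemma has_integral_ln_square:
 assumes "k >= 1"
 shows "((%x::real. x ^ k * (ln x)\<^sup>2) has_integral 2 / real (k + 1) ^ 3) {0..1}"
proof -
 obtain j where j: "k = Suc j" using assms by (cases k) auto
 \<comment> \<open>Written with x ln x to make continuity at 0 visible; the equivalent form below is
   the one that is differentiated.\<close>
 define G where "G x = x ^ j * ((x * ln x)\<^sup>2 / real (k + 1) - 2 * x * (x * ln x) / real (k + 1) ^ 2 + 2 * x\<^sup>2 / real (k + 1) ^ 3)" for x :: real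
 have G: "G x = x ^ (k + 1) * ((ln x)\<^sup>2 / real (k + 1) - 2 * ln x / real (k + 1) ^ 2 + 2 / real (k + 1) ^ 3)" for x
  unfolding G_def j by (simp add: algebra_simps power2_eq_square)
 have "((%x::real. x ^ k * (ln x)\<^sup>2) has_integral G 1 - G 0) {0..1}"
 proof (rule fundamental_theorem_of_calculus_interior)
  show "continuous_on {0..1} G" unfolding G_def
   by (intro continuous_intros continuous_on_subset[OF continuous_on_xlnx]) auto
  fix x :: real assume x: "x \<in> {0<..<1}"
  define N where "N = real (k + 1)"
  have N: "N > 0" by (simp add: N_def)
  have xk: "x ^ (k + 1) = x * x ^ k" by simp
  have P: "((%x. x ^ (k + 1)) has_real_derivative N * x ^ k) (at x)"
   using DERIV_pow[of "k + 1" x] by (simp add: N_def)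
  have l: "(ln has_real_derivative 1 / x) (at x)" using x DERIV_ln_divide by auto
  have "((%x. (ln x)\<^sup>2) has_real_derivative 2 * ln x * (1 / x)) (at x)"
   using DERIV_power[OF l, of 2] by simp
  note L = DERIV_add[OF DERIV_diff[OF DERIV_cdivide[OF this, of N] DERIV_cdivide[OF DERIV_cmult[OF l, of 2], of "N\<^sup>2"]]
   DERIV_const[of "2 / N ^ 3"]]
  have "(G has_real_derivative x ^ k * (ln x)\<^sup>2) (at x)"
   unfolding G[abs_def] N_def[symmetric]
  proof (rule DERIV_cong[OF DERIV_mult[OF P L]])
   have "N * y * (l\<^sup>2 / N - 2 * l / N\<^sup>2 + 2 / N ^ 3) + (2 * l * (1 / x) / N - 2 * (1 / x) / N\<^sup>2) * (x * y) = y * l\<^sup>2"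
    for y l :: real
   proof -
    have "N * y * (l\<^sup>2 / N) = y * l\<^sup>2" "N * y * (2 * l / N\<^sup>2) = 2 * l / N * y" "N * y * (2 / N ^ 3) = 2 / N\<^sup>2 * y"
     "2 * l * (1 / x) / N * (x * y) = 2 * l / N * y" "2 * (1 / x) / N\<^sup>2 * (x * y) = 2 / N\<^sup>2 * y"
     using x N by (simp_all add: power2_eq_square power3_eq_cube)
    then show ?thesis unfolding distrib_left right_diff_distrib left_diff_distrib by linarith
   qed
   from this[of "x ^ k" "ln x"] show "N * x ^ k * ((ln x)\<^sup>2 / N - 2 * ln x / N\<^sup>2 + 2 / N ^ 3) +
    (2 * ln x * (1 / x) / N - 2 * (1 / x) / N\<^sup>2 + 0) * x ^ (k + 1) = x ^ k * (ln x)\<^sup>2" unfolding xk by simp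
  qed
  then show "(G has_vector_derivative x ^ k * (ln x)\<^sup>2) (at x)"
   by (simp add: has_real_derivative_iff_has_vector_derivative)
 qed auto
 then show ?thesis by (simp add: G)
qed

lemma has_integral_power_ln:
 "((%x::real. x ^ k * ln x) has_integral - 1 / real (k + 1) ^ 2) {0..1}"
proof -
 define G where "G x = x ^ k * ((x * ln x) / real (k + 1) - x / real (k + 1) ^ 2)" for x :: real
 have G: "G x = x ^ (k + 1) * (ln x / real (k + 1) - 1 / real (k + 1) ^ 2)" for x
  unfolding G_def by (simp add: algebra_simps)
 have "((%x::real. x ^ k * ln x) has_integral G 1 - G 0) {0..1}"
 proof (rule fundamental_theorem_of_calculus_interior)
  show "continuous_on {0..1} G" unfolding G_def
   by (intro continuous_intros continuous_on_subset[OF continuous_on_xlnx]) auto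
  fix x :: real assume x: "x \<in> {0<..<1}"
  define N where "N = real (k + 1)"
  have N: "N > 0" by (simp add: N_def)
  have P: "((%x. x ^ (k + 1)) has_real_derivative N * x ^ k) (at x)"
   using DERIV_pow[of "k + 1" x] by (simp add: N_def)
  have L: "((%x. ln x / N - 1 / N ^ 2) has_real_derivative 1 / x / N) (at x)"
   using x N by (auto intro!: derivative_eq_intros simp: field_simps)
  have "(G has_real_derivative x ^ k * ln x) (at x)"
   unfolding G[abs_def] N_def[symmetric]
  proof (rule DERIV_cong[OF DERIV_mult[OF P L]])
   have "N * y * (l / N - 1 / N\<^sup>2) + 1 / x / N * (x * y) = y * l" for y l :: real
    using x N by (simp add: field_simps power2_eq_square)
   then show "N * x ^ k * (ln x / N - 1 / N\<^sup>2) + 1 / x / N * x ^ (k + 1) = x ^ k * ln x" by simp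
  qed
  then show "(G has_vector_derivative x ^ k * ln x) (at x)"
   by (simp add: has_real_derivative_iff_has_vector_derivative)
 qed auto
 then show ?thesis by (simp add: G)
qed

text \<open>Partial fractions: 1 / (x (x+m)^2) = (1/x - 1/(x+m)) / m^2 - 1 / (m (x+m)^2). The first
  part telescopes to H_m / m^2, the second is a tail of the series of inverse squares.\<close>

lemma sums_inverse_times_square:
 assumes "m >= 1"
 shows "(%j. 1 / (real (j + 1) * (real (j + 1 + m))\<^sup>2)) sums
   (harm m / (real m)\<^sup>2 - (pi\<^sup>2 / 6 - (\<Sum>i=1..m. 1 / (real i)\<^sup>2)) / real m)"
proof -
 have m: "real m > 0" using assms by simp
 have sq: "(%j. 1 / (real (j + 1 + m))\<^sup>2) sums (pi\<^sup>2 / 6 - (\<Sum>i=1..m. 1 / (real i)\<^sup>2))"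
 proof -
  have "(%j. 1 / (real (j + m) + 1)\<^sup>2) sums (pi\<^sup>2 / 6 - (\<Sum>i<m. 1 / (real i + 1)\<^sup>2))"
   using sums_split_initial_segment[OF inverse_squares_sums, of m] by (simp add: add_ac)
  moreover have "(\<Sum>i<m. 1 / (real i + 1)\<^sup>2) = (\<Sum>i=1..m. 1 / (real i)\<^sup>2)"
   by (rule sum.reindex_bij_witness[of _ "%i. i - 1" Suc]) (auto simp: add.commute)
  ultimately show ?thesis by (simp add: add_ac)
 qed
 have "(%j. harm (j + m) - harm j :: real) \<longlonglongrightarrow> 0"
 proof (rule tendsto_sandwich[of "%_. 0" _ _ "%j. real m * (1 / real (j + 1))"])
  have h: "(harm (j + m) :: real) - harm j = (\<Sum>i\<in>{j+1..j+m}. 1 / real i)" for j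
  proof -
   have "{1..j+m} = {1..j} \<union> {j+1..j+m}" by auto
   then show ?thesis unfolding harm_def by (simp add: sum.union_disjoint inverse_eq_divide)
  qed
  show "\<forall>\<^sub>F j in sequentially. (0::real) <= harm (j + m) - harm j"
   unfolding h by (intro always_eventually allI sum_nonneg) auto
  have "(\<Sum>i\<in>{j+1..j+m}. 1 / real i) <= (\<Sum>i\<in>{j+1..j+m}. 1 / real (j + 1))" for j
   by (intro sum_mono divide_left_mono) auto
  then show "\<forall>\<^sub>F j in sequentially. (harm (j + m) :: real) - harm j <= real m * (1 / real (j + 1))"
   unfolding h by simp
  show "(%j. real m * (1 / real (j + 1))) \<longlonglongrightarrow> 0" by real_asymp
 qed simp
 then have "(%j. harm m - (harm (j + m) - harm j) :: real) \<longlonglongrightarrow> harm m - 0" by (intro tendsto_intros)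
 moreover have "(\<Sum>i<n. 1 / real (i + 1) - 1 / real (i + 1 + m)) = harm m - (harm (n + m) - harm n)" for n
  by (induction n) (auto simp: harm_Suc harm_expand(1) inverse_eq_divide)
 ultimately have tel: "(%i. 1 / real (i + 1) - 1 / real (i + 1 + m)) sums harm m" by (simp add: sums_def)
 have "1 / (real (j + 1) * (real (j + 1 + m))\<^sup>2)
   = (1 / real (j + 1) - 1 / real (j + 1 + m)) / (real m)\<^sup>2 - 1 / (real (j + 1 + m))\<^sup>2 / real m" for j
 proof -
  define x where "x = real (j + 1)"
  have x: "x > 0" "real (j + 1 + m) = x + real m" by (auto simp: x_def)
  have "1 / (x * (x + y)\<^sup>2) = (1 / x - 1 / (x + y)) / y\<^sup>2 - 1 / (x + y)\<^sup>2 / y" if "y > 0" for y :: real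
  proof -
   have nz: "x \<noteq> 0" "y \<noteq> 0" "x + y \<noteq> 0" using x that by auto
   then show ?thesis by (simp add: divide_simps) (simp add: algebra_simps power2_eq_square)
  qed
  from this[OF m] show ?thesis unfolding x(2) x_def[symmetric] .
 qed
 then show ?thesis using sums_diff[OF sums_divide[OF tel, of "(real m)\<^sup>2"] sums_divide[OF sq, of "real m"]] by simp
qed

lemma ln_1_minus_series:
 fixes x :: real
 assumes "0 < x" "x < 1"
 shows "(%j. x ^ (j + 1) / real (j + 1)) sums (- ln (1 - x))"
proof -
 have "(%n. x ^ n / real n) sums (- ln (1 - x))"
  using sums_minus[OF ln_series'[of "- x"]] assms by simp
 from sums_split_initial_segment[OF this, of 1] show ?thesis by simp
qed

text \<open>Expand - ln (1 - x) as a power series. All terms are nonnegative on (0,1), so sum and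
  integral may be exchanged; the square of pi in the final constant originates here.\<close>

lemma nn_integral_ln_ln:
 shows "(\<integral>\<^sup>+x. ennreal (x ^ k * (ln x * ln (1 - x))) * indicator {0<..<1} x \<partial>lborel)
  = ennreal (harm (k + 1) / (real (k + 1))\<^sup>2 - (pi\<^sup>2 / 6 - (\<Sum>i=1..k+1. 1 / (real i)\<^sup>2)) / real (k + 1))"
proof -
 define f where "f j x = x ^ (k + (j + 1)) * (- ln x) / real (j + 1)" for j and x :: real
 have f0: "0 <= f j x" if "0 < x" "x < 1" for j x
  unfolding f_def using that by (intro divide_nonneg_nonneg mult_nonneg_nonneg) auto
 have fs: "(%j. f j x) sums (x ^ k * (ln x * ln (1 - x)))" if "0 < x" "x < 1" for x
  using sums_mult[OF ln_1_minus_series[OF that], of "x ^ k * (- ln x)"]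
  by (simp add: f_def power_add mult_ac)
 have "(\<integral>\<^sup>+x. ennreal (x ^ k * (ln x * ln (1 - x))) * indicator {0<..<1} x \<partial>lborel)
   = (\<integral>\<^sup>+x. (\<Sum>j. ennreal (f j x) * indicator {0<..<1} x) \<partial>lborel)"
 proof (intro nn_integral_cong)
  fix x :: real
  show "ennreal (x ^ k * (ln x * ln (1 - x))) * indicator {0<..<1} x = (\<Sum>j. ennreal (f j x) * indicator {0<..<1} x)"
  proof (cases "x \<in> {0<..<1}")
   case True
   then have x: "0 < x" "x < 1" by auto
   have "(\<Sum>j. ennreal (f j x)) = ennreal (\<Sum>j. f j x)"
    by (rule suminf_ennreal2[OF f0[OF x] sums_summable[OF fs[OF x]]])
   also have "(\<Sum>j. f j x) = x ^ k * (ln x * ln (1 - x))" by (rule sums_unique[OF fs[OF x], symmetric])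
   finally have "(\<Sum>j. ennreal (f j x)) = ennreal (x ^ k * (ln x * ln (1 - x)))" .
   then show ?thesis using True by simp
  qed simp
 qed
 also have "... = (\<Sum>j. \<integral>\<^sup>+x. ennreal (f j x) * indicator {0<..<1} x \<partial>lborel)"
  unfolding f_def by (intro nn_integral_suminf) measurable
 also have "... = (\<Sum>j. ennreal (1 / (real (j + 1) * (real (j + 1 + (k + 1)))\<^sup>2)))"
 proof (intro arg_cong[where f = suminf] ext nn_integral_between f0)
  fix j
  show "(f j has_integral 1 / (real (j + 1) * (real (j + 1 + (k + 1)))\<^sup>2)) {0..1}"
   using has_integral_mult_right[OF has_integral_power_ln[of "k + (j + 1)"], of "- 1 / real (j + 1)"]
   by (simp add: f_def[abs_def] mult_ac add_ac)
 qed
 also have "... = ennreal (harm (k + 1) / (real (k + 1))\<^sup>2 - (pi\<^sup>2 / 6 - (\<Sum>i=1..k+1. 1 / (real i)\<^sup>2)) / real (k + 1))"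
  by (subst suminf_ennreal2[OF _ sums_summable[OF sums_inverse_times_square[of "k + 1"]]])
   (auto simp only: sums_unique[OF sums_inverse_times_square[of "k + 1"], symmetric] intro!: divide_nonneg_nonneg mult_nonneg_nonneg, auto)
 finally show ?thesis .
qed

section \<open>Integration over the simplex of spacings\<close>

abbreviation borel4 :: "(real \<times> real \<times> real \<times> real) measure" where
 "borel4 \<equiv> borel \<Otimes>\<^sub>M borel \<Otimes>\<^sub>M borel \<Otimes>\<^sub>M borel"

text \<open>Integration over the plane of coordinate sum 1, charted by the first three coordinates.
  With values in \<open>ennreal\<close>, exchanging integrals and substituting ask for measurability
  only.\<close>

definition plane_integral :: "(real \<times> real \<times> real \<times> real => ennreal) => ennreal" where
 "plane_integral H = (\<integral>\<^sup>+x. \<integral>\<^sup>+y. \<integral>\<^sup>+z. H (x, y, z, 1 - x - y - z) \<partial>lborel \<partial>lborel \<partial>lborel)"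

lemma plane_integral_swap12:
 assumes [measurable]: "H \<in> borel_measurable borel4"
 shows "plane_integral (%(x, y, z, w). H (y, x, z, w)) = plane_integral H"
proof -
 have "plane_integral (%(x, y, z, w). H (y, x, z, w))
   = (\<integral>\<^sup>+x. \<integral>\<^sup>+y. \<integral>\<^sup>+z. H (y, x, z, 1 - y - x - z) \<partial>lborel \<partial>lborel \<partial>lborel)"
  unfolding plane_integral_def prod.case by (intro nn_integral_cong arg_cong[where f = H]) simp
 also have "... = plane_integral H"
  unfolding plane_integral_def by (rule lborel_pair.Fubini') measurable
 finally show ?thesis .
qed

lemma plane_integral_swap23:
 assumes [measurable]: "H \<in> borel_measurable borel4"
 shows "plane_integral (%(x, y, z, w). H (x, z, y, w)) = plane_integral H"
proof -
 have "plane_integral (%(x, y, z, w). H (x, z, y, w))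
   = (\<integral>\<^sup>+x. \<integral>\<^sup>+y. \<integral>\<^sup>+z. H (x, z, y, 1 - x - z - y) \<partial>lborel \<partial>lborel \<partial>lborel)"
  unfolding plane_integral_def prod.case by (intro nn_integral_cong arg_cong[where f = H]) simp
 also have "... = plane_integral H"
  unfolding plane_integral_def by (intro nn_integral_cong lborel_pair.Fubini') measurable
 finally show ?thesis .
qed

lemma plane_integral_swap34:
 assumes [measurable]: "H \<in> borel_measurable borel4"
 shows "plane_integral (%(x, y, z, w). H (x, y, w, z)) = plane_integral H"
proof -
 have "(\<integral>\<^sup>+z. H (x, y, z, 1 - x - y - z) \<partial>lborel) = (\<integral>\<^sup>+z. H (x, y, 1 - x - y - z, z) \<partial>lborel)" for x y
  using nn_integral_real_affine[of "%z. H (x, y, z, 1 - x - y - z)" "-1" "1 - x - y"] by simp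
 then show ?thesis unfolding plane_integral_def by simp
qed

lemma plane_integral_swap_pairs:
 assumes [measurable]: "H \<in> borel_measurable borel4"
 shows "plane_integral (%(x, y, z, w). H (z, w, x, y)) = plane_integral H"
proof -
 have m: "(%(x, y, z, w). H (x, z, y, w)) \<in> borel_measurable borel4"
  "(%(x, y, z, w). H (y, z, x, w)) \<in> borel_measurable borel4"
  "(%(x, y, z, w). H (y, w, x, z)) \<in> borel_measurable borel4" by measurable
 have "plane_integral H = plane_integral (%(x, y, z, w). H (x, z, y, w))"
  by (simp add: plane_integral_swap23)
 also have "... = plane_integral (%(x, y, z, w). H (y, z, x, w))" using plane_integral_swap12[OF m(1)] by simp
 also have "... = plane_integral (%(x, y, z, w). H (y, w, x, z))" using plane_integral_swap34[OF m(2)] by simp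
 also have "... = plane_integral (%(x, y, z, w). H (z, w, x, y))" using plane_integral_swap23[OF m(3)] by simp
 finally show ?thesis by simp
qed

text \<open>The map preserves x + y, hence the plane, and has determinant 1 / (1 + c). Exchanging
  the two pairs of coordinates moves it to the last pair, where it is an affine substitution in z
  alone.\<close>

lemma plane_integral_shear:
 assumes [measurable]: "H \<in> borel_measurable borel4" and c: "0 <= c"
 shows "plane_integral (%(x, y, z, w). H (x + c / (1 + c) * y, y / (1 + c), z, w)) = ennreal (1 + c) * plane_integral H"
proof -
 define d where "d = c / (1 + c)"
 define i where "i = 1 / (1 + c)"
 have i: "i > 0" "i = 1 - d" using c by (auto simp: i_def d_def field_simps)
 have e: "s * d + i * z = z + d * (s - z)" "s - (z + d * (s - z)) = i * (s - z)" for s z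
  unfolding i by (simp_all add: algebra_simps)
 have dv: "y / (1 + c) = i * y" for y by (simp add: i_def)
 have inner: "(\<integral>\<^sup>+z. H (z + d * (1 - x - y - z), i * (1 - x - y - z), x, y) \<partial>lborel)
  = ennreal (1 + c) * (\<integral>\<^sup>+z. H (z, 1 - x - y - z, x, y) \<partial>lborel)" for x y
 proof -
  have "(\<integral>\<^sup>+z. H (z, 1 - x - y - z, x, y) \<partial>lborel) = ennreal i *
    (\<integral>\<^sup>+z. H (z + d * (1 - x - y - z), i * (1 - x - y - z), x, y) \<partial>lborel)"
   using nn_integral_real_affine[of "%z. H (z, 1 - x - y - z, x, y)" i "(1 - x - y) * d"] i(1)
   by (simp add: e)
  then have "ennreal (1 + c) * (\<integral>\<^sup>+z. H (z, 1 - x - y - z, x, y) \<partial>lborel) = ennreal (1 + c) * ennreal i *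
    (\<integral>\<^sup>+z. H (z + d * (1 - x - y - z), i * (1 - x - y - z), x, y) \<partial>lborel)"
   by (simp add: mult.assoc)
  also have "ennreal (1 + c) * ennreal i = 1" unfolding i_def by (subst ennreal_mult[symmetric]) (use c in auto)
  finally show ?thesis by simp
 qed
 have "(%(x, y, z, w). H (x + d * y, i * y, z, w)) \<in> borel_measurable borel4" by measurable
 from plane_integral_swap_pairs[OF this]
 have "plane_integral (%(x, y, z, w). H (x + c / (1 + c) * y, y / (1 + c), z, w))
  = plane_integral (%(x, y, z, w). H (z + d * w, i * w, x, y))"
  unfolding d_def[symmetric] unfolding dv by simp
 also have "... = ennreal (1 + c) * plane_integral (%(x, y, z, w). H (z, w, x, y))"
  unfolding plane_integral_def by (simp add: inner nn_integral_cmult)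
 also have "plane_integral (%(x, y, z, w). H (z, w, x, y)) = plane_integral H"
  by (rule plane_integral_swap_pairs) fact
 finally show ?thesis .
qed

definition spacings :: "(nat => real) => real \<times> real \<times> real \<times> real" where
 "spacings v = (spacing 3 v 0, spacing 3 v 1, spacing 3 v 2, spacing 3 v 3)"

lemma spacings_measurable_compose:
 assumes "!!j. j \<in> {1..3} ==> f j \<in> borel_measurable M"
 shows "(%x. spacings (%j. f j x)) \<in> M \<rightarrow>\<^sub>M borel4"
proof -
 have [measurable]: "(%x. spacing 3 (%j. f j x) i) \<in> borel_measurable M" for i
  by (rule spacing_measurable[OF assms])
 show ?thesis unfolding spacings_def by measurable
qed

lemma spacings_measurable [measurable]: "spacings \<in> pivot_space 3 \<rightarrow>\<^sub>M borel4"
 using spacings_measurable_compose[of "%j v. v j" "pivot_space 3"] by (simp add: sets_pivot_space)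

definition positive4 :: "(real \<times> real \<times> real \<times> real) set" where
 "positive4 = {(x, y, z, w). 0 < x \<and> 0 < y \<and> 0 < z \<and> 0 < w}"

lemma positive4_measurable [measurable]: "positive4 \<in> sets borel4"
proof -
 have "{p \<in> space borel4. 0 < fst p \<and> 0 < fst (snd p) \<and> 0 < fst (snd (snd p)) \<and> 0 < snd (snd (snd p))} \<in> sets borel4"
  by measurable
 moreover have "positive4 = {p \<in> space borel4. 0 < fst p \<and> 0 < fst (snd p) \<and> 0 < fst (snd (snd p)) \<and> 0 < snd (snd (snd p))}"
  by (auto simp: positive4_def space_pair_measure)
 ultimately show ?thesis by (simp only:)
qed

lemma AE_spacings_positive: "AE v in pivot_space 3. spacings v \<in> positive4"
 using AE_pivot_space_inj[of 3] AE_pivot_space_unit[of 3]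
proof eventually_elim
 case (elim v)
 have "pivot 3 v j \<in> {0<..<1}" if "j \<in> {1..3}" for j
  using pivot_image[of 3 v] elim(2) that by (metis image_eqI image_iff)
 then have "0 < spacing 3 v i" if "i <= 3" for i
  using pivot_strict[OF elim(1), of i "Suc i"] that
  by (cases "i = 0"; cases "i = 3") (auto simp: spacing_def pivot_def[of 3 v 0] pivot_def[of 3 v 4])
 then show ?case by (simp add: spacings_def positive4_def)
qed

lemma iterated_integral_swap:
 fixes g :: "real \<times> real \<times> real => ennreal"
 assumes [measurable]: "g \<in> borel_measurable (borel \<Otimes>\<^sub>M borel \<Otimes>\<^sub>M borel)"
 shows "(\<integral>\<^sup>+x. \<integral>\<^sup>+y. \<integral>\<^sup>+z. g (y, x, z) \<partial>lborel \<partial>lborel \<partial>lborel) = (\<integral>\<^sup>+x. \<integral>\<^sup>+y. \<integral>\<^sup>+z. g (x, y, z) \<partial>lborel \<partial>lborel \<partial>lborel)"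
  and "(\<integral>\<^sup>+x. \<integral>\<^sup>+y. \<integral>\<^sup>+z. g (x, z, y) \<partial>lborel \<partial>lborel \<partial>lborel) = (\<integral>\<^sup>+x. \<integral>\<^sup>+y. \<integral>\<^sup>+z. g (x, y, z) \<partial>lborel \<partial>lborel \<partial>lborel)"
proof -
 show "(\<integral>\<^sup>+x. \<integral>\<^sup>+y. \<integral>\<^sup>+z. g (y, x, z) \<partial>lborel \<partial>lborel \<partial>lborel) = (\<integral>\<^sup>+x. \<integral>\<^sup>+y. \<integral>\<^sup>+z. g (x, y, z) \<partial>lborel \<partial>lborel \<partial>lborel)"
  by (rule lborel_pair.Fubini') measurable
 show "(\<integral>\<^sup>+x. \<integral>\<^sup>+y. \<integral>\<^sup>+z. g (x, z, y) \<partial>lborel \<partial>lborel \<partial>lborel) = (\<integral>\<^sup>+x. \<integral>\<^sup>+y. \<integral>\<^sup>+z. g (x, y, z) \<partial>lborel \<partial>lborel \<partial>lborel)"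
  by (intro nn_integral_cong lborel_pair.Fubini') measurable
qed

lemma nn_integral_pivot_space_3:
 assumes [measurable]: "f \<in> borel_measurable (\<Pi>\<^sub>M i\<in>{1..3}. borel)"
 shows "(\<integral>\<^sup>+v. f v \<partial>pivot_space 3)
  = (\<integral>\<^sup>+a. \<integral>\<^sup>+b. \<integral>\<^sup>+c. f ((%_::nat. undefined)(1 := c, 2 := b, 3 := a)) \<partial>unif01 \<partial>unif01 \<partial>unif01)"
proof -
 have I: "{1..3} = insert 3 (insert 2 (insert 1 ({} :: nat set)))" by auto
 have f: "f \<in> borel_measurable (\<Pi>\<^sub>M i\<in>insert 3 (insert 2 (insert 1 {})). unif01)"
  using assms unfolding I[symmetric] by (simp cong: measurable_cong_sets add: sets_pivot_space)
 have f2: "(%v. f (v(3 := a))) \<in> borel_measurable (\<Pi>\<^sub>M i\<in>insert 2 (insert 1 {}). unif01)" for a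
  by (rule measurable_compose[OF measurable_fun_upd f]) auto
 have f3: "(%v. f (v(2 := b, 3 := a))) \<in> borel_measurable (\<Pi>\<^sub>M i\<in>insert 1 {}. unif01)" for a b
  by (rule measurable_compose[OF measurable_fun_upd f2]) auto
 have "(\<integral>\<^sup>+v. f v \<partial>pivot_space 3)
  = (\<integral>\<^sup>+a. \<integral>\<^sup>+b. \<integral>\<^sup>+c. \<integral>\<^sup>+v. f (v(1 := c, 2 := b, 3 := a)) \<partial>(\<Pi>\<^sub>M i\<in>{}. unif01) \<partial>unif01 \<partial>unif01 \<partial>unif01)"
  unfolding I using unif01_product.product_nn_integral_insert_rev[OF _ _ f]
   unif01_product.product_nn_integral_insert_rev[OF _ _ f2] unif01_product.product_nn_integral_insert_rev[OF _ _ f3] by simp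
 then show ?thesis by (simp add: unif01_product.nn_integral_empty fun_upd_def)
qed

lemma nn_integral_unif01:
 "f \<in> borel_measurable borel ==> (\<integral>\<^sup>+x. f x \<partial>unif01) = (\<integral>\<^sup>+x. indicator {0..1} x * f x \<partial>lborel)"
 unfolding unif01_eq_density by (subst nn_integral_density) (auto simp: ennreal_indicator)

text \<open>Each term on the right vanishes unless its arguments increase strictly within (0,1).
  Hence at most the term of the sorted order survives, and in case of ties both sides are 0.\<close>

lemma spacings_eq_sorted:
 fixes a b c :: real
 assumes "v 1 = a" "v 2 = b" "v 3 = c" and H: "!!p. p \<notin> positive4 ==> H p = (0 :: ennreal)"
 defines "h x y z \<equiv> H (x, y - x, z - y, 1 - z)"
 shows "indicator {0..1} a * (indicator {0..1} b * (indicator {0..1} c * H (spacings v)))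
  = h a b c + h a c b + h b a c + h b c a + h c a b + h c b a"
proof -
 have s: "sort [a, b, c] = (if a <= b then if b <= c then [a, b, c] else if a <= c then [a, c, b] else [c, a, b]
  else if a <= c then [b, a, c] else if b <= c then [b, c, a] else [c, b, a])" by auto
 have p: "spacings v = (let q = sort [a, b, c] in (q ! 0, q ! 1 - q ! 0, q ! 2 - q ! 1, 1 - q ! 2))"
 proof -
  have "map v [1..<Suc 3] = [a, b, c]" using assms(1-3) by (simp add: upt_rec eval_nat_numeral)
  then have P: "pivot 3 v i = (if i = 0 then 0 else if i <= 3 then sort [a, b, c] ! (i - 1) else 1)" for i
   unfolding pivot_def by (simp only:)
  show ?thesis unfolding spacings_def spacing_def P Let_def by (simp del: sort_key_simps)
 qed
 have h0: "h x y z = 0" if "\<not> (0 < x \<and> x < y \<and> y < z \<and> z < 1)" for x y z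
  unfolding h_def using that by (intro H) (auto simp: positive4_def)
 have h1: "indicator {0..1} a * (indicator {0..1} b * (indicator {0..1} c * h x y z)) = h x y z"
  if "{x, y, z} = {a, b, c}" for x y z
 proof (cases "0 < x \<and> x < y \<and> y < z \<and> z < 1")
  case True
  then have "{x, y, z} \<subseteq> {0..1}" by auto
  then show ?thesis unfolding that by (auto simp: indicator_def)
 qed (simp add: h0)
 have h': "H (x, y - x, z - y, 1 - z) = h x y z" for x y z by (simp add: h_def)
 consider "a <= b" "b <= c" | "a <= b" "c < b" "a <= c" | "a <= b" "c < b" "c < a" | "b < a" "a <= c"
  | "b < a" "c < a" "b <= c" | "b < a" "c < a" "c < b" by linarith
 then show ?thesis
 proof cases
  case 1
  then have "H (spacings v) = h a b c" unfolding p s by (simp add: h')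
  then show ?thesis using 1 h1[of a b c] by (simp add: h0)
 next
  case 2
  then have "H (spacings v) = h a c b" unfolding p s by (simp add: h')
  then show ?thesis using 2 h1[of a c b] by (simp add: h0 insert_commute)
 next
  case 3
  then have "H (spacings v) = h c a b" unfolding p s by (simp add: h')
  then show ?thesis using 3 h1[of c a b] by (simp add: h0 insert_commute)
 next
  case 4
  then have "H (spacings v) = h b a c" unfolding p s by (simp add: h')
  then show ?thesis using 4 h1[of b a c] by (simp add: h0 insert_commute)
 next
  case 5
  then have "H (spacings v) = h b c a" unfolding p s by (simp add: h')
  then show ?thesis using 5 h1[of b c a] by (simp add: h0 insert_commute)
 next
  case 6
  then have "H (spacings v) = h c b a" unfolding p s by (simp add: h')
  then show ?thesis using 6 h1[of c b a] by (simp add: h0 insert_commute)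
 qed
qed

text \<open>The factor is 3!, the density of the spacings: the six orders of the pivots contribute
  equally after renaming the integration variables, and translations turn sorted pivots into
  spacings.\<close>

lemma nn_integral_spacings_positive:
 assumes [measurable]: "H \<in> borel_measurable borel4" and H: "!!p. p \<notin> positive4 ==> H p = 0"
 shows "(\<integral>\<^sup>+v. H (spacings v) \<partial>pivot_space 3) = 6 * plane_integral H"
proof -
 define h where "h p = (case p of (x, y, z) => H (x, y - x, z - y, 1 - z))" for p :: "real \<times> real \<times> real"
 have [measurable]: "h \<in> borel_measurable (borel \<Otimes>\<^sub>M borel \<Otimes>\<^sub>M borel)"
  unfolding h_def[abs_def] case_prod_beta by measurable
 define T where "T g = (\<integral>\<^sup>+x. \<integral>\<^sup>+y. \<integral>\<^sup>+z. g x y z \<partial>lborel \<partial>lborel \<partial>lborel)" for g :: "real => real => real => ennreal"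
 have m [measurable]: "(%v. H (spacings v)) \<in> borel_measurable (\<Pi>\<^sub>M i\<in>{1..3}. borel)"
  using measurable_compose[OF spacings_measurable assms(1)] by (simp cong: measurable_cong_sets add: sets_pivot_space)
 define u where "u a b c = (%_::nat. undefined)(1 := c, 2 := b, 3 := a :: real)" for a b c :: real
 have [measurable]: "(%x. H (spacings (u (f1 x) (f2 x) (f3 x)))) \<in> borel_measurable M"
  if "f1 \<in> borel_measurable M" "f2 \<in> borel_measurable M" "f3 \<in> borel_measurable M" for f1 f2 f3 and M :: "'z measure"
 proof (rule measurable_compose[OF _ assms(1)])
  have "(%x. u (f1 x) (f2 x) (f3 x) j) \<in> borel_measurable M" if "j \<in> {1..3}" for j
  proof -
   have "j = 1 \<or> j = 2 \<or> j = 3" using that by auto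
   then show ?thesis using \<open>f1 \<in> _\<close> \<open>f2 \<in> _\<close> \<open>f3 \<in> _\<close> by (auto simp: u_def)
  qed
  then show "(%x. spacings (u (f1 x) (f2 x) (f3 x))) \<in> M \<rightarrow>\<^sub>M borel4"
   using spacings_measurable_compose[of "%j x. u (f1 x) (f2 x) (f3 x) j" M] by simp
 qed
 have "(\<integral>\<^sup>+v. H (spacings v) \<partial>pivot_space 3)
  = (\<integral>\<^sup>+a. \<integral>\<^sup>+b. \<integral>\<^sup>+c. H (spacings (u a b c)) \<partial>unif01 \<partial>unif01 \<partial>unif01)"
  unfolding u_def by (rule nn_integral_pivot_space_3[OF m])
 also have "... = T (%a b c. indicator {0..1} c * (indicator {0..1} b * (indicator {0..1} a * H (spacings (u a b c)))))"
 proof -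
  have ac: "indicator {0..1} c * (indicator {0..1} b * (indicator {0..1} a * t)) =
   indicator {0..1} a * (indicator {0..1} b * (indicator {0..1} c * t))" for a b c :: real and t :: ennreal
   by (simp only: mult_ac)
  show ?thesis unfolding T_def ac by (simp add: nn_integral_unif01 nn_integral_cmult)
 qed
 also have "... = T (%a b c. h (c, b, a) + h (c, a, b) + h (b, c, a) + h (b, a, c) + h (a, c, b) + h (a, b, c))"
  unfolding h_def by (subst spacings_eq_sorted[where H = H]) (auto simp: u_def H)
 also have "... = T (%a b c. h (c, b, a)) + T (%a b c. h (c, a, b)) + T (%a b c. h (b, c, a)) + T (%a b c. h (b, a, c))
   + T (%a b c. h (a, c, b)) + T (%a b c. h (a, b, c))"
  unfolding T_def by (simp add: nn_integral_add)
 also have "... = 6 * T (%a b c. h (a, b, c))"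
 proof -
  define k where "k = T (%a b c. h (a, b, c))"
  have 1: "T (%a b c. h (a, c, b)) = k" "T (%a b c. h (b, a, c)) = k"
   unfolding T_def k_def by (rule iterated_integral_swap, measurable)+
  have 2: "T (%a b c. h (c, a, b)) = T (%a b c. h (b, a, c))"
   unfolding T_def using iterated_integral_swap(2)[of "%(a, b, c). h (b, a, c)"] by simp
  have 3: "T (%a b c. h (b, c, a)) = T (%a b c. h (a, c, b))"
   unfolding T_def using iterated_integral_swap(1)[of "%(a, b, c). h (a, c, b)"] by simp
  have 4: "T (%a b c. h (c, b, a)) = T (%a b c. h (c, a, b))"
   unfolding T_def using iterated_integral_swap(1)[of "%(a, b, c). h (c, a, b)"] by simp
  show ?thesis unfolding 4 3 2 1 k_def[symmetric]
  proof -
   have "(6 :: ennreal) = 1 + 1 + 1 + 1 + 1 + 1" by simp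
   then show "k + k + k + k + k + k = 6 * k" by (simp only: distrib_right mult_1)
  qed
 qed
 also have "T (%a b c. h (a, b, c)) = plane_integral H"
 proof -
  have 1: "(\<integral>\<^sup>+z. H (x, y - x, z - y, 1 - z) \<partial>lborel) = (\<integral>\<^sup>+z. H (x, y - x, z, 1 - y - z) \<partial>lborel)" for x y
   using nn_integral_real_affine[of "%z. H (x, y - x, z, 1 - y - z)" 1 "- y"] by (simp add: add.commute[of "- y"])
  have 2: "(\<integral>\<^sup>+y. \<integral>\<^sup>+z. H (x, y - x, z, 1 - y - z) \<partial>lborel \<partial>lborel) = (\<integral>\<^sup>+y. \<integral>\<^sup>+z. H (x, y, z, 1 - x - y - z) \<partial>lborel \<partial>lborel)" for x
   using nn_integral_real_affine[of "%y. \<integral>\<^sup>+z. H (x, y, z, 1 - x - y - z) \<partial>lborel" 1 "- x"] by (simp add: add.commute[of "- x"])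
  show ?thesis unfolding T_def plane_integral_def h_def by (simp add: 1 2)
 qed
 finally show ?thesis .
qed

text \<open>The distribution of the four spacings is exchangeable, and the cone \<open>x > c y\<close> is
 the image of the whole simplex under a shear of determinant \<open>1 / (1 + c)\<close>.\<close>

definition spacing_ev :: "(real \<times> real \<times> real \<times> real => ennreal) => ennreal" where
 "spacing_ev G = (\<integral>\<^sup>+v. G (spacings v) \<partial>pivot_space 3)"

lemma spacing_ev_eq_plane:
 assumes [measurable]: "G \<in> borel_measurable borel4"
 shows "spacing_ev G = 6 * plane_integral (%p. G p * indicator positive4 p)"
proof -
 have "spacing_ev G = (\<integral>\<^sup>+v. G (spacings v) * indicator positive4 (spacings v) \<partial>pivot_space 3)"
  unfolding spacing_ev_def by (rule nn_integral_cong_AE) (use AE_spacings_positive in eventually_elim, auto)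
 also have "... = 6 * plane_integral (%p. G p * indicator positive4 p)"
  by (rule nn_integral_spacings_positive[where H = "%p. G p * indicator positive4 p"]) auto
 finally show ?thesis .
qed

lemma spacing_ev_swap12:
 assumes [measurable]: "G \<in> borel_measurable borel4"
 shows "spacing_ev (%(x, y, z, w). G (y, x, z, w)) = spacing_ev G"
proof -
 have "plane_integral (%p. (%(x, y, z, w). G (y, x, z, w)) p * indicator positive4 p)
   = plane_integral (%(x, y, z, w). G (y, x, z, w) * indicator positive4 (y, x, z, w))"
  by (intro arg_cong[where f = plane_integral]) (auto simp: positive4_def indicator_def)
 also have "... = plane_integral (%p. G p * indicator positive4 p)"
  by (rule plane_integral_swap12[where H = "%p. G p * indicator positive4 p"]) measurable
 finally show ?thesis by (simp add: spacing_ev_eq_plane)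
qed

lemma spacing_ev_swap23:
 assumes [measurable]: "G \<in> borel_measurable borel4"
 shows "spacing_ev (%(x, y, z, w). G (x, z, y, w)) = spacing_ev G"
proof -
 have "plane_integral (%p. (%(x, y, z, w). G (x, z, y, w)) p * indicator positive4 p)
   = plane_integral (%(x, y, z, w). G (x, z, y, w) * indicator positive4 (x, z, y, w))"
  by (intro arg_cong[where f = plane_integral]) (auto simp: positive4_def indicator_def)
 also have "... = plane_integral (%p. G p * indicator positive4 p)"
  by (rule plane_integral_swap23[where H = "%p. G p * indicator positive4 p"]) measurable
 finally show ?thesis by (simp add: spacing_ev_eq_plane)
qed

lemma spacing_ev_swap34:
 assumes [measurable]: "G \<in> borel_measurable borel4"
 shows "spacing_ev (%(x, y, z, w). G (x, y, w, z)) = spacing_ev G"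
proof -
 have "plane_integral (%p. (%(x, y, z, w). G (x, y, w, z)) p * indicator positive4 p)
   = plane_integral (%(x, y, z, w). G (x, y, w, z) * indicator positive4 (x, y, w, z))"
  by (intro arg_cong[where f = plane_integral]) (auto simp: positive4_def indicator_def)
 also have "... = plane_integral (%p. G p * indicator positive4 p)"
  by (rule plane_integral_swap34[where H = "%p. G p * indicator positive4 p"]) measurable
 finally show ?thesis by (simp add: spacing_ev_eq_plane)
qed

lemma spacing_ev_shear:
 assumes [measurable]: "G \<in> borel_measurable borel4" and c: "0 <= c"
 shows "spacing_ev (%(x, y, z, w). G (x + c / (1 + c) * y, y / (1 + c), z, w))
  = ennreal (1 + c) * spacing_ev (%(x, y, z, w). if c * y < x then G (x, y, z, w) else 0)"
proof -
 define H where "H p = (if c * fst (snd p) < fst p then G p else 0) * indicator positive4 p" for p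
 have c1: "1 + c > 0" using c by simp
 have [measurable]: "H \<in> borel_measurable borel4"
  unfolding H_def[abs_def] by measurable
 have mm: "(%(x, y, z, w). if c * y < x then G (x, y, z, w) else 0) \<in> borel_measurable borel4"
  by measurable
 \<comment> \<open>If (X, Y) is the image of (x, y), then X - c Y = x, so positivity of x is
   precisely the cone condition for the image.\<close>
 have dom: "x + c / (1 + c) * y > c * (y / (1 + c)) \<and> (x + c / (1 + c) * y, y / (1 + c), z, w) \<in> positive4 \<longleftrightarrow> (x, y, z, w) \<in> positive4"
  for x y z w
  using c c1 by (auto simp: positive4_def zero_less_divide_iff intro!: add_pos_nonneg)
 have "spacing_ev (%(x, y, z, w). G (x + c / (1 + c) * y, y / (1 + c), z, w))
  = 6 * plane_integral (%p. (%(x, y, z, w). G (x + c / (1 + c) * y, y / (1 + c), z, w)) p * indicator positive4 p)"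
  by (rule spacing_ev_eq_plane) measurable
 also have "(%p. (%(x, y, z, w). G (x + c / (1 + c) * y, y / (1 + c), z, w)) p * indicator positive4 p)
  = (%(x, y, z, w). H (x + c / (1 + c) * y, y / (1 + c), z, w))"
  using dom by (auto simp: H_def fun_eq_iff indicator_def)
 also have "plane_integral ... = ennreal (1 + c) * plane_integral H"
  using c by (intro plane_integral_shear) measurable
 also have "H = (%p. (%(x, y, z, w). if c * y < x then G (x, y, z, w) else 0) p * indicator positive4 p)"
  by (auto simp: H_def)
 also have "6 * (ennreal (1 + c) * plane_integral ...)
  = ennreal (1 + c) * spacing_ev (%(x, y, z, w). if c * y < x then G (x, y, z, w) else 0)"
  unfolding spacing_ev_eq_plane[OF mm] by (simp only: mult.left_commute)
 finally show ?thesis .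
qed

text \<open>For fixed x and y the third spacing ranges over an interval of length 1 - x - y, which
  becomes the weight.\<close>

lemma spacing_ev_two:
 assumes [measurable]: "(%(x, y). g x y) \<in> borel_measurable (borel \<Otimes>\<^sub>M borel)"
 shows "spacing_ev (%(x, y, z, w). g x y)
  = 6 * (\<integral>\<^sup>+x. (\<integral>\<^sup>+y. g x y * ennreal (1 - x - y) * indicator {0<..<1 - x} y \<partial>lborel) * indicator {0<..<1} x \<partial>lborel)"
proof -
 have m: "(%(x, y, z, w). g x y) \<in> borel_measurable borel4" by measurable
 have "(\<integral>\<^sup>+z. g x y * indicator positive4 (x, y, z, 1 - x - y - z) \<partial>lborel)
  = g x y * ennreal (1 - x - y) * indicator {0<..<1 - x} y * indicator {0<..<1} x" for x y
 proof -
  have "indicator positive4 (x, y, z, 1 - x - y - z)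
    = indicator {0<..<1 - x} y * (indicator {0<..<1} x * indicator {0<..<1 - x - y} z :: ennreal)" for z
   by (auto simp: positive4_def indicator_def)
  then have "(\<integral>\<^sup>+z. g x y * indicator positive4 (x, y, z, 1 - x - y - z) \<partial>lborel)
   = g x y * (indicator {0<..<1 - x} y * (indicator {0<..<1} x * emeasure lborel {0<..<1 - x - y}))"
   by (simp add: nn_integral_cmult)
  also have "indicator {0<..<1 - x} y * (indicator {0<..<1} x * emeasure lborel {0<..<1 - x - y})
   = ennreal (1 - x - y) * (indicator {0<..<1 - x} y * indicator {0<..<1} x)"
   by (auto simp: indicator_def)
  finally show ?thesis by (simp add: mult_ac)
 qed
 then have "plane_integral (%p. (%(x, y, z, w). g x y) p * indicator positive4 p)
  = (\<integral>\<^sup>+x. (\<integral>\<^sup>+y. g x y * ennreal (1 - x - y) * indicator {0<..<1 - x} y \<partial>lborel) * indicator {0<..<1} x \<partial>lborel)"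
  unfolding plane_integral_def by (simp add: nn_integral_multc)
 then show ?thesis unfolding spacing_ev_eq_plane[OF m] by simp
qed

lemma spacing_ev_iterated:
 fixes g :: "real => real => real"
 assumes [measurable]: "(%(x, y). g x y) \<in> borel_measurable (borel \<Otimes>\<^sub>M borel)"
  and nonneg: "!!x y. 0 < x ==> 0 < y ==> x + y < 1 ==> 0 <= g x y"
  and inner: "!!x. 0 < x ==> x < 1 ==> ((%y. g x y * (1 - x - y)) has_integral h x) {0..1 - x}"
  and outer: "(h has_integral I) {0..1}"
 shows "spacing_ev (%(x, y, z, w). ennreal (g x y)) = ennreal (6 * I)"
proof -
 have h: "(\<integral>\<^sup>+y. ennreal (g x y) * ennreal (1 - x - y) * indicator {0<..<1 - x} y \<partial>lborel) = ennreal (h x)" "0 <= h x"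
  if "0 < x" "x < 1" for x
 proof -
  have "(\<integral>\<^sup>+y. ennreal (g x y) * ennreal (1 - x - y) * indicator {0<..<1 - x} y \<partial>lborel)
   = (\<integral>\<^sup>+y. ennreal (g x y * (1 - x - y)) * indicator {0<..<1 - x} y \<partial>lborel)"
   by (intro nn_integral_cong) (auto simp: indicator_def ennreal_mult'')
  also have "... = ennreal (h x)"
   using that by (intro nn_integral_between[OF inner] mult_nonneg_nonneg nonneg) auto
  finally show "(\<integral>\<^sup>+y. ennreal (g x y) * ennreal (1 - x - y) * indicator {0<..<1 - x} y \<partial>lborel) = ennreal (h x)" .
  have "((%y. g x y * (1 - x - y)) has_integral h x) {0<..<1 - x}"
   using inner[OF that] has_integral_Icc_iff_Ioo by blast
  then show "0 <= h x"
   by (rule has_integral_nonneg) (use that in \<open>auto intro!: mult_nonneg_nonneg nonneg\<close>)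
 qed
 have "spacing_ev (%(x, y, z, w). ennreal (g x y))
  = 6 * (\<integral>\<^sup>+x. (\<integral>\<^sup>+y. ennreal (g x y) * ennreal (1 - x - y) * indicator {0<..<1 - x} y \<partial>lborel) * indicator {0<..<1} x \<partial>lborel)"
  by (rule spacing_ev_two) measurable
 also have "(\<integral>\<^sup>+x. (\<integral>\<^sup>+y. ennreal (g x y) * ennreal (1 - x - y) * indicator {0<..<1 - x} y \<partial>lborel) * indicator {0<..<1} x \<partial>lborel)
  = (\<integral>\<^sup>+x. ennreal (h x) * indicator {0<..<1} x \<partial>lborel)"
  using h(1) by (intro nn_integral_cong) (auto simp: indicator_def)
 also have "... = ennreal I" by (rule nn_integral_between[OF outer h(2)])
 also have "6 * ennreal I = ennreal (6 * I)" by (simp add: ennreal_mult')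
 finally show ?thesis .
qed

lemma spacings_sum: "spacings v = (x, y, z, w) ==> x + y + z + w = 1"
 using sum_spacing[of 3 v] by (auto simp: spacings_def eval_nat_numeral)

lemma spacing_ev_cong:
 assumes "!!x y z w. 0 < x ==> 0 < y ==> 0 < z ==> 0 < w ==> x + y + z + w = 1 ==> F (x, y, z, w) = G (x, y, z, w)"
 shows "spacing_ev F = spacing_ev G"
 unfolding spacing_ev_def
proof (rule nn_integral_cong_AE)
 show "AE v in pivot_space 3. F (spacings v) = G (spacings v)"
  using AE_spacings_positive
 proof eventually_elim
  case (elim v)
  obtain x y z w where e: "spacings v = (x, y, z, w)" by (cases "spacings v")
  show ?case using elim assms[of x y z w] spacings_sum[OF e] unfolding e by (auto simp: positive4_def)
 qed
qed

lemma spacing_ev_add: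
 assumes [measurable]: "F \<in> borel_measurable borel4" "G \<in> borel_measurable borel4"
 shows "spacing_ev (%p. F p + G p) = spacing_ev F + spacing_ev G"
 unfolding spacing_ev_def by (rule nn_integral_add) measurable

lemma spacing_ev_cmult:
 assumes [measurable]: "F \<in> borel_measurable borel4"
 shows "spacing_ev (%p. c * F p) = c * spacing_ev F"
 unfolding spacing_ev_def by (rule nn_integral_cmult) measurable

lemma ennreal_half: "X + X = ennreal v ==> X = ennreal (v / 2)"
proof -
 assume a: "X + X = ennreal v"
 then have "X \<noteq> \<top>" by auto
 then obtain r where r: "X = ennreal r" "r >= 0" by (cases X) auto
 have "ennreal (2 * r) = ennreal v" using a r by (simp flip: ennreal_plus)
 then show ?thesis using r by (cases "v >= 0") (auto simp: ennreal_neg ennreal_eq_0_iff)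
qed

text \<open>By exchangeability, \<open>z\<close> may be replaced by the mean \<open>(1 - x - y) / 2\<close> of \<open>z\<close> and \<open>w\<close>.\<close>

lemma spacing_ev_iterated_third:
 fixes g :: "real => real => real"
 assumes [measurable]: "(%(x, y). g x y) \<in> borel_measurable (borel \<Otimes>\<^sub>M borel)"
  and nonneg: "!!x y. 0 < x ==> 0 < y ==> x + y < 1 ==> 0 <= g x y"
  and inner: "!!x. 0 < x ==> x < 1 ==> ((%y. g x y * (1 - x - y)\<^sup>2) has_integral h x) {0..1 - x}"
  and outer: "(h has_integral I) {0..1}"
 shows "spacing_ev (%(x, y, z, w). ennreal (z * g x y)) = ennreal (3 * I)"
proof -
 have m: "(%(x, y, z, w). ennreal (z * g x y)) \<in> borel_measurable borel4"
  "(%(x, y, z, w). ennreal (w * g x y)) \<in> borel_measurable borel4" by measurable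
 have "spacing_ev (%(x, y, z, w). ennreal (w * g x y)) = spacing_ev (%(x, y, z, w). ennreal (z * g x y))"
  using spacing_ev_swap34[OF m(1)] by simp
 then have "spacing_ev (%(x, y, z, w). ennreal (z * g x y)) + spacing_ev (%(x, y, z, w). ennreal (z * g x y))
  = spacing_ev (%p. (%(x, y, z, w). ennreal (z * g x y)) p + (%(x, y, z, w). ennreal (w * g x y)) p)"
  by (simp only: spacing_ev_add[OF m])
 also have "... = spacing_ev (%(x, y, z, w). ennreal (g x y * (1 - x - y)))"
 proof (rule spacing_ev_cong)
  fix x y z w :: real assume *: "0 < x" "0 < y" "0 < z" "0 < w" "x + y + z + w = 1"
  then have "0 <= g x y" by (intro nonneg) auto
  moreover have "g x y * (1 - x - y) = z * g x y + w * g x y"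
  proof -
   have "1 - x - y = z + w" using * by simp
   show ?thesis unfolding \<open>1 - x - y = z + w\<close> by (simp add: algebra_simps)
  qed
  ultimately show "(%(x, y, z, w). ennreal (z * g x y)) (x, y, z, w) + (%(x, y, z, w). ennreal (w * g x y)) (x, y, z, w)
   = (%(x, y, z, w). ennreal (g x y * (1 - x - y))) (x, y, z, w)"
   using * by (simp flip: ennreal_plus)
 qed
 also have "... = ennreal (6 * I)"
 proof (rule spacing_ev_iterated[OF _ _ _ outer])
  show "((%y. g x y * (1 - x - y) * (1 - x - y)) has_integral h x) {0..1 - x}" if "0 < x" "x < 1" for x
   using inner[OF that] by (simp add: power2_eq_square mult.assoc)
 qed (auto intro!: mult_nonneg_nonneg nonneg)
 finally have "spacing_ev (%(x, y, z, w). ennreal (z * g x y)) + spacing_ev (%(x, y, z, w). ennreal (z * g x y)) = ennreal (6 * I)" .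
 from ennreal_half[OF this] show ?thesis by simp
qed

lemma entropy_spacing_nonneg:
 assumes "0 < x" "0 < y" "x + y < 1" "0 <= \<alpha>" "\<alpha> <= 1" "0 <= \<beta>" "\<beta> <= 1" "0 <= \<gamma>" "\<gamma> <= 1"
 shows "0 <= entropy_int 0 (\<alpha> * x + \<beta> * y + \<gamma> * (1 - x - y))"
proof (rule entropy_int_nonneg)
 show "0 <= \<alpha> * x + \<beta> * y + \<gamma> * (1 - x - y)" using assms by simp
 have "\<alpha> * x + \<beta> * y + \<gamma> * (1 - x - y) <= 1 * x + 1 * y + 1 * (1 - x - y)"
  using assms by (intro add_mono mult_right_mono) auto
 then show "\<alpha> * x + \<beta> * y + \<gamma> * (1 - x - y) <= 1" by simp
qed

section \<open>Expected entropy of linear forms in the spacings\<close>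

definition parts_diff :: "real => real => real => real => nat => real => real => real" where
 "parts_diff a b c d k \<beta> \<delta> = parts_int a b c d k \<beta> \<delta> 1 - parts_int a b c d k \<beta> \<delta> 0"

lemma has_integral_parts_diff:
 assumes "0 <= \<beta>" "0 <= \<beta> + \<delta>" "\<delta> \<noteq> 0"
 shows "((%t. (a + b * t + c * t\<^sup>2 + d * t ^ 3) * entropy_int k (\<beta> + \<delta> * t)) has_integral parts_diff a b c d k \<beta> \<delta>) {0..1}"
 unfolding parts_diff_def using assms by (intro has_integral_parts_int) auto

lemma parts_int_0:
 "parts_int a b c d 0 \<beta> \<delta> t = (a + b * t + c * t\<^sup>2 + d * t ^ 3) * entropy_int 1 (\<beta> + \<delta> * t) / \<delta>
   - (b + 2 * c * t + 3 * d * t\<^sup>2) * entropy_int 2 (\<beta> + \<delta> * t) / \<delta>\<^sup>2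
   + (2 * c + 6 * d * t) * entropy_int 3 (\<beta> + \<delta> * t) / \<delta> ^ 3
   - 6 * d * entropy_int 4 (\<beta> + \<delta> * t) / \<delta> ^ 4"
proof -
 have "0 + 1 = (1::nat)" "0 + 2 = (2::nat)" "0 + 3 = (3::nat)" "0 + 4 = (4::nat)" by auto
 then show ?thesis unfolding parts_int_def by (simp only:)
qed

text \<open>Removing the terms with zero coefficients, here and in the two companions, keeps every
  evaluation within \<open>entropy_int 0\<close> to \<open>entropy_int 4\<close>, whose values are
  tabulated.\<close>

lemma parts_int_1:
 "parts_int a b c 0 1 \<beta> \<delta> t = (a + b * t + c * t\<^sup>2) * entropy_int 2 (\<beta> + \<delta> * t) / \<delta>
   - (b + 2 * c * t) * entropy_int 3 (\<beta> + \<delta> * t) / \<delta>\<^sup>2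
   + 2 * c * entropy_int 4 (\<beta> + \<delta> * t) / \<delta> ^ 3"
proof -
 have "1 + 1 = (2::nat)" "1 + 2 = (3::nat)" "1 + 3 = (4::nat)" "1 + 4 = (5::nat)" by auto
 then show ?thesis unfolding parts_int_def by (simp only: mult_zero_left mult_zero_right add_0_right diff_0_right div_0)
qed

lemma parts_int_2:
 "parts_int a b 0 0 2 \<beta> \<delta> t = (a + b * t) * entropy_int 3 (\<beta> + \<delta> * t) / \<delta>
   - b * entropy_int 4 (\<beta> + \<delta> * t) / \<delta>\<^sup>2"
proof -
 have "2 + 1 = (3::nat)" "2 + 2 = (4::nat)" by auto
 then show ?thesis unfolding parts_int_def by (simp only: mult_zero_left mult_zero_right add_0_right diff_0_right div_0)
qed

lemma parts_int_3: "parts_int a 0 0 0 3 \<beta> \<delta> t = a * entropy_int 4 (\<beta> + \<delta> * t) / \<delta>"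
proof -
 have "3 + 1 = (4::nat)" by auto
 then show ?thesis unfolding parts_int_def by (simp only: mult_zero_left mult_zero_right add_0_right diff_0_right div_0)
qed

lemmas parts_diff_unfold = parts_diff_def parts_int_0 parts_int_1 parts_int_2 parts_int_3

text \<open>\<alpha>, \<beta> and \<gamma> are the values of the linear form at the vertices of the
  simplex. They have to differ pairwise because both integrations by parts divide by their
  differences.\<close>

lemma spacing_ev_three_nodes:
 assumes "0 <= \<alpha>" "\<alpha> <= 1" "0 <= \<beta>" "\<beta> <= 1" "0 <= \<gamma>" "\<gamma> <= 1" and ne: "\<alpha> \<noteq> \<beta>" "\<alpha> \<noteq> \<gamma>" "\<beta> \<noteq> \<gamma>"
 shows "spacing_ev (%(x, y, z, w). ennreal (x * entropy_int 0 (\<alpha> * x + \<beta> * y + \<gamma> * (z + w))))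
  = ennreal (6 * (parts_diff 0 1 0 0 2 \<beta> (\<alpha> - \<beta>) * (1 / (\<beta> - \<gamma>)\<^sup>2) - parts_diff 0 1 (-1) 0 1 \<gamma> (\<alpha> - \<gamma>) * (1 / (\<beta> - \<gamma>))
    - parts_diff 0 1 0 0 2 \<gamma> (\<alpha> - \<gamma>) * (1 / (\<beta> - \<gamma>)\<^sup>2)))"
proof -
 define \<eta> where "\<eta> = \<beta> - \<gamma>"
 have \<eta>: "\<eta> \<noteq> 0" using ne by (simp add: \<eta>_def)
 have "spacing_ev (%(x, y, z, w). ennreal (x * entropy_int 0 (\<alpha> * x + \<beta> * y + \<gamma> * (z + w))))
  = spacing_ev (%(x, y, z, w). ennreal (x * entropy_int 0 (\<alpha> * x + \<beta> * y + \<gamma> * (1 - x - y))))"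
 proof (rule spacing_ev_cong)
  fix x y z w :: real assume "x + y + z + w = 1"
  then have "z + w = 1 - x - y" by simp
  then show "(%(x, y, z, w). ennreal (x * entropy_int 0 (\<alpha> * x + \<beta> * y + \<gamma> * (z + w)))) (x, y, z, w)
   = (%(x, y, z, w). ennreal (x * entropy_int 0 (\<alpha> * x + \<beta> * y + \<gamma> * (1 - x - y)))) (x, y, z, w)" by simp
 qed
 also have "... = ennreal (6 * (parts_diff 0 1 0 0 2 \<beta> (\<alpha> - \<beta>) * (1 / \<eta>\<^sup>2) - parts_diff 0 1 (-1) 0 1 \<gamma> (\<alpha> - \<gamma>) * (1 / \<eta>)
    - parts_diff 0 1 0 0 2 \<gamma> (\<alpha> - \<gamma>) * (1 / \<eta>\<^sup>2)))"
 proof (rule spacing_ev_iterated)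
  fix x y :: real assume "0 < x" "0 < y" "x + y < 1"
  then show "0 <= x * entropy_int 0 (\<alpha> * x + \<beta> * y + \<gamma> * (1 - x - y))"
   using assms by (intro mult_nonneg_nonneg entropy_spacing_nonneg) auto
 next
  fix x :: real assume x: "0 < x" "x < 1"
  define A where "A = \<gamma> + (\<alpha> - \<gamma>) * x"
  have A: "A = \<alpha> * x + \<gamma> * (1 - x)" by (simp add: A_def algebra_simps)
  have Ae: "A + \<eta> * (1 - x) = \<beta> + (\<alpha> - \<beta>) * x" by (simp add: A_def \<eta>_def algebra_simps)
  have nn: "0 <= A" "0 <= A + \<eta> * (1 - x)"
  proof -
   show "0 <= A" unfolding A using x assms by (intro add_nonneg_nonneg mult_nonneg_nonneg) auto
   have "A + \<eta> * (1 - x) = \<alpha> * x + \<beta> * (1 - x)" unfolding Ae by (simp add: algebra_simps)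
   then show "0 <= A + \<eta> * (1 - x)" using x assms by (auto intro!: add_nonneg_nonneg mult_nonneg_nonneg)
  qed
  have "((%y. x * (((1 - x) + -1 * y + 0 * y\<^sup>2 + 0 * y ^ 3) * entropy_int 0 (A + \<eta> * y))) has_integral
    x * (parts_int (1 - x) (-1) 0 0 0 A \<eta> (1 - x) - parts_int (1 - x) (-1) 0 0 0 A \<eta> 0)) {0..1 - x}"
   using x nn \<eta> by (intro has_integral_mult_right has_integral_parts_int) auto
  also have "(%y. x * (((1 - x) + -1 * y + 0 * y\<^sup>2 + 0 * y ^ 3) * entropy_int 0 (A + \<eta> * y)))
   = (%y. x * entropy_int 0 (\<alpha> * x + \<beta> * y + \<gamma> * (1 - x - y)) * (1 - x - y))"
  proof
   fix y
   have "A + \<eta> * y = \<alpha> * x + \<beta> * y + \<gamma> * (1 - x - y)" by (simp add: A \<eta>_def algebra_simps)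
   show "x * (((1 - x) + -1 * y + 0 * y\<^sup>2 + 0 * y ^ 3) * entropy_int 0 (A + \<eta> * y))
    = x * entropy_int 0 (\<alpha> * x + \<beta> * y + \<gamma> * (1 - x - y)) * (1 - x - y)"
    unfolding \<open>A + \<eta> * y = _\<close> by (simp add: algebra_simps)
  qed
  also have "x * (parts_int (1 - x) (-1) 0 0 0 A \<eta> (1 - x) - parts_int (1 - x) (-1) 0 0 0 A \<eta> 0)
   = (0 + 1 * x + 0 * x\<^sup>2 + 0 * x ^ 3) * entropy_int 2 (\<beta> + (\<alpha> - \<beta>) * x) * (1 / \<eta>\<^sup>2)
    - (0 + 1 * x + (-1) * x\<^sup>2 + 0 * x ^ 3) * entropy_int 1 (\<gamma> + (\<alpha> - \<gamma>) * x) * (1 / \<eta>)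
    - (0 + 1 * x + 0 * x\<^sup>2 + 0 * x ^ 3) * entropy_int 2 (\<gamma> + (\<alpha> - \<gamma>) * x) * (1 / \<eta>\<^sup>2)"
   unfolding parts_int_0 Ae A_def[symmetric] by (simp add: algebra_simps power2_eq_square diff_divide_distrib)
  finally show "((%y. x * entropy_int 0 (\<alpha> * x + \<beta> * y + \<gamma> * (1 - x - y)) * (1 - x - y)) has_integral
    ((0 + 1 * x + 0 * x\<^sup>2 + 0 * x ^ 3) * entropy_int 2 (\<beta> + (\<alpha> - \<beta>) * x) * (1 / \<eta>\<^sup>2)
    - (0 + 1 * x + (-1) * x\<^sup>2 + 0 * x ^ 3) * entropy_int 1 (\<gamma> + (\<alpha> - \<gamma>) * x) * (1 / \<eta>)
    - (0 + 1 * x + 0 * x\<^sup>2 + 0 * x ^ 3) * entropy_int 2 (\<gamma> + (\<alpha> - \<gamma>) * x) * (1 / \<eta>\<^sup>2))) {0..1 - x}" .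
 next
  show "((%x. (0 + 1 * x + 0 * x\<^sup>2 + 0 * x ^ 3) * entropy_int 2 (\<beta> + (\<alpha> - \<beta>) * x) * (1 / \<eta>\<^sup>2)
    - (0 + 1 * x + (-1) * x\<^sup>2 + 0 * x ^ 3) * entropy_int 1 (\<gamma> + (\<alpha> - \<gamma>) * x) * (1 / \<eta>)
    - (0 + 1 * x + 0 * x\<^sup>2 + 0 * x ^ 3) * entropy_int 2 (\<gamma> + (\<alpha> - \<gamma>) * x) * (1 / \<eta>\<^sup>2)) has_integral
   (parts_diff 0 1 0 0 2 \<beta> (\<alpha> - \<beta>) * (1 / \<eta>\<^sup>2) - parts_diff 0 1 (-1) 0 1 \<gamma> (\<alpha> - \<gamma>) * (1 / \<eta>)
    - parts_diff 0 1 0 0 2 \<gamma> (\<alpha> - \<gamma>) * (1 / \<eta>\<^sup>2))) {0..1}"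
   using assms by (intro has_integral_diff has_integral_mult_left has_integral_parts_diff) auto
 qed measurable
 finally show ?thesis unfolding \<eta>_def .
qed

text \<open>Here the weight z is a spacing that the linear form does not involve; averaging it with
  the fourth spacing produces the square of 1 - x - y in the inner integral.\<close>

lemma spacing_ev_two_nodes:
 assumes "0 < \<alpha>" "\<alpha> <= 1" "0 < \<beta>" "\<beta> <= 1" and ne: "\<alpha> \<noteq> \<beta>"
 shows "spacing_ev (%(x, y, z, w). ennreal (z * entropy_int 0 (\<alpha> * x + \<beta> * y)))
  = ennreal (3 * (parts_diff 1 0 0 0 3 \<beta> (\<alpha> - \<beta>) * (2 / \<beta> ^ 3) - parts_diff 1 (-2) 1 0 1 0 \<alpha> * (1 / \<beta>)
    - parts_diff 1 (-1) 0 0 2 0 \<alpha> * (2 / \<beta>\<^sup>2) - parts_diff 1 0 0 0 3 0 \<alpha> * (2 / \<beta> ^ 3)))"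
proof (rule spacing_ev_iterated_third)
 fix x y :: real assume "0 < x" "0 < y" "x + y < 1"
 then show "0 <= entropy_int 0 (\<alpha> * x + \<beta> * y)"
  using entropy_spacing_nonneg[of x y \<alpha> \<beta> 0] assms by simp
next
 fix x :: real assume x: "0 < x" "x < 1"
 have "((%y. ((1 - x)\<^sup>2 + (- 2 * (1 - x)) * y + 1 * y\<^sup>2 + 0 * y ^ 3) * entropy_int 0 (\<alpha> * x + \<beta> * y)) has_integral
   (parts_int ((1 - x)\<^sup>2) (- 2 * (1 - x)) 1 0 0 (\<alpha> * x) \<beta> (1 - x) - parts_int ((1 - x)\<^sup>2) (- 2 * (1 - x)) 1 0 0 (\<alpha> * x) \<beta> 0)) {0..1 - x}"
  using x assms by (intro has_integral_parts_int) auto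
 also have "(%y. ((1 - x)\<^sup>2 + (- 2 * (1 - x)) * y + 1 * y\<^sup>2 + 0 * y ^ 3) * entropy_int 0 (\<alpha> * x + \<beta> * y))
  = (%y. entropy_int 0 (\<alpha> * x + \<beta> * y) * (1 - x - y)\<^sup>2)"
  by (simp add: fun_eq_iff algebra_simps power2_eq_square)
 also have "parts_int ((1 - x)\<^sup>2) (- 2 * (1 - x)) 1 0 0 (\<alpha> * x) \<beta> (1 - x) - parts_int ((1 - x)\<^sup>2) (- 2 * (1 - x)) 1 0 0 (\<alpha> * x) \<beta> 0
  = (1 + 0 * x + 0 * x\<^sup>2 + 0 * x ^ 3) * entropy_int 3 (\<beta> + (\<alpha> - \<beta>) * x) * (2 / \<beta> ^ 3)
   - (1 + (-2) * x + 1 * x\<^sup>2 + 0 * x ^ 3) * entropy_int 1 (0 + \<alpha> * x) * (1 / \<beta>)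
   - (1 + (-1) * x + 0 * x\<^sup>2 + 0 * x ^ 3) * entropy_int 2 (0 + \<alpha> * x) * (2 / \<beta>\<^sup>2)
   - (1 + 0 * x + 0 * x\<^sup>2 + 0 * x ^ 3) * entropy_int 3 (0 + \<alpha> * x) * (2 / \<beta> ^ 3)"
 proof -
  have b: "\<alpha> * x + \<beta> * (1 - x) = \<beta> + (\<alpha> - \<beta>) * x" by (simp add: algebra_simps)
  have p: "(1 - x)\<^sup>2 + (- 2 * (1 - x)) * (1 - x) + 1 * (1 - x)\<^sup>2 + 0 * (1 - x) ^ 3 = 0"
   by (simp add: power2_eq_square algebra_simps)
  show ?thesis unfolding parts_int_0 b p by (simp add: algebra_simps power2_eq_square diff_divide_distrib add_divide_distrib)
 qed
 finally show "((%y. entropy_int 0 (\<alpha> * x + \<beta> * y) * (1 - x - y)\<^sup>2) has_integral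
  ((1 + 0 * x + 0 * x\<^sup>2 + 0 * x ^ 3) * entropy_int 3 (\<beta> + (\<alpha> - \<beta>) * x) * (2 / \<beta> ^ 3)
   - (1 + (-2) * x + 1 * x\<^sup>2 + 0 * x ^ 3) * entropy_int 1 (0 + \<alpha> * x) * (1 / \<beta>)
   - (1 + (-1) * x + 0 * x\<^sup>2 + 0 * x ^ 3) * entropy_int 2 (0 + \<alpha> * x) * (2 / \<beta>\<^sup>2)
   - (1 + 0 * x + 0 * x\<^sup>2 + 0 * x ^ 3) * entropy_int 3 (0 + \<alpha> * x) * (2 / \<beta> ^ 3))) {0..1 - x}" .
next
 show "((%x. (1 + 0 * x + 0 * x\<^sup>2 + 0 * x ^ 3) * entropy_int 3 (\<beta> + (\<alpha> - \<beta>) * x) * (2 / \<beta> ^ 3)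
   - (1 + (-2) * x + 1 * x\<^sup>2 + 0 * x ^ 3) * entropy_int 1 (0 + \<alpha> * x) * (1 / \<beta>)
   - (1 + (-1) * x + 0 * x\<^sup>2 + 0 * x ^ 3) * entropy_int 2 (0 + \<alpha> * x) * (2 / \<beta>\<^sup>2)
   - (1 + 0 * x + 0 * x\<^sup>2 + 0 * x ^ 3) * entropy_int 3 (0 + \<alpha> * x) * (2 / \<beta> ^ 3)) has_integral
  (parts_diff 1 0 0 0 3 \<beta> (\<alpha> - \<beta>) * (2 / \<beta> ^ 3) - parts_diff 1 (-2) 1 0 1 0 \<alpha> * (1 / \<beta>)
    - parts_diff 1 (-1) 0 0 2 0 \<alpha> * (2 / \<beta>\<^sup>2) - parts_diff 1 0 0 0 3 0 \<alpha> * (2 / \<beta> ^ 3))) {0..1}"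
  using assms by (intro has_integral_diff has_integral_mult_left has_integral_parts_diff) auto
qed measurable

lemma has_integral_mult_linear: "0 <= l ==> ((%y::real. y * (l - y)) has_integral l ^ 3 / 6) {0..l}"
proof -
 assume l: "0 <= l"
 have "((%y::real. y * (l - y)) has_integral (l * l\<^sup>2 / 2 - l ^ 3 / 3) - (l * 0\<^sup>2 / 2 - 0 ^ 3 / 3)) {0..l}"
 proof (rule fundamental_theorem_of_calculus[OF l])
  fix x :: real
  have "((%y. l * y\<^sup>2 / 2 - y ^ 3 / 3) has_real_derivative x * (l - x)) (at x within {0..l})"
   by (auto intro!: derivative_eq_intros simp: power2_eq_square algebra_simps)
  then show "((%y. l * y\<^sup>2 / 2 - y ^ 3 / 3) has_vector_derivative x * (l - x)) (at x within {0..l})"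
   by (simp add: has_real_derivative_iff_has_vector_derivative)
 qed
 then show ?thesis by (simp add: power2_eq_square power3_eq_cube mult.assoc)
qed

lemma spacing_ev_one_node:
 assumes "0 < \<alpha>" "\<alpha> <= 1"
 shows "spacing_ev (%(x, y, z, w). ennreal (x * entropy_int 0 (\<alpha> * y))) = ennreal (parts_diff 1 (-3) 3 (-1) 0 0 \<alpha>)"
proof -
 have "spacing_ev (%(x, y, z, w). ennreal (y * entropy_int 0 (\<alpha> * x))) = ennreal (6 * (parts_diff 1 (-3) 3 (-1) 0 0 \<alpha> * (1 / 6)))"
 proof (rule spacing_ev_iterated)
  fix x y :: real assume "0 < x" "0 < y" "x + y < 1"
  then show "0 <= y * entropy_int 0 (\<alpha> * x)"
   using entropy_spacing_nonneg[of x y \<alpha> 0 0] assms by simp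
 next
  fix x :: real assume x: "0 < x" "x < 1"
  have "((%y. y * (1 - x - y) * entropy_int 0 (\<alpha> * x)) has_integral (1 - x) ^ 3 / 6 * entropy_int 0 (\<alpha> * x)) {0..1 - x}"
   using x by (intro has_integral_mult_left has_integral_mult_linear) auto
  moreover have "(1 + (-3) * x + 3 * x\<^sup>2 + (-1) * x ^ 3) * entropy_int 0 (0 + \<alpha> * x) * (1 / 6) = (1 - x) ^ 3 / 6 * entropy_int 0 (\<alpha> * x)"
  proof -
   have "1 + (-3) * x + 3 * x\<^sup>2 + (-1) * x ^ 3 = (1 - x) ^ 3"
    by (simp add: power2_eq_square power3_eq_cube algebra_simps)
   then show ?thesis by simp
  qed
  moreover have "y * entropy_int 0 (\<alpha> * x) * (1 - x - y) = y * (1 - x - y) * entropy_int 0 (\<alpha> * x)" for y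
   by simp
  ultimately show "((%y. y * entropy_int 0 (\<alpha> * x) * (1 - x - y)) has_integral
    (1 + (-3) * x + 3 * x\<^sup>2 + (-1) * x ^ 3) * entropy_int 0 (0 + \<alpha> * x) * (1 / 6)) {0..1 - x}"
   by (simp only:)
 next
  show "((%x. (1 + (-3) * x + 3 * x\<^sup>2 + (-1) * x ^ 3) * entropy_int 0 (0 + \<alpha> * x) * (1 / 6)) has_integral
   parts_diff 1 (-3) 3 (-1) 0 0 \<alpha> * (1 / 6)) {0..1}"
   using assms by (intro has_integral_mult_left has_integral_parts_diff) auto
 qed measurable
 moreover have "(%(x, y, z, w). ennreal (y * entropy_int 0 (\<alpha> * x))) \<in> borel_measurable borel4" by measurable
 from spacing_ev_swap12[OF this] have "spacing_ev (%(x, y, z, w). ennreal (x * entropy_int 0 (\<alpha> * y)))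
  = spacing_ev (%(x, y, z, w). ennreal (y * entropy_int 0 (\<alpha> * x)))" by simp
 ultimately show ?thesis by simp
qed

lemma ln_inverses: "ln (1 / 2) = - ln (2::real)" "ln (1 / 3) = - ln (3::real)" "ln (2 / 3) = ln 2 - ln (3::real)"
 by (simp_all add: ln_div)

lemma entropy_int_values:
 "entropy_int 0 x = x * (- ln x)" "entropy_int 1 x = x\<^sup>2 / 2 * (1 / 2 - ln x)" "entropy_int 2 x = x ^ 3 / 6 * (5 / 6 - ln x)"
 "entropy_int 3 x = x ^ 4 / 24 * (13 / 12 - ln x)" "entropy_int 4 x = x ^ 5 / 120 * (77 / 60 - ln x)"
 by (simp_all add: entropy_int_def harm_Suc harm_expand(1) eval_nat_numeral)

lemma one_node_values:
 "parts_diff 1 (-3) 3 (-1) 0 0 1 = 77 / 1200"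
 "parts_diff 1 (-3) 3 (-1) 0 0 (1 / 2) = 77 / 2400 + ln 2 / 40"
 "parts_diff 1 (-3) 3 (-1) 0 0 (1 / 3) = 77 / 3600 + ln 3 / 60"
 unfolding parts_diff_unfold
 by (simp_all add: entropy_int_values ln_inverses power_divide field_simps)

text \<open>The letters A, B and C refer to the three types of cones: each value belongs to one
  summand of the entropy after the cone has been sheared onto the simplex.\<close>

lemma spacing_ev_A:
 "spacing_ev (%(x, y, z, w). ennreal (x * entropy_int 0 (1 * x + 0 * y + 1 / 2 * (z + w)))) = ennreal (3 / 20 * ln 2 - 13 / 400)"
 by (subst spacing_ev_three_nodes, simp_all del: One_nat_def add: parts_diff_unfold entropy_int_values ln_inverses power_divide)
  (intro arg_cong[where f = ennreal], simp add: field_simps)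

lemma spacing_ev_B1:
 "spacing_ev (%(x, y, z, w). ennreal (x * entropy_int 0 (1 * x + 1 / 3 * y + 1 / 2 * (z + w)))) = ennreal (3 / 10 * ln 2 + ln 3 / 60 - 29 / 180)"
 by (subst spacing_ev_three_nodes, simp_all del: One_nat_def add: parts_diff_unfold entropy_int_values ln_inverses power_divide)
  (intro arg_cong[where f = ennreal], simp add: field_simps)

lemma spacing_ev_B2:
 "spacing_ev (%(x, y, z, w). ennreal (z * entropy_int 0 (1 / 2 * x + 1 / 3 * y))) = ennreal (77 / 1440 + 3 / 40 * ln 2 - ln 3 / 30)"
 by (subst spacing_ev_two_nodes, simp_all del: One_nat_def add: parts_diff_unfold entropy_int_values ln_inverses power_divide)
  (intro arg_cong[where f = ennreal], simp add: field_simps)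

lemma spacing_ev_C1:
 "spacing_ev (%(x, y, z, w). ennreal (x * entropy_int 0 (1 / 2 * x + 1 * y + 1 / 3 * (z + w)))) = ennreal (773 / 1800 - 19 / 60 * ln 3)"
 by (subst spacing_ev_three_nodes, simp_all del: One_nat_def add: parts_diff_unfold entropy_int_values ln_inverses power_divide)
  (intro arg_cong[where f = ennreal], simp add: field_simps)

lemma spacing_ev_C2:
 "spacing_ev (%(x, y, z, w). ennreal (x * entropy_int 0 (1 / 2 * x + 0 * y + 1 / 3 * (z + w)))) = ennreal (8 / 15 * ln 3 - 9 / 20 * ln 2 - 133 / 720)"
 by (subst spacing_ev_three_nodes, simp_all del: One_nat_def add: parts_diff_unfold entropy_int_values ln_inverses power_divide)
  (intro arg_cong[where f = ennreal], simp add: field_simps)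

section \<open>Permutations, shears and cones\<close>

lemma measurable_curried:
 assumes "(%(x, y, z, w). g x y z w) \<in> borel_measurable borel4"
  and "f1 \<in> borel_measurable N" "f2 \<in> borel_measurable N" "f3 \<in> borel_measurable N" "f4 \<in> borel_measurable N"
 shows "(%x. g (f1 x) (f2 x) (f3 x) (f4 x)) \<in> borel_measurable N"
proof -
 have "(%x. (f1 x, f2 x, f3 x, f4 x)) \<in> N \<rightarrow>\<^sub>M borel4" using assms(2-) by measurable
 from measurable_compose[OF this assms(1)] show ?thesis by simp
qed

lemma spacing_ev_swaps:
 assumes m: "(%(x, y, z, w). g x y z w) \<in> borel_measurable borel4"
 shows "spacing_ev (%(x, y, z, w). g y x z w) = spacing_ev (%(x, y, z, w). g x y z w)" (is ?s12)
  and "spacing_ev (%(x, y, z, w). g x z y w) = spacing_ev (%(x, y, z, w). g x y z w)" (is ?s23)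
  and "spacing_ev (%(x, y, z, w). g x y w z) = spacing_ev (%(x, y, z, w). g x y z w)" (is ?s34)
 using spacing_ev_swap12[OF assms] spacing_ev_swap23[OF assms] spacing_ev_swap34[OF m] by simp_all

lemma spacing_ev_swap13:
 assumes m: "(%(x, y, z, w). g x y z w) \<in> borel_measurable borel4"
 shows "spacing_ev (%(x, y, z, w). g z y x w) = spacing_ev (%(x, y, z, w). g x y z w)"
proof -
 note [measurable] = measurable_curried[OF m]
 have m: "(%(x, y, z, w). g y x z w) \<in> borel_measurable borel4" "(%(x, y, z, w). g z x y w) \<in> borel_measurable borel4" by measurable
 show ?thesis using spacing_ev_swaps(1)[OF m(2)] spacing_ev_swaps(2)[OF m(1)] spacing_ev_swaps(1)[OF \<open>(%(x, y, z, w). g x y z w) \<in> _\<close>] by simp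
qed

lemma spacing_ev_swap24:
 assumes m: "(%(x, y, z, w). g x y z w) \<in> borel_measurable borel4"
 shows "spacing_ev (%(x, y, z, w). g x w z y) = spacing_ev (%(x, y, z, w). g x y z w)"
proof -
 note [measurable] = measurable_curried[OF m]
 have m: "(%(x, y, z, w). g x z y w) \<in> borel_measurable borel4" "(%(x, y, z, w). g x w y z) \<in> borel_measurable borel4" by measurable
 show ?thesis using spacing_ev_swaps(2)[OF m(2)] spacing_ev_swaps(3)[OF m(1)] spacing_ev_swaps(2)[OF \<open>(%(x, y, z, w). g x y z w) \<in> _\<close>] by simp
qed

lemma spacing_ev_swap14:
 assumes m: "(%(x, y, z, w). g x y z w) \<in> borel_measurable borel4"
 shows "spacing_ev (%(x, y, z, w). g w y z x) = spacing_ev (%(x, y, z, w). g x y z w)"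
proof -
 note [measurable] = measurable_curried[OF m]
 have m: "(%(x, y, z, w). g x y w z) \<in> borel_measurable borel4" "(%(x, y, z, w). g z y w x) \<in> borel_measurable borel4" by measurable
 show ?thesis using spacing_ev_swaps(3)[OF m(2)] spacing_ev_swap13[OF m(1)] spacing_ev_swaps(3)[OF \<open>(%(x, y, z, w). g x y z w) \<in> _\<close>] by simp
qed

lemma spacing_ev_swap_pairs:
 assumes m: "(%(x, y, z, w). g x y z w) \<in> borel_measurable borel4"
 shows "spacing_ev (%(x, y, z, w). g z w x y) = spacing_ev (%(x, y, z, w). g x y z w)"
proof -
 note [measurable] = measurable_curried[OF m]
 have m: "(%(x, y, z, w). g z y x w) \<in> borel_measurable borel4" by measurable
 show ?thesis using spacing_ev_swap13[OF \<open>(%(x, y, z, w). g x y z w) \<in> _\<close>] spacing_ev_swap24[OF m] by simp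
qed

text \<open>A form of the shear that can be chained: \<open>h\<close> is the pullback of
  \<open>g\<close>, and \<open>supp\<close> says that \<open>g\<close> already vanishes outside the
  cone, so that no indicator has to be carried along.\<close>

lemma spacing_ev_cone:
 assumes m: "(%(x, y, z, w). g x y z w) \<in> borel_measurable borel4" and c: "0 <= c"
  and supp: "!!x y z w. 0 < x ==> 0 < y ==> 0 < z ==> 0 < w ==> x <= c * y ==> g x y z w = 0"
  and eq: "!!x y z w. 0 < x ==> 0 < y ==> 0 < z ==> 0 < w ==> h x y z w = g (x + c / (1 + c) * y) (y / (1 + c)) z w"
 shows "spacing_ev (%(x, y, z, w). h x y z w) = ennreal (1 + c) * spacing_ev (%(x, y, z, w). g x y z w)"
proof -
 have "spacing_ev (%(x, y, z, w). h x y z w) = spacing_ev (%(x, y, z, w). g (x + c / (1 + c) * y) (y / (1 + c)) z w)"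
  by (rule spacing_ev_cong) (simp add: eq)
 also have "... = ennreal (1 + c) * spacing_ev (%(x, y, z, w). if c * y < x then g x y z w else 0)"
  using spacing_ev_shear[OF m c] by (simp only: prod.case)
 also have "spacing_ev (%(x, y, z, w). if c * y < x then g x y z w else 0) = spacing_ev (%(x, y, z, w). g x y z w)"
  by (rule spacing_ev_cong) (auto simp: supp)
 finally show ?thesis .
qed

text \<open>The diagonal z = w is a null set of the plane, and the two halves beside it are
  exchanged by the symmetry of \<open>g\<close>.\<close>

lemma spacing_ev_split_ties:
 assumes gm: "(%(x, y, z, w). g x y z w) \<in> borel_measurable borel4"
  and sym: "!!x y z w. g x y w z = g x y z w"
 shows "spacing_ev (%(x, y, z, w). g x y z w) = 2 * spacing_ev (%(x, y, z, w). if w < z then g x y z w else 0)"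
proof -
 note [measurable] = measurable_curried[OF gm]
 have m: "(%(x, y, z, w). if w < z then g x y z w else 0) \<in> borel_measurable borel4"
  "(%(x, y, z, w). if z < w then g x y z w else 0) \<in> borel_measurable borel4" by measurable
 have "plane_integral (%(x, y, z, w). if z <= w \<and> w <= z then 1 else 0) = 0"
 proof -
  have "(\<integral>\<^sup>+z. (if z <= 1 - x - y - z \<and> 1 - x - y - z <= z then 1 else 0) \<partial>lborel) = (0 :: ennreal)" for x y :: real
  proof -
   have "(\<integral>\<^sup>+z. (if z <= 1 - x - y - z \<and> 1 - x - y - z <= z then 1 else 0 :: ennreal) \<partial>lborel) = (\<integral>\<^sup>+z. indicator {(1 - x - y) / 2} z \<partial>lborel)"
    by (intro nn_integral_cong) (auto simp: indicator_def)
   then show ?thesis by simp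
  qed
  then show ?thesis unfolding plane_integral_def by simp
 qed
 moreover have le: "plane_integral (%p. (%(x, y, z, w). if z <= w \<and> w <= z then 1 else 0) p * indicator positive4 p) <= plane_integral (%(x, y, z, w). if z <= w \<and> w <= z then 1 else 0)"
  unfolding plane_integral_def by (intro nn_integral_mono) (auto simp: indicator_def)
 ultimately have pz: "plane_integral (%p. (%(x, y, z, w). if z <= w \<and> w <= z then 1 else 0) p * indicator positive4 p) = 0"
  by (simp only: le_zero_eq)
 have "(%(x, y, z, w). if z <= w \<and> w <= z then 1 else 0 :: ennreal) \<in> borel_measurable borel4" (is "?tie \<in> _") by measurable
 note tm = measurable_compose[OF spacings_measurable this]
 from spacing_ev_eq_plane[OF \<open>?tie \<in> _\<close>]
 have "spacing_ev (%(x, y, z, w). if z <= w \<and> w <= z then 1 else 0) = 0"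
  by (simp only: pz mult_zero_right)
 then have "AE v in pivot_space 3. (%(x, y, z, w). if z <= w \<and> w <= z then 1 else 0 :: ennreal) (spacings v) = 0"
  unfolding spacing_ev_def by (simp only: nn_integral_0_iff_AE[OF tm])
 then have "spacing_ev (%(x, y, z, w). g x y z w)
  = spacing_ev (%p. (%(x, y, z, w). if w < z then g x y z w else 0) p + (%(x, y, z, w). if z < w then g x y z w else 0) p)"
  unfolding spacing_ev_def
 proof (intro nn_integral_cong_AE, elim AE_mp, intro AE_I2 impI)
  fix v assume "(%(x, y, z, w). if z <= w \<and> w <= z then 1 else 0 :: ennreal) (spacings v) = 0"
  then show "(%(x, y, z, w). g x y z w) (spacings v) = (%(x, y, z, w). if w < z then g x y z w else 0) (spacings v)
    + (%(x, y, z, w). if z < w then g x y z w else 0) (spacings v)"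
   by (cases "spacings v") (auto split: if_splits)
 qed
 also have "... = spacing_ev (%(x, y, z, w). if w < z then g x y z w else 0) + spacing_ev (%(x, y, z, w). if z < w then g x y z w else 0)"
  by (rule spacing_ev_add[OF m])
 also have "spacing_ev (%(x, y, z, w). if z < w then g x y z w else 0) = spacing_ev (%(x, y, z, w). if z < w then g x y w z else 0)"
  by (rule spacing_ev_cong) (simp only: prod.case sym)
 also have "... = spacing_ev (%(x, y, z, w). if w < z then g x y z w else 0)"
  using spacing_ev_swap34[OF m(1)] by (simp only: prod.case)
 finally show ?thesis by (simp add: mult_2)
qed

context
 fixes F :: "real => real => real => real => ennreal" and P :: "real => ennreal"
 assumes Fm: "(%(x, y, z, w). F x y z w) \<in> borel_measurable borel4" and Pm [measurable]: "P \<in> borel_measurable borel"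
begin

text \<open>The cone y + z < x is simplicial. Two shears with c = 1, one for each of y and z,
  straighten it, and each contributes a factor 2.\<close>

lemma cone_A:
 "spacing_ev (%(x, y, z, w). P x * F (x + y / 2 + z / 2) (z / 2) (y / 2) w)
  = 4 * spacing_ev (%(x, y, z, w). if y + z < x then P (x - y - z) * F x y z w else 0)"
proof -
 note [measurable] = measurable_curried[OF Fm]
 have "spacing_ev (%(x, y, z, w). P x * F (x + y / 2 + z / 2) (z / 2) (y / 2) w)
  = ennreal (1 + 1) * spacing_ev (%(x, y, z, w). if y < x then P (x - y) * F (x + z / 2) (z / 2) y w else 0)"
 proof (rule spacing_ev_cone, goal_cases)
  case 1 show ?case by measurable
 next
  case (3 x y z w)
  then show ?case by auto
 next
  case (4 x y z w)
  then show ?case by (auto simp: algebra_simps add_divide_distrib)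
 qed simp
 also have "spacing_ev (%(x, y, z, w). if y < x then P (x - y) * F (x + z / 2) (z / 2) y w else 0)
  = spacing_ev (%(x, y, z, w). if z < x then P (x - z) * F (x + y / 2) (y / 2) z w else 0)"
  by (rule spacing_ev_swaps(2)[of "%x y z w. if z < x then P (x - z) * F (x + y / 2) (y / 2) z w else 0"]) measurable
 also have "... = ennreal (1 + 1) * spacing_ev (%(x, y, z, w). if y + z < x then P (x - y - z) * F x y z w else 0)"
 proof (rule spacing_ev_cone, goal_cases)
  case 1 show ?case by measurable
 next
  case (3 x y z w)
  then show ?case by auto
 next
  case (4 x y z w)
  then show ?case by (auto simp: algebra_simps add_divide_distrib)
 qed simp
 finally show ?thesis by (simp add: mult.assoc[symmetric] ennreal_mult[symmetric])
qed

text \<open>On the half w < z the maximum is linear and the cone is simplicial. Read backwards from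
  the simplex, the shears have c = 1/2, 1, 1, 1 with product of determinants 12; the cone consists
  of two such halves, hence 6.\<close>

lemma cone_B:
 assumes sym: "!!x y z w. F x y w z = F x y z w"
 shows "spacing_ev (%(x, y, z, w). P x * F (x + y / 3 + w / 2 + z / 2) (z / 2) (w / 2 + y / 3) (y / 3))
  = 6 * spacing_ev (%(x, y, z, w). if y + max z w < x then P (x - y - max z w) * F x y z w else 0)"
proof -
 note [measurable] = measurable_curried[OF Fm]
 have "spacing_ev (%(x, y, z, w). P x * F (x + y / 3 + w / 2 + z / 2) (z / 2) (w / 2 + y / 3) (y / 3))
  = ennreal (1 + 1 / 2) * spacing_ev (%(x, y, z, w). if y / 2 < x then P (x - y / 2) * F (x + w / 2 + z / 2) (z / 2) (w / 2 + y / 2) (y / 2) else 0)"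
 proof (rule spacing_ev_cone, goal_cases)
  case 1 show ?case by measurable
 next
  case (3 x y z w)
  then show ?case by auto
 next
  case (4 x y z w)
  then show ?case by (auto simp: algebra_simps add_divide_distrib)
 qed simp
 also have "spacing_ev (%(x, y, z, w). if y / 2 < x then P (x - y / 2) * F (x + w / 2 + z / 2) (z / 2) (w / 2 + y / 2) (y / 2) else 0)
  = spacing_ev (%(x, y, z, w). if w / 2 < x then P (x - w / 2) * F (x + y / 2 + z / 2) (z / 2) (y / 2 + w / 2) (w / 2) else 0)"
  by (rule spacing_ev_swap24[of "%x y z w. if w / 2 < x then P (x - w / 2) * F (x + y / 2 + z / 2) (z / 2) (y / 2 + w / 2) (w / 2) else 0"]) measurable
 also have "... = ennreal (1 + 1) * spacing_ev (%(x, y, z, w). if y + w / 2 < x then P (x - y - w / 2) * F (x + z / 2) (z / 2) (y + w / 2) (w / 2) else 0)"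
 proof (rule spacing_ev_cone, goal_cases)
  case 1 show ?case by measurable
 next
  case (3 x y z w)
  then show ?case by auto
 next
  case (4 x y z w)
  then show ?case by (auto simp: algebra_simps add_divide_distrib)
 qed simp
 also have "spacing_ev (%(x, y, z, w). if y + w / 2 < x then P (x - y - w / 2) * F (x + z / 2) (z / 2) (y + w / 2) (w / 2) else 0)
  = spacing_ev (%(x, y, z, w). if z + w / 2 < x then P (x - z - w / 2) * F (x + y / 2) (y / 2) (z + w / 2) (w / 2) else 0)"
  by (rule spacing_ev_swaps(2)[of "%x y z w. if z + w / 2 < x then P (x - z - w / 2) * F (x + y / 2) (y / 2) (z + w / 2) (w / 2) else 0"]) measurable
 also have "... = ennreal (1 + 1) * spacing_ev (%(x, y, z, w). if y + z + w / 2 < x then P (x - y - z - w / 2) * F x y (z + w / 2) (w / 2) else 0)"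
 proof (rule spacing_ev_cone, goal_cases)
  case 1 show ?case by measurable
 next
  case (3 x y z w)
  then show ?case by auto
 next
  case (4 x y z w)
  then show ?case by (auto simp: algebra_simps add_divide_distrib)
 qed simp
 also have "spacing_ev (%(x, y, z, w). if y + z + w / 2 < x then P (x - y - z - w / 2) * F x y (z + w / 2) (w / 2) else 0)
  = spacing_ev (%(x, y, z, w). if w + x + y / 2 < z then P (z - w - x - y / 2) * F z w (x + y / 2) (y / 2) else 0)"
  by (rule spacing_ev_swap_pairs[of "%x y z w. if w + x + y / 2 < z then P (z - w - x - y / 2) * F z w (x + y / 2) (y / 2) else 0"]) measurable
 also have "... = ennreal (1 + 1) * spacing_ev (%(x, y, z, w). if w + x < z \<and> y < x then P (z - w - x) * F z w x y else 0)"
 proof (rule spacing_ev_cone, goal_cases)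
  case 1 show ?case by measurable
 next
  case (3 x y z w)
  then show ?case by auto
 next
  case (4 x y z w)
  then show ?case by (auto simp: algebra_simps add_divide_distrib)
 qed simp
 also have "spacing_ev (%(x, y, z, w). if w + x < z \<and> y < x then P (z - w - x) * F z w x y else 0)
  = spacing_ev (%(x, y, z, w). if y + z < x \<and> w < z then P (x - y - z) * F x y z w else 0)"
  by (rule spacing_ev_swap_pairs[of "%x y z w. if y + z < x \<and> w < z then P (x - y - z) * F x y z w else 0"]) measurable
 also have "... = spacing_ev (%(x, y, z, w). if w < z then if y + max z w < x then P (x - y - max z w) * F x y z w else 0 else 0)"
  by (rule spacing_ev_cong) auto
 finally have "spacing_ev (%(x, y, z, w). P x * F (x + y / 3 + w / 2 + z / 2) (z / 2) (w / 2 + y / 3) (y / 3))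
  = ennreal 12 * spacing_ev (%(x, y, z, w). if w < z then if y + max z w < x then P (x - y - max z w) * F x y z w else 0 else 0)"
  by (simp add: mult.assoc[symmetric] ennreal_mult[symmetric] del: ennreal_plus ennreal_numeral)
 moreover have "spacing_ev (%(x, y, z, w). if y + max z w < x then P (x - y - max z w) * F x y z w else 0)
  = 2 * spacing_ev (%(x, y, z, w). if w < z then if y + max z w < x then P (x - y - max z w) * F x y z w else 0 else 0)"
  by (rule spacing_ev_split_ties) (measurable, simp add: sym max.commute)
 ultimately show ?thesis by (simp add: mult.assoc[symmetric])
qed

text \<open>On the half w < z the minimum is w and the cone is the chain x + y < w < z. Shears with
  c = 2, 2, 1 give the factor 18, and the two halves together reduce it to 9.\<close>

lemma cone_C:
 assumes sym: "!!x y z w. F x y w z = F x y z w"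
 shows "spacing_ev (%(x, y, z, w). P (x / 2) * F (z / 3) (y / 3) (w + x / 2 + y / 3 + z / 3) (x / 2 + y / 3 + z / 3))
  = 9 * spacing_ev (%(x, y, z, w). if x + y < min z w then P (min z w - x - y) * F x y z w else 0)"
proof -
 note [measurable] = measurable_curried[OF Fm]
 have "spacing_ev (%(x, y, z, w). P (x / 2) * F (z / 3) (y / 3) (w + x / 2 + y / 3 + z / 3) (x / 2 + y / 3 + z / 3))
  = ennreal (1 + 2) * spacing_ev (%(x, y, z, w). if y < x / 2 then P (x / 2 - y) * F (z / 3) y (w + x / 2 + z / 3) (x / 2 + z / 3) else 0)"
 proof (rule spacing_ev_cone, goal_cases)
  case 1 show ?case by measurable
 next
  case (3 x y z w)
  then show ?case by auto
 next
  case (4 x y z w)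
  then show ?case by (auto simp: algebra_simps add_divide_distrib)
 qed simp
 also have "spacing_ev (%(x, y, z, w). if y < x / 2 then P (x / 2 - y) * F (z / 3) y (w + x / 2 + z / 3) (x / 2 + z / 3) else 0)
  = spacing_ev (%(x, y, z, w). if z < x / 2 then P (x / 2 - z) * F (y / 3) z (w + x / 2 + y / 3) (x / 2 + y / 3) else 0)"
  by (rule spacing_ev_swaps(2)[of "%x y z w. if z < x / 2 then P (x / 2 - z) * F (y / 3) z (w + x / 2 + y / 3) (x / 2 + y / 3) else 0"]) measurable
 also have "... = ennreal (1 + 2) * spacing_ev (%(x, y, z, w). if y + z < x / 2 then P (x / 2 - y - z) * F y z (w + x / 2) (x / 2) else 0)"
 proof (rule spacing_ev_cone, goal_cases)
  case 1 show ?case by measurable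
 next
  case (3 x y z w)
  then show ?case by auto
 next
  case (4 x y z w)
  then show ?case by (auto simp: algebra_simps add_divide_distrib)
 qed simp
 also have "spacing_ev (%(x, y, z, w). if y + z < x / 2 then P (x / 2 - y - z) * F y z (w + x / 2) (x / 2) else 0)
  = spacing_ev (%(x, y, z, w). if x + z < y / 2 then P (y / 2 - x - z) * F x z (w + y / 2) (y / 2) else 0)"
  by (rule spacing_ev_swaps(1)[of "%x y z w. if x + z < y / 2 then P (y / 2 - x - z) * F x z (w + y / 2) (y / 2) else 0"]) measurable
 also have "... = spacing_ev (%(x, y, z, w). if w + z < y / 2 then P (y / 2 - w - z) * F w z (x + y / 2) (y / 2) else 0)"
  by (rule spacing_ev_swap14[of "%x y z w. if w + z < y / 2 then P (y / 2 - w - z) * F w z (x + y / 2) (y / 2) else 0"]) measurable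
 also have "... = spacing_ev (%(x, y, z, w). if z + w < y / 2 then P (y / 2 - z - w) * F z w (x + y / 2) (y / 2) else 0)"
  by (rule spacing_ev_swaps(3)[of "%x y z w. if z + w < y / 2 then P (y / 2 - z - w) * F z w (x + y / 2) (y / 2) else 0"]) measurable
 also have "... = ennreal (1 + 1) * spacing_ev (%(x, y, z, w). if z + w < y \<and> y < x then P (y - z - w) * F z w x y else 0)"
 proof (rule spacing_ev_cone, goal_cases)
  case 1 show ?case by measurable
 next
  case (3 x y z w)
  then show ?case by auto
 next
  case (4 x y z w)
  then show ?case by (auto simp: algebra_simps add_divide_distrib)
 qed simp
 also have "spacing_ev (%(x, y, z, w). if z + w < y \<and> y < x then P (y - z - w) * F z w x y else 0)
  = spacing_ev (%(x, y, z, w). if x + y < w \<and> w < z then P (w - x - y) * F x y z w else 0)"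
  by (rule spacing_ev_swap_pairs[of "%x y z w. if x + y < w \<and> w < z then P (w - x - y) * F x y z w else 0"]) measurable
 also have "... = spacing_ev (%(x, y, z, w). if w < z then if x + y < min z w then P (min z w - x - y) * F x y z w else 0 else 0)"
  by (rule spacing_ev_cong) auto
 finally have "spacing_ev (%(x, y, z, w). P (x / 2) * F (z / 3) (y / 3) (w + x / 2 + y / 3 + z / 3) (x / 2 + y / 3 + z / 3))
  = ennreal 18 * spacing_ev (%(x, y, z, w). if w < z then if x + y < min z w then P (min z w - x - y) * F x y z w else 0 else 0)"
  by (simp add: mult.assoc[symmetric] ennreal_mult[symmetric] del: ennreal_plus ennreal_numeral)
 moreover have "spacing_ev (%(x, y, z, w). if x + y < min z w then P (min z w - x - y) * F x y z w else 0)
  = 2 * spacing_ev (%(x, y, z, w). if w < z then if x + y < min z w then P (min z w - x - y) * F x y z w else 0 else 0)"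
  by (rule spacing_ev_split_ties) (measurable, simp add: sym min.commute)
 ultimately show ?thesis by (simp add: mult.assoc[symmetric])
qed

end

section \<open>Optimal trees for three pivots\<close>

text \<open>The saving over the balanced tree, all of whose leaves have depth 2; each of the four
  linear forms is the saving of one of the other four trees when the spacings sum to 1.\<close>

definition max_gain :: "real => real => real => real => real" where
 "max_gain x y z w = max 0 (max (x - y - z) (max (x - z - w) (max (w - x - y) (w - y - z))))"

lemma class_trees_3:
 "class_trees 3 = {\<langle>\<langle>\<langle>\<rangle>, 1, \<langle>\<rangle>\<rangle>, 2, \<langle>\<langle>\<rangle>, 3, \<langle>\<rangle>\<rangle>\<rangle>,
   \<langle>\<langle>\<rangle>, 1, \<langle>\<langle>\<langle>\<rangle>, 2, \<langle>\<rangle>\<rangle>, 3, \<langle>\<rangle>\<rangle>\<rangle>, \<langle>\<langle>\<rangle>, 1, \<langle>\<langle>\<rangle>, 2, \<langle>\<langle>\<rangle>, 3, \<langle>\<rangle>\<rangle>\<rangle>\<rangle>,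
   \<langle>\<langle>\<langle>\<langle>\<rangle>, 1, \<langle>\<rangle>\<rangle>, 2, \<langle>\<rangle>\<rangle>, 3, \<langle>\<rangle>\<rangle>, \<langle>\<langle>\<langle>\<rangle>, 1, \<langle>\<langle>\<rangle>, 2, \<langle>\<rangle>\<rangle>\<rangle>, 3, \<langle>\<rangle>\<rangle>}" (is "_ = ?R")
proof
 define T where "T A = {t. bst t \<and> set_tree t = A}" for A :: "nat set"
 have T0: "T {} = {\<langle>\<rangle>}"
 proof -
  have "t = \<langle>\<rangle>" if "set_tree t = {}" for t :: "nat tree" using that by (cases t) auto
  then show ?thesis by (auto simp: T_def)
 qed
 have TA: "\<exists>k\<in>A. \<exists>l\<in>T {x\<in>A. x < k}. \<exists>r\<in>T {x\<in>A. k < x}. t = \<langle>l, k, r\<rangle>" if t: "t \<in> T A" and ne: "A \<noteq> {}" for A t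
 proof -
  obtain l k r where e: "t = \<langle>l, k, r\<rangle>" using t ne by (cases t) (auto simp: T_def)
  then have "l \<in> T {x\<in>A. x < k}" "r \<in> T {x\<in>A. k < x}" "k \<in> A" using t by (auto simp: T_def)
  then show ?thesis using e by blast
 qed
 have T0': "t = \<langle>\<rangle>" if "t \<in> T {}" for t using that T0 by simp
 have T1: "t = \<langle>\<langle>\<rangle>, k, \<langle>\<rangle>\<rangle>" if h: "t \<in> T {k}" for t k
 proof -
  have e: "{x \<in> {k}. x < k} = {}" "{x \<in> {k}. k < x} = {}" by auto
  obtain j l r where "j = k" "l \<in> T {x\<in>{k}. x < j}" "r \<in> T {x\<in>{k}. j < x}" "t = \<langle>l, j, r\<rangle>" using TA[OF h insert_not_empty] by (elim bexE) (rule that[OF singletonD])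
  then show ?thesis using T0' unfolding \<open>j = k\<close> e by blast
 qed
 have s: "{x \<in> {1, 2::nat}. x < 1} = {}" "{x \<in> {1, 2::nat}. 1 < x} = {2}" "{x \<in> {1, 2::nat}. x < 2} = {1}" "{x \<in> {1, 2::nat}. 2 < x} = {}"
  "{x \<in> {2, 3::nat}. x < 2} = {}" "{x \<in> {2, 3::nat}. 2 < x} = {3}" "{x \<in> {2, 3::nat}. x < 3} = {2}" "{x \<in> {2, 3::nat}. 3 < x} = {}"
  "{x \<in> {1, 2, 3::nat}. x < 1} = {}" "{x \<in> {1, 2, 3::nat}. 1 < x} = {2, 3}" "{x \<in> {1, 2, 3::nat}. x < 2} = {1}" "{x \<in> {1, 2, 3::nat}. 2 < x} = {3}"
  "{x \<in> {1, 2, 3::nat}. x < 3} = {1, 2}" "{x \<in> {1, 2, 3::nat}. 3 < x} = {}"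
  by auto
 have T12: "t = \<langle>\<langle>\<rangle>, 1, \<langle>\<langle>\<rangle>, 2, \<langle>\<rangle>\<rangle>\<rangle> \<or> t = \<langle>\<langle>\<langle>\<rangle>, 1, \<langle>\<rangle>\<rangle>, 2, \<langle>\<rangle>\<rangle>" if h: "t \<in> T {1, 2}" for t
 proof -
  obtain k l r where k: "k \<in> {1, 2}" and l: "l \<in> T {x\<in>{1, 2}. x < k}" and r: "r \<in> T {x\<in>{1, 2}. k < x}" and t: "t = \<langle>l, k, r\<rangle>"
   using TA[OF h insert_not_empty] by (elim bexE) (rule that)
  from k consider "k = 1" | "k = 2" by blast
  then show ?thesis
  proof cases
   case 1
   show ?thesis unfolding t 1 T0'[OF l[unfolded 1 s]] T1[OF r[unfolded 1 s]] by simp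
  next
   case 2
   show ?thesis unfolding t 2 T1[OF l[unfolded 2 s]] T0'[OF r[unfolded 2 s]] by simp
  qed
 qed
 have T23: "t = \<langle>\<langle>\<rangle>, 2, \<langle>\<langle>\<rangle>, 3, \<langle>\<rangle>\<rangle>\<rangle> \<or> t = \<langle>\<langle>\<langle>\<rangle>, 2, \<langle>\<rangle>\<rangle>, 3, \<langle>\<rangle>\<rangle>" if h: "t \<in> T {2, 3}" for t
 proof -
  obtain k l r where k: "k \<in> {2, 3}" and l: "l \<in> T {x\<in>{2, 3}. x < k}" and r: "r \<in> T {x\<in>{2, 3}. k < x}" and t: "t = \<langle>l, k, r\<rangle>"
   using TA[OF h insert_not_empty] by (elim bexE) (rule that)
  from k consider "k = 2" | "k = 3" by blast
  then show ?thesis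
  proof cases
   case 1
   show ?thesis unfolding t 1 T0'[OF l[unfolded 1 s]] T1[OF r[unfolded 1 s]] by simp
  next
   case 2
   show ?thesis unfolding t 2 T1[OF l[unfolded 2 s]] T0'[OF r[unfolded 2 s]] by simp
  qed
 qed
 have "T {1, 2, 3} \<subseteq> ?R"
 proof
  fix t assume h: "t \<in> T {1, 2, 3}"
  obtain k l r where k: "k \<in> {1, 2, 3}" and l: "l \<in> T {x\<in>{1, 2, 3}. x < k}" and r: "r \<in> T {x\<in>{1, 2, 3}. k < x}" and t: "t = \<langle>l, k, r\<rangle>"
   using TA[OF h insert_not_empty] by (elim bexE) (rule that)
  from k consider "k = 1" | "k = 2" | "k = 3" by blast
  then show "t \<in> ?R"
  proof cases
   case 1
   show ?thesis using T0'[OF l[unfolded 1 s]] T23[OF r[unfolded 1 s]] unfolding t 1 by (elim disjE) simp_all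
  next
   case 2
   show ?thesis unfolding t 2 T1[OF l[unfolded 2 s]] T1[OF r[unfolded 2 s]] by simp
  next
   case 3
   show ?thesis using T12[OF l[unfolded 3 s]] T0'[OF r[unfolded 3 s]] unfolding t 3 by (elim disjE) simp_all
  qed
 qed
 moreover have "{1..3} = {1, 2, 3::nat}" by auto
 ultimately show "class_trees 3 \<subseteq> ?R" unfolding class_trees_def T_def by simp
 show "?R \<subseteq> class_trees 3" by (auto simp: class_trees_def)
qed

lemma opt_cost_3:
 assumes "x 0 + x 1 + x 2 + x 3 = 1"
 shows "opt_cost 3 x = 2 - max_gain (x 0) (x 1) (x 2) (x 3)"
proof -
 have p: "path_cost 3 t x = x 0 * leaf_depth t 0 + x 1 * leaf_depth t 1 + x 2 * leaf_depth t 2 + x 3 * leaf_depth t 3" for t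
  by (simp add: path_cost_def eval_nat_numeral)
 have l: "min (2 - a) (2 - b) = 2 - max a b" for a b :: real by auto
 have "opt_cost 3 x = Min {2 * x 0 + 2 * x 1 + 2 * x 2 + 2 * x 3, x 0 + 3 * x 1 + 3 * x 2 + 2 * x 3, x 0 + 2 * x 1 + 3 * x 2 + 3 * x 3,
   3 * x 0 + 3 * x 1 + 2 * x 2 + x 3, 2 * x 0 + 3 * x 1 + 3 * x 2 + x 3}"
  unfolding opt_cost_def class_trees_3 p leaf_depth_def by (simp add: eval_nat_numeral mult.commute)
 also have "... = Min {2 - 0, 2 - (x 0 - x 1 - x 2), 2 - (x 0 - x 2 - x 3), 2 - (x 3 - x 0 - x 1), 2 - (x 3 - x 1 - x 2)}"
 proof -
  have e: "2 * x 0 + 2 * x 1 + 2 * x 2 + 2 * x 3 = 2 - 0" "x 0 + 3 * x 1 + 3 * x 2 + 2 * x 3 = 2 - (x 0 - x 1 - x 2)"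
   "x 0 + 2 * x 1 + 3 * x 2 + 3 * x 3 = 2 - (x 0 - x 2 - x 3)" "3 * x 0 + 3 * x 1 + 2 * x 2 + x 3 = 2 - (x 3 - x 0 - x 1)"
   "2 * x 0 + 3 * x 1 + 3 * x 2 + x 3 = 2 - (x 3 - x 1 - x 2)"
   using assms by linarith+
  show ?thesis by (simp only: e)
 qed
 also have "... = 2 - max_gain (x 0) (x 1) (x 2) (x 3)"
  by (subst Min_insert, simp, simp, subst Min_insert, simp, simp, subst Min_insert, simp, simp, subst Min_insert, simp, simp)
   (simp only: l Min_singleton max_gain_def)
 finally show ?thesis .
qed

text \<open>Arrange the forms as the path x-z-w, x-y-z, w-y-z, w-x-y. Those above any level t >= 0
  are consecutive, so vertices minus edges count 1 as soon as the maximum exceeds t. The three extra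
  terms on the left are \<open>P\<close> of the minima of neighbouring forms.\<close>

lemma max_gain_valuation:
 fixes P :: "real => ennreal"
 assumes "P 0 = 0" "0 < x" "0 < y" "0 < z" "0 < w"
 shows "P (max_gain x y z w) + (if z + max y w < x then P (x - z - max y w) else 0)
   + (if y + max x z < w then P (w - y - max x z) else 0) + (if y + z < min x w then P (min x w - y - z) else 0)
  = (if z + w < x then P (x - z - w) else 0) + (if y + z < x then P (x - y - z) else 0)
   + (if y + z < w then P (w - y - z) else 0) + (if x + y < w then P (w - x - y) else 0)"
proof (cases "w <= x")
 case True
 then have z: "\<not> y + max x z < w" "\<not> x + y < w" and mw: "min x w = w" using assms by auto
 \<comment> \<open>For w <= x the last form is not positive and w-y-z is dominated by x-y-z, so the
   comparison of y with w decides between the first two.\<close>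
 have M: "max_gain x y z w = (if y <= w then if y + z < x then x - y - z else 0 else if z + w < x then x - z - w else 0)"
 proof -
  have "max 0 (max b (max a (max d c))) = (if a <= b then if 0 < b then b else 0 else if 0 < a then a else 0)"
   if "d <= 0" "c <= b" for a b c d :: real using that by (auto simp: max_def)
  moreover have "w - x - y <= 0" "w - y - z <= x - y - z" using assms True by auto
  moreover have "x - z - w <= x - y - z \<longleftrightarrow> y <= w" "0 < x - y - z \<longleftrightarrow> y + z < x" "0 < x - z - w \<longleftrightarrow> z + w < x" by auto
  ultimately show ?thesis unfolding max_gain_def by (simp only:)
 qed
 show ?thesis
 proof (cases "y <= w")
  case y: True
  then have 1: "max y w = w" by simp
  have 2: "P (max_gain x y z w) = (if y + z < x then P (x - y - z) else 0)" using y assms(1) by (simp add: M)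
  show ?thesis by (simp only: 1 2 z mw if_False add_0_right add_ac)
 next
  case y: False
  then have 1: "max y w = y" "\<not> y + z < w" "x - z - y = x - y - z" using assms by auto
  have 2: "P (max_gain x y z w) = (if z + w < x then P (x - z - w) else 0)" using y assms(1) by (simp add: M)
  show ?thesis by (simp only: 1 2 z mw if_False add_0_right add_0_left add.commute[of z y])
 qed
next
 case False
 then have z: "\<not> z + max y w < x" "\<not> z + w < x" and mw: "min x w = x" using assms by auto
 have M: "max_gain x y z w = (if z <= x then if y + z < w then w - y - z else 0 else if x + y < w then w - x - y else 0)"
 proof -
  have "max 0 (max b (max a (max d c))) = (if d <= c then if 0 < c then c else 0 else if 0 < d then d else 0)"
   if "a <= 0" "b <= c" for a b c d :: real using that by (auto simp: max_def)
  moreover have "x - z - w <= 0" "x - y - z <= w - y - z" using assms False by auto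
  moreover have "w - x - y <= w - y - z \<longleftrightarrow> z <= x" "0 < w - y - z \<longleftrightarrow> y + z < w" "0 < w - x - y \<longleftrightarrow> x + y < w" by auto
  ultimately show ?thesis unfolding max_gain_def by (simp only:)
 qed
 show ?thesis
 proof (cases "z <= x")
  case y: True
  then have 1: "max x z = x" "w - y - x = w - x - y" by auto
  have 2: "P (max_gain x y z w) = (if y + z < w then P (w - y - z) else 0)" using y assms(1) by (simp add: M)
  show ?thesis by (simp only: 1 2 z mw if_False add_0_right add_0_left add.commute[of y x]) (simp only: add_ac)
 next
  case y: False
  then have 1: "max x z = z" "\<not> y + z < x" using assms by auto
  have 2: "P (max_gain x y z w) = (if x + y < w then P (w - x - y) else 0)" using y assms(1) by (simp add: M)
  show ?thesis by (simp only: 1 2 z mw if_False add_0_right add_0_left) (simp only: add_ac)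
 qed
qed

lemma max_gain_measurable [measurable]:
 assumes "f1 \<in> borel_measurable N" "f2 \<in> borel_measurable N" "f3 \<in> borel_measurable N" "f4 \<in> borel_measurable N"
 shows "(%x. max_gain (f1 x) (f2 x) (f3 x) (f4 x)) \<in> borel_measurable N"
 unfolding max_gain_def by (intro borel_measurable_max borel_measurable_diff borel_measurable_const assms)

context
 fixes F :: "real => real => real => real => ennreal" and P :: "real => ennreal"
 assumes Fm: "(%(x, y, z, w). F x y z w) \<in> borel_measurable borel4" and Pm [measurable]: "P \<in> borel_measurable borel"
begin

lemma cone_integrands_measurable:
 shows "(%(x, y, z, w). if y + z < x then P (x - y - z) * F x y z w else 0) \<in> borel_measurable borel4" (is ?g1)
  and "(%(x, y, z, w). if y + max z w < x then P (x - y - max z w) * F x y z w else 0) \<in> borel_measurable borel4" (is ?g2)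
  and "(%(x, y, z, w). if x + y < min z w then P (min z w - x - y) * F x y z w else 0) \<in> borel_measurable borel4" (is ?g3)
  and "(%(x, y, z, w). P (max_gain x y z w) * F x y z w) \<in> borel_measurable borel4" (is ?g4)
proof -
 note [measurable] = measurable_curried[OF Fm]
 show ?g1 ?g2 ?g3 ?g4 by measurable
qed

end

lemma measurable_permuted:
 assumes m: "(%(x, y, z, w). g x y z w) \<in> borel_measurable borel4"
 shows "(%(x, y, z, w). g x y w z) \<in> borel_measurable borel4" "(%(x, y, z, w). g x z y w) \<in> borel_measurable borel4"
  "(%(x, y, z, w). g x w z y) \<in> borel_measurable borel4" "(%(x, y, z, w). g w y z x) \<in> borel_measurable borel4"
  "(%(x, y, z, w). g w y x z) \<in> borel_measurable borel4" "(%(x, y, z, w). g z y x w) \<in> borel_measurable borel4"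
 unfolding case_prod_beta by (rule measurable_curried[OF m]; measurable)+

text \<open>By symmetry of \<open>F\<close> the valuation identity involves four cones of type A,
  two of type B and one of type C, which gives 4 (a/4) - 2 (b/6) - c/9. The identity is integrated
  as an equality of sums, since subtraction in \<open>ennreal\<close> truncates.\<close>

lemma max_gain_integral:
 fixes F :: "real => real => real => real => ennreal" and P :: "real => ennreal"
 assumes Fm: "(%(x, y, z, w). F x y z w) \<in> borel_measurable borel4" and Pm: "P \<in> borel_measurable borel"
  and P0: "P 0 = 0"
  and sym: "!!x y z w. F y x z w = F x y z w" "!!x y z w. F x z y w = F x y z w" "!!x y z w. F x y w z = F x y z w"
  and a: "spacing_ev (%(x, y, z, w). P x * F (x + y / 2 + z / 2) (z / 2) (y / 2) w) = ennreal a" "0 <= a"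
  and b: "spacing_ev (%(x, y, z, w). P x * F (x + y / 3 + w / 2 + z / 2) (z / 2) (w / 2 + y / 3) (y / 3)) = ennreal b" "0 <= b"
  and c: "spacing_ev (%(x, y, z, w). P (x / 2) * F (z / 3) (y / 3) (w + x / 2 + y / 3 + z / 3) (x / 2 + y / 3 + z / 3)) = ennreal c" "0 <= c"
 shows "spacing_ev (%(x, y, z, w). P (max_gain x y z w) * F x y z w) = ennreal (a - b / 3 - c / 9)"
proof -
 define A where "A x y z w = (if y + z < x then P (x - y - z) * F x y z w else 0)" for x y z w
 define B where "B x y z w = (if y + max z w < x then P (x - y - max z w) * F x y z w else 0)" for x y z w
 define C where "C x y z w = (if x + y < min z w then P (min z w - x - y) * F x y z w else 0)" for x y z w
 define m where "m x y z w = P (max_gain x y z w) * F x y z w" for x y z w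
 have Am: "(%(x, y, z, w). A x y z w) \<in> borel_measurable borel4"
  unfolding A_def by (rule cone_integrands_measurable(1)[OF Fm Pm])
 have Bm: "(%(x, y, z, w). B x y z w) \<in> borel_measurable borel4"
  unfolding B_def by (rule cone_integrands_measurable(2)[OF Fm Pm])
 have Cm: "(%(x, y, z, w). C x y z w) \<in> borel_measurable borel4"
  unfolding C_def by (rule cone_integrands_measurable(3)[OF Fm Pm])
 have mm: "(%(x, y, z, w). m x y z w) \<in> borel_measurable borel4"
  unfolding m_def by (rule cone_integrands_measurable(4)[OF Fm Pm])
 have div: "X = ennreal (v / k)" if "ennreal k * X = ennreal v" "0 < k" "0 <= v" for X k v
 proof (cases X)
  case (real r)
  then have "ennreal (k * r) = ennreal v" using that by (simp add: ennreal_mult)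
  then have "k * r = v" using that real by simp
  then show ?thesis using that real by (simp add: field_simps)
 next
  case top
  then show ?thesis using that by (simp add: ennreal_mult_top)
 qed
 have EA: "spacing_ev (%(x, y, z, w). A x y z w) = ennreal (a / 4)"
  using cone_A[OF Fm Pm] a by (intro div) (simp_all add: A_def)
 have EB: "spacing_ev (%(x, y, z, w). B x y z w) = ennreal (b / 6)"
  using cone_B[OF Fm Pm sym(3)] b by (intro div) (simp_all add: B_def)
 have EC: "spacing_ev (%(x, y, z, w). C x y z w) = ennreal (c / 9)"
  using cone_C[OF Fm Pm sym(3)] c by (intro div) (simp_all add: C_def)
 have E: "spacing_ev (%(x, y, z, w). A x w z y) = ennreal (a / 4)" "spacing_ev (%(x, y, z, w). A w y z x) = ennreal (a / 4)"
  "spacing_ev (%(x, y, z, w). A w y x z) = ennreal (a / 4)" "spacing_ev (%(x, y, z, w). B x z y w) = ennreal (b / 6)"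
  "spacing_ev (%(x, y, z, w). B w y x z) = ennreal (b / 6)" "spacing_ev (%(x, y, z, w). C z y x w) = ennreal (c / 9)"
 proof -
  note m = measurable_permuted(1)[OF Am] measurable_permuted(1)[OF Bm]
  show "spacing_ev (%(x, y, z, w). A x w z y) = ennreal (a / 4)" using spacing_ev_swap24[OF Am] EA by simp
  show "spacing_ev (%(x, y, z, w). A w y z x) = ennreal (a / 4)" using spacing_ev_swap14[OF Am] EA by simp
  show "spacing_ev (%(x, y, z, w). A w y x z) = ennreal (a / 4)"
   using spacing_ev_swap14[OF m(1)] spacing_ev_swaps(3)[OF Am] EA by simp
  show "spacing_ev (%(x, y, z, w). B x z y w) = ennreal (b / 6)" using spacing_ev_swaps(2)[OF Bm] EB by simp
  show "spacing_ev (%(x, y, z, w). B w y x z) = ennreal (b / 6)"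
   using spacing_ev_swap14[OF m(2)] spacing_ev_swaps(3)[OF Bm] EB by simp
  show "spacing_ev (%(x, y, z, w). C z y x w) = ennreal (c / 9)" using spacing_ev_swap13[OF Cm] EC by simp
 qed
 have add: "spacing_ev (%(x, y, z, w). f x y z w + g x y z w)
   = spacing_ev (%(x, y, z, w). f x y z w) + spacing_ev (%(x, y, z, w). g x y z w)"
  if "(%(x, y, z, w). f x y z w) \<in> borel_measurable borel4" "(%(x, y, z, w). g x y z w) \<in> borel_measurable borel4" for f g :: "real => real => real => real => ennreal"
  using spacing_ev_add[OF that] by (simp add: case_prod_unfold)
 have addm: "(%(x, y, z, w). f x y z w + g x y z w) \<in> borel_measurable borel4"
  if "(%(x, y, z, w). f x y z w) \<in> borel_measurable borel4" "(%(x, y, z, w). g x y z w) \<in> borel_measurable borel4" for f g :: "real => real => real => real => ennreal"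
  using borel_measurable_add[OF that] by (simp add: case_prod_unfold)
 note perms = Am mm measurable_permuted(3-5)[OF Am] measurable_permuted(2,5)[OF Bm] measurable_permuted(6)[OF Cm]
 have "spacing_ev (%(x, y, z, w). m x y z w + B x z y w + B w y x z + C z y x w)
  = spacing_ev (%(x, y, z, w). A x w z y + A x y z w + A w y z x + A w y x z)"
 proof (rule spacing_ev_cong)
  fix x y z w :: real assume pos: "0 < x" "0 < y" "0 < z" "0 < w"
  have s: "F x w z y = F x y z w" "F w y z x = F x y z w" "F w y x z = F x y z w" "F z y x w = F x y z w" "F x z y w = F x y z w"
   by (metis sym)+
  have e: "x - w - z = x - z - w" "w - y - x = w - x - y" "min x w - z - y = min x w - y - z" "w + z = z + w" "y + x = x + y" "z + y = y + z" by auto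
  have "m x y z w + B x z y w + B w y x z + C z y x w
   = (P (max_gain x y z w) + (if z + max y w < x then P (x - z - max y w) else 0)
   + (if y + max x z < w then P (w - y - max x z) else 0) + (if y + z < min x w then P (min x w - y - z) else 0)) * F x y z w"
   unfolding m_def B_def C_def s e distrib_right by (simp add: if_distrib[of "%t. t * F x y z w"] cong: if_cong)
  also have "... = ((if z + w < x then P (x - z - w) else 0) + (if y + z < x then P (x - y - z) else 0)
   + (if y + z < w then P (w - y - z) else 0) + (if x + y < w then P (w - x - y) else 0)) * F x y z w"
   by (simp only: max_gain_valuation[of P, OF P0 pos])
  also have "... = A x w z y + A x y z w + A w y z x + A w y x z"
   unfolding A_def s e distrib_right by (simp add: if_distrib[of "%t. t * F x y z w"] cong: if_cong)
  finally show "(%(x, y, z, w). m x y z w + B x z y w + B w y x z + C z y x w) (x, y, z, w)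
   = (%(x, y, z, w). A x w z y + A x y z w + A w y z x + A w y x z) (x, y, z, w)" by simp
 qed
 moreover have "spacing_ev (%(x, y, z, w). m x y z w + B x z y w + B w y x z + C z y x w)
  = spacing_ev (%(x, y, z, w). m x y z w) + ennreal (b / 6) + ennreal (b / 6) + ennreal (c / 9)"
  by (simp only: add addm perms E)
 moreover have "spacing_ev (%(x, y, z, w). A x w z y + A x y z w + A w y z x + A w y x z)
  = ennreal (a / 4) + ennreal (a / 4) + ennreal (a / 4) + ennreal (a / 4)"
  by (simp only: add addm perms E EA)
 ultimately have "spacing_ev (%(x, y, z, w). m x y z w) + ennreal (b / 3 + c / 9) = ennreal a"
  using a(2) b(2) c(2) by (simp add: add.assoc ennreal_plus[symmetric] del: ennreal_plus)
 then have "spacing_ev (%(x, y, z, w). m x y z w) = ennreal a - ennreal (b / 3 + c / 9)"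
  using b(2) c(2) by (metis ennreal_add_diff_cancel_right ennreal_neq_top)
 also have "... = ennreal (a - (b / 3 + c / 9))" by (rule ennreal_minus) (use b(2) c(2) in auto)
 finally show ?thesis by (simp add: m_def diff_diff_eq)
qed

section \<open>Moments of the entropy and of the gain\<close>

lemma spacing_ev_single:
 fixes f :: "real => real"
 assumes [measurable]: "f \<in> borel_measurable borel" and nonneg: "!!x. 0 < x ==> x < 1 ==> 0 <= f x"
  and I: "((%x. f x * (1 - x)\<^sup>2) has_integral I) {0..1}"
 shows "spacing_ev (%(x, y, z, w). ennreal (f x)) = ennreal (3 * I)"
proof -
 have "spacing_ev (%(x, y, z, w). ennreal (f x)) = ennreal (6 * (I * (1 / 2)))"
 proof (rule spacing_ev_iterated)
  show "((%x. f x * (1 - x)\<^sup>2 * (1 / 2)) has_integral I * (1 / 2)) {0..1}"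
   by (rule has_integral_mult_left[OF I])
  fix x :: real assume x: "0 < x" "x < 1"
  have "((%y. 1 - x - y) has_integral (((1 - x) * (1 - x) - (1 - x)\<^sup>2 / 2) - ((1 - x) * 0 - 0\<^sup>2 / 2))) {0..1 - x}"
  proof (rule fundamental_theorem_of_calculus)
   fix t :: real
   have "((%y. (1 - x) * y - y\<^sup>2 / 2) has_real_derivative 1 - x - t) (at t within {0..1 - x})"
    by (auto intro!: derivative_eq_intros)
   then show "((%y. (1 - x) * y - y\<^sup>2 / 2) has_vector_derivative 1 - x - t) (at t within {0..1 - x})"
    by (simp add: has_real_derivative_iff_has_vector_derivative)
  qed (use x in auto)
  then have "((%y. 1 - x - y) has_integral (1 - x)\<^sup>2 * (1 / 2)) {0..1 - x}"
   by (simp add: power2_eq_square)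
  from has_integral_mult_right[OF this, of "f x"]
  show "((%y. f x * (1 - x - y)) has_integral f x * (1 - x)\<^sup>2 * (1 / 2)) {0..1 - x}"
   by (simp only: mult.assoc)
 qed (use nonneg in auto)
 then show ?thesis by simp
qed

lemma spacing_ev_power: "spacing_ev (%(x, y, z, w). ennreal (x ^ k)) = ennreal (3 * (fact k * fact 2 / fact (k + 2 + 1)))"
 by (rule spacing_ev_single[OF _ _ integral_power_mult_power]) auto

lemma spacing_ev_entropy: "spacing_ev (%(x, y, z, w). ennreal (entropy_int 0 x)) = ennreal (13 / 48)"
proof -
 have "((%x. (1 + (-2) * x + 1 * x\<^sup>2 + 0 * x ^ 3) * entropy_int 0 (0 + 1 * x)) has_integral parts_diff 1 (-2) 1 0 0 0 1) {0..1}"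
  by (rule has_integral_parts_diff) auto
 also have "(%x. (1 + (-2) * x + 1 * x\<^sup>2 + 0 * x ^ 3) * entropy_int 0 (0 + 1 * x)) = (%x. entropy_int 0 x * (1 - x)\<^sup>2)"
  by (simp add: fun_eq_iff power2_eq_square algebra_simps)
 finally have "spacing_ev (%(x, y, z, w). ennreal (entropy_int 0 x)) = ennreal (3 * parts_diff 1 (-2) 1 0 0 0 1)"
  by (intro spacing_ev_single) (auto intro: entropy_int_nonneg)
 also have "3 * parts_diff 1 (-2) 1 0 0 0 1 = 13 / 48"
  unfolding parts_diff_unfold by (simp add: entropy_int_values)
 finally show ?thesis .
qed

lemma spacing_ev_entropy_square:
 "spacing_ev (%(x, y, z, w). ennreal ((entropy_int 0 x)\<^sup>2)) = ennreal (1489 / 18000)"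
proof -
 have "((%x::real. x ^ 2 * (ln x)\<^sup>2 - 2 * (x ^ 3 * (ln x)\<^sup>2) + x ^ 4 * (ln x)\<^sup>2) has_integral
   2 / real (2 + 1) ^ 3 - 2 * (2 / real (3 + 1) ^ 3) + 2 / real (4 + 1) ^ 3) {0..1}"
  by (intro has_integral_add has_integral_diff has_integral_mult_right has_integral_ln_square) auto
 also have "(%x::real. x ^ 2 * (ln x)\<^sup>2 - 2 * (x ^ 3 * (ln x)\<^sup>2) + x ^ 4 * (ln x)\<^sup>2) = (%x. (entropy_int 0 x)\<^sup>2 * (1 - x)\<^sup>2)"
  by (simp add: fun_eq_iff entropy_int_0 power2_eq_square power3_eq_cube power4_eq_xxxx algebra_simps)
 finally have "spacing_ev (%(x, y, z, w). ennreal ((entropy_int 0 x)\<^sup>2))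
  = ennreal (3 * (2 / real (2 + 1) ^ 3 - 2 * (2 / real (3 + 1) ^ 3) + 2 / real (4 + 1) ^ 3))"
  by (intro spacing_ev_single) auto
 then show ?thesis by simp
qed

lemma has_integral_ln_ln:
 "((%x. x ^ k * (ln x * ln (1 - x))) has_integral
  (harm (k + 1) / (real (k + 1))\<^sup>2 - (pi\<^sup>2 / 6 - (\<Sum>i=1..k+1. 1 / (real i)\<^sup>2)) / real (k + 1))) {0..1}" (is "(?f has_integral ?I) _")
proof -
 have "0 <= ?I"
  using sums_le[OF _ sums_zero sums_inverse_times_square[of "k + 1"]] by simp
 moreover have "(\<integral>\<^sup>+x. ennreal (?f x * indicator {0<..<1} x) \<partial>lborel) = ennreal ?I"
  unfolding nn_integral_ln_ln[of k, symmetric] by (intro nn_integral_cong) (auto simp: indicator_def)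
 moreover have "0 <= ?f x * indicator {0<..<1} x" for x
 proof (cases "x \<in> {0<..<1}")
  case True
  then have "0 <= ln x * ln (1 - x)" by (intro mult_nonpos_nonpos) auto
  then show ?thesis using True by simp
 qed simp
 ultimately have "((%x. ?f x * indicator {0<..<1} x) has_integral ?I) UNIV"
  by (intro nn_integral_has_integral) auto
 also have "(%x. ?f x * indicator {0<..<1} x) = (%x. if x \<in> {0<..<1} then ?f x else 0)" by (auto simp: indicator_def)
 finally have "(?f has_integral ?I) {0<..<1}" by (simp only: has_integral_restrict_UNIV)
 then show ?thesis using has_integral_Icc_iff_Ioo by blast
qed

text \<open>Integrating one entropy term against 1 - x - y gives
  \<open>entropy_int 2 (1 - x)\<close>. Its product with the other term contains ln x ln (1 - x),
  the only place where two different logarithms meet.\<close>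

lemma spacing_ev_entropy_product:
 "spacing_ev (%(x, y, z, w). ennreal (entropy_int 0 x * entropy_int 0 y)) = ennreal (5599 / 36000 - pi\<^sup>2 / 120)"
proof -
 define J where "J k = harm (k + 1) / (real (k + 1))\<^sup>2 - (pi\<^sup>2 / 6 - (\<Sum>i=1..k+1. 1 / (real i)\<^sup>2)) / real (k + 1)" for k
 \<comment> \<open>\<open>entropy_int 2\<close> carries the factor 1/6 and the constant 5/6, whence
   5/36; the coefficients 1, -3, 3, -1 come from x (1 - x)^3.\<close>
 define I where "I = 5 / 36 * parts_diff 1 (-3) 3 (-1) 0 0 1 + 1 / 6 * (J 1 - 3 * J 2 + 3 * J 3 - J 4)"
 have "spacing_ev (%(x, y, z, w). ennreal (entropy_int 0 x * entropy_int 0 y)) = ennreal (6 * I)"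
 proof (rule spacing_ev_iterated)
  fix x y :: real assume "0 < x" "0 < y" "x + y < 1"
  then show "0 <= entropy_int 0 x * entropy_int 0 y" by (auto intro!: mult_nonneg_nonneg entropy_int_nonneg)
 next
  fix x :: real assume x: "0 < x" "x < 1"
  have "((%y. entropy_int 0 x * (((1 - x) + -1 * y + 0 * y\<^sup>2 + 0 * y ^ 3) * entropy_int 0 (0 + 1 * y))) has_integral
    entropy_int 0 x * (parts_int (1 - x) (-1) 0 0 0 0 1 (1 - x) - parts_int (1 - x) (-1) 0 0 0 0 1 0)) {0..1 - x}"
   using x by (intro has_integral_mult_right has_integral_parts_int) auto
  also have "(%y. entropy_int 0 x * (((1 - x) + -1 * y + 0 * y\<^sup>2 + 0 * y ^ 3) * entropy_int 0 (0 + 1 * y)))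
   = (%y. entropy_int 0 x * entropy_int 0 y * (1 - x - y))" by (simp add: fun_eq_iff algebra_simps)
  also have "parts_int (1 - x) (-1) 0 0 0 0 1 (1 - x) - parts_int (1 - x) (-1) 0 0 0 0 1 0 = entropy_int 2 (1 - x)"
   unfolding parts_int_0 by simp
  finally show "((%y. entropy_int 0 x * entropy_int 0 y * (1 - x - y)) has_integral entropy_int 0 x * entropy_int 2 (1 - x)) {0..1 - x}" .
 next
  have "((%x. 5 / 36 * ((1 + (-3) * x + 3 * x\<^sup>2 + (-1) * x ^ 3) * entropy_int 0 (0 + 1 * x))
    + 1 / 6 * (x ^ 1 * (ln x * ln (1 - x)) - 3 * (x ^ 2 * (ln x * ln (1 - x))) + 3 * (x ^ 3 * (ln x * ln (1 - x))) - x ^ 4 * (ln x * ln (1 - x))))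
   has_integral I) {0..1}"
   unfolding I_def J_def
   by (intro has_integral_add has_integral_diff has_integral_mult_right has_integral_ln_ln has_integral_parts_diff) auto
  also have "(%x. 5 / 36 * ((1 + (-3) * x + 3 * x\<^sup>2 + (-1) * x ^ 3) * entropy_int 0 (0 + 1 * x))
    + 1 / 6 * (x ^ 1 * (ln x * ln (1 - x)) - 3 * (x ^ 2 * (ln x * ln (1 - x))) + 3 * (x ^ 3 * (ln x * ln (1 - x))) - x ^ 4 * (ln x * ln (1 - x))))
   = (%x. entropy_int 0 x * entropy_int 2 (1 - x))"
   by (simp add: fun_eq_iff entropy_int_values power2_eq_square power3_eq_cube power4_eq_xxxx field_simps)
  finally show "((%x. entropy_int 0 x * entropy_int 2 (1 - x)) has_integral I) {0..1}" .
 qed measurable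
 also have "6 * I = 5599 / 36000 - pi\<^sup>2 / 120"
  unfolding I_def J_def one_node_values(1) by (simp add: harm_expand(1) harm_Suc eval_nat_numeral field_simps)
 finally show ?thesis .
qed

lemma ln_3_bounds: "1.0985 <= ln (3::real)" "ln (3::real) <= 1.0987"
 using ln_approx_bounds[of 3 6] by (simp_all add: eval_nat_numeral)

lemma ln_2_bounds: "0.69313 <= ln (2::real)" "ln (2::real) <= 0.69315"
 using ln_approx_bounds[of 2 5] by (simp_all add: eval_nat_numeral)

lemma spacing_ev_4:
 fixes f1 f2 f3 f4 :: "real => real => real => real => real"
 assumes "(%(x, y, z, w). f1 x y z w) \<in> borel_measurable borel4" "(%(x, y, z, w). f2 x y z w) \<in> borel_measurable borel4"
  "(%(x, y, z, w). f3 x y z w) \<in> borel_measurable borel4" "(%(x, y, z, w). f4 x y z w) \<in> borel_measurable borel4"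
  and v: "spacing_ev (%(x, y, z, w). ennreal (f1 x y z w)) = ennreal v1" "spacing_ev (%(x, y, z, w). ennreal (f2 x y z w)) = ennreal v2"
  "spacing_ev (%(x, y, z, w). ennreal (f3 x y z w)) = ennreal v3" "spacing_ev (%(x, y, z, w). ennreal (f4 x y z w)) = ennreal v4"
  and nonneg: "0 <= v1" "0 <= v2" "0 <= v3" "0 <= v4"
 shows "spacing_ev (%(x, y, z, w). ennreal (f1 x y z w) + ennreal (f2 x y z w) + ennreal (f3 x y z w) + ennreal (f4 x y z w))
  = ennreal (v1 + v2 + v3 + v4)"
proof -
 have m: "(%(x, y, z, w). ennreal (f1 x y z w)) \<in> borel_measurable borel4" "(%(x, y, z, w). ennreal (f2 x y z w)) \<in> borel_measurable borel4"
  "(%(x, y, z, w). ennreal (f3 x y z w)) \<in> borel_measurable borel4" "(%(x, y, z, w). ennreal (f4 x y z w)) \<in> borel_measurable borel4"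
  using assms(1-4)[THEN measurable_compose, OF measurable_ennreal] by (simp_all add: case_prod_unfold)
 have "spacing_ev (%(x, y, z, w). ennreal (f1 x y z w) + ennreal (f2 x y z w) + ennreal (f3 x y z w) + ennreal (f4 x y z w))
  = spacing_ev (%p. (%(x, y, z, w). ennreal (f1 x y z w)) p + (%(x, y, z, w). ennreal (f2 x y z w)) p
    + (%(x, y, z, w). ennreal (f3 x y z w)) p + (%(x, y, z, w). ennreal (f4 x y z w)) p)"
  by (simp add: case_prod_unfold)
 also have "... = ennreal v1 + ennreal v2 + ennreal v3 + ennreal v4"
  unfolding v[symmetric] by (intro trans[OF spacing_ev_add] arg_cong2[where f = "(+)"] refl m borel_measurable_add)
 finally show ?thesis using nonneg by (simp add: ennreal_plus[symmetric] del: ennreal_plus)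
qed

definition entropy_sum :: "real => real => real => real => real" where
 "entropy_sum x y z w = entropy_int 0 x + entropy_int 0 y + entropy_int 0 z + entropy_int 0 w"

text \<open>Agrees with the real sum on the simplex, but splits additively under
  \<open>spacing_ev\<close> without side conditions on the signs of its terms.\<close>

definition entropy_sum_e :: "real => real => real => real => ennreal" where
 "entropy_sum_e x y z w = ennreal (entropy_int 0 x) + ennreal (entropy_int 0 y) + ennreal (entropy_int 0 z) + ennreal (entropy_int 0 w)"

lemma spacing_ev_one_node_variants:
 assumes "0 < \<alpha>" "\<alpha> <= 1"
 shows "spacing_ev (%(x, y, z, w). ennreal (x * entropy_int 0 (\<alpha> * z))) = ennreal (parts_diff 1 (-3) 3 (-1) 0 0 \<alpha>)"
  and "spacing_ev (%(x, y, z, w). ennreal (x * entropy_int 0 (\<alpha> * w))) = ennreal (parts_diff 1 (-3) 3 (-1) 0 0 \<alpha>)"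
proof -
 have m: "(%(x, y, z, w). ennreal (x * entropy_int 0 (\<alpha> * y))) \<in> borel_measurable borel4" by measurable
 show "spacing_ev (%(x, y, z, w). ennreal (x * entropy_int 0 (\<alpha> * z))) = ennreal (parts_diff 1 (-3) 3 (-1) 0 0 \<alpha>)"
  using spacing_ev_swap23[OF m] spacing_ev_one_node[OF assms] by simp
 show "spacing_ev (%(x, y, z, w). ennreal (x * entropy_int 0 (\<alpha> * w))) = ennreal (parts_diff 1 (-3) 3 (-1) 0 0 \<alpha>)"
  using spacing_ev_swap24[OF m] spacing_ev_one_node[OF assms] by simp
qed

text \<open>After the shear each coordinate is a linear form: one has the vertex values 1, 1/2, 1/2,
  0, and the other three depend on a single spacing.\<close>

lemma cone_A_entropy:
 "spacing_ev (%(x, y, z, w). ennreal x * entropy_sum_e (x + y / 2 + z / 2) (z / 2) (y / 2) w) = ennreal (23 / 240 + ln 2 / 5)"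
proof -
 have "spacing_ev (%(x, y, z, w). ennreal x * entropy_sum_e (x + y / 2 + z / 2) (z / 2) (y / 2) w)
  = spacing_ev (%(x, y, z, w). ennreal (x * entropy_int 0 (1 * x + 0 * w + 1 / 2 * (z + y))) + ennreal (x * entropy_int 0 (1 / 2 * z))
    + ennreal (x * entropy_int 0 (1 / 2 * y)) + ennreal (x * entropy_int 0 (1 * w)))"
  by (rule spacing_ev_cong) (simp add: entropy_sum_e_def distrib_left ennreal_mult' add_divide_distrib add_ac)
 also have "... = ennreal (3 / 20 * ln 2 - 13 / 400 + (77 / 2400 + ln 2 / 40) + (77 / 2400 + ln 2 / 40) + 77 / 1200)"
 proof (rule spacing_ev_4)
  have m: "(%(x, y, z, w). ennreal (x * entropy_int 0 (1 * x + 0 * y + 1 / 2 * (z + w)))) \<in> borel_measurable borel4" by measurable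
  show "spacing_ev (%(x, y, z, w). ennreal (x * entropy_int 0 (1 * x + 0 * w + 1 / 2 * (z + y)))) = ennreal (3 / 20 * ln 2 - 13 / 400)"
   using spacing_ev_swap24[OF m] spacing_ev_A by (simp only:)
  show "spacing_ev (%(x, y, z, w). ennreal (x * entropy_int 0 (1 / 2 * z))) = ennreal (77 / 2400 + ln 2 / 40)"
   unfolding one_node_values(2)[symmetric] by (rule spacing_ev_one_node_variants) auto
  show "spacing_ev (%(x, y, z, w). ennreal (x * entropy_int 0 (1 / 2 * y))) = ennreal (77 / 2400 + ln 2 / 40)"
   unfolding one_node_values(2)[symmetric] by (rule spacing_ev_one_node) auto
  show "spacing_ev (%(x, y, z, w). ennreal (x * entropy_int 0 (1 * w))) = ennreal (77 / 1200)"
   unfolding one_node_values(1)[symmetric] by (rule spacing_ev_one_node_variants) auto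
 qed (measurable, use ln_2_bounds in auto)
 finally show ?thesis by (rule trans) (intro arg_cong[where f = ennreal], simp add: field_simps)
qed

text \<open>Of the four sheared coordinates one has three distinct vertex values, one involves two
  spacings other than the weight x, and two involve a single spacing.\<close>

lemma cone_B_entropy:
 "spacing_ev (%(x, y, z, w). ennreal x * entropy_sum_e (x + y / 3 + w / 2 + z / 2) (z / 2) (w / 2 + y / 3) (y / 3)) = ennreal (2 / 5 * ln 2 - 13 / 240)"
proof -
 have "spacing_ev (%(x, y, z, w). ennreal x * entropy_sum_e (x + y / 3 + w / 2 + z / 2) (z / 2) (w / 2 + y / 3) (y / 3))
  = spacing_ev (%(x, y, z, w). ennreal (x * entropy_int 0 (1 * x + 1 / 3 * y + 1 / 2 * (z + w))) + ennreal (x * entropy_int 0 (1 / 2 * z))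
    + ennreal (x * entropy_int 0 (1 / 2 * w + 1 / 3 * y)) + ennreal (x * entropy_int 0 (1 / 3 * y)))"
  by (rule spacing_ev_cong) (simp add: entropy_sum_e_def distrib_left ennreal_mult' add_divide_distrib add_ac)
 also have "... = ennreal (3 / 10 * ln 2 + ln 3 / 60 - 29 / 180 + (77 / 2400 + ln 2 / 40) + (77 / 1440 + 3 / 40 * ln 2 - ln 3 / 30) + (77 / 3600 + ln 3 / 60))"
 proof (rule spacing_ev_4)
  show "spacing_ev (%(x, y, z, w). ennreal (x * entropy_int 0 (1 * x + 1 / 3 * y + 1 / 2 * (z + w)))) = ennreal (3 / 10 * ln 2 + ln 3 / 60 - 29 / 180)"
   by (rule spacing_ev_B1)
  show "spacing_ev (%(x, y, z, w). ennreal (x * entropy_int 0 (1 / 2 * z))) = ennreal (77 / 2400 + ln 2 / 40)"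
   unfolding one_node_values(2)[symmetric] by (rule spacing_ev_one_node_variants) auto
  have m: "(%(x, y, z, w). ennreal (z * entropy_int 0 (1 / 2 * x + 1 / 3 * y))) \<in> borel_measurable borel4"
   "(%(x, y, z, w). ennreal (x * entropy_int 0 (1 / 2 * z + 1 / 3 * y))) \<in> borel_measurable borel4" by measurable
  have "spacing_ev (%(x, y, z, w). ennreal (x * entropy_int 0 (1 / 2 * w + 1 / 3 * y)))
   = spacing_ev (%(x, y, z, w). ennreal (x * entropy_int 0 (1 / 2 * z + 1 / 3 * y)))"
   by (rule spacing_ev_swaps(3)[OF m(2)])
  also have "... = spacing_ev (%(x, y, z, w). ennreal (z * entropy_int 0 (1 / 2 * x + 1 / 3 * y)))"
   by (rule spacing_ev_swap13[OF m(1)])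
  finally show "spacing_ev (%(x, y, z, w). ennreal (x * entropy_int 0 (1 / 2 * w + 1 / 3 * y))) = ennreal (77 / 1440 + 3 / 40 * ln 2 - ln 3 / 30)"
   by (simp only: spacing_ev_B2)
  show "spacing_ev (%(x, y, z, w). ennreal (x * entropy_int 0 (1 / 3 * y))) = ennreal (77 / 3600 + ln 3 / 60)"
   unfolding one_node_values(3)[symmetric] by (rule spacing_ev_one_node) auto
 qed (measurable, use ln_2_bounds ln_3_bounds in auto)
 finally show ?thesis by (rule trans) (intro arg_cong[where f = ennreal], simp add: field_simps)
qed

text \<open>The weight is x / 2, so the factor 1/2 is taken out first. Two of the remaining forms
  have three distinct vertex values, the other two a single node.\<close>

lemma cone_C_entropy:
 "spacing_ev (%(x, y, z, w). ennreal (x / 2) * entropy_sum_e (z / 3) (y / 3) (w + x / 2 + y / 3 + z / 3) (x / 2 + y / 3 + z / 3))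
  = ennreal (23 / 160 - 9 / 40 * ln 2 + ln 3 / 8)"
proof -
 define G where "G x y z w = ennreal (x * entropy_int 0 (1 / 3 * z)) + ennreal (x * entropy_int 0 (1 / 3 * y))
  + ennreal (x * entropy_int 0 (1 / 2 * x + 1 * w + 1 / 3 * (z + y))) + ennreal (x * entropy_int 0 (1 / 2 * x + 0 * w + 1 / 3 * (z + y)))" for x y z w
 have Gm: "(%(x, y, z, w). G x y z w) \<in> borel_measurable borel4" unfolding G_def by measurable
 have "spacing_ev (%(x, y, z, w). ennreal (x / 2) * entropy_sum_e (z / 3) (y / 3) (w + x / 2 + y / 3 + z / 3) (x / 2 + y / 3 + z / 3))
  = spacing_ev (%p. ennreal (1 / 2) * (%(x, y, z, w). G x y z w) p)"
 proof (rule spacing_ev_cong)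
  fix x y z w :: real assume pos: "0 < x"
  have h: "ennreal (x / 2) = ennreal (1 / 2) * ennreal x" using pos by (subst ennreal_mult[symmetric]) auto
  show "(%(x, y, z, w). ennreal (x / 2) * entropy_sum_e (z / 3) (y / 3) (w + x / 2 + y / 3 + z / 3) (x / 2 + y / 3 + z / 3)) (x, y, z, w)
   = ennreal (1 / 2) * (%(x, y, z, w). G x y z w) (x, y, z, w)"
   unfolding prod.case h mult.assoc G_def using pos by (intro arg_cong2[where f = times] refl)
    (simp add: entropy_sum_e_def distrib_left ennreal_mult' add_divide_distrib add_ac)
 qed
 also have "... = ennreal (1 / 2) * spacing_ev (%(x, y, z, w). G x y z w)"
  by (rule spacing_ev_cmult[OF Gm])
 also have "spacing_ev (%(x, y, z, w). G x y z w) = ennreal ((77 / 3600 + ln 3 / 60) + (77 / 3600 + ln 3 / 60) + (773 / 1800 - 19 / 60 * ln 3) + (8 / 15 * ln 3 - 9 / 20 * ln 2 - 133 / 720))"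
  unfolding G_def
 proof (rule spacing_ev_4)
  have m: "(%(x, y, z, w). ennreal (x * entropy_int 0 (1 / 2 * x + 1 * y + 1 / 3 * (z + w)))) \<in> borel_measurable borel4"
   "(%(x, y, z, w). ennreal (x * entropy_int 0 (1 / 2 * x + 0 * y + 1 / 3 * (z + w)))) \<in> borel_measurable borel4" by measurable
  show "spacing_ev (%(x, y, z, w). ennreal (x * entropy_int 0 (1 / 2 * x + 1 * w + 1 / 3 * (z + y)))) = ennreal (773 / 1800 - 19 / 60 * ln 3)"
   using spacing_ev_swap24[OF m(1)] spacing_ev_C1 by (simp only:)
  show "spacing_ev (%(x, y, z, w). ennreal (x * entropy_int 0 (1 / 2 * x + 0 * w + 1 / 3 * (z + y)))) = ennreal (8 / 15 * ln 3 - 9 / 20 * ln 2 - 133 / 720)"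
   using spacing_ev_swap24[OF m(2)] spacing_ev_C2 by (simp only:)
  show "spacing_ev (%(x, y, z, w). ennreal (x * entropy_int 0 (1 / 3 * y))) = ennreal (77 / 3600 + ln 3 / 60)"
   unfolding one_node_values(3)[symmetric] by (rule spacing_ev_one_node) auto
  show "spacing_ev (%(x, y, z, w). ennreal (x * entropy_int 0 (1 / 3 * z))) = ennreal (77 / 3600 + ln 3 / 60)"
   unfolding one_node_values(3)[symmetric] by (rule spacing_ev_one_node_variants) auto
 qed (measurable, use ln_2_bounds ln_3_bounds in auto)
 also have "ennreal (1 / 2) * ... = ennreal (23 / 160 - 9 / 40 * ln 2 + ln 3 / 8)"
  by (subst ennreal_mult''[symmetric]) (use ln_2_bounds ln_3_bounds in \<open>auto simp: field_simps\<close>)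
 finally show ?thesis .
qed

lemma max_gain_nonneg: "0 <= max_gain x y z w" by (simp add: max_gain_def)

lemma entropy_sum_e_measurable: "(%(x, y, z, w). entropy_sum_e x y z w) \<in> borel_measurable borel4"
 unfolding entropy_sum_e_def by measurable

lemma spacing_ev_max_gain_entropy:
 "spacing_ev (%(x, y, z, w). ennreal (max_gain x y z w * entropy_sum x y z w)) = ennreal (47 / 480 + 11 / 120 * ln 2 - ln 3 / 72)"
proof -
 have "spacing_ev (%(x, y, z, w). ennreal (max_gain x y z w) * entropy_sum_e x y z w)
  = ennreal ((23 / 240 + ln 2 / 5) - (2 / 5 * ln 2 - 13 / 240) / 3 - (23 / 160 - 9 / 40 * ln 2 + ln 3 / 8) / 9)"
  by (rule max_gain_integral[OF entropy_sum_e_measurable _ _ _ _ _ cone_A_entropy _ cone_B_entropy _ cone_C_entropy])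
   (use ln_2_bounds ln_3_bounds in \<open>auto simp: entropy_sum_e_def add_ac\<close>)
 moreover have "spacing_ev (%(x, y, z, w). ennreal (max_gain x y z w * entropy_sum x y z w))
   = spacing_ev (%(x, y, z, w). ennreal (max_gain x y z w) * entropy_sum_e x y z w)"
  by (rule spacing_ev_cong)
   (auto simp: entropy_sum_def entropy_sum_e_def ennreal_mult' max_gain_nonneg entropy_int_nonneg)
 moreover have "(23 / 240 + ln 2 / 5) - (2 / 5 * ln 2 - 13 / 240) / 3 - (23 / 160 - 9 / 40 * ln 2 + ln 3 / 8) / 9 = 47 / 480 + 11 / 120 * ln 2 - ln 3 / (72::real)"
  by (simp add: field_simps)
 ultimately show ?thesis by (simp only:)
qed

lemma spacing_ev_x: "spacing_ev (%(x, y, z, w). ennreal (c * x)) = ennreal (c / 4)" if "0 <= c"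
proof -
 have "spacing_ev (%(x, y, z, w). ennreal (c * x)) = spacing_ev (%p. ennreal c * (%(x, y, z, w). ennreal (x ^ 1)) p)"
  using that by (intro spacing_ev_cong) (simp add: ennreal_mult)
 also have "... = ennreal c * spacing_ev (%(x, y, z, w). ennreal (x ^ 1))"
  by (rule spacing_ev_cmult) measurable
 also have "... = ennreal (c / 4)"
  unfolding spacing_ev_power using that by (subst ennreal_mult[symmetric]) (auto simp: fact_numeral)
 finally show ?thesis .
qed

lemma spacing_ev_x2: "spacing_ev (%(x, y, z, w). ennreal (c * x\<^sup>2)) = ennreal (c / 10)" if "0 <= c"
proof -
 have "spacing_ev (%(x, y, z, w). ennreal (c * x\<^sup>2)) = spacing_ev (%p. ennreal c * (%(x, y, z, w). ennreal (x ^ 2)) p)"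
  using that by (intro spacing_ev_cong) (simp add: ennreal_mult)
 also have "... = ennreal c * spacing_ev (%(x, y, z, w). ennreal (x ^ 2))"
  by (rule spacing_ev_cmult) measurable
 also have "... = ennreal (c / 10)"
  unfolding spacing_ev_power using that by (subst ennreal_mult[symmetric]) (auto simp: fact_numeral)
 finally show ?thesis .
qed

text \<open>With \<open>F\<close> constant only the weight is integrated: x has mean 1/4 for types A
  and B, and x / 2 has mean 1/8 for type C.\<close>

lemma spacing_ev_max_gain: "spacing_ev (%(x, y, z, w). ennreal (max_gain x y z w)) = ennreal (11 / 72)"
 using max_gain_integral[of "%_ _ _ _. 1" "%x. ennreal x" "1 / 4" "1 / 4" "1 / 8"] spacing_ev_x[of 1] spacing_ev_x[of "1 / 2"]
 by simp

lemma spacing_ev_max_gain_square: "spacing_ev (%(x, y, z, w). ennreal ((max_gain x y z w)\<^sup>2)) = ennreal (23 / 360)"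
 using max_gain_integral[of "%_ _ _ _. 1" "%x. ennreal (x\<^sup>2)" "1 / 10" "1 / 10" "1 / 40"] spacing_ev_x2[of 1] spacing_ev_x2[of "1 / 4"]
 by (simp add: power_divide)

lemma has_bochner_integral_spacings:
 fixes f :: "real => real => real => real => real"
 assumes m: "(%(x, y, z, w). f x y z w) \<in> borel_measurable borel4"
  and nonneg: "!!x y z w. 0 < x ==> 0 < y ==> 0 < z ==> 0 < w ==> x + y + z + w = 1 ==> 0 <= f x y z w"
  and v: "spacing_ev (%(x, y, z, w). ennreal (f x y z w)) = ennreal r" "0 <= r"
 shows "has_bochner_integral (pivot_space 3) (%v. f (spacing 3 v 0) (spacing 3 v 1) (spacing 3 v 2) (spacing 3 v 3)) r"
proof (rule has_bochner_integral_nn_integral[OF _ _ v(2)])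
 show "(%v. f (spacing 3 v 0) (spacing 3 v 1) (spacing 3 v 2) (spacing 3 v 3)) \<in> borel_measurable (pivot_space 3)"
  using measurable_compose[OF spacings_measurable m] by (simp add: spacings_def)
 show "AE v in pivot_space 3. 0 <= f (spacing 3 v 0) (spacing 3 v 1) (spacing 3 v 2) (spacing 3 v 3)"
  using AE_spacings_positive
 proof eventually_elim
  case (elim v)
  then show ?case using spacings_sum[of v] by (intro nonneg) (auto simp: spacings_def positive4_def)
 qed
 show "(\<integral>\<^sup>+v. ennreal (f (spacing 3 v 0) (spacing 3 v 1) (spacing 3 v 2) (spacing 3 v 3)) \<partial>pivot_space 3) = ennreal r"
  using v(1) by (simp add: spacing_ev_def spacings_def)
qed

text \<open>Exchangeability reduces both claims to one mean, one square and one mixed product. The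
  value 13/12 equals H_4 - 1, the denominator of \<open>alpha_const 3\<close>.\<close>

lemma has_bochner_integral_entropy_sum:
 shows "has_bochner_integral (pivot_space 3) (%v. entropy_sum (spacing 3 v 0) (spacing 3 v 1) (spacing 3 v 2) (spacing 3 v 3)) (13 / 12)" (is ?t1)
  and "has_bochner_integral (pivot_space 3) (%v. (entropy_sum (spacing 3 v 0) (spacing 3 v 1) (spacing 3 v 2) (spacing 3 v 3))\<^sup>2) (791 / 360 - pi\<^sup>2 / 10)" (is ?t2)
proof -
 let ?B = "has_bochner_integral (pivot_space 3)"
 define e where "e i v = entropy_int 0 (spacing 3 v i)" for i v
 define q where "q = 5599 / 36000 - pi\<^sup>2 / 120"
 have q: "0 <= q"
 proof -
  have "pi\<^sup>2 <= 3.15\<^sup>2" using pi_approx pi_ge_zero by (intro power_mono) auto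
  then show ?thesis by (simp add: q_def power2_eq_square)
 qed
 have m: "(%(x, y, z, w). ennreal (entropy_int 0 x)) \<in> borel_measurable borel4"
  "(%(x, y, z, w). ennreal ((entropy_int 0 x)\<^sup>2)) \<in> borel_measurable borel4"
  "(%(x, y, z, w). ennreal (entropy_int 0 x * entropy_int 0 y)) \<in> borel_measurable borel4" by measurable
 have h1: "?B (%v. e 0 v) (13 / 48)"
  "?B (%v. e 1 v) (13 / 48)"
  "?B (%v. e 2 v) (13 / 48)"
  "?B (%v. e 3 v) (13 / 48)"
 proof -
  note vals = spacing_ev_swap12[OF m(1)] spacing_ev_swap13[OF m(1)] spacing_ev_swap14[OF m(1)]
  note vals = vals[unfolded prod.case spacing_ev_entropy]
  show "?B (%v. e 0 v) (13 / 48)" unfolding e_def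
   by (rule has_bochner_integral_spacings[where f = "%x y z w. entropy_int 0 x"]) (measurable, auto intro!: mult_nonneg_nonneg entropy_int_nonneg q simp: vals spacing_ev_entropy)
  show "?B (%v. e 1 v) (13 / 48)" unfolding e_def
   by (rule has_bochner_integral_spacings[where f = "%x y z w. entropy_int 0 y"]) (measurable, auto intro!: mult_nonneg_nonneg entropy_int_nonneg q simp: vals spacing_ev_entropy)
  show "?B (%v. e 2 v) (13 / 48)" unfolding e_def
   by (rule has_bochner_integral_spacings[where f = "%x y z w. entropy_int 0 z"]) (measurable, auto intro!: mult_nonneg_nonneg entropy_int_nonneg q simp: vals spacing_ev_entropy)
  show "?B (%v. e 3 v) (13 / 48)" unfolding e_def
   by (rule has_bochner_integral_spacings[where f = "%x y z w. entropy_int 0 w"]) (measurable, auto intro!: mult_nonneg_nonneg entropy_int_nonneg q simp: vals spacing_ev_entropy)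
 qed
 have h2: "?B (%v. (e 0 v)\<^sup>2) (1489 / 18000)"
  "?B (%v. (e 1 v)\<^sup>2) (1489 / 18000)"
  "?B (%v. (e 2 v)\<^sup>2) (1489 / 18000)"
  "?B (%v. (e 3 v)\<^sup>2) (1489 / 18000)"
 proof -
  note vals = spacing_ev_swap12[OF m(2)] spacing_ev_swap13[OF m(2)] spacing_ev_swap14[OF m(2)]
  note vals = vals[unfolded prod.case spacing_ev_entropy_square]
  show "?B (%v. (e 0 v)\<^sup>2) (1489 / 18000)" unfolding e_def
   by (rule has_bochner_integral_spacings[where f = "%x y z w. (entropy_int 0 x)\<^sup>2"]) (measurable, auto intro!: mult_nonneg_nonneg entropy_int_nonneg q simp: vals spacing_ev_entropy_square)
  show "?B (%v. (e 1 v)\<^sup>2) (1489 / 18000)" unfolding e_def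
   by (rule has_bochner_integral_spacings[where f = "%x y z w. (entropy_int 0 y)\<^sup>2"]) (measurable, auto intro!: mult_nonneg_nonneg entropy_int_nonneg q simp: vals spacing_ev_entropy_square)
  show "?B (%v. (e 2 v)\<^sup>2) (1489 / 18000)" unfolding e_def
   by (rule has_bochner_integral_spacings[where f = "%x y z w. (entropy_int 0 z)\<^sup>2"]) (measurable, auto intro!: mult_nonneg_nonneg entropy_int_nonneg q simp: vals spacing_ev_entropy_square)
  show "?B (%v. (e 3 v)\<^sup>2) (1489 / 18000)" unfolding e_def
   by (rule has_bochner_integral_spacings[where f = "%x y z w. (entropy_int 0 w)\<^sup>2"]) (measurable, auto intro!: mult_nonneg_nonneg entropy_int_nonneg q simp: vals spacing_ev_entropy_square)
 qed
 note prod = spacing_ev_entropy_product[folded q_def]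
 have h3: "?B (%v. e 0 v * e 1 v) q"
  "?B (%v. e 0 v * e 2 v) q"
  "?B (%v. e 0 v * e 3 v) q"
  "?B (%v. e 2 v * e 1 v) q"
  "?B (%v. e 3 v * e 1 v) q"
  "?B (%v. e 2 v * e 3 v) q"
 proof -
  note vals = spacing_ev_swap23[OF m(3)] spacing_ev_swap24[OF m(3)] spacing_ev_swap13[OF m(3)] spacing_ev_swap14[OF m(3)] spacing_ev_swap_pairs[OF m(3)]
  note vals = vals[unfolded prod.case prod]
  show "?B (%v. e 0 v * e 1 v) q" unfolding e_def
   by (rule has_bochner_integral_spacings[where f = "%x y z w. entropy_int 0 x * entropy_int 0 y"]) (measurable, auto intro!: mult_nonneg_nonneg entropy_int_nonneg q simp: vals prod)
  show "?B (%v. e 0 v * e 2 v) q" unfolding e_def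
   by (rule has_bochner_integral_spacings[where f = "%x y z w. entropy_int 0 x * entropy_int 0 z"]) (measurable, auto intro!: mult_nonneg_nonneg entropy_int_nonneg q simp: vals prod)
  show "?B (%v. e 0 v * e 3 v) q" unfolding e_def
   by (rule has_bochner_integral_spacings[where f = "%x y z w. entropy_int 0 x * entropy_int 0 w"]) (measurable, auto intro!: mult_nonneg_nonneg entropy_int_nonneg q simp: vals prod)
  show "?B (%v. e 2 v * e 1 v) q" unfolding e_def
   by (rule has_bochner_integral_spacings[where f = "%x y z w. entropy_int 0 z * entropy_int 0 y"]) (measurable, auto intro!: mult_nonneg_nonneg entropy_int_nonneg q simp: vals prod)
  show "?B (%v. e 3 v * e 1 v) q" unfolding e_def
   by (rule has_bochner_integral_spacings[where f = "%x y z w. entropy_int 0 w * entropy_int 0 y"]) (measurable, auto intro!: mult_nonneg_nonneg entropy_int_nonneg q simp: vals prod)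
  show "?B (%v. e 2 v * e 3 v) q" unfolding e_def
   by (rule has_bochner_integral_spacings[where f = "%x y z w. entropy_int 0 z * entropy_int 0 w"]) (measurable, auto intro!: mult_nonneg_nonneg entropy_int_nonneg q simp: vals prod)
 qed
 have "?B (%v. e 0 v + e 1 v + e 2 v + e 3 v) (13 / 48 + 13 / 48 + 13 / 48 + 13 / 48)"
  by (intro has_bochner_integral_add h1)
 then show ?t1 by (simp add: entropy_sum_def e_def)
 have "?B (%v. (e 0 v)\<^sup>2 + (e 1 v)\<^sup>2 + (e 2 v)\<^sup>2 + (e 3 v)\<^sup>2
   + 2 * (e 0 v * e 1 v + e 0 v * e 2 v + e 0 v * e 3 v + e 2 v * e 1 v + e 3 v * e 1 v + e 2 v * e 3 v))
  (1489 / 18000 + 1489 / 18000 + 1489 / 18000 + 1489 / 18000 + 2 * (q + q + q + q + q + q))"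
  by (intro has_bochner_integral_add has_bochner_integral_mult_right h2 h3)
 also have "(%v. (e 0 v)\<^sup>2 + (e 1 v)\<^sup>2 + (e 2 v)\<^sup>2 + (e 3 v)\<^sup>2
   + 2 * (e 0 v * e 1 v + e 0 v * e 2 v + e 0 v * e 3 v + e 2 v * e 1 v + e 3 v * e 1 v + e 2 v * e 3 v))
  = (%v. (entropy_sum (spacing 3 v 0) (spacing 3 v 1) (spacing 3 v 2) (spacing 3 v 3))\<^sup>2)"
  by (simp add: fun_eq_iff entropy_sum_def e_def power2_eq_square algebra_simps)
 also have "1489 / 18000 + 1489 / 18000 + 1489 / 18000 + 1489 / 18000 + 2 * (q + q + q + q + q + q) = 791 / 360 - pi\<^sup>2 / 10"
  by (simp add: q_def field_simps)
 finally show ?t2 .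
qed

lemma sigma_sq_3:
 "sigma_sq 3 = 3051169 / 657072 - 17689 / 36504 * pi\<^sup>2 + 1463 / 2808 * ln 2 - 665 / 8424 * ln 3"
proof -
 let ?B = "has_bochner_integral (pivot_space 3)"
 interpret Q: prob_space "pivot_space 3" by (rule prob_space_pivot_space)
 define S where "S v = entropy_sum (spacing 3 v 0) (spacing 3 v 1) (spacing 3 v 2) (spacing 3 v 3)" for v
 define G where "G v = max_gain (spacing 3 v 0) (spacing 3 v 1) (spacing 3 v 2) (spacing 3 v 3)" for v
 have gm: "(%(x, y, z, w). max_gain x y z w) \<in> borel_measurable borel4"
  "(%(x, y, z, w). (max_gain x y z w)\<^sup>2) \<in> borel_measurable borel4"
  "(%(x, y, z, w). max_gain x y z w * entropy_sum x y z w) \<in> borel_measurable borel4"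
  unfolding entropy_sum_def by measurable
 have es: "0 <= entropy_sum x y z w" if "0 < x" "0 < y" "0 < z" "0 < w" "x + y + z + w = 1" for x y z w
  unfolding entropy_sum_def using that by (intro add_nonneg_nonneg entropy_int_nonneg) auto
 have hS: "?B S (13 / 12)" and hS2: "?B (%v. (S v)\<^sup>2) (791 / 360 - pi\<^sup>2 / 10)"
  unfolding S_def by (rule has_bochner_integral_entropy_sum)+
 have hG: "?B G (11 / 72)"
  unfolding G_def by (rule has_bochner_integral_spacings[OF gm(1) _ spacing_ev_max_gain]) (auto simp: max_gain_nonneg)
 have hG2: "?B (%v. (G v)\<^sup>2) (23 / 360)"
  unfolding G_def by (rule has_bochner_integral_spacings[OF gm(2) _ spacing_ev_max_gain_square]) auto
 have hGS: "?B (%v. G v * S v) (47 / 480 + 11 / 120 * ln 2 - ln 3 / 72)"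
  unfolding G_def S_def
  by (rule has_bochner_integral_spacings[OF gm(3) _ spacing_ev_max_gain_entropy])
   (use ln_2_bounds ln_3_bounds in \<open>auto intro!: mult_nonneg_nonneg max_gain_nonneg es\<close>)
 have const: "?B (%v. c) c" for c :: real
 proof -
  have "?B (%v. c) (LINT v|pivot_space 3. c)"
   by (rule has_bochner_integral_integrable) (rule Q.integrable_const)
  then show ?thesis using Q.prob_space by (simp only: lebesgue_integral_const scaleR_one)
 qed
 have opt: "opt_cost 3 (spacing 3 v) = 2 - G v" for v
  unfolding G_def using sum_spacing[of 3 v] by (intro opt_cost_3) (simp add: eval_nat_numeral)
 have ent: "(\<Sum>i\<le>3. spacing 3 v i * ln (spacing 3 v i)) = - S v" for v
  by (simp add: S_def entropy_sum_def entropy_int_0 eval_nat_numeral)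
 have "gamma_const 3 = 2 - 11 / 72"
  unfolding gamma_const_def opt by (rule has_bochner_integral_integral_eq[OF has_bochner_integral_diff[OF const hG]])
 moreover have "harm (3 + 1) - 1 = (13 / 12 :: real)" by (simp add: harm_Suc harm_expand(1) eval_nat_numeral)
 ultimately have al: "alpha_const 3 = 133 / 78" unfolding alpha_const_def by (simp only:) simp
 define A where "A = (133 / 78 :: real)"
 \<comment> \<open>The expanded square of A (- S) + (2 - G), where 133/78 is (2 - 11/72) / (13/12);
   all six moments are now known.\<close>
 have "?B (%v. A\<^sup>2 * (S v)\<^sup>2 + 4 + (G v)\<^sup>2 - (4 * A) * S v - 4 * G v + (2 * A) * (G v * S v))
  (A\<^sup>2 * (791 / 360 - pi\<^sup>2 / 10) + 4 + 23 / 360 - (4 * A) * (13 / 12) - 4 * (11 / 72) + (2 * A) * (47 / 480 + 11 / 120 * ln 2 - ln 3 / 72))"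
  by (intro has_bochner_integral_add has_bochner_integral_diff has_bochner_integral_mult_right const hS hS2 hG hG2 hGS)
 also have "(%v. A\<^sup>2 * (S v)\<^sup>2 + 4 + (G v)\<^sup>2 - (4 * A) * S v - 4 * G v + (2 * A) * (G v * S v))
  = (%v. (A * (- S v) + (2 - G v))\<^sup>2)"
  by (simp add: fun_eq_iff power2_eq_square algebra_simps)
 finally have I: "(LINT v|pivot_space 3. (A * (- S v) + (2 - G v))\<^sup>2)
  = A\<^sup>2 * (791 / 360 - pi\<^sup>2 / 10) + 4 + 23 / 360 - (4 * A) * (13 / 12) - 4 * (11 / 72) + (2 * A) * (47 / 480 + 11 / 120 * ln 2 - ln 3 / 72)"
  by (rule has_bochner_integral_integral_eq)
 have "sigma_sq 3 = (real 3 + 2) / real 3 * (LINT v|pivot_space 3. (A * (- S v) + (2 - G v))\<^sup>2)"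
  unfolding sigma_sq_def ent opt al A_def ..
 then show ?thesis unfolding I by (simp add: A_def power2_eq_square field_simps)
qed

text \<open>The value is about 0.13541. Its closed form is affine in the square of pi, ln 2 and ln
  3, and the rational enclosures of these are narrow enough for linear arithmetic.\<close>

lemma sigma_sq_3_approx: "\<bar>sigma_sq 3 - 0.1354\<bar> < 0.00005"
proof -
 have "pi\<^sup>2 <= 3.1415926535899\<^sup>2" using pi_approx(2) pi_ge_zero by (rule power_mono)
 moreover have "3.141592653588\<^sup>2 <= pi\<^sup>2" using pi_approx(1) by (rule power_mono) simp
 ultimately have "pi\<^sup>2 <= 98696045 / 10000000" "98696043 / 10000000 <= pi\<^sup>2" by (simp_all add: power2_eq_square)
 moreover have "69313 / 100000 <= ln (2::real)" "ln (2::real) <= 69315 / 100000" using ln_2_bounds by simp_all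
 moreover have "10985 / 10000 <= ln (3::real)" "ln (3::real) <= 10987 / 10000" using ln_3_bounds by simp_all
 ultimately have "sigma_sq 3 - 677 / 5000 < 1 / 20000 \<and> - (sigma_sq 3 - 677 / 5000) < 1 / 20000"
  unfolding sigma_sq_3 by (intro conjI; linarith)
 moreover have "(0.1354 :: real) = 677 / 5000" "(0.00005 :: real) = 1 / 20000" by simp_all
 ultimately show ?thesis by (simp only: abs_less_iff)
qed

theorem theorem3:
  fixes M :: "'a measure" and N :: "'b measure"
    and K :: nat
    and r :: "(nat tree \<times> nat tree) set"
    and base :: "nat \<Rightarrow> nat cmp_alg" and piv :: "nat cmp_alg"
    and V a :: "nat \<Rightarrow> 'a \<Rightarrow> real"
    and Y :: "nat \<Rightarrow> nat \<Rightarrow> 'a \<Rightarrow> nat"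
    and X :: "nat \<Rightarrow> 'b \<Rightarrow> nat"
  shows "(K \<ge> 1 \<longrightarrow> optimal_quicksort M N K r base piv V a Y X \<longrightarrow>
            (\<lambda>n. prob_space.variance N (\<lambda>\<omega>. real (X n \<omega>)))
              \<sim>[at_top] (\<lambda>n. sigma_sq K * (real n)\<^sup>2))
    \<and> sigma_sq 3 = 3051169 / 657072 - 17689 / 36504 * pi\<^sup>2
                   + 1463 / 2808 * ln 2 - 665 / 8424 * ln 3
    \<and> \<bar>sigma_sq 3 - 0.1354\<bar> < 0.00005"
  using optimal_quicksort.variance_equivalent sigma_sq_3 sigma_sq_3_approx by blast

end
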